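(* Let $n\ge 2$, let $P$ be a simple $K_{1,n}$-module and let $V$ be a simple weight $\mathfrak{sl}(1,n)$-module. Assume that the $\mathcal{S}'(1,n)$-module $F(P,V)$ is not simple. Then, up to a parity-change, $V\cong L(N(\lambda))$ for some $\lambda\in\mathbb{C}^n$.
   Context: All vector spaces are over $\mathbb{C}$; $n\ge 2$; modules over (Lie or associative) superalgebras are $\mathbb{Z}_2$-graded (submodules and simplicity are in the graded sense), and $\Pi$ (parity-change) interchanges the grading. $[1,n]=\{1,\dots,n\}$. The algebra $\mathcal{S}'(1,n)$. $\Lambda(n)$ is the exterior algebra in odd variables $\xi_1,\dots,\xi_n$; for $I=\{i_1<\dots<i_r\}\subseteq[1,n]$, $\xi_I=\xi_{i_1}\cdots\xi_{i_r}$, $\xi_\varnothing=1$. $\mathcal{W}(1,n)=\mathrm{Der}(\mathbb{C}[t^{\pm1}]\otimes\Lambda(n))$ is the Lie superalgebra of superderivations $f_0\frac{d}{dt}+\sum_i f_i\frac{\partial}{\partial\xi_i}$. $\mathcal{S}(1,n)\subset\mathcal{W}(1,n)$ is the subalgebra spanned by the homogeneous ones with $\frac{d(f_0)}{dt}+\sum_i(-1)^{|f_i|}\frac{\partial(f_i)}{\partial\xi_i}=0$, and $\mathcal{S}'(1,n)=[\mathcal{S}(1,n),\mathcal{S}(1,n)]$. It is spanned by $t^k\frac{\partial(\xi_I)}{\partial\xi_i}\frac{d}{dt}+(-1)^{1+|I|}kt^{k-1}\xi_I\frac{\partial}{\partial\xi_i}$ and $t^k\frac{\partial(\xi_I)}{\partial\xi_i}\frac{\partial}{\partial\xi_j}+t^k\frac{\partial(\xi_I)}{\partial\xi_j}\frac{\partial}{\partial\xi_i}$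 ($k\in\mathbb{Z}$, $I\subseteq[1,n]$, $i,j\in[1,n]$). $\mathfrak{gl}(1,n)$ has basis $E_{i,j}$, $0\le i,j\le n$ (odd: $E_{0,i},E_{i,0}$ with $i\ge1$; the others even), with the supercommutator bracket; $\mathfrak{sl}(1,n)=\{A:\ a_{0,0}-\sum_{i\ge1}a_{i,i}=0\}$. For $\mathfrak{g}=\mathfrak{sl}(1,n)$: $\mathfrak{g}_{-1}=\mathrm{span}\{E_{i,0}\}_{i\ge1}$, $\mathfrak{g}_1=\mathrm{span}\{E_{0,i}\}_{i\ge1}$, $\mathfrak{g}_0=\mathfrak{g}_{\bar0}$. A weight module over $\mathfrak{sl}(1,n)$ or $\mathfrak{g}_0$ is one on which the diagonal matrices of $\mathfrak{sl}(1,n)$ act diagonalizably. Shen-Larsson modules. $K_{1,n}=\mathbb{C}[t^{\pm1},\xi_1,\dots,\xi_n,\frac{d}{dt},\frac{\partial}{\partial\xi_1},\dots,\frac{\partial}{\partial\xi_n}]$ is the Weyl superalgebra (superdifferential operators on $\mathbb{C}[t^{\pm1}]\otimes\Lambda(n)$). There is a Lie superalgebra homomorphism $\pi:\mathcal{W}(1,n)\to K_{1,n}\otimes U(\mathfrak{gl}(1,n))$ (super tensor product) given by $$\pi(t^k\xi_I\tfrac{d}{dt})=t^k\xi_I\tfrac{d}{dt}\otimes1+kt^{k-1}\xi_I\otimes E_{0,0}+(-1)^{|I|-1}\sum_{s=1}^n\tfrac{\partial(t^k\xi_I)}{\partial\xi_s}\otimes E_{s,0},$$ $$\pi(t^k\xi_I\tfrac{\partial}{\partial\xi_i})=t^k\xi_I\tfrac{\partial}{\partial\xi_i}\otimes1+kt^{k-1}\xi_I\otimes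 E_{0,i}+(-1)^{|I|-1}\sum_{s=1}^n\tfrac{\partial(t^k\xi_I)}{\partial\xi_s}\otimes E_{s,i},$$ and $\pi(\mathcal{S}'(1,n))\subseteq K_{1,n}\otimes U(\mathfrak{sl}(1,n))$. For a $K_{1,n}$-module $P$ and an $\mathfrak{sl}(1,n)$-module $M$, $F(P,M)$ is the $\mathcal{S}'(1,n)$-module $P\otimes M$ with $x\cdot(p\otimes v)=\pi(x)(p\otimes v)$, where $(a\otimes b)(p\otimes v)=(-1)^{|b||p|}ap\otimes bv$. The modules $L(N(\lambda))$. For $\lambda\in\mathbb{C}^n$ let $A^+_{n,0}(\lambda)=V_1\otimes\cdots\otimes V_n$, where $V_i=\mathbb{C}[t_i]$ if $\lambda_i\in\mathbb{Z}_+$ (nonnegative integers), $V_i=\mathbb{C}[t_i^{\pm1}]/\mathbb{C}[t_i]$ if $\lambda_i\in\mathbb{Z}_{<0}$, $V_i=t_i^{\lambda_i}\mathbb{C}[t_i^{\pm1}]$ if $\lambda_i\notin\mathbb{Z}$, a module over $\mathbb{C}[t_1,\dots,t_n,\partial/\partial t_1,\dots,\partial/\partial t_n]$. Put $|\lambda|=\lambda_1+\dots+\lambda_n$ and $N(\lambda)=\{v\in A^+_{n,0}(\lambda):\sum_s t_s\frac{\partial}{\partial t_s}v=|\lambda|v\}$, a simple $\mathfrak{gl}(n)$-module via $E_{i,j}\mapsto t_i\frac{\partial}{\partial t_j}$. It is regarded as an $\mathfrak{sl}(1,n)_0$-module via the isomorphism $\sigma:\mathfrak{gl}(n)\to\mathfrak{sl}(1,n)_0$,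 $A\mapsto\mathrm{diag}(\mathrm{tr}(A),A)$. For a simple $\mathfrak{g}_0$-module $M$, extend $M$ by $\mathfrak{g}_{-1}M=0$; the Kac module $K(M)=\mathrm{Ind}_{\mathfrak{g}_0\oplus\mathfrak{g}_{-1}}^{\mathfrak{g}}M$ has a unique maximal submodule, and $L(M)$ denotes its simple top. Every simple $\mathfrak{g}$-module is, up to parity-change, of the form $L(M)$. *)

theory Defs
  imports "HOL-Algebra.Module" "HOL-Algebra.AbelCoset" "HOL-Library.Poly_Mapping" Complex_Main
begin

section \<open>Super vector spaces, superalgebras and graded modules\<close>

text \<open>Parities are booleans: False is even, True is odd, and the sum of parities is
  the inequality of booleans.\<close>

definition ksign :: "bool \<Rightarrow> bool \<Rightarrow> complex"
  where "ksign p q = (if p \<and> q then -1 else 1)"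

definition complex_field :: "complex ring"
  where "complex_field = \<lparr>carrier = UNIV, monoid.mult = (*), one = 1, ring.zero = 0, add = (+)\<rparr>"

text \<open>The fields \<open>mult\<close> and \<open>one\<close> inherited from rings are left unspecified for bare
  spaces. They are the product and the unit of an associative superalgebra; in a Lie
  superalgebra \<open>mult\<close> is the bracket and \<open>one\<close> is unspecified.\<close>

record 'v super_space = "(complex, 'v) module" +
  part :: "bool \<Rightarrow> 'v set"

record ('g, 'v) super_module = "'v super_space" +
  act :: "'g \<Rightarrow> 'v \<Rightarrow> 'v"

definition super_space :: "('v, 'e) super_space_scheme \<Rightarrow> bool"
  where "super_space M \<longleftrightarrow>
     Module.module complex_field M \<and> (\<forall>p. submodule (part M p) complex_field M) \<and>
     (\<forall>x \<in> carrier M. \<exists>!ab. fst ab \<in> part M False \<and> snd ab \<in> part M True \<and>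
        x = fst ab \<oplus>\<^bsub>M\<^esub> snd ab)"

definition component :: "('v, 'e) super_space_scheme \<Rightarrow> bool \<Rightarrow> 'v \<Rightarrow> 'v"
  where "component M p x = (THE a. a \<in> part M p \<and> (\<exists>b \<in> part M (\<not> p). x = a \<oplus>\<^bsub>M\<^esub> b))"

definition lin_span :: "('v, 'e) super_space_scheme \<Rightarrow> 'v set \<Rightarrow> 'v set"
  where "lin_span M S = \<Inter> {N. submodule N complex_field M \<and> S \<subseteq> N}"

definition with_action :: "'v super_space \<Rightarrow> ('g \<Rightarrow> 'v \<Rightarrow> 'v) \<Rightarrow> ('g, 'v) super_module"
  where "with_action M a = super_space.extend M (super_module.fields a)"

definition supercommutator :: "('a, 'e) super_space_scheme \<Rightarrow> 'a \<Rightarrow> 'a \<Rightarrow> 'a"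
  where "supercommutator A x y =
     (\<Oplus>\<^bsub>A\<^esub>p\<in>UNIV. \<Oplus>\<^bsub>A\<^esub>q\<in>UNIV.
        (component A p x \<otimes>\<^bsub>A\<^esub> component A q y) \<oplus>\<^bsub>A\<^esub>
        (- ksign p q) \<odot>\<^bsub>A\<^esub> (component A q y \<otimes>\<^bsub>A\<^esub> component A p x))"

text \<open>The graded subspace \<open>C\<close> of the associative superalgebra \<open>A\<close> as a Lie superalgebra
  (for \<open>C\<close> closed under the supercommutator).\<close>

definition lie_sub :: "'a super_space \<Rightarrow> 'a set \<Rightarrow> 'a super_space"
  where "lie_sub A C = A\<lparr>carrier := C, monoid.mult := supercommutator A, one := undefined,
     part := (\<lambda>p. part A p \<inter> C)\<rparr>"

definition graded_action :: "'a super_space \<Rightarrow> ('a, 'v) super_module \<Rightarrow> bool"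
  where "graded_action A M \<longleftrightarrow>
     super_space M \<and>
     (\<forall>x \<in> carrier A. \<forall>v \<in> carrier M. act M x v \<in> carrier M) \<and>
     (\<forall>x \<in> carrier A. \<forall>y \<in> carrier A. \<forall>v \<in> carrier M.
        act M (x \<oplus>\<^bsub>A\<^esub> y) v = act M x v \<oplus>\<^bsub>M\<^esub> act M y v) \<and>
     (\<forall>x \<in> carrier A. \<forall>v \<in> carrier M. \<forall>w \<in> carrier M.
        act M x (v \<oplus>\<^bsub>M\<^esub> w) = act M x v \<oplus>\<^bsub>M\<^esub> act M x w) \<and>
     (\<forall>x \<in> carrier A. \<forall>v \<in> carrier M. \<forall>c.
        act M (c \<odot>\<^bsub>A\<^esub> x) v = c \<odot>\<^bsub>M\<^esub> act M x v \<and>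
        act M x (c \<odot>\<^bsub>M\<^esub> v) = c \<odot>\<^bsub>M\<^esub> act M x v) \<and>
     (\<forall>p q. \<forall>x \<in> part A p. \<forall>v \<in> part M q. act M x v \<in> part M (p \<noteq> q))"

definition assoc_supermodule :: "'a super_space \<Rightarrow> ('a, 'v) super_module \<Rightarrow> bool"
  where "assoc_supermodule A M \<longleftrightarrow>
     graded_action A M \<and>
     (\<forall>v \<in> carrier M. act M \<one>\<^bsub>A\<^esub> v = v) \<and>
     (\<forall>x \<in> carrier A. \<forall>y \<in> carrier A. \<forall>v \<in> carrier M.
        act M (x \<otimes>\<^bsub>A\<^esub> y) v = act M x (act M y v))"

definition lie_supermodule :: "'a super_space \<Rightarrow> ('a, 'v) super_module \<Rightarrow> bool"
  where "lie_supermodule G M \<longleftrightarrow>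
     graded_action G M \<and>
     (\<forall>p q. \<forall>x \<in> part G p. \<forall>y \<in> part G q. \<forall>v \<in> carrier M.
        act M (x \<otimes>\<^bsub>G\<^esub> y) v =
          act M x (act M y v) \<oplus>\<^bsub>M\<^esub> (- ksign p q) \<odot>\<^bsub>M\<^esub> act M y (act M x v))"

definition sub_supermodule :: "'a super_space \<Rightarrow> ('a, 'v) super_module \<Rightarrow> 'v set \<Rightarrow> bool"
  where "sub_supermodule A M N \<longleftrightarrow>
     submodule N complex_field M \<and>
     (\<forall>x \<in> N. \<forall>p. component M p x \<in> N) \<and>
     (\<forall>a \<in> carrier A. \<forall>x \<in> N. act M a x \<in> N)"

definition simple_supermodule :: "'a super_space \<Rightarrow> ('a, 'v) super_module \<Rightarrow> bool"
  where "simple_supermodule A M \<longleftrightarrow>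
     carrier M \<noteq> {\<zero>\<^bsub>M\<^esub>} \<and>
     (\<forall>N. sub_supermodule A M N \<longrightarrow> N = {\<zero>\<^bsub>M\<^esub>} \<or> N = carrier M)"

definition parity_change :: "('a, 'v) super_module \<Rightarrow> ('a, 'v) super_module"
  where "parity_change M = M\<lparr>part := (\<lambda>p. part M (\<not> p))\<rparr>"

definition supermodule_iso ::
    "'a super_space \<Rightarrow> ('a, 'v) super_module \<Rightarrow> ('a, 'w) super_module \<Rightarrow> bool"
  where "supermodule_iso A M N \<longleftrightarrow>
     (\<exists>\<phi>. bij_betw \<phi> (carrier M) (carrier N) \<and>
        (\<forall>x \<in> carrier M. \<forall>y \<in> carrier M. \<phi> (x \<oplus>\<^bsub>M\<^esub> y) = \<phi> x \<oplus>\<^bsub>N\<^esub> \<phi> y) \<and>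
        (\<forall>x \<in> carrier M. \<forall>c. \<phi> (c \<odot>\<^bsub>M\<^esub> x) = c \<odot>\<^bsub>N\<^esub> \<phi> x) \<and>
        (\<forall>p. \<phi> ` part M p = part N p) \<and>
        (\<forall>a \<in> carrier A. \<forall>x \<in> carrier M. \<phi> (act M a x) = act N a (\<phi> x)))"


section \<open>Quotients\<close>

text \<open>If \<open>f\<close> maps \<open>M\<close> to itself and preserves the subspace \<open>N\<close>, then \<open>descend M N f\<close> is
  the induced map on cosets: the union below consists of equal cosets.\<close>

definition descend :: "('v, 'e) super_space_scheme \<Rightarrow> 'v set \<Rightarrow> ('v \<Rightarrow> 'v) \<Rightarrow> 'v set \<Rightarrow> 'v set"
  where "descend M N f X = (\<Union>x\<in>X. N +>\<^bsub>M\<^esub> f x)"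

definition quot_space :: "('v, 'e) super_space_scheme \<Rightarrow> 'v set \<Rightarrow> 'v set super_space"
  where "quot_space M N =
     \<lparr>carrier = a_rcosets\<^bsub>M\<^esub> N, monoid.mult = undefined, one = undefined,
      ring.zero = N, add = set_add M, smult = (\<lambda>c. descend M N (\<lambda>x. c \<odot>\<^bsub>M\<^esub> x)),
      part = (\<lambda>p. a_r_coset M N ` part M p)\<rparr>"

definition quot_module :: "('g, 'v) super_module \<Rightarrow> 'v set \<Rightarrow> ('g, 'v set) super_module"
  where "quot_module M N = with_action (quot_space M N) (\<lambda>a. descend M N (act M a))"

definition maximal_submodule :: "'a super_space \<Rightarrow> ('a, 'v) super_module \<Rightarrow> 'v set \<Rightarrow> bool"
  where "maximal_submodule A M N \<longleftrightarrow>
     sub_supermodule A M N \<and> N \<noteq> carrier M \<and>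
     (\<forall>N'. sub_supermodule A M N' \<and> N \<subseteq> N' \<longrightarrow> N' = N \<or> N' = carrier M)"

definition simple_top :: "'a super_space \<Rightarrow> ('a, 'v) super_module \<Rightarrow> ('a, 'v set) super_module"
  where "simple_top A M = quot_module M (THE N. maximal_submodule A M N)"


section \<open>Free spaces, tensor products and enveloping algebras\<close>

abbreviation bvec :: "'b \<Rightarrow> 'b \<Rightarrow>\<^sub>0 complex"
  where "bvec b \<equiv> Poly_Mapping.single b 1"

definition pscale :: "complex \<Rightarrow> ('b \<Rightarrow>\<^sub>0 complex) \<Rightarrow> ('b \<Rightarrow>\<^sub>0 complex)"
  where "pscale c f = Poly_Mapping.map ((*) c) f"

definition linext :: "('a \<Rightarrow> ('b \<Rightarrow>\<^sub>0 complex)) \<Rightarrow> ('a \<Rightarrow>\<^sub>0 complex) \<Rightarrow> ('b \<Rightarrow>\<^sub>0 complex)"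
  where "linext \<phi> f = (\<Sum>a \<in> Poly_Mapping.keys f. pscale (Poly_Mapping.lookup f a) (\<phi> a))"

text \<open>The space with basis \<open>B\<close>. The basis elements in \<open>d p\<close> are declared homogeneous of
  parity \<open>p\<close>; elements of \<open>B\<close> may also have no parity, so that in general only
  quotients of this space are super vector spaces.\<close>

definition free_space :: "'b set \<Rightarrow> (bool \<Rightarrow> 'b set) \<Rightarrow> ('b \<Rightarrow>\<^sub>0 complex) super_space"
  where "free_space B d =
     \<lparr>carrier = {f. Poly_Mapping.keys f \<subseteq> B}, monoid.mult = undefined, one = undefined,
      ring.zero = 0, add = (+), smult = pscale, part = (\<lambda>p. {f. Poly_Mapping.keys f \<subseteq> d p})\<rparr>"

definition pair_space ::
    "('p, 'd) super_space_scheme \<Rightarrow> ('v, 'e) super_space_scheme \<Rightarrow> ('p \<times> 'v \<Rightarrow>\<^sub>0 complex) super_space"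
  where "pair_space P V = free_space (carrier P \<times> carrier V) (\<lambda>r. \<Union>q. part P (r \<noteq> q) \<times> part V q)"

definition bilinear_rels ::
    "('p, 'd) super_space_scheme \<Rightarrow> ('v, 'e) super_space_scheme \<Rightarrow> ('p \<times> 'v \<Rightarrow>\<^sub>0 complex) set"
  where "bilinear_rels P V =
     {bvec (x \<oplus>\<^bsub>P\<^esub> y, v) - bvec (x, v) - bvec (y, v) | x y v.
        x \<in> carrier P \<and> y \<in> carrier P \<and> v \<in> carrier V} \<union>
     {bvec (x, v \<oplus>\<^bsub>V\<^esub> w) - bvec (x, v) - bvec (x, w) | x v w.
        x \<in> carrier P \<and> v \<in> carrier V \<and> w \<in> carrier V} \<union>
     {bvec (c \<odot>\<^bsub>P\<^esub> x, v) - pscale c (bvec (x, v)) | c x v. x \<in> carrier P \<and> v \<in> carrier V} \<union>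
     {bvec (x, c \<odot>\<^bsub>V\<^esub> v) - pscale c (bvec (x, v)) | c x v. x \<in> carrier P \<and> v \<in> carrier V}"

definition tensor_null ::
    "('p, 'd) super_space_scheme \<Rightarrow> ('v, 'e) super_space_scheme \<Rightarrow> ('p \<times> 'v \<Rightarrow>\<^sub>0 complex) set"
  where "tensor_null P V = lin_span (pair_space P V) (bilinear_rels P V)"

definition tensor ::
    "('p, 'd) super_space_scheme \<Rightarrow> ('v, 'e) super_space_scheme \<Rightarrow> ('p \<times> 'v \<Rightarrow>\<^sub>0 complex) set super_space"
  where "tensor P V = quot_space (pair_space P V) (tensor_null P V)"

inductive hom_word :: "'g super_space \<Rightarrow> bool \<Rightarrow> 'g list \<Rightarrow> bool" for G
  where
    Nil: "hom_word G False []"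
  | Cons: "x \<in> part G p \<Longrightarrow> hom_word G q w \<Longrightarrow> hom_word G (p \<noteq> q) (x # w)"

definition word_space :: "'g super_space \<Rightarrow> ('g list \<Rightarrow>\<^sub>0 complex) super_space"
  where "word_space G = free_space (lists (carrier G)) (\<lambda>p. {w. hom_word G p w})"

definition word_mult :: "('g list \<Rightarrow>\<^sub>0 complex) \<Rightarrow> ('g list \<Rightarrow>\<^sub>0 complex) \<Rightarrow> ('g list \<Rightarrow>\<^sub>0 complex)"
  where "word_mult f g = linext (\<lambda>a. linext (\<lambda>b. bvec (a @ b)) g) f"

text \<open>The enveloping algebra is the free associative algebra on the set \<open>G\<close> modulo the
  two-sided ideal \<open>env_null G\<close>.\<close>

definition env_null :: "'g super_space \<Rightarrow> ('g list \<Rightarrow>\<^sub>0 complex) set"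
  where "env_null G = lin_span (word_space G)
     ({bvec (a @ (x \<oplus>\<^bsub>G\<^esub> y) # b) - bvec (a @ x # b) - bvec (a @ y # b) | a b x y.
        a \<in> lists (carrier G) \<and> b \<in> lists (carrier G) \<and> x \<in> carrier G \<and> y \<in> carrier G} \<union>
      {bvec (a @ (c \<odot>\<^bsub>G\<^esub> x) # b) - pscale c (bvec (a @ x # b)) | a b c x.
        a \<in> lists (carrier G) \<and> b \<in> lists (carrier G) \<and> x \<in> carrier G} \<union>
      {bvec (a @ x # y # b) - pscale (ksign p q) (bvec (a @ y # x # b)) - bvec (a @ (x \<otimes>\<^bsub>G\<^esub> y) # b)
        | a b x y p q.
        a \<in> lists (carrier G) \<and> b \<in> lists (carrier G) \<and> x \<in> part G p \<and> y \<in> part G q})"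

definition env :: "'g super_space \<Rightarrow> ('g list \<Rightarrow>\<^sub>0 complex) set super_space"
  where "env G = (quot_space (word_space G) (env_null G))
     \<lparr>monoid.mult := (\<lambda>X Y. \<Union>f\<in>X. \<Union>g\<in>Y. env_null G +>\<^bsub>word_space G\<^esub> word_mult f g),
      one := env_null G +>\<^bsub>word_space G\<^esub> bvec []\<rparr>"

definition env_incl :: "'g super_space \<Rightarrow> 'g \<Rightarrow> ('g list \<Rightarrow>\<^sub>0 complex) set"
  where "env_incl G x = env_null G +>\<^bsub>word_space G\<^esub> bvec [x]"

text \<open>For a subalgebra \<open>H\<close> of \<open>G\<close> and an \<open>H\<close>-module \<open>M\<close>, the induced module is the tensor
  product of \<open>env G\<close> and \<open>M\<close> over the enveloping algebra of \<open>H\<close>. As the latter is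
  generated by \<open>H\<close>, it suffices to balance over \<open>H\<close>.\<close>

definition induced_null ::
    "'g super_space \<Rightarrow> 'g set \<Rightarrow> ('g, 'v) super_module \<Rightarrow> (('g list \<Rightarrow>\<^sub>0 complex) set \<times> 'v \<Rightarrow>\<^sub>0 complex) set"
  where "induced_null G H M = lin_span (pair_space (env G) M)
     (bilinear_rels (env G) M \<union>
      {bvec (u \<otimes>\<^bsub>env G\<^esub> env_incl G y, v) - bvec (u, act M y v) | u y v.
        u \<in> carrier (env G) \<and> y \<in> H \<and> v \<in> carrier M})"

definition induced ::
    "'g super_space \<Rightarrow> 'g set \<Rightarrow> ('g, 'v) super_module \<Rightarrow>
     ('g, (('g list \<Rightarrow>\<^sub>0 complex) set \<times> 'v \<Rightarrow>\<^sub>0 complex) set) super_module"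
  where "induced G H M = with_action (quot_space (pair_space (env G) M) (induced_null G H M))
     (\<lambda>y. descend (pair_space (env G) M) (induced_null G H M)
        (linext (\<lambda>(u, v). bvec (env_incl G y \<otimes>\<^bsub>env G\<^esub> u, v))))"


section \<open>The Weyl superalgebra and the Lie superalgebra S'(1,n)\<close>

text \<open>Laurent polynomials in \<open>t\<close> with coefficients in the exterior algebra: the basis
  element \<open>(k, I)\<close> stands for \<open>t\<^sup>k \<xi>\<^sub>I\<close>.\<close>

type_synonym laur = "int \<times> nat set \<Rightarrow>\<^sub>0 complex"

definition laur :: "nat \<Rightarrow> laur set"
  where "laur n = {f. Poly_Mapping.keys f \<subseteq> UNIV \<times> Pow {1..n}}"

definition laur_part :: "nat \<Rightarrow> bool \<Rightarrow> laur set"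
  where "laur_part n p = {f. Poly_Mapping.keys f \<subseteq> UNIV \<times> {I. I \<subseteq> {1..n} \<and> odd (card I) = p}}"

text \<open>\<open>\<xi>\<^sub>I \<xi>\<^sub>J\<close> is \<open>\<xi>\<close> of the union up to the sign of the permutation sorting the
  concatenation of the increasing enumerations of \<open>I\<close> and \<open>J\<close>.\<close>

definition laur_mult :: "laur \<Rightarrow> laur \<Rightarrow> laur"
  where "laur_mult f g = linext (\<lambda>(k, I). linext (\<lambda>(l, J).
     if I \<inter> J = {}
     then Poly_Mapping.single (k + l, I \<union> J) ((-1) ^ card {(i, j). i \<in> I \<and> j \<in> J \<and> j < i})
     else 0) g) f"

text \<open>Operators on \<open>laur n\<close> are represented by linear maps on the whole type that vanish on
  the basis elements outside \<open>laur n\<close>; the identity is the corresponding projection.\<close>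

definition laur_op :: "nat \<Rightarrow> (int \<times> nat set \<Rightarrow> laur) \<Rightarrow> laur \<Rightarrow> laur"
  where "laur_op n \<phi> = linext (\<lambda>(k, I). if I \<subseteq> {1..n} then \<phi> (k, I) else 0)"

definition mul_op :: "nat \<Rightarrow> laur \<Rightarrow> laur \<Rightarrow> laur"
  where "mul_op n f = laur_op n (\<lambda>b. laur_mult f (bvec b))"

text \<open>\<open>der_basis 0\<close> is \<open>d/dt\<close>, and \<open>der_basis i\<close> is the (left) derivative with respect to
  \<open>\<xi>\<^sub>i\<close> for positive \<open>i\<close>.\<close>

definition der_basis :: "nat \<Rightarrow> int \<times> nat set \<Rightarrow> laur"
  where "der_basis j = (\<lambda>(k, I).
     if j = 0 then Poly_Mapping.single (k - 1, I) (of_int k)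
     else if j \<in> I then Poly_Mapping.single (k, I - {j}) ((-1) ^ card {i \<in> I. i < j})
     else 0)"

definition der_op :: "nat \<Rightarrow> nat \<Rightarrow> laur \<Rightarrow> laur"
  where "der_op n j = laur_op n (der_basis j)"

inductive_set weyl_ops :: "nat \<Rightarrow> (laur \<Rightarrow> laur) set" for n
  where
    one: "mul_op n (bvec (0, {})) \<in> weyl_ops n"
  | t: "mul_op n (bvec (1, {})) \<in> weyl_ops n"
  | t_inverse: "mul_op n (bvec (-1, {})) \<in> weyl_ops n"
  | xi: "i \<in> {1..n} \<Longrightarrow> mul_op n (bvec (0, {i})) \<in> weyl_ops n"
  | der: "j \<le> n \<Longrightarrow> der_op n j \<in> weyl_ops n"
  | scale: "T \<in> weyl_ops n \<Longrightarrow> (\<lambda>f. pscale c (T f)) \<in> weyl_ops n"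
  | add: "S \<in> weyl_ops n \<Longrightarrow> T \<in> weyl_ops n \<Longrightarrow> (\<lambda>f. S f + T f) \<in> weyl_ops n"
  | comp: "S \<in> weyl_ops n \<Longrightarrow> T \<in> weyl_ops n \<Longrightarrow> S \<circ> T \<in> weyl_ops n"

definition weyl :: "nat \<Rightarrow> (laur \<Rightarrow> laur) super_space"
  where "weyl n =
     \<lparr>carrier = weyl_ops n, monoid.mult = (\<circ>), one = mul_op n (bvec (0, {})),
      ring.zero = (\<lambda>f. 0), add = (\<lambda>S T f. S f + T f), smult = (\<lambda>c T f. pscale c (T f)),
      part = (\<lambda>p. {T \<in> weyl_ops n. \<forall>q. T ` laur_part n q \<subseteq> laur_part n (p \<noteq> q)})\<rparr>"

text \<open>The derivation with coefficients \<open>f 0\<close> of \<open>d/dt\<close> and \<open>f i\<close> of the \<open>\<xi>\<^sub>i\<close>-derivatives;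
  these operators form W(1,n).\<close>

definition derivation :: "nat \<Rightarrow> (nat \<Rightarrow> laur) \<Rightarrow> laur \<Rightarrow> laur"
  where "derivation n f = (\<lambda>g. \<Sum>j\<le>n. laur_mult (f j) (der_op n j g))"

text \<open>A derivation is homogeneous of parity \<open>p\<close> iff \<open>f 0\<close> has parity \<open>p\<close> and the other
  coefficients have the opposite parity, which gives the sign in the divergence.\<close>

definition div_free :: "nat \<Rightarrow> bool \<Rightarrow> (laur \<Rightarrow> laur) set"
  where "div_free n p = {derivation n f | f.
     f 0 \<in> laur_part n p \<and> (\<forall>i \<in> {1..n}. f i \<in> laur_part n (\<not> p)) \<and>
     der_op n 0 (f 0) + (\<Sum>i\<in>{1..n}. pscale (if \<not> p then -1 else 1) (der_op n i (f i))) = 0}"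

definition S_ops :: "nat \<Rightarrow> (laur \<Rightarrow> laur) set"
  where "S_ops n = lin_span (weyl n) (div_free n False \<union> div_free n True)"

definition S_prime :: "nat \<Rightarrow> (laur \<Rightarrow> laur) super_space"
  where "S_prime n = lie_sub (weyl n)
     (lin_span (weyl n) {supercommutator (weyl n) x y | x y. x \<in> S_ops n \<and> y \<in> S_ops n})"


section \<open>The Lie superalgebras gl(1,n) and sl(1,n)\<close>

type_synonym mat = "nat \<Rightarrow> nat \<Rightarrow> complex"

definition mat_alg :: "nat \<Rightarrow> mat super_space"
  where "mat_alg n =
     \<lparr>carrier = {A. \<forall>i j. A i j \<noteq> 0 \<longrightarrow> i \<le> n \<and> j \<le> n},
      monoid.mult = (\<lambda>A B i j. \<Sum>k\<le>n. A i k * B k j),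
      one = (\<lambda>i j. if i = j \<and> i \<le> n then 1 else 0),
      ring.zero = (\<lambda>i j. 0), add = (\<lambda>A B i j. A i j + B i j), smult = (\<lambda>c A i j. c * A i j),
      part = (\<lambda>p. {A. \<forall>i j. A i j \<noteq> 0 \<longrightarrow> i \<le> n \<and> j \<le> n \<and> ((i = 0) \<noteq> (j = 0)) = p})\<rparr>"

definition gl :: "nat \<Rightarrow> mat super_space"
  where "gl n = lie_sub (mat_alg n) (carrier (mat_alg n))"

definition sl :: "nat \<Rightarrow> mat super_space"
  where "sl n = lie_sub (mat_alg n) {A \<in> carrier (gl n). A 0 0 - (\<Sum>i\<in>{1..n}. A i i) = 0}"

definition sl_minus :: "nat \<Rightarrow> mat set"
  where "sl_minus n = {A \<in> carrier (sl n). \<forall>i j. A i j \<noteq> 0 \<longrightarrow> 1 \<le> i \<and> j = 0}"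

definition weight_module :: "nat \<Rightarrow> (mat, 'v) super_module \<Rightarrow> bool"
  where "weight_module n V \<longleftrightarrow>
     carrier V = lin_span V {v \<in> carrier V.
       \<forall>h \<in> carrier (sl n). (\<forall>i j. i \<noteq> j \<longrightarrow> h i j = 0) \<longrightarrow> (\<exists>c. act V h v = c \<odot>\<^bsub>V\<^esub> v)}"


section \<open>Shen-Larsson modules\<close>

text \<open>\<open>pi_coeff s\<close> sends \<open>a = t\<^sup>k \<xi>\<^sub>I\<close> to the coefficient at \<open>E\<^sub>s\<^sub>,\<^sub>j\<close> of the image under
  \<open>\<pi>\<close> of \<open>a\<close> times the \<open>j\<close>-th derivative; it does not depend on \<open>j\<close>.\<close>

definition pi_coeff :: "nat \<Rightarrow> int \<times> nat set \<Rightarrow> laur"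
  where "pi_coeff s = (\<lambda>(k, I).
     if s = 0 then Poly_Mapping.single (k - 1, I) (of_int k)
     else pscale ((-1) ^ (card I - 1)) (der_basis s (k, I)))"

definition gen :: "nat \<Rightarrow> laur"
  where "gen j = (if j = 0 then bvec (1, {}) else bvec (0, {j}))"

text \<open>For \<open>x\<close> in W(1,n), whose coefficients are the values \<open>x (gen j)\<close>, the element
  \<open>\<pi> x\<close> is the sum of \<open>x \<otimes> 1\<close> and of \<open>t\<^sup>k \<xi>\<^sub>I \<otimes> pi_mat n x (k, I)\<close> over all \<open>(k, I)\<close>.
  For \<open>x\<close> in S'(1,n) the matrices \<open>pi_mat n x (k, I)\<close> belong to sl(1,n).\<close>

definition pi_mat :: "nat \<Rightarrow> (laur \<Rightarrow> laur) \<Rightarrow> int \<times> nat set \<Rightarrow> mat"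
  where "pi_mat n x b = (\<lambda>s j.
     if s \<le> n \<and> j \<le> n then Poly_Mapping.lookup (linext (pi_coeff s) (x (gen j))) b else 0)"

definition shen_larsson_pair ::
    "nat \<Rightarrow> (laur \<Rightarrow> laur, 'p) super_module \<Rightarrow> (mat, 'v) super_module \<Rightarrow> (laur \<Rightarrow> laur) \<Rightarrow>
     'p \<times> 'v \<Rightarrow> ('p \<times> 'v \<Rightarrow>\<^sub>0 complex)"
  where "shen_larsson_pair n P V x = (\<lambda>(y, v).
     bvec (act P x y, v) +
     (\<Sum>b | pi_mat n x b \<noteq> (\<lambda>s j. 0). \<Sum>q\<in>UNIV. \<Sum>r\<in>UNIV.
        Poly_Mapping.single
          (act P (mul_op n (bvec b)) (component P r y), act V (component (sl n) q (pi_mat n x b)) v)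
          (ksign q r)))"

definition F_module ::
    "nat \<Rightarrow> (laur \<Rightarrow> laur, 'p) super_module \<Rightarrow> (mat, 'v) super_module \<Rightarrow>
     (laur \<Rightarrow> laur, ('p \<times> 'v \<Rightarrow>\<^sub>0 complex) set) super_module"
  where "F_module n P V = with_action (tensor P V)
     (\<lambda>x. descend (pair_space P V) (tensor_null P V) (linext (shen_larsson_pair n P V x)))"


section \<open>The modules L(N(lambda))\<close>

text \<open>\<open>V\<^sub>i\<close> has as basis the (classes of the) powers of \<open>t\<^sub>i\<close> with exponent in
  \<open>exponents (\<lambda>\<^sub>i)\<close>. Hence \<open>A\<^sup>+\<^sub>n\<^sub>,\<^sub>0(\<lambda>)\<close> has a basis of monomials, which are represented
  by their exponent vectors \<open>\<mu>\<close>. A product with \<open>t\<^sub>i\<close> that leaves this basis is zero: this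
  only happens for negative integers \<open>\<lambda>\<^sub>i\<close>, where \<open>V\<^sub>i\<close> is a quotient by the polynomials.\<close>

definition exponents :: "complex \<Rightarrow> complex set"
  where "exponents z = (if z \<in> \<nat> then \<nat> else if z \<in> \<int> then \<int> - \<nat> else {z + of_int k | k. True})"

definition monomials :: "nat \<Rightarrow> (nat \<Rightarrow> complex) \<Rightarrow> (nat \<Rightarrow> complex) set"
  where "monomials n lam =
     {\<mu>. (\<forall>i \<in> {1..n}. \<mu> i \<in> exponents (lam i)) \<and> (\<forall>i. i \<notin> {1..n} \<longrightarrow> \<mu> i = 0)}"

definition t_mult ::
    "nat \<Rightarrow> (nat \<Rightarrow> complex) \<Rightarrow> nat \<Rightarrow> ((nat \<Rightarrow> complex) \<Rightarrow>\<^sub>0 complex) \<Rightarrow> ((nat \<Rightarrow> complex) \<Rightarrow>\<^sub>0 complex)"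
  where "t_mult n lam i = linext (\<lambda>\<mu>.
     if \<mu>(i := \<mu> i + 1) \<in> monomials n lam then bvec (\<mu>(i := \<mu> i + 1)) else 0)"

definition t_der ::
    "nat \<Rightarrow> ((nat \<Rightarrow> complex) \<Rightarrow>\<^sub>0 complex) \<Rightarrow> ((nat \<Rightarrow> complex) \<Rightarrow>\<^sub>0 complex)"
  where "t_der i = linext (\<lambda>\<mu>. Poly_Mapping.single (\<mu>(i := \<mu> i - 1)) (\<mu> i))"

definition N_carrier :: "nat \<Rightarrow> (nat \<Rightarrow> complex) \<Rightarrow> ((nat \<Rightarrow> complex) \<Rightarrow>\<^sub>0 complex) set"
  where "N_carrier n lam = {v. Poly_Mapping.keys v \<subseteq> monomials n lam \<and>
     (\<Sum>s\<in>{1..n}. t_mult n lam s (t_der s v)) = pscale (\<Sum>i\<in>{1..n}. lam i) v}"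

text \<open>\<open>N(\<lambda>)\<close> is purely even. The inverse of \<open>\<sigma>(A) = diag(tr A, A)\<close> deletes row and column 0,
  so \<open>A\<close> in the even part of sl(1,n) acts through its entries with indices in \<open>{1..n}\<close>. The
  same formula gives the zero action of \<open>sl_minus n\<close>, as required in the Kac module.\<close>

definition N_module ::
    "nat \<Rightarrow> (nat \<Rightarrow> complex) \<Rightarrow> (mat, (nat \<Rightarrow> complex) \<Rightarrow>\<^sub>0 complex) super_module"
  where "N_module n lam =
     \<lparr>carrier = N_carrier n lam, monoid.mult = undefined, one = undefined,
      ring.zero = 0, add = (+), smult = pscale,
      part = (\<lambda>p. if p then {0} else N_carrier n lam),
      act = (\<lambda>A v. \<Sum>i\<in>{1..n}. \<Sum>j\<in>{1..n}. pscale (A i j) (t_mult n lam i (t_der j v)))\<rparr>"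

definition sl_nonpos :: "nat \<Rightarrow> mat set"
  where "sl_nonpos n = {A. \<exists>B \<in> part (sl n) False. \<exists>C \<in> sl_minus n. A = B \<oplus>\<^bsub>sl n\<^esub> C}"

text \<open>\<open>M\<close> is a module over the even part of sl(1,n); it is extended by zero to \<open>sl_minus n\<close>.\<close>

definition extend_by_zero :: "nat \<Rightarrow> (mat, 'v) super_module \<Rightarrow> (mat, 'v) super_module"
  where "extend_by_zero n M = M\<lparr>act := (\<lambda>A. act M (component (sl n) False A))\<rparr>"

definition kac ::
    "nat \<Rightarrow> (mat, 'v) super_module \<Rightarrow>
     (mat, ((mat list \<Rightarrow>\<^sub>0 complex) set \<times> 'v \<Rightarrow>\<^sub>0 complex) set) super_module"
  where "kac n M = induced (sl n) (sl_nonpos n) (extend_by_zero n M)"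

definition L_module ::
    "nat \<Rightarrow> (mat, 'v) super_module \<Rightarrow>
     (mat, ((mat list \<Rightarrow>\<^sub>0 complex) set \<times> 'v \<Rightarrow>\<^sub>0 complex) set set) super_module"
  where "L_module n M = simple_top (sl n) (kac n M)"

end

(*
Let N be a proper nonzero submodule of F(P,V). The action of t^k xi_I d/d xi_i-type fields on N is polynomial in k up to
a shift by t^k, and second differences in k isolate its quadratic part, which only involves products E_{0,i} E_{0,j} on V.
As P is simple of countable dimension, its endomorphisms are scalars (Dixmier), and the operators on P can be separated from
those on V; so a nonzero product E_{0,i} E_{0,j} on V would force N = F(P,V). Hence all these products vanish on V.

Then V is the sum of M = {v : E_{i,0} v = 0 for all i} and the spaces E_{0,i} M. Applying E_{l,0} and E_{k,0} to
E_{0,i} E_{0,j} v = 0 for v in M gives a quadratic relation for gl(n) on M which says that the normally ordered product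
of t_k d/dt_j and t_l d/dt_i is symmetric in i, j. By this relation, a module generated by a weight vector g has no
vectors of the weight of g except the multiples of g. Applied to the sum of g in M and the monomial of the same weight mu
in N(mu), it shows that the submodule generated by this pair is the graph of an isomorphism. Finally, V is the simple top of
the Kac module of M because diag(n, 1, ..., 1) separates the layers of the Kac module.
*)
theory Submission
 imports Defs "HOL-Library.Product_Plus" "HOL-Library.Countable_Set" "HOL-Computational_Algebra.Fundamental_Theorem_Algebra" "HOL-Analysis.Continuum_Not_Denumerable"
begin

section \<open>Free vector spaces\<close>

text \<open>The modules of the statement are records on sets in arbitrary types, some of them
  quotients of quotients. Each is transported to finitely supported functions on a homogeneous
  basis: tensor products become functions on pairs of basis elements, the Kac module becomes the
  range of a projection along its relations, and a grading becomes stability under an involution.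

  Two points shape the argument. Koszul signs tie the two tensor factors together; they can be
  undone because the parity of P is, up to sign, the action of the product of all 1 - 2 xi_j
  d/dxi_j, which lies in the Weyl superalgebra. Further, E_{0,i} enters pi of t^k xi_I d/dxi_i with
  the factor k t^{k-1} xi_I, so two such fields can place any monomial t^m xi_L in front of E_{0,i}
  E_{0,j}. Hence this product maps N into the largest subspace of N stable under all
  multiplications. That subspace turns out to be stable under both tensor factors, so it is zero.
  The operators on V that annihilate N then annihilate V itself, because their common kernel is a
  nonzero submodule.\<close>

type_synonym 'a fv = "'a \<Rightarrow>\<^sub>0 complex"

abbreviation sgl where "sgl \<equiv> Poly_Mapping.single"

abbreviation supp :: "'a fv => 'a set" where "supp \<equiv> Poly_Mapping.keys"
abbreviation cf :: "'a fv => 'a => complex" where "cf \<equiv> Poly_Mapping.lookup"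

lemma cf_pscale [simp]: "cf (pscale c f) b = c * cf f b"
 by (simp add: pscale_def Poly_Mapping.map.rep_eq when_def)

lemma supp_iff: "b \<in> supp f \<longleftrightarrow> cf f b ~= 0"
 by (simp add: in_keys_iff)

interpretation pv: vector_space pscale
 by unfold_locales
   (auto intro!: poly_mapping_eqI simp: lookup_add algebra_simps)

abbreviation "subsp \<equiv> pv.subspace"

lemmas sub_add = pv.subspace_add and sub_scale = pv.subspace_scale and sub_diff = pv.subspace_diff
 and sub_sum = pv.subspace_sum and sub_0 = pv.subspace_0 and sub_neg = pv.subspace_neg

abbreviation "slc n \<equiv> carrier (sl n)"

lemma pscale_single [simp]: "pscale c (sgl b d) = sgl b (c * d)"
 by (auto intro!: poly_mapping_eqI simp: lookup_single when_def)

lemma supp_pscale: "supp (pscale c f) <= supp f"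
 by (auto simp: supp_iff)

definition plin :: "('a fv => 'b fv) => bool"
 where "plin F \<longleftrightarrow> (\<forall>x y. F (x + y) = F x + F y) & (\<forall>c x. F (pscale c x) = pscale c (F x))"

lemma plinI:
 assumes "!!x y. F (x + y) = F x + F y" "!!c x. F (pscale c x) = pscale c (F x)"
 shows "plin F"
 using assms by (auto simp: plin_def)

lemma plin_add: "plin F ==> F (x + y) = F x + F y"
 and plin_scale: "plin F ==> F (pscale c x) = pscale c (F x)"
 by (auto simp: plin_def)

lemma plin_zero: "plin F ==> F 0 = 0"
 using plin_scale[of F 0 0] by simp

lemma plin_neg: "plin F ==> F (- x) = - F x"
 using plin_scale[of F "-1" x] by simp

lemma plin_diff: "plin F ==> F (x - y) = F x - F y"
 using plin_add[of F x "-y"] plin_neg[of F y] by simp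

lemma plin_sum: "plin F ==> F (\<Sum>a\<in>A. g a) = (\<Sum>a\<in>A. F (g a))"
 by (induction A rule: infinite_finite_induct) (auto simp: plin_add plin_zero)

lemma plin_comp: "plin F ==> plin G ==> plin (%x. F (G x))"
 by (simp add: plin_def)

lemma plin_plus: "plin F ==> plin G ==> plin (%x. F x + G x)"
 by (rule plinI) (simp_all add: plin_add plin_scale pv.scale_right_distrib)

lemma plin_minus: "plin F ==> plin G ==> plin (%x. F x - G x)"
 by (rule plinI) (simp_all add: plin_add plin_scale pv.scale_right_diff_distrib)

lemma plin_pscale: "plin F ==> plin (%x. pscale c (F x))"
 by (rule plinI) (simp_all add: plin_add plin_scale pv.scale_right_distrib mult.commute)

lemma plin_id: "plin (%x. x)" by (simp add: plin_def)
lemma plin_null: "plin (%x. 0)" by (simp add: plin_def)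

lemma plin_if: "plin F ==> plin G ==> plin (%x. if P then F x else G x)"
 by (cases P) simp_all

lemma plin_sum_fun: "(!!a. a \<in> A ==> plin (F a)) ==> plin (%x. \<Sum>a\<in>A. F a x)"
 by (induction A rule: infinite_finite_induct) (auto intro: plin_plus plin_null)

lemma linext_superset:
 assumes "finite A" "supp f <= A"
 shows "linext \<phi> f = (\<Sum>a\<in>A. pscale (cf f a) (\<phi> a))"
 unfolding linext_def using assms
 by (intro sum.mono_neutral_left) (auto simp: in_keys_iff)

lemma plin_linext [simp]: "plin (linext \<phi>)"
proof (rule plinI)
 fix x y :: "'a \<Rightarrow>\<^sub>0 complex" and c
 let ?A = "supp x Un supp y"
 have "supp (x + y) <= ?A" by (rule Poly_Mapping.keys_add)
 thus "linext \<phi> (x + y) = linext \<phi> x + linext \<phi> y"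
  by (simp add: linext_superset[of ?A] lookup_add pv.scale_left_distrib sum.distrib)
 show "linext \<phi> (pscale c x) = pscale c (linext \<phi> x)"
  by (simp add: linext_superset[of "supp x"] supp_pscale pv.scale_sum_right)
qed

lemma linext_single [simp]: "linext \<phi> (sgl b c) = pscale c (\<phi> b)"
 by (subst linext_superset[of "{b}"]) auto

lemma poly_mapping_expand:
 assumes "finite A" "supp f <= A"
 shows "f = (\<Sum>b\<in>A. pscale (cf f b) (bvec b))"
 using assms
 by (auto intro!: poly_mapping_eqI simp: lookup_sum lookup_single when_def in_keys_iff sum.delta'
    if_distrib[of "%x. _ * x"] cong: if_cong)

lemma supp_induct:
 assumes "subsp W" "supp f <= B" "!!b. b \<in> B ==> bvec b \<in> W"
 shows "f \<in> W"
proof -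
 have "(\<Sum>b\<in>supp f. pscale (cf f b) (bvec b)) \<in> W"
  using assms by (intro sub_sum sub_scale) auto
 thus ?thesis using poly_mapping_expand[of "supp f" f] by simp
qed

lemma plin_eqI:
 assumes "plin F" "plin G" "supp f <= B" "!!b. b \<in> B ==> F (bvec b) = G (bvec b)"
 shows "F f = G f"
proof -
 have "subsp {f. F f = G f}"
  by (rule pv.subspaceI) (auto simp: assms(1,2) plin_add plin_scale plin_zero)
 thus ?thesis using supp_induct[of "{f. F f = G f}" f B] assms(3,4) by auto
qed

lemma plin_ext: "plin F ==> plin G ==> (!!b. F (bvec b) = G (bvec b)) ==> F = G"
 by (rule ext, rule plin_eqI[where B=UNIV]) auto

lemma subspace_supp: "subsp {f. supp f <= B}"
proof (rule pv.subspaceI)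
 show "x + y \<in> {f. supp f <= B}" if "x \<in> {f. supp f <= B}" "y \<in> {f. supp f <= B}" for x y
  using that Poly_Mapping.keys_add[of x y] by blast
 show "pscale c x \<in> {f. supp f <= B}" if "x \<in> {f. supp f <= B}" for c x
  using that supp_pscale[of c x] by blast
qed simp

lemma supp_subspaceD:
 "supp x <= B ==> supp y <= B ==> supp (x + y) <= B"
 "supp x <= B ==> supp y <= B ==> supp (x - y) <= B"
 "supp x <= B ==> supp (pscale c x) <= B"
 "supp x <= B ==> supp (- x) <= B"
 using sub_add[OF subspace_supp[of B]] sub_diff[OF subspace_supp[of B]]
   sub_scale[OF subspace_supp[of B]] sub_neg[OF subspace_supp[of B]] by auto

lemma subspace_vimage: "plin F ==> subsp W ==> subsp {x. F x \<in> W}"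
 by (rule pv.subspaceI)
  (auto simp: plin_add plin_scale plin_zero sub_add sub_scale sub_0)

lemma supp_image:
 assumes "plin F" "subsp W" "supp f <= B" "!!b. b \<in> B ==> F (bvec b) \<in> W"
 shows "F f \<in> W"
 using supp_induct[OF subspace_vimage[OF assms(1,2)] assms(3)] assms(4) by auto

lemma plin_span:
 assumes "plin F" "subsp W" "!!s. s \<in> S ==> F s \<in> W" "f \<in> pv.span S"
 shows "F f \<in> W"
 using pv.span_minimal[OF _ subspace_vimage[OF assms(1,2)], of S] assms(3,4) by auto

lemma span_sub_supp: "S <= {f. supp f <= B} ==> pv.span S <= {f. supp f <= B}"
 by (rule pv.span_minimal[OF _ subspace_supp])

lemma span_bvec: "supp f <= B ==> f \<in> pv.span (bvec ` B)"
 by (rule supp_induct[OF pv.subspace_span]) (auto intro: pv.span_base)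

text \<open>The eigenvalue equations are only required modulo \<open>N\<close>, so that the lemma also applies to
  quotients.\<close>

lemma (in vector_space) joint_eigenvectors_in_subspace:
 assumes N: "subspace N" and HN: "!!h y. h \<in> H ==> y \<in> N ==> h y \<in> N"
  and add: "!!h y z. h \<in> H ==> h (y + z) = h y + h z"
  and sc: "!!h y c. h \<in> H ==> h (scale c y) = scale c (h y)"
 shows "finite A ==> (!!r h. r \<in> A ==> h \<in> H ==> h (x r) - scale (\<chi> h r) (x r) \<in> N) ==>
   (!!r s. r \<in> A ==> s \<in> A ==> r ~= s ==> \<exists>h\<in>H. \<chi> h r ~= \<chi> h s) ==>
   (\<Sum>r\<in>A. x r) \<in> N ==> r \<in> A ==> x r \<in> N"
proof (induction "card A" arbitrary: A x r)
 case 0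
 thus ?case by auto
next
 case (Suc k)
 show ?case
 proof (cases "A = {r}")
  case True
  with Suc.prems show ?thesis by simp
 next
  case False
  \<comment> \<open>Applying \<open>h - \<chi> h s\<close> removes the summand at \<open>s\<close>
    modulo \<open>N\<close> and multiplies every other one by
    \<open>\<chi> h r - \<chi> h s\<close>, which is nonzero at \<open>u\<close>. The smaller index
    set is covered by induction.\<close>
  have main: "x u \<in> N" if u: "u \<in> A" "s \<in> A" "u ~= s" for u s
  proof -
   obtain h where h: "h \<in> H" "\<chi> h u ~= \<chi> h s" using Suc.prems(3)[OF u] by auto
   have h0: "h 0 = 0" using sc[OF h(1), of 0 0] by simp
   have hsum: "h (sum x B) = (\<Sum>r\<in>B. h (x r))" if "finite B" for B
    using that by induction (auto simp: h0 add[OF h(1)])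
   let ?y = "%r. scale (\<chi> h r - \<chi> h s) (x r)"
   have "(\<Sum>r\<in>A. h (x r) - scale (\<chi> h r) (x r)) \<in> N"
    by (rule subspace_sum[OF N]) (use Suc.prems(2) h in auto)
   moreover have "h (sum x A) - scale (\<chi> h s) (sum x A) \<in> N"
    using Suc.prems(4) HN[OF h(1)] N by (intro subspace_diff subspace_scale) auto
   ultimately have "(h (sum x A) - scale (\<chi> h s) (sum x A)) - (\<Sum>r\<in>A. h (x r) - scale (\<chi> h r) (x r)) \<in> N"
    using subspace_diff[OF N] by blast
   also have "(h (sum x A) - scale (\<chi> h s) (sum x A)) - (\<Sum>r\<in>A. h (x r) - scale (\<chi> h r) (x r)) = (\<Sum>r\<in>A. ?y r)"
    using Suc.prems(1)
    by (simp add: hsum scale_sum_right sum_subtractf[symmetric] scale_left_diff_distrib)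
   also have "\<dots> = (\<Sum>r\<in>A-{s}. ?y r)"
    using Suc.prems(1) u by (intro sum.mono_neutral_right) auto
   finally have sumN: "(\<Sum>r\<in>A-{s}. ?y r) \<in> N" .
   have "?y u \<in> N"
   proof (rule Suc.hyps(1)[of "A - {s}" ?y u])
    show "k = card (A - {s})" using Suc.hyps(2) u Suc.prems(1) by simp
    show "finite (A - {s})" using Suc.prems(1) by simp
    show "g (?y r) - scale (\<chi> g r) (?y r) \<in> N" if "r \<in> A - {s}" "g \<in> H" for r g
    proof -
     have "scale (\<chi> h r - \<chi> h s) (g (x r) - scale (\<chi> g r) (x r)) \<in> N"
      using Suc.prems(2)[of r g] that N by (intro subspace_scale) auto
     thus ?thesis
      by (simp add: sc[OF that(2)] scale_right_diff_distrib mult.commute)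
    qed
    show "\<exists>h\<in>H. \<chi> h r ~= \<chi> h t" if "r \<in> A - {s}" "t \<in> A - {s}" "r ~= t" for r t
     using Suc.prems(3) that by auto
   qed (use sumN u in auto)
   hence "scale (inverse (\<chi> h u - \<chi> h s)) (?y u) \<in> N" by (rule subspace_scale[OF N])
   moreover have "scale (inverse (\<chi> h u - \<chi> h s)) (?y u) = x u" using h(2) by simp
   ultimately show ?thesis by simp
  qed
  from False Suc.prems(5) obtain s where "s \<in> A" "s ~= r" by auto
  thus ?thesis using main[of r s] Suc.prems(5) by auto
 qed
qed

section \<open>Modules and quotients\<close>

lemma complex_field_simps [simp]:
 "carrier complex_field = UNIV" "\<zero>\<^bsub>complex_field\<^esub> = 0" "\<one>\<^bsub>complex_field\<^esub> = 1"
 "x \<oplus>\<^bsub>complex_field\<^esub> y = x + y" "x \<otimes>\<^bsub>complex_field\<^esub> y = x * y"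
 by (simp_all add: complex_field_def)

lemma cring_complex_field: "cring complex_field"
proof (intro cringI abelian_groupI comm_monoidI)
 fix x :: complex
 show "\<exists>y\<in>carrier complex_field. y \<oplus>\<^bsub>complex_field\<^esub> x = \<zero>\<^bsub>complex_field\<^esub>"
  by (auto intro: exI[of _ "-x"])
qed (auto simp: algebra_simps)

lemma complex_field_minus [simp]: "\<ominus>\<^bsub>complex_field\<^esub> x = - x"
proof -
 interpret cring complex_field by (rule cring_complex_field)
 show ?thesis using add.inv_equality[of "-x" x] by (simp add: a_inv_def)
qed

lemma free_space_simps [simp]:
 "carrier (free_space B d) = {f. supp f <= B}" "\<zero>\<^bsub>free_space B d\<^esub> = 0"
 "x \<oplus>\<^bsub>free_space B d\<^esub> y = x + y" "c \<odot>\<^bsub>free_space B d\<^esub> x = pscale c x"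
 "part (free_space B d) p = {f. supp f <= d p}"
 by (simp_all add: free_space_def)

lemma module_free_space: "Module.module complex_field (free_space B d)"
proof (rule moduleI[OF cring_complex_field])
 show "abelian_group (free_space B d)"
 proof (rule abelian_groupI)
  fix x assume "x \<in> carrier (free_space B d)"
  thus "\<exists>y\<in>carrier (free_space B d). y \<oplus>\<^bsub>free_space B d\<^esub> x = \<zero>\<^bsub>free_space B d\<^esub>"
   by (intro bexI[of _ "-x"]) (auto simp: supp_subspaceD)
 qed (auto simp: supp_subspaceD[THEN subsetD] algebra_simps)
qed (auto simp: supp_subspaceD[THEN subsetD] pv.scale_left_distrib pv.scale_right_distrib)

lemma complex_module:
 fixes M :: "(complex, 'v, 'e) module_scheme" (structure)
 assumes "Module.module complex_field M"
 shows "x \<in> carrier M ==> c \<odot> x \<in> carrier M"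
  "x \<in> carrier M ==> (a + b) \<odot> x = a \<odot> x \<oplus> b \<odot> x"
  "x \<in> carrier M ==> y \<in> carrier M ==> c \<odot> (x \<oplus> y) = c \<odot> x \<oplus> c \<odot> y"
  "x \<in> carrier M ==> (a * b) \<odot> x = a \<odot> (b \<odot> x)"
  "x \<in> carrier M ==> 1 \<odot> x = x"
  "x \<in> carrier M ==> 0 \<odot> x = \<zero>"
  "c \<odot> \<zero> = \<zero>"
  "x \<in> carrier M ==> (-1) \<odot> x = \<ominus> x"
proof -
 interpret Module.module complex_field M by fact
 show "x \<in> carrier M ==> c \<odot> x \<in> carrier M"
  "x \<in> carrier M ==> (a + b) \<odot> x = a \<odot> x \<oplus> b \<odot> x"
  "x \<in> carrier M ==> y \<in> carrier M ==> c \<odot> (x \<oplus> y) = c \<odot> x \<oplus> c \<odot> y"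
  "x \<in> carrier M ==> (a * b) \<odot> x = a \<odot> (b \<odot> x)"
  and 1: "x \<in> carrier M ==> 1 \<odot> x = x" for x y
  using smult_l_distr[of a b x] smult_assoc1[of a b x] smult_one[of x]
  by (auto simp: smult_r_distr)
 show "x \<in> carrier M ==> 0 \<odot> x = \<zero>" "c \<odot> \<zero> = \<zero>"
  using smult_l_null smult_r_null by auto
 show "x \<in> carrier M ==> (-1) \<odot> x = \<ominus> x"
  using smult_l_minus[of 1 x] 1[of x] by auto
qed

lemma submodule_iff:
 fixes M :: "(complex, 'v, 'e) module_scheme"
 assumes "Module.module complex_field M"
 shows "submodule N complex_field M \<longleftrightarrow> N <= carrier M & \<zero>\<^bsub>M\<^esub> \<in> N \<and>
   (\<forall>x\<in>N. \<forall>y\<in>N. x \<oplus>\<^bsub>M\<^esub> y \<in> N) & (\<forall>c. \<forall>x\<in>N. c \<odot>\<^bsub>M\<^esub> x \<in> N)"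
  (is "?L \<longleftrightarrow> ?R")
proof -
 interpret Module.module complex_field M by fact
 show ?thesis
 proof
  assume L: ?L
  then interpret submodule N complex_field M .
  have "\<zero>\<^bsub>M\<^esub> \<in> N" using one_closed by simp
  with submoduleE[OF L] show ?R by auto
 next
  assume r: ?R
  show ?L
  proof (rule submoduleI)
   fix a assume a: "a \<in> N"
   hence "(-1) \<odot>\<^bsub>M\<^esub> a = \<ominus>\<^bsub>M\<^esub> a"
    using smult_l_minus[of 1 a] smult_one[of a] r by auto
   thus "\<ominus>\<^bsub>M\<^esub> a \<in> N" using r a by metis
  qed (use r in auto)
 qed
qed

lemma submodule_free_space:
 "submodule N complex_field (free_space B d) \<longleftrightarrow> subsp N & N <= {f. supp f <= B}"
 using submodule_iff[OF module_free_space, of N B d] by (auto simp: pv.subspace_def)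

lemma lin_span_free_space:
 assumes "S <= {f. supp f <= B}"
 shows "lin_span (free_space B d) S = pv.span S"
proof
 show "lin_span (free_space B d) S <= pv.span S"
  unfolding lin_span_def submodule_free_space
  using span_sub_supp[OF assms] by (intro Inter_lower) (auto intro: pv.span_base)
 show "pv.span S <= lin_span (free_space B d) S"
  unfolding lin_span_def submodule_free_space
  by (intro Inter_greatest) (auto intro: pv.span_minimal[THEN subsetD])
qed

lemma with_action_simps [simp]:
 "carrier (with_action M a) = carrier M" "\<zero>\<^bsub>with_action M a\<^esub> = \<zero>\<^bsub>M\<^esub>"
 "add (with_action M a) = add M" "module.smult (with_action M a) = module.smult M"
 "part (with_action M a) = part M" "act (with_action M a) = a"
 by (simp_all add: with_action_def super_space.defs super_module.defs)

lemma quot_space_simps [simp]: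
 "carrier (quot_space M N) = a_rcosets\<^bsub>M\<^esub> N" "\<zero>\<^bsub>quot_space M N\<^esub> = N"
 "add (quot_space M N) = set_add M"
 "module.smult (quot_space M N) = (%c. descend M N (%x. c \<odot>\<^bsub>M\<^esub> x))"
 "part (quot_space M N) = (%p. a_r_coset M N ` part M p)"
 by (simp_all add: quot_space_def)

locale module_quotient = Module.module complex_field M
 for M :: "('v, 'e) super_space_scheme" (structure) +
 fixes N assumes sub: "submodule N complex_field M"
begin

lemma abelian_subgroup: "abelian_subgroup N M"
 using sub by (intro abelian_subgroupI3 additive_subgroup.intro)
  (auto intro: submodule.axioms abelian_group_axioms)

sublocale abelian_subgroup N M by (rule abelian_subgroup)

lemma coset_eq_iff:
 assumes "x \<in> carrier M" "y \<in> carrier M"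
 shows "N +> x = N +> y \<longleftrightarrow> x \<ominus> y \<in> N"
 using a_rcos_module[of y x] assms a_repr_independence[of x N y] a_rcos_self[of x] a_subgroup
 by (auto simp: a_minus_def)

lemma carrier_quot: "carrier (quot_space M N) = (%x. N +> x) ` carrier M"
 by (auto simp: A_RCOSETS_def RCOSETS_def a_r_coset_def)

lemma coset_self: "x \<in> carrier M ==> x \<in> N +> x"
 by (rule a_rcos_self)

lemma coset_sub: "x \<in> carrier M ==> N +> x <= carrier M"
 using a_r_coset_subset_G a_subset by blast

lemma coset_mem:
 assumes "x \<in> carrier M" "y \<in> N +> x"
 shows "y \<in> carrier M" "y \<ominus> x \<in> N"
proof -
 show y: "y \<in> carrier M" using coset_sub assms by auto
 show "y \<ominus> x \<in> N" using a_rcos_module[OF assms(1) y] assms(2) by (simp add: a_minus_def)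
qed

lemma descend_coset:
 assumes "!!x. x \<in> carrier M ==> f x \<in> carrier M"
  and "!!x y. x \<in> carrier M ==> y \<in> carrier M ==> x \<ominus> y \<in> N ==> f x \<ominus> f y \<in> N"
  and "x \<in> carrier M"
 shows "descend M N f (N +> x) = N +> f x"
proof -
 have "N +> f y = N +> f x" if "y \<in> N +> x" for y
  using coset_mem[OF assms(3) that] assms by (subst coset_eq_iff) auto
 hence "descend M N f (N +> x) = (\<Union>y\<in>N +> x. N +> f x)"
  unfolding descend_def by (rule SUP_cong[OF refl])
 moreover have "N +> x ~= {}" using coset_self[OF assms(3)] by blast
 ultimately show ?thesis by simp
qed

lemma add_coset: "x \<in> carrier M ==> y \<in> carrier M ==> set_add M (N +> x) (N +> y) = N +> (x \<oplus> y)"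
 by (rule a_rcos_sum)

lemma smult_coset:
 assumes "x \<in> carrier M"
 shows "descend M N (%x. c \<odot> x) (N +> x) = N +> (c \<odot> x)"
proof (rule descend_coset)
 fix x y assume *: "x \<in> carrier M" "y \<in> carrier M" "x \<ominus> y \<in> N"
 have "c \<odot> (x \<ominus> y) \<in> N" using submodule.smult_closed[OF sub] * by simp
 thus "c \<odot> x \<ominus> c \<odot> y \<in> N"
  using * by (simp add: a_minus_def smult_r_distr smult_r_minus)
qed (use assms in auto)

lemma module_quot: "Module.module complex_field (quot_space M N)"
proof (rule moduleI[OF cring_complex_field])
 have N0: "N +> \<zero> = N" using a_subset by simp
 show "abelian_group (quot_space M N)"
 proof (rule abelian_groupI, unfold carrier_quot)
  fix X assume "X \<in> (+>) N ` carrier M"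
  then obtain x where x: "x \<in> carrier M" "X = N +> x" by auto
  thus "\<exists>Y\<in>(+>) N ` carrier M. Y \<oplus>\<^bsub>quot_space M N\<^esub> X = \<zero>\<^bsub>quot_space M N\<^esub>"
   by (intro bexI[of _ "N +> (\<ominus> x)"]) (auto simp: add_coset l_neg N0)
  show "\<zero>\<^bsub>quot_space M N\<^esub> \<oplus>\<^bsub>quot_space M N\<^esub> X = X"
   using x add_coset[of \<zero> x] by (simp add: N0)
 next
  show "\<zero>\<^bsub>quot_space M N\<^esub> \<in> (+>) N ` carrier M" using N0 by force
 qed (auto simp: add_coset a_ac)
qed (auto simp: carrier_quot add_coset smult_coset complex_module[OF module_axioms]
    simp del: quot_space_simps(1))

end

lemma super_spaceD:
 assumes "super_space M"
 shows "Module.module complex_field M" "submodule (part M p) complex_field M"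
 using assms by (auto simp: super_space_def)

lemma super_space_part_sub:
 assumes "super_space M"
 shows "part M p <= carrier M"
 using super_spaceD(2)[OF assms, of p] submodule_iff[OF super_spaceD(1)[OF assms], of "part M p"]
 by simp

lemma super_space_unique:
 assumes "super_space M" "a \<in> part M p" "b \<in> part M (~ p)" "a' \<in> part M p" "b' \<in> part M (~ p)"
  "a \<oplus>\<^bsub>M\<^esub> b = a' \<oplus>\<^bsub>M\<^esub> b'"
 shows "a = a'" "b = b'"
proof -
 interpret Module.module complex_field M by (rule super_spaceD(1)[OF assms(1)])
 note sub = super_space_part_sub[OF assms(1)]
 have c: "a \<in> carrier M" "b \<in> carrier M" "a' \<in> carrier M" "b' \<in> carrier M"
  using assms(2-5) sub by (meson subsetD)+
 have ex1: "\<exists>!ab. fst ab \<in> part M False & snd ab \<in> part M True & a \<oplus>\<^bsub>M\<^esub> b = fst ab \<oplus>\<^bsub>M\<^esub> snd ab"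
  using assms(1) add.m_closed[OF c(1,2)] unfolding super_space_def by simp
 have "a = a' & b = b'"
 proof (cases p)
  case False
  thus ?thesis using ex1 assms by (metis fst_conv snd_conv)
 next
  case True
  have e: "a \<oplus>\<^bsub>M\<^esub> b = b \<oplus>\<^bsub>M\<^esub> a" "a \<oplus>\<^bsub>M\<^esub> b = b' \<oplus>\<^bsub>M\<^esub> a'" using c assms(6) by (auto simp: a_comm)
  show ?thesis using ex1 assms True e by (metis fst_conv snd_conv)
 qed
 thus "a = a'" "b = b'" by auto
qed

lemma component_eq:
 assumes "super_space M" "a \<in> part M p" "b \<in> part M (~ p)" "x = a \<oplus>\<^bsub>M\<^esub> b"
 shows "component M p x = a"
 unfolding component_def
 by (rule the_equality) (use assms super_space_unique[OF assms(1)] in auto)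

lemma super_space_decomp:
 assumes "super_space M" "x \<in> carrier M"
 obtains a b where "a \<in> part M p" "b \<in> part M (~ p)" "x = a \<oplus>\<^bsub>M\<^esub> b"
  "component M p x = a" "component M (~ p) x = b"
proof -
 interpret Module.module complex_field M by (rule super_spaceD(1)[OF assms(1)])
 note sub = super_space_part_sub[OF assms(1)]
 from assms obtain a b where ab: "a \<in> part M False" "b \<in> part M True" "x = a \<oplus>\<^bsub>M\<^esub> b"
  unfolding super_space_def by (metis (full_types))
 have e: "x = b \<oplus>\<^bsub>M\<^esub> a" using ab sub a_comm by blast
 show ?thesis
 proof (cases p)
  case True
  thus ?thesis using that[of b a] ab e component_eq[OF assms(1), of b True a x]
   component_eq[OF assms(1), of a False b x] by auto
 next
  case False
  thus ?thesis using that[of a b] ab e component_eq[OF assms(1), of b True a x]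
   component_eq[OF assms(1), of a False b x] by auto
 qed
qed

section \<open>Coordinates\<close>

text \<open>The basis is found in the free space on the carrier. With \<open>R\<close> the kernel of
  the evaluation \<open>ev\<close>, a basis of \<open>R\<close> is extended by vectors
  \<open>bvec s\<close> with \<open>s\<close> in \<open>S\<close>. The added \<open>s\<close> form
  the basis \<open>B\<close>, and the coordinates of \<open>x\<close> are those of
  \<open>bvec x\<close> with the \<open>R\<close>-part dropped.\<close>

lemma module_coordinates:
 fixes M :: "(complex, 'v, 'e) module_scheme" (structure)
 assumes M: "Module.module complex_field M" and S: "S <= carrier M"
  and gen: "!!N. submodule N complex_field M ==> S <= N ==> carrier M <= N"
 obtains B kap where "B <= S" "bij_betw kap (carrier M) {f. supp f <= B}"
  "!!x y. x \<in> carrier M ==> y \<in> carrier M ==> kap (x \<oplus> y) = kap x + kap y"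
  "!!c x. x \<in> carrier M ==> kap (c \<odot> x) = pscale c (kap x)"
  "!!b. b \<in> B ==> kap b = bvec b"
proof -
 interpret Module.module complex_field M by fact
 define D where "D = {f. supp f <= carrier M}"
 define ev where "ev f = (\<Oplus>b\<in>supp f. cf f b \<odot> b)" for f
 have ev_sup: "ev f = (\<Oplus>b\<in>A. cf f b \<odot> b)" if "finite A" "supp f <= A" "A <= carrier M" for f A
  unfolding ev_def using that
  by (intro add.finprod_mono_neutral_cong_left) (auto simp: in_keys_iff complex_module[OF M])
 have ev_cl: "ev f \<in> carrier M" if "f \<in> D" for f
  unfolding ev_def using that by (intro finsum_closed) (auto simp: D_def)
 have ev_add: "ev (f + g) = ev f \<oplus> ev g" if "f \<in> D" "g \<in> D" for f g
 proof -
  let ?A = "supp f Un supp g"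
  have A: "finite ?A" "?A <= carrier M" "supp (f + g) <= ?A"
   using that Poly_Mapping.keys_add[of f g] by (auto simp: D_def)
  have "ev (f + g) = (\<Oplus>b\<in>?A. cf f b \<odot> b \<oplus> cf g b \<odot> b)"
   unfolding ev_sup[OF A(1,3,2)] using A
   by (intro finsum_cong') (auto simp: lookup_add smult_l_distr[simplified])
  also have "\<dots> = (\<Oplus>b\<in>?A. cf f b \<odot> b) \<oplus> (\<Oplus>b\<in>?A. cf g b \<odot> b)"
   using A by (intro finsum_addf) auto
  finally show ?thesis using ev_sup[OF A(1) _ A(2)] by simp
 qed
 have ev_sc: "ev (pscale c f) = c \<odot> ev f" if "f \<in> D" for c f
 proof -
  have A: "supp f <= carrier M" using that by (auto simp: D_def)
  have "ev (pscale c f) = (\<Oplus>b\<in>supp f. c \<odot> (cf f b \<odot> b))"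
   unfolding ev_sup[OF finite_keys supp_pscale A] using A
   by (intro finsum_cong') (auto simp: smult_assoc1[simplified])
  also have "\<dots> = c \<odot> ev f"
   unfolding ev_def using A by (intro finsum_smult_ldistr[symmetric]) auto
  finally show ?thesis .
 qed
 have ev_bvec: "ev (bvec x) = x" if "x \<in> carrier M" for x
  using that ev_sup[of "{x}" "bvec x"] smult_one[of x] by (simp add: Pi_def)
 have Dsub: "subsp D" unfolding D_def by (rule subspace_supp)
 define R where "R = {f \<in> D. ev f = \<zero>}"
 have Rsub: "subsp R"
  by (rule pv.subspaceI)
   (auto simp: R_def ev_add ev_sc sub_add[OF Dsub] sub_scale[OF Dsub]
    sub_0[OF Dsub] ev_def[of 0] smult_r_null[simplified])
 have ev_eq: "f - g \<in> R \<longleftrightarrow> ev f = ev g" if "f \<in> D" "g \<in> D" for f g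
 proof -
  have fg: "f - g \<in> D" using that Dsub sub_diff by blast
  have "ev f = ev (f - g) \<oplus> ev g" using ev_add[OF fg that(2)] by simp
  thus ?thesis using fg ev_cl[OF fg] ev_cl[OF that(2)] by (auto simp: R_def)
 qed
 obtain A0 where A0: "A0 <= R" "pv.independent A0" "R <= pv.span A0"
  using pv.maximal_independent_subset by blast
 obtain C where C: "A0 <= C" "C <= A0 Un bvec ` S" "pv.independent C" "A0 Un bvec ` S <= pv.span C"
  using pv.maximal_independent_subset_extend[of A0 "A0 Un bvec ` S"] A0 by blast
 have RC: "R <= pv.span C" using A0(3) pv.span_mono[OF C(1)] by blast
 \<comment> \<open>The elements with this property form a submodule, as formal sums and multiples
   differ from the actual ones by elements of \<open>R\<close>. It contains \<open>S\<close>, so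
   \<open>gen\<close> applies.\<close>
 have spC: "bvec x \<in> pv.span C" if "x \<in> carrier M" for x
 proof -
  let ?N = "{x \<in> carrier M. bvec x \<in> pv.span C}"
  have "submodule ?N complex_field M"
  proof (subst submodule_iff[OF M], intro conjI ballI allI)
   have "bvec \<zero> \<in> R" by (simp add: R_def D_def ev_bvec)
   thus "\<zero> \<in> ?N" using RC by auto
   fix x assume x: "x \<in> ?N"
   { fix y assume y: "y \<in> ?N"
    have "bvec (x \<oplus> y) - (bvec x + bvec y) \<in> R"
     using x y by (subst ev_eq) (auto simp: ev_add ev_bvec D_def sub_add[OF Dsub, unfolded D_def, simplified])
    hence "bvec (x \<oplus> y) - (bvec x + bvec y) + (bvec x + bvec y) \<in> pv.span C"
     using x y RC by (intro pv.span_add) auto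
    thus "x \<oplus> y \<in> ?N" using x y by auto }
   fix c
   have "bvec (c \<odot> x) - pscale c (bvec x) \<in> R"
    using x ev_sc[of "bvec x" c] by (subst ev_eq) (auto simp: ev_bvec D_def split: if_splits)
   hence "bvec (c \<odot> x) - pscale c (bvec x) + pscale c (bvec x) \<in> pv.span C"
    using x RC by (intro pv.span_add pv.span_scale) auto
   thus "c \<odot> x \<in> ?N" using x by auto
  qed auto
  moreover have "S <= ?N" using S C by auto
  ultimately show ?thesis using gen that by blast
 qed
 have DC: "f \<in> pv.span C" if "f \<in> D" for f
  by (rule supp_induct[of _ f "carrier M"]) (use that spC in "auto simp: D_def")
 define B where "B = {b \<in> S. bvec b \<in> C - A0}"
 \<comment> \<open>Only the coordinates at the added basis vectors are kept. Dropping those at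
   \<open>A0\<close> makes \<open>\<pi>\<close> vanish on \<open>R\<close>, so that it factors
   through \<open>ev\<close>.\<close>
 define rep where "rep f b = (if b \<in> B then pv.representation C f (bvec b) else 0)" for f b
 have inj_bvec: "inj (bvec :: 'v => 'v \<Rightarrow>\<^sub>0 complex)"
  by (rule injI) (metis keys_single one_neq_zero singleton_inject)
 have fin: "finite {b. rep f b ~= 0}" for f
  by (rule finite_subset[OF _ finite_vimageI[OF pv.finite_representation[of C f] inj_bvec]])
   (auto simp: rep_def)
 define \<pi> where "\<pi> f = Abs_poly_mapping (rep f)" for f
 have cf_pi: "cf (\<pi> f) b = rep f b" for f b
  using fin[of f] by (simp add: \<pi>_def)
 have pi_B: "supp (\<pi> f) <= B" for f by (auto simp: supp_iff cf_pi rep_def split: if_splits)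
 have B_S: "B <= S" by (auto simp: B_def)
 have pi_D: "\<pi> f \<in> D" for f using pi_B B_S S by (auto simp: D_def)
 have pi_add: "\<pi> (f + g) = \<pi> f + \<pi> g" if "f \<in> pv.span C" "g \<in> pv.span C" for f g
  by (rule poly_mapping_eqI) (use that C in "simp add: cf_pi lookup_add rep_def pv.representation_add")
 have pi_sc: "\<pi> (pscale c f) = pscale c (\<pi> f)" if "f \<in> pv.span C" for c f
  by (rule poly_mapping_eqI) (use that C in "simp add: cf_pi rep_def pv.representation_scale")
 have pi_R: "\<pi> f = 0" if "f \<in> R" for f
 proof (rule poly_mapping_eqI)
  fix b
  have "f \<in> pv.span A0" using that A0 by auto
  hence "pv.representation C f = pv.representation A0 f"
   using pv.representation_extend[OF C(3) _ C(1)] by blast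
  thus "cf (\<pi> f) b = cf 0 b"
   using pv.representation_ne_zero[of A0 f "bvec b"] by (auto simp: cf_pi rep_def B_def)
 qed
 have pi_bvec: "\<pi> (bvec b) = bvec b" if "b \<in> B" for b
  by (rule poly_mapping_eqI)
   (use that C inj_bvec in "auto simp: cf_pi rep_def pv.representation_basis B_def lookup_single when_def dest: injD")
 have pi_eq: "\<pi> f = \<pi> g" if "ev f = ev g" "f \<in> D" "g \<in> D" for f g
 proof -
  have r: "f - g \<in> R" using that ev_eq by auto
  have "\<pi> (f - g + g) = \<pi> (f - g) + \<pi> g" using that DC r RC by (intro pi_add) auto
  thus ?thesis using pi_R[OF r] by simp
 qed
 have pi_id: "\<pi> f = f" if "supp f <= B" for f
 proof -
  let ?W = "{f \<in> D. \<pi> f = f}"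
  have "subsp ?W"
   by (rule pv.subspaceI)
    (auto simp: pi_add pi_sc DC sub_add[OF Dsub] sub_scale[OF Dsub]
     sub_0[OF Dsub] intro!: pi_R sub_0[OF Rsub])
  hence "f \<in> ?W" using that
   by (rule supp_induct) (use B_S S pi_bvec in "auto simp: D_def")
  thus ?thesis by simp
 qed
 have ev_pi: "ev (\<pi> f) = ev f" if "f \<in> D" for f
 proof -
  \<comment> \<open>Since \<open>f - \<pi> f\<close> is linear in \<open>f\<close>, it suffices to
    look at \<open>C\<close>: on \<open>A0\<close> the projection is zero, and the vectors
    \<open>bvec b\<close> with \<open>b\<close> in \<open>B\<close> are fixed.\<close>
  have sub: "pv.span C <= {f \<in> D. f - \<pi> f \<in> R}"
  proof
   fix f assume f: "f \<in> pv.span C"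
   thus "f \<in> {f \<in> D. f - \<pi> f \<in> R}"
   proof (induction rule: pv.span_induct_alt)
    case base
    have "\<pi> 0 = 0" by (intro pi_R sub_0[OF Rsub])
    thus ?case using Dsub Rsub by (simp add: sub_0)
   next
    case (step c x y)
    have xs: "x \<in> pv.span C" using step(1) by (rule pv.span_base)
    have ys: "y \<in> pv.span C" using step(2) DC by auto
    have x: "x \<in> D" "x - \<pi> x \<in> R"
    proof -
     have "bvec ` S <= D" using S by (auto simp: D_def)
     moreover have "A0 <= D" using A0(1) by (auto simp: R_def)
     ultimately show "x \<in> D" using step(1) C(2) by blast
     show "x - \<pi> x \<in> R"
     proof (cases "x \<in> A0")
      case True
      thus ?thesis using pi_R[of x] A0(1) by auto
     next
      case False
      then obtain b where "x = bvec b" "b \<in> B" using C(2) step(1) by (auto simp: B_def)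
      thus ?thesis using pi_bvec sub_0[OF Rsub] by simp
     qed
    qed
    have e: "pscale c x + y - \<pi> (pscale c x + y) = pscale c (x - \<pi> x) + (y - \<pi> y)"
     using xs ys by (simp add: pi_add pi_sc pv.span_scale pv.scale_right_diff_distrib)
    have "pscale c (x - \<pi> x) + (y - \<pi> y) \<in> R"
     using x step(2) by (intro sub_add[OF Rsub] sub_scale[OF Rsub]) auto
    moreover have "pscale c x + y \<in> D"
     using x step(2) by (intro sub_add[OF Dsub] sub_scale[OF Dsub]) auto
    ultimately show ?case unfolding e[symmetric] by simp
   qed
  qed
  thus ?thesis using ev_eq[of f "\<pi> f"] DC[OF that] pi_D that by auto
 qed
 show thesis
 proof (rule that[of B "%x. \<pi> (bvec x)"])
  show "bij_betw (%x. \<pi> (bvec x)) (carrier M) {f. supp f <= B}"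
  proof (rule bij_betw_byWitness[where f'=ev])
   show "\<forall>x\<in>carrier M. ev (\<pi> (bvec x)) = x" using ev_pi ev_bvec by (auto simp: D_def)
   show "\<forall>f\<in>{f. supp f <= B}. \<pi> (bvec (ev f)) = f"
   proof safe
    fix f assume f: "supp f <= B"
    hence fD: "f \<in> D" using B_S S by (auto simp: D_def)
    have "\<pi> (bvec (ev f)) = \<pi> f"
     by (rule pi_eq) (use ev_bvec ev_cl fD in "auto simp: D_def")
    thus "\<pi> (bvec (ev f)) = f" using pi_id f by simp
   qed
   show "ev ` {f. supp f <= B} <= carrier M" using ev_cl B_S S by (force simp: D_def)
  qed (use pi_B in auto)
  show "\<pi> (bvec (x \<oplus> y)) = \<pi> (bvec x) + \<pi> (bvec y)" if "x \<in> carrier M" "y \<in> carrier M" for x y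
  proof -
   have "\<pi> (bvec (x \<oplus> y)) = \<pi> (bvec x + bvec y)"
    by (rule pi_eq) (use that Poly_Mapping.keys_add[of "bvec x" "bvec y"] in "auto simp: ev_bvec ev_add D_def")
   thus ?thesis using that spC pi_add by auto
  qed
  show "\<pi> (bvec (c \<odot> x)) = pscale c (\<pi> (bvec x))" if "x \<in> carrier M" for c x
  proof -
   have "\<pi> (bvec (c \<odot> x)) = \<pi> (pscale c (bvec x))"
    by (rule pi_eq) (use that ev_sc[of "bvec x" c] in "auto simp: ev_bvec D_def split: if_splits")
   thus ?thesis using that spC pi_sc by metis
  qed
 qed (use B_S pi_bvec in auto)
qed

text \<open>A basis chosen among homogeneous generators consists of homogeneous vectors, and each
  part is then spanned by the basis vectors of its parity.\<close>

lemma super_space_coordinates: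
 fixes M :: "('v, 'e) super_space_scheme" (structure)
 assumes M: "super_space M" and S: "S <= part M False Un part M True"
  and gen: "!!N. submodule N complex_field M ==> S <= N ==> carrier M <= N"
 obtains B kap where "B <= S" "bij_betw kap (carrier M) {f. supp f <= B}"
  "!!x y. x \<in> carrier M ==> y \<in> carrier M ==> kap (x \<oplus> y) = kap x + kap y"
  "!!c x. x \<in> carrier M ==> kap (c \<odot> x) = pscale c (kap x)"
  "!!b. b \<in> B ==> kap b = bvec b"
  "!!p. kap ` part M p = {f. supp f <= B Int part M p}"
  "B Int part M False Int part M True = {}"
proof -
 have mod: "Module.module complex_field M" by (rule super_spaceD(1)[OF M])
 interpret Module.module complex_field M by fact
 have psub: "submodule (part M p) complex_field M" for p by (rule super_spaceD(2)[OF M])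
 note pp = psub[unfolded submodule_iff[OF mod]]
 have sub: "part M q <= carrier M" for q using pp by blast
 obtain B kap where B: "B <= S" "bij_betw kap (carrier M) {f. supp f <= B}"
  "!!x y. x \<in> carrier M ==> y \<in> carrier M ==> kap (x \<oplus> y) = kap x + kap y"
  "!!c x. x \<in> carrier M ==> kap (c \<odot> x) = pscale c (kap x)"
  "!!b. b \<in> B ==> kap b = bvec b"
  using module_coordinates[OF mod _ gen] S sub by blast
 have k0: "kap \<zero> = 0" using B(3)[of \<zero> \<zero>] by simp
 have pz: "x = \<zero>" if "x \<in> part M False" "x \<in> part M True" for x
  using super_space_unique(1)[OF M, of x False \<zero> \<zero> x] that sub[of False] pp[of False] pp[of True]
  by (auto simp: subset_iff)
 have "B Int part M False Int part M True = {}"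
 proof safe
  fix b assume b: "b \<in> B" "b \<in> part M False" "b \<in> part M True"
  hence "kap b = 0" using pz k0 by auto
  thus "b \<in> {}" using B(5) b by (metis keys_single keys_zero one_neq_zero insert_not_empty)
 qed
 moreover have sup: "{f. supp f <= B Int part M p} <= kap ` part M p" for p
 proof safe
  fix f assume f: "supp f <= B Int part M p"
  have "subsp (kap ` part M p)"
  proof (rule pv.subspaceI)
   show "0 \<in> kap ` part M p" using k0 pp by force
   fix x y c assume "x \<in> kap ` part M p"
   then obtain u where u: "u \<in> part M p" "x = kap u" by auto
   { assume "y \<in> kap ` part M p"
    then obtain v where "v \<in> part M p" "y = kap v" by auto
    thus "x + y \<in> kap ` part M p" using u B(3)[of u v] pp[of p] by (metis imageI subsetD) }
   show "pscale c x \<in> kap ` part M p" using u B(4)[of u c] pp[of p] by (metis imageI subsetD)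
  qed
  thus "f \<in> kap ` part M p" using f
   by (rule supp_induct) (use B(5) in force)
 qed
 moreover have "kap ` part M p <= {f. supp f <= B Int part M p}" for p
 proof safe
  fix x b assume x: "x \<in> part M p" and b: "b \<in> supp (kap x)"
  have kx: "supp (kap x) <= B" using B(2) x sub by (auto simp: bij_betw_def)
  \<comment> \<open>\<open>?r q\<close> collects the coordinates at basis vectors of parity
    \<open>q\<close>. Both halves are coordinates of homogeneous elements, and uniqueness of the
    decomposition \<open>x = x + 0\<close> leaves only the half of parity \<open>p\<close>.\<close>
  let ?r = "%q. \<Sum>b\<in>supp (kap x) Int part M q. pscale (cf (kap x) b) (bvec b)"
  have rs: "supp (?r q) <= supp (kap x) Int part M q" for q
  proof -
   have "?r q \<in> {f. supp f <= supp (kap x) Int part M q}"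
    by (intro sub_sum[OF subspace_supp]) auto
   thus ?thesis by simp
  qed
  have dis: "(supp (kap x) Int part M p) Int (supp (kap x) Int part M (~ p)) = {}"
   using \<open>B Int part M False Int part M True = {}\<close> kx by (cases p) auto
  have un: "(supp (kap x) Int part M p) Un (supp (kap x) Int part M (~ p)) = supp (kap x)"
   using kx B(1) S by (cases p) auto
  have e: "kap x = ?r p + ?r (~ p)"
   unfolding sum.union_disjoint[OF finite_Int[OF disjI1, OF finite_keys] finite_Int[OF disjI1, OF finite_keys] dis, symmetric] un
   by (rule poly_mapping_expand) auto
  have "\<exists>u\<in>part M q. ?r q = kap u" for q
  proof -
   have "?r q \<in> kap ` part M q" using rs[of q] kx by (intro sup[THEN subsetD]) blast
   thus ?thesis by auto
  qed
  then obtain u v where uv: "u \<in> part M p" "?r p = kap u" "v \<in> part M (~ p)" "?r (~ p) = kap v" by metis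
  have uvM: "u \<in> carrier M" "v \<in> carrier M" using uv sub by blast+
  have "kap x = kap u + kap v" using e unfolding uv(2) uv(4) .
  hence "kap x = kap (u \<oplus> v)" using B(3)[OF uvM] by simp
  hence "x = u \<oplus> v" using B(2) x uv sub by (auto simp: bij_betw_def dest!: inj_onD)
  moreover have "\<zero> \<in> part M (~ p)" "x \<in> carrier M" using pp[of "~ p"] x sub by blast+
  ultimately have "x = u" using super_space_unique(1)[OF M x _ uv(1,3), of \<zero>] by simp
  hence "kap x = ?r p" using uv by simp
  hence "b \<in> supp (kap x) Int part M p" using rs[of p] b by auto
  thus "b \<in> B" "b \<in> part M p" using kx by auto
 qed
 ultimately show thesis using that[OF B(1-5)] by (metis subset_antisym)
qed

section \<open>Laurent polynomials with odd variables\<close>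

abbreviation mon :: "nat => int \<times> nat set => laur => laur" where "mon n b \<equiv> mul_op n (bvec b)"

definition inversions :: "nat set => nat set => nat"
 where "inversions I J = card {(i, j). i \<in> I & j \<in> J & j < i}"

lemma finite_inversions: "finite I ==> finite J ==> finite {(i, j). i \<in> I & j \<in> J & j < i}"
 by (rule finite_subset[of _ "I \<times> J"]) auto

lemma inversions_Un_left:
 assumes "finite I" "finite J" "finite K" "I Int J = {}"
 shows "inversions (I Un J) K = inversions I K + inversions J K"
proof -
 have "{(i, j). i \<in> I Un J & j \<in> K & j < i}
   = {(i, j). i \<in> I & j \<in> K & j < i} Un {(i, j). i \<in> J & j \<in> K & j < i}" by auto
 thus ?thesis unfolding inversions_def
  using assms finite_inversions by (simp only:) (intro card_Un_disjoint; auto)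
qed

lemma inversions_Un_right:
 assumes "finite I" "finite J" "finite K" "I Int J = {}"
 shows "inversions K (I Un J) = inversions K I + inversions K J"
proof -
 have "{(i, j). i \<in> K & j \<in> I Un J & j < i}
   = {(i, j). i \<in> K & j \<in> I & j < i} Un {(i, j). i \<in> K & j \<in> J & j < i}" by auto
 thus ?thesis unfolding inversions_def
  using assms finite_inversions by (simp only:) (intro card_Un_disjoint; auto)
qed

lemma inversions_single_left: "inversions {j} I = card {i \<in> I. i < j}"
proof -
 have "{(i', i). i' \<in> {j} & i \<in> I & i < i'} = Pair j ` {i \<in> I. i < j}" by auto
 thus ?thesis unfolding inversions_def by (simp add: card_image inj_on_def)
qed

lemma inversions_single_right: "inversions I {j} = card {i \<in> I. j < i}"
proof -
 have "{(i, i'). i \<in> I & i' \<in> {j} & i' < i} = (%i. (i, j)) ` {i \<in> I. j < i}" by auto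
 thus ?thesis unfolding inversions_def by (simp add: card_image inj_on_def)
qed

lemma inversions_empty [simp]: "inversions {} J = 0" "inversions I {} = 0"
 by (auto simp: inversions_def)

text \<open>Each element of \<open>I\<close> lies on exactly one side of \<open>j\<close>. This
  yields the sign for moving one odd variable past \<open>card I\<close> others.\<close>

lemma inversions_swap:
 assumes "finite I" "j \<notin> I"
 shows "inversions I {j} + inversions {j} I = card I"
proof -
 have "j < x | x < j" if "x \<in> I" for x using that assms(2) by (cases x j rule: linorder_cases) auto
 hence I: "I = {i \<in> I. j < i} Un {i \<in> I. i < j}" by blast
 have "card I = card {i \<in> I. j < i} + card {i \<in> I. i < j}"
  by (subst I, rule card_Un_disjoint) (use assms(1) in auto)
 thus ?thesis by (simp add: inversions_single_left inversions_single_right)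
qed

lemma inversions_remove:
 assumes "finite I" "finite K" "j \<in> I"
 shows "inversions K I = inversions K {j} + inversions K (I - {j})"
  "inversions I K = inversions {j} K + inversions (I - {j}) K"
 using inversions_Un_right[of "{j}" "I - {j}" K] inversions_Un_left[of "{j}" "I - {j}" K] assms
 by (auto simp: insert_absorb)

lemma inversions_self [simp]: "inversions {j} {j} = 0"
 by (simp add: inversions_single_left)

lemma plin_laur_op [simp]: "plin (laur_op n \<phi>)"
 by (simp add: laur_op_def)

lemma plin_mul_op [simp]: "plin (mul_op n f)"
 by (simp add: mul_op_def)

lemma plin_der_op [simp]: "plin (der_op n j)"
 by (simp add: der_op_def)

lemmas plin_laur_intros = plin_if plin_plus plin_minus plin_pscale plin_comp[OF plin_mul_op]
 plin_comp[OF plin_der_op] plin_mul_op plin_der_op plin_null plin_id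

lemma laur_mult_bvec:
 "laur_mult (bvec (k, I)) (bvec (l, J)) =
   (if I Int J = {} then sgl (k + l, I Un J) ((-1) ^ inversions I J) else 0)"
 by (simp add: laur_mult_def inversions_def)

lemma mon_bvec:
 "mon n (k, I) (bvec (l, J)) =
   (if J <= {1..n} & I Int J = {} then sgl (k + l, I Un J) ((-1) ^ inversions I J) else 0)"
 by (simp add: mul_op_def laur_op_def laur_mult_bvec)

lemma der_bvec:
 "der_op n j (bvec (k, I)) = (if I <= {1..n} then
   (if j = 0 then sgl (k - 1, I) (of_int k)
   else if j \<in> I then sgl (k, I - {j}) ((-1) ^ inversions {j} I) else 0) else 0)"
 by (simp add: der_op_def laur_op_def der_basis_def inversions_single_left)

lemma single_pscale: "sgl b c = pscale c (bvec b)"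
 by simp

lemma mon_single:
 "mon n (k, I) (sgl (l, J) c) =
   (if J <= {1..n} & I Int J = {} then sgl (k + l, I Un J) (c * (-1) ^ inversions I J) else 0)"
 by (subst single_pscale, subst plin_scale[OF plin_mul_op]) (simp add: mon_bvec)

lemma der_single:
 "der_op n j (sgl (k, I) c) = (if I <= {1..n} then
   (if j = 0 then sgl (k - 1, I) (c * of_int k)
   else if j \<in> I then sgl (k, I - {j}) (c * (-1) ^ inversions {j} I) else 0) else 0)"
 by (subst single_pscale, subst plin_scale[OF plin_der_op]) (simp add: der_bvec)

lemma laur_ext:
 assumes "plin F" "plin G" "!!k I. F (bvec (k, I)) = G (bvec (k, I))"
 shows "F = G"
 using assms by (intro plin_ext) auto

section \<open>Relations between multiplications and derivations\<close>

lemma mon_mon: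
 assumes "I <= {1..n}" "J <= {1..n}"
 shows "mon n (k, I) (mon n (l, J) f) =
  (if I Int J = {} then pscale ((-1) ^ inversions I J) (mon n (k + l, I Un J) f) else 0)"
proof -
 have fin: "finite I" "finite J" using assms finite_subset by auto
 have "(%f. mon n (k, I) (mon n (l, J) f)) =
  (%f. if I Int J = {} then pscale ((-1) ^ inversions I J) (mon n (k + l, I Un J) f) else 0)"
 proof (rule laur_ext)
  fix m K
  show "mon n (k, I) (mon n (l, J) (bvec (m, K))) = (if I Int J = {}
   then pscale ((-1) ^ inversions I J) (mon n (k + l, I Un J) (bvec (m, K))) else 0)"
  proof (cases "K <= {1..n} & J Int K = {} & I Int J = {} & I Int K = {}")
   case True
   hence "finite K" using finite_subset by auto
   hence "inversions J K + inversions I (J Un K) = inversions I J + inversions (I Un J) K"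
    using True fin by (simp add: inversions_Un_left inversions_Un_right)
   hence "((-1) ^ inversions J K * (-1) ^ inversions I (J Un K) :: complex)
     = (-1) ^ inversions I J * (-1) ^ inversions (I Un J) K"
    by (metis power_add)
   thus ?thesis using True assms by (simp add: mon_bvec mon_single Int_Un_distrib Int_Un_distrib2 Un_assoc add.assoc)
  next
   case False
   thus ?thesis using assms
    by (auto simp: mon_bvec mon_single plin_zero Int_Un_distrib Int_Un_distrib2)
  qed
 qed (intro plin_laur_intros)+
 thus ?thesis by meson
qed

lemma der0_mon:
 assumes "I <= {1..n}"
 shows "der_op n 0 (mon n (k, I) f) = pscale (of_int k) (mon n (k - 1, I) f) + mon n (k, I) (der_op n 0 f)"
proof -
 have "(%f. der_op n 0 (mon n (k, I) f)) =
  (%f. pscale (of_int k) (mon n (k - 1, I) f) + mon n (k, I) (der_op n 0 f))"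
 proof (rule laur_ext)
  fix m K
  show "der_op n 0 (mon n (k, I) (bvec (m, K))) =
   pscale (of_int k) (mon n (k - 1, I) (bvec (m, K))) + mon n (k, I) (der_op n 0 (bvec (m, K)))"
   using assms
   by (auto simp: mon_bvec mon_single der_bvec der_single plin_zero single_add[symmetric] algebra_simps)
 qed (intro plin_laur_intros)+
 thus ?thesis by meson
qed

lemma sign_eq_iff: "((-1) ^ a = ((-1) ^ b :: complex)) \<longleftrightarrow> (even a \<longleftrightarrow> even b)"
 by (cases "even a"; cases "even b") auto

lemma sign_eq_neg_iff: "((-1) ^ a = - ((-1) ^ b :: complex)) \<longleftrightarrow> (even a \<longleftrightarrow> odd b)"
 by (cases "even a"; cases "even b") auto

text \<open>The super Leibniz rule for a left derivative. On a monomial all terms are multiples of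
  one and the same monomial, so only signs have to be compared, by counting inversions modulo
  2.\<close>

lemma der_mon:
 assumes "I <= {1..n}" "j ~= 0"
 shows "der_op n j (mon n (k, I) f) =
  (if j \<in> I then pscale ((-1) ^ inversions {j} I) (mon n (k, I - {j}) f) else 0)
  + pscale ((-1) ^ card I) (mon n (k, I) (der_op n j f))"
proof -
 have fI: "finite I" using assms finite_subset by auto
 have "(%f. der_op n j (mon n (k, I) f)) =
  (%f. (if j \<in> I then pscale ((-1) ^ inversions {j} I) (mon n (k, I - {j}) f) else 0)
   + pscale ((-1) ^ card I) (mon n (k, I) (der_op n j f)))"
 proof (rule laur_ext)
  fix m K
  show "der_op n j (mon n (k, I) (bvec (m, K))) =
   (if j \<in> I then pscale ((-1) ^ inversions {j} I) (mon n (k, I - {j}) (bvec (m, K))) else 0)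
   + pscale ((-1) ^ card I) (mon n (k, I) (der_op n j (bvec (m, K))))"
  proof (cases "K <= {1..n}")
   case False
   thus ?thesis by (simp add: mon_bvec der_bvec plin_zero)
  next
   case K: True
   hence fK: "finite K" using finite_subset by auto
   note fin = fI fK
   show ?thesis
   proof (cases "I Int K = {}")
    case dis: True
    show ?thesis
    proof (cases "j \<in> I")
     case jI: True
     hence jK: "j \<notin> K" using dis by auto
     have e: "I Un K - {j} = (I - {j}) Un K" using jK by auto
     have "inversions I K = inversions {j} K + inversions (I - {j}) K"
      "inversions {j} (I Un K) = inversions {j} I + inversions {j} K"
      using fin jI dis inversions_remove(2)[OF fI fK jI] by (auto simp: inversions_Un_right)
     hence s: "(-1) ^ inversions I K * (-1) ^ inversions {j} (I Un K) =
       ((-1) ^ inversions {j} I * (-1) ^ inversions (I - {j}) K :: complex)"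
      by (simp add: power_add[symmetric] sign_eq_iff) presburger
     have "(I - {j}) Int K = {}" using dis by auto
     thus ?thesis using dis K jI jK assms s e
      by (simp add: mon_bvec mon_single der_bvec der_single plin_zero)
    next
     case jI: False
     show ?thesis
     proof (cases "j \<in> K")
      case jK: True
      have e: "I Un K - {j} = I Un (K - {j})" "I Int (K - {j}) = {}" "K - {j} <= {1..n}"
       using jI dis K by auto
      have "inversions I K = inversions I {j} + inversions I (K - {j})"
       "inversions {j} (I Un K) = inversions {j} I + inversions {j} K"
       using fin dis inversions_remove(1)[OF fK fI jK] by (auto simp: inversions_Un_right)
      hence s: "(-1) ^ inversions I K * (-1) ^ inversions {j} (I Un K) =
        ((-1) ^ card I * ((-1) ^ inversions {j} K * (-1) ^ inversions I (K - {j})) :: complex)"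
       using inversions_swap[OF fI jI] by (simp add: power_add[symmetric] sign_eq_iff) presburger
      show ?thesis using dis K jI jK assms s e
       by (simp add: mon_bvec mon_single der_bvec der_single plin_zero)
     next
      case jK: False
      thus ?thesis using dis K jI assms
       by (simp add: mon_bvec mon_single der_bvec der_single plin_zero)
     qed
    qed
   next
    case ndis: False
    show ?thesis
    proof (cases "I Int K = {j}")
     \<comment> \<open>Here the product on the left is zero while both terms on the right are
       nonzero; the count of inversions shows that they cancel.\<close>
     case True
     hence jI: "j \<in> I" and jK: "j \<in> K" by auto
     have d: "(I - {j}) Int K = {}" "I Int (K - {j}) = {}" "K - {j} <= {1..n}"
       "I Un (K - {j}) = I - {j} Un K" "I - {j} <= {1..n}"
      using True jI jK K assms by auto
     have "inversions (I - {j}) K = inversions (I - {j}) {j} + inversions (I - {j}) (K - {j})"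
      "inversions I (K - {j}) = inversions {j} (K - {j}) + inversions (I - {j}) (K - {j})"
      "inversions {j} K = inversions {j} (K - {j})" "inversions {j} I = inversions {j} (I - {j})"
      using fin inversions_remove(1)[OF fK _ jK, of "I - {j}"] inversions_remove(2)[OF fI _ jI, of "K - {j}"]
       inversions_remove(1)[OF fK _ jK, of "{j}"] inversions_remove(1)[OF fI _ jI, of "{j}"] by auto
     moreover have "inversions (I - {j}) {j} + inversions {j} (I - {j}) = card (I - {j})"
      using fI by (intro inversions_swap) auto
     moreover have "card I = Suc (card (I - {j}))" using fI jI by (metis card.remove)
     ultimately have s: "(-1) ^ inversions {j} I * (-1) ^ inversions (I - {j}) K =
       - ((-1) ^ card I * ((-1) ^ inversions {j} K * (-1) ^ inversions I (K - {j})) :: complex)"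
      by (simp only: power_add[symmetric] sign_eq_neg_iff) presburger
     show ?thesis using ndis K jI jK assms s d
      by (simp add: mon_bvec mon_single der_bvec der_single plin_zero single_add[symmetric])
    next
     case False
     hence "~ I Int K <= {j}" using ndis subset_singletonD by metis
     then obtain i where "i ~= j" "i \<in> I" "i \<in> K" by blast
     hence "(I - {j}) Int K ~= {}" "I Int (K - {j}) ~= {}" by auto
     thus ?thesis using ndis by (simp add: mon_bvec mon_single der_bvec plin_zero)
    qed
   qed
  qed
 qed (intro plin_laur_intros)+
 thus ?thesis by meson
qed

text \<open>The two signs agree because removing \<open>j\<close> from \<open>J\<close> does not
  change \<open>inversions {j} J\<close>. The operator is thus the projection onto the monomials
  that contain xi_j.\<close>

lemma mon_der_diag:
 assumes "j ~= 0" "j \<le> n"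
 shows "mon n (0, {j}) (der_op n j (bvec (l, J))) = (if J <= {1..n} & j \<in> J then bvec (l, J) else 0)"
proof (cases "J <= {1..n} & j \<in> J")
 case True
 hence "finite J" using finite_subset by auto
 hence "inversions {j} J = inversions {j} (J - {j})" using True inversions_remove(1)[of J "{j}" j] by auto
 thus ?thesis using True assms by (auto simp: der_bvec mon_single insert_absorb power_add[symmetric] mult_2[symmetric])
qed (use assms in "auto simp: der_bvec plin_zero")

section \<open>The Weyl superalgebra\<close>

lemma subspace_laur: "subsp (laur n)"
 unfolding laur_def by (rule subspace_supp)

lemma subspace_laur_part: "subsp (laur_part n p)"
 unfolding laur_part_def by (rule subspace_supp)

lemma laur_part_mapI:
 assumes "plin F" "subsp W" "f \<in> laur_part n p"
  "!!k I. I <= {1..n} ==> odd (card I) = p ==> F (bvec (k, I)) \<in> W"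
 shows "F f \<in> W"
 by (rule supp_image[OF assms(1,2), of _ "UNIV \<times> {I. I <= {1..n} & odd (card I) = p}"])
  (use assms(3,4) in "auto simp: laur_part_def")

lemma weyl_plin: "T \<in> weyl_ops n ==> plin T"
 by (induction rule: weyl_ops.induct)
  (auto intro: plin_pscale plin_plus plin_comp simp: o_def)

lemma weyl_outside: "T \<in> weyl_ops n ==> ~ I <= {1..n} ==> T (bvec (k, I)) = 0"
proof (induction rule: weyl_ops.induct)
 case (comp S T)
 thus ?case using plin_zero[OF weyl_plin] by simp
qed (auto simp: mon_bvec der_bvec)

lemma der_laur: "der_op n j f \<in> laur n"
 by (rule supp_image[OF plin_der_op subspace_laur, where B=UNIV])
  (auto simp: der_bvec laur_def split: if_splits simp del: atLeastAtMost_iff)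

lemma weyl_eqI:
 assumes "plin S" "T \<in> weyl_ops n" "!!k I. ~ I <= {1..n} ==> S (bvec (k, I)) = 0"
  "!!k I. I <= {1..n} ==> S (bvec (k, I)) = T (bvec (k, I))"
 shows "S = T"
 by (rule laur_ext[OF assms(1) weyl_plin[OF assms(2)]])
  (use assms(3,4) weyl_outside[OF assms(2)] in metis)

lemma mon_unit: "f \<in> laur n ==> mon n (0, {}) f = f"
 by (rule plin_eqI[OF plin_mul_op plin_id, of _ "UNIV \<times> Pow {1..n}"])
  (auto simp: laur_def mon_bvec)

lemma weyl_mon: "I <= {1..n} ==> mon n (k, I) \<in> weyl_ops n"
proof -
 have c: "mon n (a, {}) \<circ> mon n (b, J) = mon n (a + b, J)" if "J <= {1..n}" for a b J
  using that by (auto simp: mon_mon)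
 have pos: "mon n (int m, {}) \<in> weyl_ops n" for m
 proof (induction m)
  case (Suc m)
  thus ?case using weyl_ops.comp[OF weyl_ops.t Suc] c[of "{}" 1 "int m"] by (simp add: add.commute)
 qed (simp add: weyl_ops.one)
 have neg: "mon n (- int m, {}) \<in> weyl_ops n" for m
 proof (induction m)
  case (Suc m)
  thus ?case using weyl_ops.comp[OF weyl_ops.t_inverse Suc] c[of "{}" "-1" "- int m"] by (simp add: algebra_simps)
 qed (simp add: weyl_ops.one)
 have t: "mon n (k, {}) \<in> weyl_ops n"
  using pos[of "nat k"] neg[of "nat (-k)"] by (cases "k \<ge> 0") auto
 assume I: "I <= {1..n}"
 hence "finite I" using finite_subset by auto
 hence "mon n (0, I) \<in> weyl_ops n" using I
 proof (induction I)
  case empty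
  thus ?case by (simp add: weyl_ops.one)
 next
  case (insert i I)
  let ?s = "(-1) ^ inversions {i} I :: complex"
  have "(%f. pscale ?s ((mon n (0, {i}) \<circ> mon n (0, I)) f)) \<in> weyl_ops n"
   using insert by (intro weyl_ops.scale weyl_ops.comp weyl_ops.xi) auto
  also have "(%f. pscale ?s ((mon n (0, {i}) \<circ> mon n (0, I)) f)) = mon n (0, insert i I)"
   using insert by (auto simp: mon_mon power_add[symmetric] mult_2[symmetric])
  finally show ?case .
 qed
 from weyl_ops.comp[OF t this] show ?thesis using c[OF I, of k 0] by simp
qed

section \<open>Parity of operators and supercommutators\<close>

lemma weyl_simps [simp]:
 "carrier (weyl n) = weyl_ops n" "S \<otimes>\<^bsub>weyl n\<^esub> T = S \<circ> T" "\<one>\<^bsub>weyl n\<^esub> = mon n (0, {})"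
 "\<zero>\<^bsub>weyl n\<^esub> = (%f. 0)" "S \<oplus>\<^bsub>weyl n\<^esub> T = (%f. S f + T f)" "c \<odot>\<^bsub>weyl n\<^esub> T = (%f. pscale c (T f))"
 by (simp_all add: weyl_def)

lemma weyl_part_iff: "T \<in> part (weyl n) p \<longleftrightarrow> T \<in> weyl_ops n & (\<forall>q. T ` laur_part n q <= laur_part n (p ~= q))"
 by (simp add: weyl_def)

lemma weyl_partD:
 "T \<in> part (weyl n) p ==> T \<in> weyl_ops n"
 "T \<in> part (weyl n) p ==> f \<in> laur_part n q ==> T f \<in> laur_part n (p ~= q)"
 unfolding weyl_part_iff by blast+

lemma weyl_partI:
 assumes "T \<in> weyl_ops n"
  "!!k I. I <= {1..n} ==> T (bvec (k, I)) \<in> laur_part n (p ~= odd (card I))"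
 shows "T \<in> part (weyl n) p"
 unfolding weyl_part_iff
proof (intro conjI allI image_subsetI)
 fix q f assume f: "f \<in> laur_part n q"
 show "T f \<in> laur_part n (p ~= q)"
 proof (rule laur_part_mapI[OF weyl_plin[OF assms(1)] subspace_laur_part f])
  show "T (bvec (k, I)) \<in> laur_part n (p ~= q)" if "I <= {1..n}" "odd (card I) = q" for k I
   using assms(2)[OF that(1), of k] unfolding that(2) .
 qed
qed (rule assms(1))

lemma weyl_zero: "(%f. 0) \<in> weyl_ops n"
 using weyl_ops.scale[OF weyl_ops.one, of 0 n] by simp

lemma weyl_diff: "S \<in> weyl_ops n ==> T \<in> weyl_ops n ==> (%f. S f - T f) \<in> weyl_ops n"
 using weyl_ops.add[of S n, OF _ weyl_ops.scale[of T n "-1"]] by simp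

lemma weyl_part_zero: "(%f. 0) \<in> part (weyl n) p"
 by (rule weyl_partI) (auto simp: weyl_zero sub_0[OF subspace_laur_part])

lemma weyl_part_diff: "S \<in> part (weyl n) p ==> T \<in> part (weyl n) p ==> (%f. S f - T f) \<in> part (weyl n) p"
 unfolding weyl_part_iff by (blast intro: weyl_diff sub_diff[OF subspace_laur_part])

lemma weyl_part_add: "S \<in> part (weyl n) p ==> T \<in> part (weyl n) p ==> (%f. S f + T f) \<in> part (weyl n) p"
 unfolding weyl_part_iff by (blast intro: weyl_ops.add sub_add[OF subspace_laur_part])

lemma weyl_part_scale: "T \<in> part (weyl n) p ==> (%f. pscale c (T f)) \<in> part (weyl n) p"
 unfolding weyl_part_iff by (blast intro: weyl_ops.scale sub_scale[OF subspace_laur_part])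

lemma weyl_part_comp:
 assumes "S \<in> part (weyl n) p" "T \<in> part (weyl n) q"
 shows "(%f. S (T f)) \<in> part (weyl n) (p ~= q)"
proof -
 have "S (T f) \<in> laur_part n ((p ~= q) ~= r)" if "f \<in> laur_part n r" for f r
 proof -
  have "S (T f) \<in> laur_part n (p ~= (q ~= r))" using assms that unfolding weyl_part_iff by blast
  moreover have "(p ~= (q ~= r)) = ((p ~= q) ~= r)" by auto
  ultimately show ?thesis by simp
 qed
 thus ?thesis using assms weyl_ops.comp[of S n T] by (auto simp: weyl_part_iff o_def)
qed

lemma weyl_part_disjoint:
 assumes "T \<in> part (weyl n) p" "T \<in> part (weyl n) (~ p)"
 shows "T = (%f. 0)"
proof (rule weyl_eqI[symmetric, of "%f. 0" T n, THEN sym, THEN sym])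
 fix k I assume I: "I <= {1..n}"
 hence "bvec (k, I) \<in> laur_part n (odd (card I))" by (simp add: laur_part_def)
 hence "T (bvec (k, I)) \<in> laur_part n (p ~= odd (card I)) Int laur_part n ((~ p) ~= odd (card I))"
  using assms unfolding weyl_part_iff by blast
 hence "supp (T (bvec (k, I))) <= {}" unfolding laur_part_def by fastforce
 thus "0 = T (bvec (k, I))" by simp
qed (use assms in "auto simp: weyl_part_iff plin_null")

text \<open>For a homogeneous operator the decomposition \<open>T = T + 0\<close> is at hand, and it
  is unique because an operator of both parities is zero.\<close>

lemma component_weyl:
 assumes "T \<in> part (weyl n) p"
 shows "component (weyl n) q T = (if q = p then T else (%f. 0))"
proof (cases "q = p")
 case True
 have "component (weyl n) p T = T"
  unfolding component_def
 proof (rule the_equality)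
  show "T \<in> part (weyl n) p & (\<exists>b\<in>part (weyl n) (~ p). T = T \<oplus>\<^bsub>weyl n\<^esub> b)"
   using assms weyl_part_zero by (auto intro!: bexI[of _ "%f. 0"])
  fix a assume "a \<in> part (weyl n) p & (\<exists>b\<in>part (weyl n) (~ p). T = a \<oplus>\<^bsub>weyl n\<^esub> b)"
  then obtain b where b: "a \<in> part (weyl n) p" "b \<in> part (weyl n) (~ p)" "T = (%f. a f + b f)" by auto
  have "b = (%f. T f - a f)" using b by simp
  hence "b \<in> part (weyl n) p" using weyl_part_diff[OF assms b(1)] by simp
  hence "b = (%f. 0)" using weyl_part_disjoint b by blast
  thus "a = T" using b by simp
 qed
 thus ?thesis using True by simp
next
 case False
 hence q: "q = (~ p)" by auto
 have "component (weyl n) (~ p) T = (%f. 0)"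
  unfolding component_def
 proof (rule the_equality)
  show "(%f. 0) \<in> part (weyl n) (~ p) & (\<exists>b\<in>part (weyl n) (~ ~ p). T = (%f. 0) \<oplus>\<^bsub>weyl n\<^esub> b)"
   using assms weyl_part_zero by auto
  fix a assume "a \<in> part (weyl n) (~ p) & (\<exists>b\<in>part (weyl n) (~ ~ p). T = a \<oplus>\<^bsub>weyl n\<^esub> b)"
  then obtain b where b: "a \<in> part (weyl n) (~ p)" "b \<in> part (weyl n) p" "T = (%f. a f + b f)" by auto
  have "a = (%f. T f - b f)" using b by simp
  hence "a \<in> part (weyl n) p" using weyl_part_diff[OF assms b(2)] by simp
  thus "a = (%f. 0)" using weyl_part_disjoint b by blast
 qed
 thus ?thesis using q by simp
qed

lemma finsum_bool:
 assumes "abelian_monoid A" "g \<in> UNIV \<rightarrow> carrier A"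
 shows "(\<Oplus>\<^bsub>A\<^esub>p\<in>UNIV. g p) = g False \<oplus>\<^bsub>A\<^esub> g True"
proof -
 interpret abelian_monoid A by fact
 have "g False \<in> carrier A" "g True \<in> carrier A" using assms by auto
 thus ?thesis using assms by (simp add: UNIV_bool finsum_insert r_zero)
qed

lemma supercommutator_homogeneous:
 assumes A: "abelian_monoid A"
  and cl: "!!x y. x \<in> carrier A ==> y \<in> carrier A ==> x \<otimes>\<^bsub>A\<^esub> y \<in> carrier A"
   "!!x c. x \<in> carrier A ==> c \<odot>\<^bsub>A\<^esub> x \<in> carrier A"
  and z: "!!x. x \<in> carrier A ==> x \<otimes>\<^bsub>A\<^esub> \<zero>\<^bsub>A\<^esub> = \<zero>\<^bsub>A\<^esub>" "!!x. x \<in> carrier A ==> \<zero>\<^bsub>A\<^esub> \<otimes>\<^bsub>A\<^esub> x = \<zero>\<^bsub>A\<^esub>"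
   "!!c. c \<odot>\<^bsub>A\<^esub> \<zero>\<^bsub>A\<^esub> = \<zero>\<^bsub>A\<^esub>"
  and x: "x \<in> carrier A" "!!r. component A r x = (if r = p then x else \<zero>\<^bsub>A\<^esub>)"
  and y: "y \<in> carrier A" "!!r. component A r y = (if r = q then y else \<zero>\<^bsub>A\<^esub>)"
 shows "supercommutator A x y = (x \<otimes>\<^bsub>A\<^esub> y) \<oplus>\<^bsub>A\<^esub> (- ksign p q) \<odot>\<^bsub>A\<^esub> (y \<otimes>\<^bsub>A\<^esub> x)"
proof -
 interpret abelian_monoid A by fact
 show ?thesis
  unfolding supercommutator_def x(2) y(2)
  by (cases p; cases q) (simp_all add: finsum_bool[OF A] cl z x(1) y(1))
qed

lemma abelian_monoid_weyl: "abelian_monoid (weyl n)"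
 by (rule abelian_monoidI) (auto simp: weyl_ops.add weyl_zero algebra_simps)

lemma weyl_comp: "S \<in> weyl_ops n ==> T \<in> weyl_ops n ==> (%f. S (T f)) \<in> weyl_ops n"
 using weyl_ops.comp[of S n T] by (simp add: o_def)

lemma supercommutator_weyl:
 assumes "x \<in> part (weyl n) p" "y \<in> part (weyl n) q"
 shows "supercommutator (weyl n) x y = (%f. x (y f) - pscale (ksign p q) (y (x f)))"
proof -
 have c: "x \<in> weyl_ops n" "y \<in> weyl_ops n" using assms by (auto simp: weyl_part_iff)
 have "supercommutator (weyl n) x y =
  (x \<otimes>\<^bsub>weyl n\<^esub> y) \<oplus>\<^bsub>weyl n\<^esub> (- ksign p q) \<odot>\<^bsub>weyl n\<^esub> (y \<otimes>\<^bsub>weyl n\<^esub> x)"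
  by (rule supercommutator_homogeneous)
   (use c assms in "auto simp: abelian_monoid_weyl weyl_comp weyl_ops.scale component_weyl o_def
     plin_zero[OF weyl_plin]")
 thus ?thesis by simp
qed

lemma part_mon: 
 assumes "I <= {1..n}"
 shows "mon n (k, I) \<in> part (weyl n) (odd (card I))"
proof (rule weyl_partI[OF weyl_mon[OF assms]])
 fix l J assume J: "J <= {1..n}"
 have "finite I" "finite J" using assms J finite_subset by auto
 thus "mon n (k, I) (bvec (l, J)) \<in> laur_part n (odd (card I) ~= odd (card J))"
  using assms J by (auto simp: mon_bvec laur_part_def card_Un_disjoint)
qed

lemma part_der:
 assumes "j \<le> n"
 shows "der_op n j \<in> part (weyl n) (j ~= 0)"
proof (rule weyl_partI[OF weyl_ops.der[OF assms]])
 fix l J assume J: "J <= {1..n}"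
 have "card J = Suc (card (J - {j}))" if "j \<in> J" using that J by (meson card.remove finite_atLeastAtMost finite_subset)
 moreover have "J - {j} <= {1..n}" using J by auto
 ultimately show "der_op n j (bvec (l, J)) \<in> laur_part n ((j ~= 0) ~= odd (card J))"
  using J by (auto simp: der_bvec laur_part_def)
qed

section \<open>Elements of \<open>S'(1,n)\<close>\<close>

text \<open>Membership in the derived algebra is always shown in this way: the field is a multiple
  of one bracket of homogeneous divergence-free fields. The factor \<open>c\<close> normalizes the
  eigenvalue that the bracket produces.\<close>

lemma S_prime_commutator:
 assumes "x \<in> div_free n p" "y \<in> div_free n q" "x \<in> part (weyl n) p" "y \<in> part (weyl n) q"
  and "z = (%f. pscale c (x (y f) - pscale (ksign p q) (y (x f))))"
 shows "z \<in> carrier (S_prime n)"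
proof -
 have S: "div_free n r <= S_ops n" for r
  by (cases r) (auto simp: S_ops_def lin_span_def)
 let ?z = "supercommutator (weyl n) x y"
 have "c \<odot>\<^bsub>weyl n\<^esub> ?z \<in> lin_span (weyl n) {supercommutator (weyl n) x y | x y. x \<in> S_ops n & y \<in> S_ops n}"
  unfolding lin_span_def
 proof (rule InterI, clarify)
  fix N assume N: "submodule N complex_field (weyl n)"
   "{supercommutator (weyl n) x y |x y. x \<in> S_ops n & y \<in> S_ops n} <= N"
  have "?z \<in> N" using N(2) S assms(1,2) by blast
  thus "c \<odot>\<^bsub>weyl n\<^esub> ?z \<in> N" using submodule.smult_closed[OF N(1), of c ?z] by simp
 qed
 thus ?thesis
  using supercommutator_weyl[OF assms(3,4)] assms(5) by (simp add: S_prime_def lie_sub_def)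
qed

lemma laur_mult_zero [simp]: "laur_mult 0 g = 0"
 by (simp add: laur_mult_def plin_zero)

lemma plin_laur_mult: "plin (laur_mult f)"
proof -
 have e: "laur_mult f = (%g. \<Sum>a\<in>supp f. pscale (cf f a) (laur_mult (bvec a) g))"
 proof
  fix g
  have "laur_mult f g = linext (%a. laur_mult (bvec a) g) f"
   by (simp add: laur_mult_def case_prod_unfold)
  thus "laur_mult f g = (\<Sum>a\<in>supp f. pscale (cf f a) (laur_mult (bvec a) g))"
   by (simp add: linext_def)
 qed
 show ?thesis
  by (subst e, intro plin_sum_fun plin_pscale) (simp add: laur_mult_def split_beta)
qed

lemma laur_mult_left_scale: "laur_mult (pscale c f) g = pscale c (laur_mult f g)"
 by (simp add: laur_mult_def plin_scale)

lemma laur_mult_mon: "g \<in> laur n ==> laur_mult (bvec b) g = mon n b g"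
 by (rule plin_eqI[OF plin_laur_mult plin_mul_op, of _ "UNIV \<times> Pow {1..n}"])
  (auto simp: laur_def mul_op_def laur_op_def)

lemma derivation_eq:
 assumes "a \<le> n" "b \<le> n" "a ~= b"
 shows "derivation n (%j. if j = a then pscale c (bvec x) else if j = b then pscale d (bvec y) else 0)
  = (%g. pscale c (mon n x (der_op n a g)) + pscale d (mon n y (der_op n b g)))"
proof
 fix g
 have "derivation n (%j. if j = a then pscale c (bvec x) else if j = b then pscale d (bvec y) else 0) g
  = (\<Sum>j\<le>n. (if j = a then pscale c (mon n x (der_op n a g)) else 0)
     + (if j = b then pscale d (mon n y (der_op n b g)) else 0))"
  unfolding derivation_def using assms(3)
  by (intro sum.cong) (simp_all add: laur_mult_left_scale laur_mult_mon der_laur del: pscale_single)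
 thus "derivation n (%j. if j = a then pscale c (bvec x) else if j = b then pscale d (bvec y) else 0) g
  = pscale c (mon n x (der_op n a g)) + pscale d (mon n y (der_op n b g))"
  using assms by (simp add: sum.distrib)
qed

text \<open>The fields needed have at most two nonzero coefficients, at \<open>a\<close> and
  \<open>b\<close>. Parity and divergence are stated uniformly in the index, with 0 standing for
  d/dt, so that either of the two may be the t-direction.\<close>

lemma div_freeI:
 assumes "a \<le> n" "b \<le> n" "a ~= b"
  and "!!j. j \<le> n ==> (if j = a then pscale c (bvec x) else if j = b then pscale d (bvec y) else 0)
      \<in> laur_part n (p = (j = 0))"
  and "pscale (if a ~= 0 & ~ p then -1 else 1) (der_op n a (pscale c (bvec x)))
    + pscale (if b ~= 0 & ~ p then -1 else 1) (der_op n b (pscale d (bvec y))) = 0"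
 shows "(%g. pscale c (mon n x (der_op n a g)) + pscale d (mon n y (der_op n b g))) \<in> div_free n p"
proof -
 let ?f = "%j. if j = a then pscale c (bvec x) else if j = b then pscale d (bvec y) else 0 :: laur"
 let ?h = "%j. pscale (if j ~= 0 & ~ p then -1 else 1) (der_op n j (?f j))"
 have "der_op n 0 (?f 0) + (\<Sum>i\<in>{1..n}. pscale (if ~ p then -1 else 1) (der_op n i (?f i)))
   = ?h 0 + (\<Sum>i\<in>{1..n}. ?h i)"
  by (intro arg_cong2[where f="(+)"] sum.cong) auto
 also have "\<dots> = (\<Sum>i\<le>n. ?h i)"
  by (simp only: sum.atLeast1_atMost_eq sum.atMost_shift One_nat_def)
 also have "\<dots> = (\<Sum>i\<le>n. (if i = a then ?h a else 0) + (if i = b then ?h b else 0))"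
  using assms(3) by (intro sum.cong) (auto simp: plin_zero simp del: pscale_single)
 also have "\<dots> = ?h a + ?h b" using assms(1,2) by (simp add: sum.distrib)
 also have "\<dots> = 0" using assms(3,5) by (simp del: pscale_single)
 finally have "der_op n 0 (?f 0) + (\<Sum>i\<in>{1..n}. pscale (if ~ p then -1 else 1) (der_op n i (?f i))) = 0" .
 moreover have "?f 0 \<in> laur_part n p" using assms(4)[of 0] by simp
 moreover have "\<forall>i\<in>{1..n}. ?f i \<in> laur_part n (~ p)"
 proof
  fix i assume "i \<in> {1..n}"
  thus "?f i \<in> laur_part n (~ p)" using assms(4)[of i] by simp
 qed
 ultimately have "derivation n ?f \<in> div_free n p" unfolding div_free_def by blast
 thus ?thesis unfolding derivation_eq[OF assms(1-3)] .
qed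

lemma pscale_minus_one [simp]: "pscale (-1) f = - f"
 by (rule poly_mapping_eqI) simp

lemma single_arith:
 fixes c d :: complex
 shows "- sgl b c = sgl b (- c)"
  "sgl b c + sgl b d = sgl b (c + d)"
  "sgl b c - sgl b d = sgl b (c - d)"
 by (simp_all add: single_uminus single_add single_diff)

lemma sign_conj: "(-1) ^ m * c * (-1) ^ m = (c :: complex)"
 by (cases "even m") auto

lemma weyl_comm_eqI:
 assumes "plin z" "x \<in> weyl_ops n" "y \<in> weyl_ops n" "z \<in> weyl_ops n"
  and "!!k I. I <= {1..n} ==> z (bvec (k, I)) = pscale c (x (y (bvec (k, I))) - pscale s (y (x (bvec (k, I)))))"
 shows "z = (%f. pscale c (x (y f) - pscale s (y (x f))))"
proof (rule laur_ext)
 note p = weyl_plin[OF assms(2)] weyl_plin[OF assms(3)]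
 show "plin (%f. pscale c (x (y f) - pscale s (y (x f))))"
  by (intro plin_pscale plin_minus plin_comp[of x y] plin_comp[of y x] p)
 fix k I
 show "z (bvec (k, I)) = pscale c (x (y (bvec (k, I))) - pscale s (y (x (bvec (k, I)))))"
 proof (cases "I <= {1..n}")
  case False
  thus ?thesis using weyl_outside[OF assms(2), of I k] weyl_outside[OF assms(3), of I k]
    weyl_outside[OF assms(4), of I k] p by (simp add: plin_zero)
 qed (rule assms(5))
qed (rule assms(1))

text \<open>Monomials are eigenvectors of this field, so the bracket with it rescales monomial
  fields. The factors 1 and -1 are written out to fit the shape of \<open>div_freeI\<close>.\<close>

definition diag_field :: "nat => nat => nat => laur => laur"
 where "diag_field n i j = (%g. pscale 1 (mon n (0, {i}) (der_op n i g)) + pscale (-1) (mon n (0, {j}) (der_op n j g)))"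

lemma diag_field_bvec:
 assumes "i \<in> {1..n}" "j \<in> {1..n}" "J <= {1..n}"
 shows "diag_field n i j (bvec (l, J)) = pscale (of_bool (i \<in> J) - of_bool (j \<in> J)) (bvec (l, J))"
 using assms by (auto simp: diag_field_def mon_der_diag single_arith)

lemma diag_field:
 assumes "i \<in> {1..n}" "j \<in> {1..n}" "i ~= j"
 shows "diag_field n i j \<in> div_free n False" "diag_field n i j \<in> part (weyl n) False"
proof -
 show "diag_field n i j \<in> div_free n False"
  unfolding diag_field_def
  by (rule div_freeI) (use assms in "auto simp: laur_part_def der_single single_arith")
 have "(%g. mon n (0, {k}) (der_op n k g)) \<in> part (weyl n) False" if "k \<in> {1..n}" for k
  using weyl_part_comp[OF part_mon[of "{k}" n 0] part_der[of k n]] that by auto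
 thus "diag_field n i j \<in> part (weyl n) False"
  unfolding diag_field_def using assms by (intro weyl_part_add weyl_part_scale) auto
qed

definition mon_field :: "nat => int => nat set => nat => laur => laur"
 where "mon_field n k I i = (%g. mon n (k, I) (der_op n i g))"

text \<open>The coefficient does not contain the variable by which the divergence differentiates
  it.\<close>

lemma mon_field_div_free:
 assumes "I <= {1..n}" "i \<le> n" "i \<notin> I" "i = 0 ==> k = 0" "n \<ge> 2"
 shows "mon_field n k I i \<in> div_free n (odd (card I) ~= (i ~= 0))"
proof -
 \<comment> \<open>Any second index serves; its coefficient is 0.\<close>
 define j :: nat where "j = (if i = 0 then 1 else 0)"
 have j: "j ~= i" "j \<le> n" using assms by (auto simp: j_def)
 have "(%g. pscale 1 (mon n (k, I) (der_op n i g)) + pscale 0 (mon n (0, {}) (der_op n j g)))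
   \<in> div_free n (odd (card I) ~= (i ~= 0))"
  by (rule div_freeI)
   (use assms j in "auto simp: laur_part_def der_bvec plin_zero sub_0[OF subspace_laur_part]")
 thus ?thesis by (simp add: mon_field_def)
qed

lemma mon_field_part:
 assumes "I <= {1..n}" "i \<le> n"
 shows "mon_field n k I i \<in> part (weyl n) (odd (card I) ~= (i ~= 0))"
 unfolding mon_field_def by (intro weyl_part_comp part_mon part_der assms)

lemma mon_field_weyl: "I <= {1..n} ==> i \<le> n ==> mon_field n k I i \<in> weyl_ops n"
 using mon_field_part weyl_partD(1) by blast

lemma mon_field_bvec:
 assumes "J <= {1..n}"
 shows "mon_field n k I i (bvec (l, J)) =
  (if i = 0 then if I Int J = {} then sgl (k + (l - 1), I Un J) (of_int l * (-1) ^ inversions I J) else 0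
   else if i \<in> J & I Int (J - {i}) = {} then
    sgl (k + l, I Un (J - {i})) ((-1) ^ inversions {i} J * (-1) ^ inversions I (J - {i})) else 0)"
proof -
 have "J - {i} <= {1..n}" using assms by auto
 thus ?thesis using assms by (auto simp: mon_field_def der_bvec mon_single plin_zero)
qed

lemma mon_field_single:
 assumes "J <= {1..n}"
 shows "mon_field n k I i (sgl (l, J) c) =
  (if i = 0 then if I Int J = {} then sgl (k + (l - 1), I Un J) (c * of_int l * (-1) ^ inversions I J) else 0
   else if i \<in> J & I Int (J - {i}) = {} then
    sgl (k + l, I Un (J - {i})) (c * (-1) ^ inversions {i} J * (-1) ^ inversions I (J - {i})) else 0)"
proof -
 have "J - {i} <= {1..n}" using assms by auto
 thus ?thesis using assms by (auto simp: mon_field_def der_single mon_single plin_zero)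
qed

lemma S_prime_mon_field:
 assumes "I <= {1..n}" "i \<in> {1..n}" "i \<notin> I" "n \<ge> 2"
 shows "mon_field n k I i \<in> carrier (S_prime n)"
proof -
 obtain j where j: "j \<in> {1..n}" "j ~= i"
  using that[of "if i = 1 then 2 else 1"] assms by (auto split: if_splits)
 \<comment> \<open>Bracketing with xi_j d/dxi_j - xi_i d/dxi_i multiplies the field by
   \<open>d\<close>: the derivative by xi_i contributes 1, since \<open>i\<close> is not in
   \<open>I\<close>, and a factor xi_j contributes another 1. So \<open>d\<close> is 1 or 2.\<close>
 define d :: complex where "d = 1 + of_bool (j \<in> I)"
 have d: "d ~= 0" by (auto simp: d_def)
 show ?thesis
 proof (rule S_prime_commutator[OF diag_field(1)[OF j(1) assms(2) j(2)] mon_field_div_free[OF assms(1)]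
   diag_field(2)[OF j(1) assms(2) j(2)] mon_field_part[OF assms(1)]])
  have dw: "diag_field n j i \<in> weyl_ops n" using diag_field(2)[OF j(1) assms(2) j(2)] weyl_partD(1) by blast
  have fw: "mon_field n k I i \<in> weyl_ops n" using mon_field_weyl assms by auto
  show "mon_field n k I i = (%f. pscale (inverse d) (diag_field n j i (mon_field n k I i f) -
    pscale (ksign False (odd (card I) ~= (i ~= 0))) (mon_field n k I i (diag_field n j i f))))"
  proof (rule weyl_comm_eqI[OF weyl_plin[OF fw] dw fw fw])
   fix l J assume J: "J <= {1..n}"
   let ?b = "bvec (l, J) :: laur"
   show "mon_field n k I i ?b = pscale (inverse d) (diag_field n j i (mon_field n k I i ?b) -
     pscale (ksign False (odd (card I) ~= (i ~= 0))) (mon_field n k I i (diag_field n j i ?b)))"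
   proof (cases "i \<in> J & I Int (J - {i}) = {}")
    case False
    hence z: "mon_field n k I i ?b = 0" using assms J by (auto simp: mon_field_bvec)
    thus ?thesis
     unfolding z diag_field_bvec[OF j(1) assms(2) J] plin_scale[OF weyl_plin[OF fw]]
     by (simp add: plin_zero[OF weyl_plin[OF dw]])
   next
    case True
    have s: "I Un (J - {i}) <= {1..n}" using assms J by auto
    have "of_bool (j \<in> I Un (J - {i})) - of_bool (i \<in> I Un (J - {i})) - (of_bool (j \<in> J) - of_bool (i \<in> J)) = d"
     using True assms j by (auto simp: d_def)
    hence e: "of_bool (j \<in> I Un (J - {i})) - of_bool (i \<in> I Un (J - {i})) = d + (of_bool (j \<in> J) - of_bool (i \<in> J))"
     by (simp add: algebra_simps)
    let ?c = "(-1) ^ inversions {i} J * (-1) ^ inversions I (J - {i}) :: complex"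
    have m: "mon_field n k I i ?b = pscale ?c (bvec (k + l, I Un (J - {i})))"
     using True J assms by (simp add: mon_field_bvec)
    have "diag_field n j i (mon_field n k I i ?b) = pscale (d + (of_bool (j \<in> J) - of_bool (i \<in> J))) (mon_field n k I i ?b)"
     unfolding m plin_scale[OF weyl_plin[OF dw]] diag_field_bvec[OF j(1) assms(2) s] e
     by (simp add: mult.commute)
    moreover have "mon_field n k I i (diag_field n j i ?b) = pscale (of_bool (j \<in> J) - of_bool (i \<in> J)) (mon_field n k I i ?b)"
     unfolding diag_field_bvec[OF j(1) assms(2) J] plin_scale[OF weyl_plin[OF fw]] ..
    ultimately show ?thesis using d
     by (simp add: ksign_def pv.scale_left_diff_distrib[symmetric] pv.scale_left_distrib del: pscale_single)
   qed
  qed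
 qed (use assms in auto)
qed

text \<open>Its divergence is 1 - 1: the coefficient xi_i of the second summand is odd and therefore
  counts with a minus sign.\<close>

definition euler_field :: "nat => nat => laur => laur"
 where "euler_field n i = (%g. pscale 1 (mon n (1, {}) (der_op n 0 g)) + pscale 1 (mon n (0, {i}) (der_op n i g)))"

lemma euler_field_bvec:
 assumes "i \<in> {1..n}" "J <= {1..n}"
 shows "euler_field n i (bvec (l, J)) = pscale (of_int l + of_bool (i \<in> J)) (bvec (l, J))"
 using assms by (auto simp: euler_field_def mon_der_diag der_bvec[of n 0] mon_single single_arith)

lemma euler_field:
 assumes "i \<in> {1..n}"
 shows "euler_field n i \<in> div_free n False" "euler_field n i \<in> part (weyl n) False"
proof -
 show "euler_field n i \<in> div_free n False"
  unfolding euler_field_def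
  by (rule div_freeI) (use assms in "auto simp: laur_part_def der_single single_arith")
 have "(%g. mon n (0, {i}) (der_op n i g)) \<in> part (weyl n) False"
  using weyl_part_comp[OF part_mon[of "{i}" n 0] part_der[of i n]] assms by auto
 moreover have "(%g. mon n (1, {}) (der_op n 0 g)) \<in> part (weyl n) False"
  using weyl_part_comp[OF part_mon[of "{}" n 1] part_der[of 0 n]] by auto
 ultimately show "euler_field n i \<in> part (weyl n) False"
  unfolding euler_field_def using assms by (intro weyl_part_add weyl_part_scale) auto
qed

text \<open>Under the bracket with the Euler-type field, d/dt has the eigenvalue -1; this explains
  the factor \<open>-1\<close>.\<close>

lemma S_prime_der0:
 assumes "n \<ge> 2"
 shows "mon_field n 0 {} 0 \<in> carrier (S_prime n)"
proof (rule S_prime_commutator[of "euler_field n 1" n False "mon_field n 0 {} 0" False _ "-1"])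
 have i: "1 \<in> {1..n}" using assms by auto
 show "euler_field n 1 \<in> div_free n False" "euler_field n 1 \<in> part (weyl n) False"
  using euler_field[OF i] .
 show "mon_field n 0 {} 0 \<in> div_free n False" "mon_field n 0 {} 0 \<in> part (weyl n) False"
  using mon_field_div_free[of "{}" n 0 0] mon_field_part[of "{}" n 0 0] assms by auto
 have ew: "euler_field n 1 \<in> weyl_ops n" using euler_field(2)[OF i] weyl_partD(1) by blast
 have fw: "mon_field n 0 {} 0 \<in> weyl_ops n" using mon_field_weyl assms by auto
 show "mon_field n 0 {} 0 = (%f. pscale (-1) (euler_field n 1 (mon_field n 0 {} 0 f) -
   pscale (ksign False False) (mon_field n 0 {} 0 (euler_field n 1 f))))"
 proof (rule weyl_comm_eqI[OF weyl_plin[OF fw] ew fw fw])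
  fix l J assume J: "J <= {1..n}"
  have m: "mon_field n 0 {} 0 (bvec (l, J)) = pscale (of_int l) (bvec (l - 1, J))"
   using J by (simp add: mon_field_bvec)
  show "mon_field n 0 {} 0 (bvec (l, J)) = pscale (-1) (euler_field n 1 (mon_field n 0 {} 0 (bvec (l, J))) -
   pscale (ksign False False) (mon_field n 0 {} 0 (euler_field n 1 (bvec (l, J)))))"
   unfolding m plin_scale[OF weyl_plin[OF ew]] euler_field_bvec[OF i J] plin_scale[OF weyl_plin[OF fw]]
   by (simp add: euler_field_bvec[OF i J] ksign_def single_arith algebra_simps)
 qed
qed

text \<open>A second index \<open>j\<close> gives a diagonal field under whose bracket xi_i d/dt has
  the eigenvalue 1.\<close>

lemma S_prime_xi_der0:
 assumes "n \<ge> 2" "i \<in> {1..n}"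
 shows "mon_field n 0 {i} 0 \<in> carrier (S_prime n)"
proof -
 obtain j where j: "j \<in> {1..n}" "i ~= j"
  using that[of "if i = 1 then 2 else 1"] assms by (auto split: if_splits)
 show ?thesis
 proof (rule S_prime_commutator[of "diag_field n i j" n False "mon_field n 0 {i} 0" True _ 1])
  show "diag_field n i j \<in> div_free n False" "diag_field n i j \<in> part (weyl n) False"
   using diag_field[OF assms(2) j] .
  show "mon_field n 0 {i} 0 \<in> div_free n True" "mon_field n 0 {i} 0 \<in> part (weyl n) True"
   using mon_field_div_free[of "{i}" n 0 0] mon_field_part[of "{i}" n 0 0] assms by auto
  have ew: "diag_field n i j \<in> weyl_ops n" using diag_field(2)[OF assms(2) j] weyl_partD(1) by blast
  have fw: "mon_field n 0 {i} 0 \<in> weyl_ops n" using mon_field_weyl assms by auto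
  show "mon_field n 0 {i} 0 = (%f. pscale 1 (diag_field n i j (mon_field n 0 {i} 0 f) -
    pscale (ksign False True) (mon_field n 0 {i} 0 (diag_field n i j f))))"
  proof (rule weyl_comm_eqI[OF weyl_plin[OF fw] ew fw fw])
   fix l J assume J: "J <= {1..n}"
   let ?b = "bvec (l, J) :: laur"
   show "mon_field n 0 {i} 0 ?b = pscale 1 (diag_field n i j (mon_field n 0 {i} 0 ?b) -
    pscale (ksign False True) (mon_field n 0 {i} 0 (diag_field n i j ?b)))"
   proof (cases "i \<in> J")
    case True
    thus ?thesis using J
     unfolding diag_field_bvec[OF assms(2) j(1) J] plin_scale[OF weyl_plin[OF fw]]
     by (simp add: mon_field_bvec plin_zero[OF weyl_plin[OF ew]])
   next
    case False
    have s: "insert i J <= {1..n}" using assms J by auto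
    have m: "mon_field n 0 {i} 0 ?b = pscale (of_int l * (-1) ^ inversions {i} J) (bvec (l - 1, insert i J))"
     using J False by (simp add: mon_field_bvec)
    show ?thesis
     unfolding diag_field_bvec[OF assms(2) j(1) J] plin_scale[OF weyl_plin[OF fw]] m plin_scale[OF weyl_plin[OF ew]]
      diag_field_bvec[OF assms(2) j(1) s]
     using False j by (simp add: ksign_def single_arith algebra_simps)
   qed
  qed
 qed
qed

text \<open>The anticommutator of the odd fields t d/dxi_i and xi_i d/dt yields both summands: t
  d/dt by differentiating xi_i, and xi_i d/dxi_i by differentiating t.\<close>

lemma S_prime_euler_field:
 assumes "n \<ge> 2" "i \<in> {1..n}"
 shows "euler_field n i \<in> carrier (S_prime n)"
proof (rule S_prime_commutator[of "mon_field n 1 {} i" n True "mon_field n 0 {i} 0" True _ 1])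
 show "mon_field n 1 {} i \<in> div_free n True" "mon_field n 1 {} i \<in> part (weyl n) True"
  using mon_field_div_free[of "{}" n i 1] mon_field_part[of "{}" n i 1] assms by auto
 show "mon_field n 0 {i} 0 \<in> div_free n True" "mon_field n 0 {i} 0 \<in> part (weyl n) True"
  using mon_field_div_free[of "{i}" n 0 0] mon_field_part[of "{i}" n 0 0] assms by auto
 have ew: "euler_field n i \<in> weyl_ops n" using euler_field(2)[OF assms(2)] weyl_partD(1) by blast
 have fw: "mon_field n 0 {i} 0 \<in> weyl_ops n" "mon_field n 1 {} i \<in> weyl_ops n" using mon_field_weyl assms by auto
 show "euler_field n i = (%f. pscale 1 (mon_field n 1 {} i (mon_field n 0 {i} 0 f) -
   pscale (ksign True True) (mon_field n 0 {i} 0 (mon_field n 1 {} i f))))"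
 proof (rule weyl_comm_eqI[OF weyl_plin[OF ew] fw(2,1) ew])
  fix l J assume J: "J <= {1..n}"
  let ?b = "bvec (l, J) :: laur"
  have fJ: "finite J" using J finite_subset by auto
  show "euler_field n i ?b = pscale 1 (mon_field n 1 {} i (mon_field n 0 {i} 0 ?b) -
   pscale (ksign True True) (mon_field n 0 {i} 0 (mon_field n 1 {} i ?b)))"
  proof (cases "i \<in> J")
   case True
   have J': "J - {i} <= {1..n}" using J by auto
   have "inversions {i} J = inversions {i} (J - {i})"
    using True fJ inversions_remove(1)[of J "{i}" i] by auto
   thus ?thesis
    using True J J' assms
    by (simp add: mon_field_bvec euler_field_bvec[OF assms(2) J] mon_field_single single_arith
     plin_zero[OF weyl_plin[OF fw(2)]] ksign_def insert_absorb sign_conj add.commute)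
  next
   case False
   have J': "insert i J <= {1..n}" using J assms by auto
   have "inversions {i} (insert i J) = inversions {i} J"
    using False fJ inversions_remove(1)[of "insert i J" "{i}" i] by auto
   thus ?thesis
    using False J J' assms
    by (simp add: mon_field_bvec euler_field_bvec[OF assms(2) J] mon_field_single single_arith
     plin_zero[OF weyl_plin[OF fw(1)]] ksign_def mult.assoc power_add[symmetric] mult_2[symmetric])
  qed
 qed
qed

section \<open>Schur's lemma in countable dimension\<close>

definition poly_op :: "('a fv => 'a fv) => complex poly => 'a fv => 'a fv"
 where "poly_op \<Theta> f x = (\<Sum>i\<le>degree f. pscale (coeff f i) ((\<Theta> ^^ i) x))"

lemma poly_op_sup: "degree f \<le> N ==> poly_op \<Theta> f x = (\<Sum>i\<le>N. pscale (coeff f i) ((\<Theta> ^^ i) x))"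
 unfolding poly_op_def by (rule sum.mono_neutral_left) (auto simp: coeff_eq_0)

lemma poly_op_add: "poly_op \<Theta> (f + g) x = poly_op \<Theta> f x + poly_op \<Theta> g x"
 using degree_add_le_max[of f g]
 by (simp add: poly_op_sup[of _ "max (degree f) (degree g)"] pv.scale_left_distrib sum.distrib)

lemma poly_op_smult: "poly_op \<Theta> (Polynomial.smult c f) x = pscale c (poly_op \<Theta> f x)"
 by (simp add: poly_op_sup[of _ "degree f"] pv.scale_sum_right)

lemma poly_op_0 [simp]: "poly_op \<Theta> 0 x = 0"
 by (simp add: poly_op_def)

lemma poly_op_sum: "poly_op \<Theta> (\<Sum>a\<in>A. F a) x = (\<Sum>a\<in>A. poly_op \<Theta> (F a) x)"
 by (induction A rule: infinite_finite_induct) (auto simp: poly_op_add)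

context
 fixes \<Theta> :: "'a fv => 'a fv"
 assumes lin: "plin \<Theta>"
begin

lemma plin_funpow: "plin (\<Theta> ^^ i)"
 by (induction i) (auto simp: plin_id id_def o_def intro: plin_comp lin)

lemma plin_poly_op: "plin (poly_op \<Theta> f)"
 unfolding poly_op_def[abs_def] by (intro plin_sum_fun plin_pscale plin_funpow)

lemma poly_op_pCons: "poly_op \<Theta> (pCons a f) x = pscale a x + \<Theta> (poly_op \<Theta> f x)"
proof -
 have "poly_op \<Theta> (pCons a f) x = (\<Sum>i\<le>Suc (degree f). pscale (coeff (pCons a f) i) ((\<Theta> ^^ i) x))"
  by (rule poly_op_sup) (rule degree_pCons_le)
 also have "\<dots> = pscale a x + (\<Sum>i\<le>degree f. pscale (coeff f i) (\<Theta> ((\<Theta> ^^ i) x)))"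
  unfolding sum.atMost_Suc_shift by simp
 finally show ?thesis
  by (simp add: poly_op_def plin_sum[OF lin] plin_scale[OF lin])
qed

lemma poly_op_commute: "poly_op \<Theta> f (\<Theta> x) = \<Theta> (poly_op \<Theta> f x)"
 by (simp add: poly_op_def plin_sum[OF lin] plin_scale[OF lin] funpow_swap1)

lemma poly_op_linear_factor:
 "poly_op \<Theta> ([:-r, 1:] * f) x = \<Theta> (poly_op \<Theta> f x) - pscale r (poly_op \<Theta> f x)"
 "poly_op \<Theta> ([:-r, 1:] * f) x = poly_op \<Theta> f (\<Theta> x - pscale r x)"
proof -
 have "[:-r, 1:] * f = Polynomial.smult (-r) f + pCons 0 f" by simp
 thus 1: "poly_op \<Theta> ([:-r, 1:] * f) x = \<Theta> (poly_op \<Theta> f x) - pscale r (poly_op \<Theta> f x)"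
  by (simp only: poly_op_add poly_op_smult poly_op_pCons) simp
 show "poly_op \<Theta> ([:-r, 1:] * f) x = poly_op \<Theta> f (\<Theta> x - pscale r x)"
  unfolding 1 by (simp add: plin_diff[OF plin_poly_op] plin_scale[OF plin_poly_op] poly_op_commute)
qed

end

lemma subspace_image:
 assumes "plin F" "subsp W"
 shows "subsp (F ` W)"
proof (rule pv.subspaceI)
 show "0 \<in> F ` W"
  by (rule image_eqI[of _ _ 0]) (simp_all add: plin_zero[OF assms(1)] sub_0[OF assms(2)])
 fix x y c assume "x \<in> F ` W"
 then obtain u where u: "u \<in> W" "x = F u" by auto
 { assume "y \<in> F ` W"
  then obtain v where v: "v \<in> W" "y = F v" by auto
  show "x + y \<in> F ` W"
   by (rule image_eqI[of _ _ "u + v"]) (simp_all add: u v plin_add[OF assms(1)] sub_add[OF assms(2)]) }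
 show "pscale c x \<in> F ` W"
  by (rule image_eqI[of _ _ "pscale c u"]) (simp_all add: u plin_scale[OF assms(1)] sub_scale[OF assms(2)])
qed

text \<open>As \<open>q\<close> satisfies all relations of \<open>p\<close>, the rule
  \<open>T p \<mapsto> T q\<close> defines an endomorphism \<open>\<Theta>\<close> that commutes
  with \<open>K\<close>. If it is not scalar, each \<open>\<Theta> - c\<close> is bijective. The
  preimages of \<open>p\<close> under these maps, one for each of uncountably many \<open>c\<close>,
  are linearly dependent in countable dimension. Clearing denominators gives a nonzero polynomial in
  \<open>\<Theta>\<close> that kills \<open>p\<close>, which the linear factors of that polynomial
  exclude.\<close>

lemma schur_dixmier:
 fixes K :: "('a fv => 'a fv) set" and B :: "'a set"
 defines "P \<equiv> {f. supp f <= B}"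
 assumes B: "countable B"
  and lin: "!!T. T \<in> K ==> plin T"
  and into: "!!T f. T \<in> K ==> f \<in> P ==> T f \<in> P"
  and comp: "!!S T. S \<in> K ==> T \<in> K ==> (%f. S (T f)) \<in> K"
  and add: "!!S T. S \<in> K ==> T \<in> K ==> (%f. S f + T f) \<in> K"
  and sc: "!!T c. T \<in> K ==> (%f. pscale c (T f)) \<in> K"
  and one: "E \<in> K" "!!f. f \<in> P ==> E f = f"
  and simple: "!!W. subsp W ==> W <= P ==> (!!T w. T \<in> K ==> w \<in> W ==> T w \<in> W) ==> W = {0} | W = P"
  and p: "p \<in> P" "p ~= 0" and q: "q \<in> P"
  and rel: "!!T. T \<in> K ==> T p = 0 ==> T q = 0"
 shows "\<exists>c. q = pscale c p"
proof (rule ccontr)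
 assume nc: "\<nexists>c. q = pscale c p"
 have Psub: "subsp P" unfolding P_def by (rule subspace_supp)
 have zeroK: "(%f. 0) \<in> K" using sc[OF one(1), of 0] by simp
 have "subsp {T p |T. T \<in> K}"
 proof (rule pv.subspaceI)
  show "0 \<in> {T p |T. T \<in> K}" using zeroK by force
  show "x + y \<in> {T p |T. T \<in> K}" if "x \<in> {T p |T. T \<in> K}" "y \<in> {T p |T. T \<in> K}" for x y
   using that add by force
  show "pscale c x \<in> {T p |T. T \<in> K}" if "x \<in> {T p |T. T \<in> K}" for c x
   using that sc by force
 qed
 moreover have "{T p |T. T \<in> K} <= P" using into p by auto
 moreover have "S w \<in> {T p |T. T \<in> K}" if "S \<in> K" "w \<in> {T p |T. T \<in> K}" for S w
  using that comp by force
 moreover have "p \<in> {T p |T. T \<in> K}" using one(1) one(2)[OF p(1), symmetric] by blast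
 ultimately have Kp: "{T p |T. T \<in> K} = P" using simple[of "{T p |T. T \<in> K}"] p by auto
 have wd: "T q = T' q" if "T \<in> K" "T' \<in> K" "T p = T' p" for T T'
 proof -
  have "(%f. T f + pscale (-1) (T' f)) \<in> K" by (intro add sc that)
  from rel[OF this] that show ?thesis by simp
 qed
 \<comment> \<open>An operator carrying \<open>p\<close> to \<open>x\<close>; by \<open>wd\<close>
   the value of \<open>\<tau> x\<close> at \<open>q\<close> does not depend on the choice.\<close>
 define \<tau> where "\<tau> x = (SOME T. T \<in> K & T p = x)" for x
 have tau: "\<tau> x \<in> K" "\<tau> x p = x" if "x \<in> P" for x
 proof -
  have "\<exists>T. T \<in> K & T p = x" using that Kp by auto
  from someI_ex[OF this] show "\<tau> x \<in> K" "\<tau> x p = x" by (auto simp: \<tau>_def)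
 qed
 define \<Theta> where "\<Theta> = linext (%b. if b \<in> B then \<tau> (bvec b) q else 0)"
 have lT: "plin \<Theta>" by (simp add: \<Theta>_def)
 have bP: "bvec b \<in> P" if "b \<in> B" for b using that by (simp add: P_def)
 have Th: "\<Theta> (T p) = T q" if "T \<in> K" for T
 proof -
  let ?W = "{x \<in> P. \<exists>T\<in>K. T p = x & T q = \<Theta> x}"
  have "subsp ?W"
  proof (rule pv.subspaceI)
   show "0 \<in> ?W" using zeroK by (auto simp: plin_zero[OF lT] sub_0[OF Psub] intro!: bexI[of _ "%f. 0"])
   fix x y c assume "x \<in> ?W"
   then obtain T where T: "x \<in> P" "T \<in> K" "T p = x" "T q = \<Theta> x" by auto
   { assume "y \<in> ?W"
    then obtain S where "y \<in> P" "S \<in> K" "S p = y" "S q = \<Theta> y" by auto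
    with T show "x + y \<in> ?W" using add[of T S]
     by (auto simp: plin_add[OF lT] sub_add[OF Psub]) }
   show "pscale c x \<in> ?W" using T sc[of T c]
    by (auto simp: plin_scale[OF lT] sub_scale[OF Psub])
  qed
  moreover have "supp (T p) <= B" using into[OF that p(1)] by (simp add: P_def)
  moreover have "bvec b \<in> ?W" if b: "b \<in> B" for b
  proof -
   have "\<tau> (bvec b) q = \<Theta> (bvec b)" using b by (simp add: \<Theta>_def)
   thus ?thesis using bP[OF b] tau[OF bP[OF b]] by blast
  qed
  ultimately have "T p \<in> ?W" by (rule supp_induct)
  then obtain S where "S \<in> K" "S p = T p" "S q = \<Theta> (T p)" by auto
  thus ?thesis using wd[of T S] that by simp
 qed
 have ThP: "\<Theta> x \<in> P" if "x \<in> P" for x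
  using Th[OF tau(1)[OF that]] into[OF tau(1)[OF that] q] tau(2)[OF that] by simp
 have ThK: "\<Theta> (T x) = T (\<Theta> x)" if "T \<in> K" "x \<in> P" for T x
  using Th[OF comp[OF that(1) tau(1)[OF that(2)]]] Th[OF tau(1)[OF that(2)]] tau(2)[OF that(2)] by simp
 have Thp: "\<Theta> p = q" using Th[OF one(1)] one p q by simp
 \<comment> \<open>An eigenspace of \<open>\<Theta>\<close> is stable under \<open>K\<close>. It
   does not contain \<open>p\<close>, because \<open>\<Theta> p = q\<close> is not a multiple of
   \<open>p\<close>; hence it is zero.\<close>
 have inj0: "x = 0" if "x \<in> P" "\<Theta> x = pscale c x" for x c
 proof -
  let ?W = "{x \<in> P. \<Theta> x = pscale c x}"
  have "subsp ?W"
   by (rule pv.subspaceI)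
    (auto simp: plin_add[OF lT] plin_scale[OF lT] plin_zero[OF lT] sub_add[OF Psub]
     sub_scale[OF Psub] sub_0[OF Psub] pv.scale_right_distrib mult.commute)
  moreover have "T w \<in> ?W" if "T \<in> K" "w \<in> ?W" for T w
   using that ThK[OF that(1), of w] into[OF that(1), of w] plin_scale[OF lin[OF that(1)], of c w] by simp
  moreover have "p \<notin> ?W" using Thp nc by simp
  hence "?W ~= P" using p(1) by metis
  ultimately have "?W = {0}" using simple[of ?W] by blast
  thus ?thesis using that by blast
 qed
 \<comment> \<open>The range of \<open>\<Theta> - c\<close> is stable under \<open>K\<close> and
   nonzero, hence everything.\<close>
 have "\<exists>u\<in>P. \<Theta> u - pscale c u = p" for c
 proof -
  let ?R = "%u. \<Theta> u - pscale c u"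
  have lR: "plin ?R" by (intro plin_minus lT plin_pscale plin_id)
  let ?W = "?R ` P"
  have "subsp ?W" by (rule subspace_image[OF lR Psub])
  moreover have "?W <= P"
   by (intro image_subsetI sub_diff[OF Psub] sub_scale[OF Psub] ThP)
  moreover have "T w \<in> ?W" if T: "T \<in> K" "w \<in> ?W" for T w
  proof -
   obtain u where u: "u \<in> P" "w = ?R u" using T by auto
   hence "T w = ?R (T u)"
    using ThK[OF T(1) u(1)] by (simp add: plin_diff[OF lin[OF T(1)]] plin_scale[OF lin[OF T(1)]])
   thus ?thesis using into[OF T(1) u(1)] by auto
  qed
  moreover have "?W ~= {0}"
  proof
   assume "?W = {0}"
   hence "?R p = 0" using p by blast
   thus False using inj0[of p c] p by simp
  qed
  ultimately have "?W = P" using simple[of ?W] by blast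
  thus ?thesis using p(1) by (metis (no_types, lifting) imageE)
 qed
 then obtain u where u: "!!c. u c \<in> P" "!!c. \<Theta> (u c) - pscale c (u c) = p" by metis
 have pinj: "x = 0" if "f ~= 0" "x \<in> P" "poly_op \<Theta> f x = 0" for f x
  using that
 proof (induction "degree f" arbitrary: f)
  case 0
  then obtain a where "f = [:a:]" by (metis degree_eq_zeroE)
  with 0 show ?case by (auto simp: poly_op_def)
 next
  case (Suc k)
  have "~ constant (poly f)" using Suc.hyps(2) by (simp add: constant_degree)
  then obtain r where "poly f r = 0" using fundamental_theorem_of_algebra by blast
  then obtain g where g: "f = [:-r, 1:] * g" by (metis dvdE poly_eq_0_iff_dvd)
  have gP: "poly_op \<Theta> g x \<in> P"
  proof -
   have "(\<Theta> ^^ i) x \<in> P" for i by (induction i) (use Suc.prems ThP in auto)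
   thus ?thesis unfolding poly_op_def
    by (intro sub_sum[OF Psub] sub_scale[OF Psub])
  qed
  have "\<Theta> (poly_op \<Theta> g x) = pscale r (poly_op \<Theta> g x)"
   using Suc.prems(3) poly_op_linear_factor(1)[OF lT, of r g x] g by simp
  hence "poly_op \<Theta> g x = 0" using inj0 gP by blast
  moreover have "g ~= 0" using g Suc.prems(1) by auto
  moreover have "k = degree g"
   using Suc.hyps(2) g \<open>g ~= 0\<close> degree_mult_eq[of "[:-r, 1:]" g] by simp
  ultimately show ?case using Suc.hyps(1)[of g] Suc.prems(2) by blast
 qed
 have u_inj: "inj u"
 proof (rule injI, rule ccontr)
  fix c d assume e: "u c = u d" "c ~= d"
  have "pscale (c - d) (u c) = (\<Theta> (u d) - pscale d (u d)) - (\<Theta> (u c) - pscale c (u c))"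
   unfolding e(1) by (simp add: pv.scale_left_diff_distrib)
  also have "\<dots> = 0" unfolding u(2) by simp
  finally have "u c = 0" using e by simp
  thus False using u(2)[of c] p plin_zero[OF lT] by simp
 qed
 \<comment> \<open>There are uncountably many vectors \<open>u c\<close> but only countably many
   finite subsets of \<open>B\<close>, so infinitely many of the vectors have their support in one
   finite set \<open>F\<close>.\<close>
 have "\<exists>F. finite F & F <= B & infinite {c. supp (u c) <= F}"
 proof (rule ccontr)
  assume "~ ?thesis"
  hence "!!F. F \<in> {F. finite F & F <= B} ==> countable {c. supp (u c) <= F}"
   by (auto intro: countable_finite)
  moreover have "countable {F. finite F & F <= B}"
   using countable_Collect_finite_subset[OF B] .
  ultimately have "countable (\<Union>F\<in>{F. finite F & F <= B}. {c. supp (u c) <= F})"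
   by (intro countable_UN) auto
  moreover have "(\<Union>F\<in>{F. finite F & F <= B}. {c. supp (u c) <= F}) = UNIV"
  proof (rule sym, rule UNIV_eq_I)
   fix c
   have "supp (u c) \<in> {F. finite F & F <= B}" using u(1)[of c] by (simp add: P_def)
   thus "c \<in> (\<Union>F\<in>{F. finite F & F <= B}. {c. supp (u c) <= F})" by blast
  qed
  ultimately show False using uncountable_UNIV_complex by simp
 qed
 then obtain F where F: "finite F" "F <= B" "infinite {c. supp (u c) <= F}" by blast
 let ?U = "u ` {c. supp (u c) <= F}"
 have "infinite ?U" using F(3) u_inj by (simp add: finite_image_iff inj_on_def inj_def)
 moreover have "?U <= pv.span (bvec ` F)" using span_bvec by blast
 ultimately have "pv.dependent ?U"
  using pv.independent_span_bound[of "bvec ` F" ?U] F(1) by blast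
 then obtain t a where t: "finite t" "t <= ?U" "(\<Sum>v\<in>t. pscale (a v) v) = 0" "\<exists>v\<in>t. a v ~= 0"
  unfolding pv.dependent_explicit by blast
 define G where "G = u -` t"
 have uG: "u ` G = t" using t(2) by (auto simp: G_def)
 have fG: "finite G" unfolding G_def using finite_vimageI[OF t(1) u_inj] .
 define b where "b c = a (u c)" for c
 have s0: "(\<Sum>c\<in>G. pscale (b c) (u c)) = 0"
  using t(3) unfolding uG[symmetric] b_def
  by (subst (asm) sum.reindex) (use u_inj in "auto simp: inj_on_def inj_def")
 obtain c0 where c0: "c0 \<in> G" "b c0 ~= 0" using t(4) uG by (auto simp: b_def)
 \<comment> \<open>The common denominator: applying \<open>Q G\<close> to \<open>u c\<close> cancels
   the factor at \<open>c\<close> and leaves \<open>Q (G - {c})\<close> applied to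
   \<open>p\<close>.\<close>
 define Q where "Q A = (\<Prod>c\<in>A. [:-c, 1:])" for A :: "complex set"
 have "(\<Sum>c\<in>G. pscale (b c) (poly_op \<Theta> (Q G) (u c))) = poly_op \<Theta> (Q G) 0"
  unfolding s0[symmetric] plin_sum[OF plin_poly_op[OF lT]] plin_scale[OF plin_poly_op[OF lT]] ..
 also have "\<dots> = 0" by (rule plin_zero[OF plin_poly_op[OF lT]])
 also have "(\<Sum>c\<in>G. pscale (b c) (poly_op \<Theta> (Q G) (u c))) = (\<Sum>c\<in>G. poly_op \<Theta> (Polynomial.smult (b c) (Q (G - {c}))) p)"
 proof (rule sum.cong[OF refl])
  fix c assume "c \<in> G"
  hence "Q G = [:-c, 1:] * Q (G - {c})" using fG unfolding Q_def by (rule prod.remove[rotated])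
  thus "pscale (b c) (poly_op \<Theta> (Q G) (u c)) = poly_op \<Theta> (Polynomial.smult (b c) (Q (G - {c}))) p"
   by (simp only: poly_op_linear_factor(2)[OF lT] poly_op_smult u(2))
 qed
 finally have "poly_op \<Theta> (\<Sum>c\<in>G. Polynomial.smult (b c) (Q (G - {c}))) p = 0"
  by (simp add: poly_op_sum)
 \<comment> \<open>Evaluated at \<open>c0\<close>, every summand with \<open>c \<noteq> c0\<close>
   vanishes because it contains the factor of \<open>c0\<close>.\<close>
 moreover have "(\<Sum>c\<in>G. Polynomial.smult (b c) (Q (G - {c}))) ~= 0"
 proof
  assume "(\<Sum>c\<in>G. Polynomial.smult (b c) (Q (G - {c}))) = 0"
  hence "0 = poly (\<Sum>c\<in>G. Polynomial.smult (b c) (Q (G - {c}))) c0" by simp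
  also have "\<dots> = (\<Sum>c\<in>G. b c * (\<Prod>d\<in>G - {c}. c0 - d))"
   by (simp add: poly_sum Q_def poly_prod)
  also have "\<dots> = (\<Sum>c\<in>{c0}. b c * (\<Prod>d\<in>G - {c}. c0 - d))"
   using fG c0 by (intro sum.mono_neutral_right) (auto simp: prod_zero_iff)
  finally have "b c0 * (\<Prod>d\<in>G - {c0}. c0 - d) = 0" by simp
  thus False using c0 fG by (auto simp: prod_zero_iff)
 qed
 ultimately show False using pinj[of _ p] p by blast
qed

section \<open>Graded modules in coordinates\<close>

text \<open>The grading as an involution: graded subspaces are those stable under it, and Koszul
  signs are expressed by composing with it.\<close>

definition parity_op :: "('v => bool) => 'v fv => 'v fv"
 where "parity_op d = linext (%b. if d b then - bvec b else bvec b)"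

lemma plin_parity_op [simp]: "plin (parity_op d)"
 by (simp add: parity_op_def)

lemma parity_op_bvec: "parity_op d (bvec b) = (if d b then - bvec b else bvec b)"
 by (simp add: parity_op_def)

lemma parity_op_hom: "supp f <= {b. d b = p} ==> parity_op d f = (if p then - f else f)"
proof (rule plin_eqI[of "parity_op d" "%f. if p then - f else f"])
 show "plin (%f. if p then - f else f :: 'a \<Rightarrow>\<^sub>0 complex)"
  by (rule plinI) auto
qed (auto simp: parity_op_bvec)

lemma parity_op_parity_op [simp]: "parity_op d (parity_op d f) = f"
proof -
 have "(%f. parity_op d (parity_op d f)) = (%f. f)"
  by (rule plin_ext) (auto simp: parity_op_bvec plin_neg intro: plin_comp plin_id)
 thus ?thesis by (rule fun_cong)
qed

lemma supp_parity_op: "supp f <= B ==> supp (parity_op d f) <= B"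
 using supp_image[OF plin_parity_op subspace_supp, of f B d B] by (auto simp: parity_op_bvec)

lemma parity_decomp:
 assumes "supp f <= B"
 obtains f0 f1 where "f = f0 + f1" "supp f0 <= {b \<in> B. ~ d b}" "supp f1 <= {b \<in> B. d b}"
  "f0 = pscale (1/2) (f + parity_op d f)" "f1 = pscale (1/2) (f - parity_op d f)"
proof
 let ?f0 = "pscale (1/2) (f + parity_op d f)" and ?f1 = "pscale (1/2) (f - parity_op d f)"
 show "f = ?f0 + ?f1"
  by (rule poly_mapping_eqI) (simp add: lookup_add lookup_minus add_divide_distrib diff_divide_distrib)
 have "?f0 \<in> {g. supp g <= {b \<in> B. ~ d b}}"
  by (rule supp_image[OF _ subspace_supp assms])
    (auto simp: parity_op_bvec single_arith plin_id intro!: plin_pscale plin_plus)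
 thus "supp ?f0 <= {b \<in> B. ~ d b}" by simp
 have "?f1 \<in> {g. supp g <= {b \<in> B. d b}}"
  by (rule supp_image[OF _ subspace_supp assms])
    (auto simp: parity_op_bvec single_arith plin_id intro!: plin_pscale plin_minus)
 thus "supp ?f1 <= {b \<in> B. d b}" by simp
qed auto

text \<open>Coordinates \<open>kap\<close> in a homogeneous basis \<open>B\<close> turn the module
  into the subspace \<open>V\<close> of a free vector space. The action becomes \<open>opr\<close>,
  extended by zero outside \<open>B\<close> so that it is linear on the whole type.\<close>

locale graded_coordinates =
 fixes A :: "'a super_space" and M :: "('a, 'v) super_module" and B :: "'v set"
  and kap :: "'v => 'v \<Rightarrow>\<^sub>0 complex"
 assumes ga: "graded_action A M"
  and bij: "bij_betw kap (carrier M) {f. supp f <= B}"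
  and k_add: "!!x y. x \<in> carrier M ==> y \<in> carrier M ==> kap (x \<oplus>\<^bsub>M\<^esub> y) = kap x + kap y"
  and k_scale: "!!c x. x \<in> carrier M ==> kap (c \<odot>\<^bsub>M\<^esub> x) = pscale c (kap x)"
  and k_basis: "!!b. b \<in> B ==> kap b = bvec b"
  and k_part: "!!p. kap ` part M p = {f. supp f <= B Int part M p}"
  and B_part: "B <= part M False Un part M True" "B Int part M False Int part M True = {}"
begin

definition "V = {f. supp f <= B}"
definition "d b \<longleftrightarrow> b \<in> part M True"
definition "inv_k = the_inv_into (carrier M) kap"
definition "opr a = linext (%b. if b \<in> B then kap (act M a b) else 0)"

lemma ss: "super_space M" using ga by (simp add: graded_action_def)

lemma module: "Module.module complex_field M" using super_spaceD[OF ss] by simp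

lemma M_closed: "x \<in> carrier M ==> y \<in> carrier M ==> x \<oplus>\<^bsub>M\<^esub> y \<in> carrier M"
 "x \<in> carrier M ==> c \<odot>\<^bsub>M\<^esub> x \<in> carrier M" "\<zero>\<^bsub>M\<^esub> \<in> carrier M"
proof -
 interpret Module.module complex_field M by (rule module)
 show "x \<in> carrier M ==> y \<in> carrier M ==> x \<oplus>\<^bsub>M\<^esub> y \<in> carrier M"
  "x \<in> carrier M ==> c \<odot>\<^bsub>M\<^esub> x \<in> carrier M" "\<zero>\<^bsub>M\<^esub> \<in> carrier M" by auto
qed

lemma act_closed: "a \<in> carrier A ==> x \<in> carrier M ==> act M a x \<in> carrier M"
 using ga by (simp add: graded_action_def)

lemma part_B: "b \<in> B ==> b \<in> part M p \<longleftrightarrow> d b = p"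
 using B_part by (cases p) (auto simp: d_def)

lemma B_M: "B <= carrier M"
 using B_part(1) super_space_part_sub[OF ss] by blast

lemma part_V: "kap ` part M p = {f. supp f <= {b \<in> B. d b = p}}"
proof -
 have "B Int part M p = {b \<in> B. d b = p}" using part_B by auto
 thus ?thesis unfolding k_part by simp
qed

lemma k_V: "x \<in> carrier M ==> kap x \<in> V"
 using bij by (auto simp: bij_betw_def V_def)

lemma inv_k: "f \<in> V ==> inv_k f \<in> carrier M" "f \<in> V ==> kap (inv_k f) = f"
 "x \<in> carrier M ==> inv_k (kap x) = x"
 using bij_betw_the_inv_into[OF bij] f_the_inv_into_f_bij_betw[OF bij, of f] the_inv_into_f_f[of kap "carrier M" x] bij
 by (auto simp: inv_k_def V_def bij_betw_def)

lemma k_inj: "x \<in> carrier M ==> y \<in> carrier M ==> kap x = kap y ==> x = y"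
 using inv_k(3) by metis

lemma V_sub: "subsp V" unfolding V_def by (rule subspace_supp)

lemma k_zero: "kap \<zero>\<^bsub>M\<^esub> = 0"
proof -
 interpret Module.module complex_field M by (rule module)
 show ?thesis using k_add[of "\<zero>\<^bsub>M\<^esub>" "\<zero>\<^bsub>M\<^esub>"] by simp
qed

lemma V_induct:
 assumes "x \<in> carrier M" "!!b. b \<in> B ==> Q b" "Q \<zero>\<^bsub>M\<^esub>"
  "!!x y. x \<in> carrier M ==> y \<in> carrier M ==> Q x ==> Q y ==> Q (x \<oplus>\<^bsub>M\<^esub> y)"
  "!!c x. x \<in> carrier M ==> Q x ==> Q (c \<odot>\<^bsub>M\<^esub> x)"
 shows "Q x"
proof -
 let ?W = "kap ` {x \<in> carrier M. Q x}"
 have "subsp ?W"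
 proof (rule pv.subspaceI)
  show "0 \<in> ?W" using k_zero assms(3) M_closed by force
  fix x y c assume "x \<in> ?W"
  then obtain u where u: "u \<in> carrier M" "Q u" "x = kap u" by auto
  { assume "y \<in> ?W"
   then obtain v where "v \<in> carrier M" "Q v" "y = kap v" by auto
   with u show "x + y \<in> ?W" using k_add[of u v] assms(4)[of u v] M_closed(1)[of u v] by force }
  show "pscale c x \<in> ?W" using u k_scale[of u c] assms(5)[of u c] M_closed(2)[of u c] by force
 qed
 moreover have "supp (kap x) <= B" using k_V assms(1) by (simp add: V_def)
 ultimately have "kap x \<in> ?W"
  by (rule supp_induct) (use k_basis assms(2) B_M in force)
 thus ?thesis using k_inj assms(1) by auto
qed

lemma opr_plin [simp]: "plin (opr a)" by (simp add: opr_def)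

lemma opr_k:
 assumes "a \<in> carrier A" "x \<in> carrier M"
 shows "opr a (kap x) = kap (act M a x)"
 using assms(2)
proof (rule V_induct)
 show "opr a (kap b) = kap (act M a b)" if "b \<in> B" for b
  using that by (simp add: k_basis opr_def)
 have z: "act M a \<zero>\<^bsub>M\<^esub> = \<zero>\<^bsub>M\<^esub>"
 proof -
  have "act M a (0 \<odot>\<^bsub>M\<^esub> \<zero>\<^bsub>M\<^esub>) = 0 \<odot>\<^bsub>M\<^esub> act M a \<zero>\<^bsub>M\<^esub>"
   using ga assms M_closed unfolding graded_action_def by blast
  thus ?thesis using complex_module(6,7)[OF module] act_closed[OF assms(1) M_closed(3)] by simp
 qed
 show "opr a (kap \<zero>\<^bsub>M\<^esub>) = kap (act M a \<zero>\<^bsub>M\<^esub>)" by (simp add: z k_zero plin_zero)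
 show "opr a (kap (x \<oplus>\<^bsub>M\<^esub> y)) = kap (act M a (x \<oplus>\<^bsub>M\<^esub> y))"
  if "x \<in> carrier M" "y \<in> carrier M" "opr a (kap x) = kap (act M a x)" "opr a (kap y) = kap (act M a y)" for x y
 proof -
  have "act M a (x \<oplus>\<^bsub>M\<^esub> y) = act M a x \<oplus>\<^bsub>M\<^esub> act M a y"
   using ga that assms unfolding graded_action_def by blast
  thus ?thesis using that assms by (simp add: k_add act_closed plin_add)
 qed
 show "opr a (kap (c \<odot>\<^bsub>M\<^esub> x)) = kap (act M a (c \<odot>\<^bsub>M\<^esub> x))"
  if "x \<in> carrier M" "opr a (kap x) = kap (act M a x)" for c x
 proof -
  have "act M a (c \<odot>\<^bsub>M\<^esub> x) = c \<odot>\<^bsub>M\<^esub> act M a x"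
   using ga that assms unfolding graded_action_def by blast
  thus ?thesis using that assms by (simp add: k_scale act_closed plin_scale)
 qed
qed

lemma opr_inv: "a \<in> carrier A ==> f \<in> V ==> opr a f = kap (act M a (inv_k f))"
 using opr_k[of a "inv_k f"] inv_k by simp

lemma opr_V: "a \<in> carrier A ==> f \<in> V ==> opr a f \<in> V"
 using opr_inv inv_k(1) act_closed k_V by simp

lemma opr_add: "a \<in> carrier A ==> a' \<in> carrier A ==> a \<oplus>\<^bsub>A\<^esub> a' \<in> carrier A ==> f \<in> V ==>
  opr (a \<oplus>\<^bsub>A\<^esub> a') f = opr a f + opr a' f"
proof -
 assume a: "a \<in> carrier A" "a' \<in> carrier A" "a \<oplus>\<^bsub>A\<^esub> a' \<in> carrier A" "f \<in> V"
 have "act M (a \<oplus>\<^bsub>A\<^esub> a') (inv_k f) = act M a (inv_k f) \<oplus>\<^bsub>M\<^esub> act M a' (inv_k f)"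
  using ga a inv_k(1) unfolding graded_action_def by blast
 thus ?thesis using a by (simp add: opr_inv k_add inv_k act_closed)
qed

lemma opr_scale: "a \<in> carrier A ==> c \<odot>\<^bsub>A\<^esub> a \<in> carrier A ==> f \<in> V ==>
  opr (c \<odot>\<^bsub>A\<^esub> a) f = pscale c (opr a f)"
proof -
 assume a: "a \<in> carrier A" "c \<odot>\<^bsub>A\<^esub> a \<in> carrier A" "f \<in> V"
 have "act M (c \<odot>\<^bsub>A\<^esub> a) (inv_k f) = c \<odot>\<^bsub>M\<^esub> act M a (inv_k f)"
  using ga a inv_k(1) unfolding graded_action_def by blast
 thus ?thesis using a by (simp add: opr_inv k_scale inv_k act_closed)
qed

lemma opr_parity:
 assumes "a \<in> part A p" "a \<in> carrier A" "supp f <= {b \<in> B. d b = q}"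
 shows "supp (opr a f) <= {b \<in> B. d b = (p ~= q)}"
proof -
 obtain x where x: "x \<in> part M q" "f = kap x" using part_V[of q] assms(3) by blast
 have "x \<in> carrier M" using x super_space_part_sub[OF ss] by blast
 moreover have "act M a x \<in> part M (p ~= q)" using ga x assms(1) unfolding graded_action_def by blast
 ultimately have "opr a f \<in> kap ` part M (p ~= q)" using x opr_k[OF assms(2)] by auto
 thus ?thesis unfolding part_V by simp
qed

lemma parity_op_component:
 assumes "x \<in> carrier M"
 shows "kap (component M p x) = pscale (1/2) (kap x + pscale (if p then -1 else 1) (parity_op d (kap x)))"
proof -
 obtain a b where ab: "a \<in> part M False" "b \<in> part M (~ False)" "x = a \<oplus>\<^bsub>M\<^esub> b"
  "component M False x = a" "component M (~ False) x = b"
  using super_space_decomp[OF ss assms, of False] by metis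
 have "a \<in> carrier M" "b \<in> carrier M" using ab super_space_part_sub[OF ss] by blast+
 hence k: "kap x = kap a + kap b" using ab k_add by simp
 have "kap a \<in> kap ` part M False" "kap b \<in> kap ` part M True" using ab by auto
 hence "supp (kap a) <= {b. d b = False}" "supp (kap b) <= {b. d b = True}" unfolding part_V by auto
 hence "parity_op d (kap x) = kap a - kap b"
  unfolding k plin_add[OF plin_parity_op] using parity_op_hom[of "kap a" d False] parity_op_hom[of "kap b" d True] by simp
 thus ?thesis
  using ab k by (cases p) (auto intro!: poly_mapping_eqI simp: lookup_add lookup_minus)
qed

text \<open>Stability under the parity operator is what makes the preimage of \<open>W\<close>
  closed under components, hence a graded submodule.\<close>

lemma simple_V:
 assumes "simple_supermodule A M" "subsp W" "W <= V"
  and "!!w. w \<in> W ==> parity_op d w \<in> W" "!!a w. a \<in> carrier A ==> w \<in> W ==> opr a w \<in> W"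
 shows "W = {0} | W = V"
proof -
 let ?N = "{x \<in> carrier M. kap x \<in> W}"
 have "sub_supermodule A M ?N"
  unfolding sub_supermodule_def submodule_iff[OF module]
 proof (intro conjI ballI allI)
  show "?N <= carrier M" by auto
  show "\<zero>\<^bsub>M\<^esub> \<in> ?N" using k_zero sub_0[OF assms(2)] M_closed by simp
  fix x assume x: "x \<in> ?N"
  thus "c \<odot>\<^bsub>M\<^esub> x \<in> ?N" for c using k_scale sub_scale[OF assms(2)] M_closed by simp
  show "x \<oplus>\<^bsub>M\<^esub> y \<in> ?N" if "y \<in> ?N" for y
   using x that k_add sub_add[OF assms(2)] M_closed by simp
  show "act M a x \<in> ?N" if "a \<in> carrier A" for a
   using x that assms(5)[of a "kap x"] opr_k act_closed by simp
  fix p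
  obtain a b where "a \<in> part M p" "component M p x = a"
   using super_space_decomp[OF ss, of x p] x by blast
  hence "component M p x \<in> carrier M" using super_space_part_sub[OF ss] by blast
  moreover have "kap (component M p x) \<in> W"
   using x assms(4) by (simp only: parity_op_component mem_Collect_eq)
    (intro sub_scale[OF assms(2)] sub_add[OF assms(2)]; blast)
  ultimately show "component M p x \<in> ?N" by simp
 qed
 hence N: "?N = {\<zero>\<^bsub>M\<^esub>} | ?N = carrier M" using assms(1) by (simp add: simple_supermodule_def)
 have W: "W = kap ` ?N"
 proof
  show "W <= kap ` ?N"
  proof
   fix w assume w: "w \<in> W"
   hence wV: "w \<in> V" using assms(3) by blast
   have "inv_k w \<in> ?N" using inv_k(1,2)[OF wV] w by simp
   hence "kap (inv_k w) \<in> kap ` ?N" by (rule imageI)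
   thus "w \<in> kap ` ?N" unfolding inv_k(2)[OF wV] .
  qed
 qed auto
 have "V = kap ` carrier M" using bij by (simp add: bij_betw_def V_def)
 thus ?thesis using N W k_zero by (elim disjE) simp_all
qed

lemma V_nonzero: "simple_supermodule A M ==> V ~= {0}"
proof
 assume s: "simple_supermodule A M" and V: "V = {0}"
 have "x = \<zero>\<^bsub>M\<^esub>" if "x \<in> carrier M" for x
 proof (rule k_inj[OF that M_closed(3)])
  show "kap x = kap \<zero>\<^bsub>M\<^esub>" using k_V[OF that] unfolding V k_zero by simp
 qed
 hence "carrier M = {\<zero>\<^bsub>M\<^esub>}" using M_closed(3) by blast
 thus False using s by (simp add: simple_supermodule_def)
qed

end

section \<open>The Lie superalgebra sl(1,n)\<close>

lemma mat_alg_simps [simp]: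
 "A \<otimes>\<^bsub>mat_alg n\<^esub> B = (%i j. \<Sum>k\<le>n. A i k * B k j)" "\<zero>\<^bsub>mat_alg n\<^esub> = (%i j. 0)"
 "A \<oplus>\<^bsub>mat_alg n\<^esub> B = (%i j. A i j + B i j)" "c \<odot>\<^bsub>mat_alg n\<^esub> A = (%i j. c * A i j)"
 by (simp_all add: mat_alg_def)

lemma mat_alg_carrier: "A \<in> carrier (mat_alg n) \<longleftrightarrow> (\<forall>i j. A i j ~= 0 --> i \<le> n & j \<le> n)"
 by (simp add: mat_alg_def)

lemma mat_alg_part: "A \<in> part (mat_alg n) p \<longleftrightarrow> (\<forall>i j. A i j ~= 0 --> i \<le> n & j \<le> n & ((i = 0) ~= (j = 0)) = p)"
 by (simp add: mat_alg_def)

definition mat_part :: "bool => mat => mat"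
 where "mat_part p A = (%i j. if ((i = 0) ~= (j = 0)) = p then A i j else 0)"

lemma sl_simps [simp]:
 "\<zero>\<^bsub>sl n\<^esub> = (%i j. 0)" "A \<oplus>\<^bsub>sl n\<^esub> B = (%i j. A i j + B i j)" "c \<odot>\<^bsub>sl n\<^esub> A = (%i j. c * A i j)"
 "A \<otimes>\<^bsub>sl n\<^esub> B = supercommutator (mat_alg n) A B" "part (sl n) p = part (mat_alg n) p Int slc n"
 by (simp_all add: sl_def lie_sub_def)

lemma sl_carrier: "A \<in> slc n \<longleftrightarrow> A \<in> carrier (mat_alg n) & A 0 0 = (\<Sum>i\<in>{1..n}. A i i)"
 by (simp add: sl_def gl_def lie_sub_def)

lemma sl_closed:
 "A \<in> slc n ==> B \<in> slc n ==> (%i j. A i j + B i j) \<in> slc n"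
 "A \<in> slc n ==> (%i j. c * A i j) \<in> slc n"
 "(%i j. 0) \<in> slc n"
proof -
 show "(%i j. A i j + B i j) \<in> slc n" if "A \<in> slc n" "B \<in> slc n"
  using that by (auto simp: sl_carrier mat_alg_carrier sum.distrib) (metis add_0)+
qed (auto simp: sl_carrier mat_alg_carrier sum_distrib_left)

lemma component_mat_aux:
 assumes "!!p. mat_part p A \<in> S p" "!!p X. X \<in> S p ==> mat_part p X = X"
 shows "(THE a. a \<in> S p & (\<exists>b\<in>S (~ p). A = (%i j. a i j + b i j))) = mat_part p A"
proof (rule the_equality)
 show "mat_part p A \<in> S p & (\<exists>b\<in>S (~ p). A = (%i j. mat_part p A i j + b i j))"
 proof (intro conjI bexI[of _ "mat_part (~ p) A"])
  show "A = (%i j. mat_part p A i j + mat_part (~ p) A i j)"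
   by (intro ext) (auto simp: mat_part_def)
 qed (rule assms(1))+
 fix a assume "a \<in> S p & (\<exists>b\<in>S (~ p). A = (%i j. a i j + b i j))"
 then obtain b where b: "a \<in> S p" "b \<in> S (~ p)" "A = (%i j. a i j + b i j)" by auto
 have "a = mat_part p a" "b = mat_part (~ p) b" using assms(2) b by auto
 hence "a i j = (if ((i = 0) ~= (j = 0)) = p then a i j else 0)"
  "b i j = (if ((i = 0) ~= (j = 0)) = (~ p) then b i j else 0)" for i j
  by (metis mat_part_def)+
 thus "a = mat_part p A" unfolding b(3) mat_part_def
  by (intro ext) (metis (full_types) add.right_neutral)
qed

lemma mat_part_fix: "X \<in> part (mat_alg n) p ==> mat_part p X = X"
 by (auto simp: mat_alg_part mat_part_def fun_eq_iff)

lemma mat_part_other: "X \<in> part (mat_alg n) p ==> mat_part q X = (if q = p then X else (%i j. 0))"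
 by (auto simp: mat_alg_part mat_part_def fun_eq_iff)

lemma mat_part_mem: "A \<in> carrier (mat_alg n) ==> mat_part p A \<in> part (mat_alg n) p"
 by (auto simp: mat_alg_part mat_part_def mat_alg_carrier)

lemma mat_part_sl: "A \<in> slc n ==> mat_part p A \<in> slc n"
 by (cases p) (auto simp: sl_carrier mat_part_def mat_alg_carrier)

lemma component_mat: "A \<in> carrier (mat_alg n) ==> component (mat_alg n) p A = mat_part p A"
 unfolding component_def mat_alg_simps
 by (rule component_mat_aux) (auto simp: mat_part_mem mat_part_fix)

lemma component_sl:
 assumes "A \<in> slc n"
 shows "component (sl n) p A = mat_part p A"
 unfolding component_def sl_simps
proof (rule component_mat_aux)
 show "mat_part p A \<in> part (mat_alg n) p Int slc n" for p
  using assms mat_part_mem[of A n p] mat_part_sl[OF assms, of p] by (simp add: sl_carrier[of A])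
qed (auto intro: mat_part_fix)

lemma abelian_monoid_mat: "abelian_monoid (mat_alg n)"
 by (rule abelian_monoidI) (auto simp: mat_alg_carrier algebra_simps, (metis add_0)+)

lemma bracket_sl:
 assumes "A \<in> part (sl n) p" "B \<in> part (sl n) q"
 shows "A \<otimes>\<^bsub>sl n\<^esub> B = (%i j. (\<Sum>k\<le>n. A i k * B k j) - ksign p q * (\<Sum>k\<le>n. B i k * A k j))"
proof -
 have AB: "A \<in> carrier (mat_alg n)" "B \<in> carrier (mat_alg n)" using assms by (auto simp: sl_carrier)
 have cl: "(%i j. \<Sum>k\<le>n. X i k * Y k j) \<in> carrier (mat_alg n)"
  if "X \<in> carrier (mat_alg n)" "Y \<in> carrier (mat_alg n)" for X Y
  unfolding mat_alg_carrier
 proof (intro allI impI)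
  fix i j assume "(\<Sum>k\<le>n. X i k * Y k j) ~= 0"
  then obtain k where "X i k * Y k j ~= 0" by (meson sum.neutral)
  thus "i \<le> n & j \<le> n" using that by (auto simp: mat_alg_carrier)
 qed
 have "supercommutator (mat_alg n) A B =
  (A \<otimes>\<^bsub>mat_alg n\<^esub> B) \<oplus>\<^bsub>mat_alg n\<^esub> (- ksign p q) \<odot>\<^bsub>mat_alg n\<^esub> (B \<otimes>\<^bsub>mat_alg n\<^esub> A)"
 proof (rule supercommutator_homogeneous[OF abelian_monoid_mat])
  show "component (mat_alg n) r A = (if r = p then A else \<zero>\<^bsub>mat_alg n\<^esub>)" for r
   using component_mat[OF AB(1), of r] mat_part_other[of A n p r] assms by simp
  show "component (mat_alg n) r B = (if r = q then B else \<zero>\<^bsub>mat_alg n\<^esub>)" for r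
   using component_mat[OF AB(2), of r] mat_part_other[of B n q r] assms by simp
  show "c \<odot>\<^bsub>mat_alg n\<^esub> x \<in> carrier (mat_alg n)" if "x \<in> carrier (mat_alg n)" for c x
   using that by (auto simp: mat_alg_carrier)
 qed (use AB cl in auto)
 thus ?thesis by simp
qed

definition Emat :: "nat => nat => mat"
 where "Emat i j = (%a b. if a = i & b = j then 1 else 0)"

text \<open>\<open>Gmat i j\<close> is the image of the matrix unit under \<open>\<sigma>\<close>.\<close>

definition Gmat :: "nat => nat => mat"
 where "Gmat i j = (%a b. Emat i j a b + (if i = j then Emat 0 0 a b else 0))"

lemma Emat_mult:
 "(\<Sum>k\<le>n. Emat i j a k * F k) = (if a = i & j \<le> n then F j else 0)"
 "(\<Sum>k\<le>n. F k * Emat i j k b) = (if b = j & i \<le> n then F i else 0)"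
proof -
 have "(\<Sum>k\<le>n. Emat i j a k * F k) = (\<Sum>k\<le>n. if k = j then (if a = i then F k else 0) else 0)"
  by (intro sum.cong) (auto simp: Emat_def)
 thus "(\<Sum>k\<le>n. Emat i j a k * F k) = (if a = i & j \<le> n then F j else 0)" by simp
 have "(\<Sum>k\<le>n. F k * Emat i j k b) = (\<Sum>k\<le>n. if k = i then (if b = j then F k else 0) else 0)"
  by (intro sum.cong) (auto simp: Emat_def)
 thus "(\<Sum>k\<le>n. F k * Emat i j k b) = (if b = j & i \<le> n then F i else 0)" by simp
qed

lemma Gmat_mult:
 "(\<Sum>k\<le>n. Gmat i j a k * F k) = (if a = i & j \<le> n then F j else 0) + (if i = j & a = 0 then F 0 else 0)"
 "(\<Sum>k\<le>n. F k * Gmat i j k b) = (if b = j & i \<le> n then F i else 0) + (if i = j & b = 0 then F 0 else 0)"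
 by (cases "i = j"; simp add: Gmat_def distrib_left distrib_right sum.distrib Emat_mult)+

lemma sl_gens:
 assumes "i \<in> {1..n}" "j \<in> {1..n}"
 shows "Emat 0 i \<in> part (sl n) True" "Emat i 0 \<in> part (sl n) True" "Gmat i j \<in> part (sl n) False"
proof -
 show "Emat 0 i \<in> part (sl n) True" "Emat i 0 \<in> part (sl n) True"
  using assms by (auto simp: sl_carrier mat_alg_carrier mat_alg_part Emat_def intro!: sum.neutral)
 have "(\<Sum>k = 1..n. Gmat i j k k) = (\<Sum>k = 1..n. if k = i then (if i = j then 1 else 0) else 0)"
  by (intro sum.cong) (auto simp: Gmat_def Emat_def)
 also have "\<dots> = Gmat i j 0 0" using assms by (auto simp: Gmat_def Emat_def)
 finally show "Gmat i j \<in> part (sl n) False"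
  using assms by (auto simp: sl_carrier mat_alg_carrier mat_alg_part Gmat_def Emat_def split: if_splits)
qed

lemma sl_brackets:
 assumes "i \<in> {1..n}" "j \<in> {1..n}" "k \<in> {1..n}" "l \<in> {1..n}"
 shows "Emat 0 i \<otimes>\<^bsub>sl n\<^esub> Emat 0 j = (%a b. 0)"
  "Emat i 0 \<otimes>\<^bsub>sl n\<^esub> Emat j 0 = (%a b. 0)"
  "Emat k 0 \<otimes>\<^bsub>sl n\<^esub> Emat 0 i = Gmat k i"
  "Gmat l i \<otimes>\<^bsub>sl n\<^esub> Emat 0 j = (%a b. of_bool (l = i) * Emat 0 j a b + (- of_bool (j = l)) * Emat 0 i a b)"
  "Gmat l i \<otimes>\<^bsub>sl n\<^esub> Emat k 0 = (%a b. of_bool (i = k) * Emat l 0 a b + (- of_bool (l = i)) * Emat k 0 a b)"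
  "Gmat i j \<otimes>\<^bsub>sl n\<^esub> Gmat k l = (%a b. of_bool (j = k) * Gmat i l a b + (- of_bool (l = i)) * Gmat k j a b)"
proof -
 note b = bracket_sl[OF sl_gens(1)[OF assms(1,1)] sl_gens(1)[OF assms(2,2)]]
  bracket_sl[OF sl_gens(2)[OF assms(1,1)] sl_gens(2)[OF assms(2,2)]]
  bracket_sl[OF sl_gens(2)[OF assms(3,3)] sl_gens(1)[OF assms(1,1)]]
  bracket_sl[OF sl_gens(3)[OF assms(4,1)] sl_gens(1)[OF assms(2,2)]]
  bracket_sl[OF sl_gens(3)[OF assms(4,1)] sl_gens(2)[OF assms(3,3)]]
  bracket_sl[OF sl_gens(3)[OF assms(1,2)] sl_gens(3)[OF assms(3,4)]]
 have le: "i \<le> n" "j \<le> n" "k \<le> n" "l \<le> n" "i ~= 0" "j ~= 0" "k ~= 0" "l ~= 0" using assms by auto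
 show "Emat 0 i \<otimes>\<^bsub>sl n\<^esub> Emat 0 j = (%a b. 0)"
  unfolding b(1) by (intro ext, simp only: Emat_mult ksign_def, simp add: Emat_def le)
 show "Emat i 0 \<otimes>\<^bsub>sl n\<^esub> Emat j 0 = (%a b. 0)"
  unfolding b(2) by (intro ext, simp only: Emat_mult ksign_def, simp add: Emat_def le)
 show "Emat k 0 \<otimes>\<^bsub>sl n\<^esub> Emat 0 i = Gmat k i"
  unfolding b(3) by (intro ext, simp only: Emat_mult ksign_def, simp add: Emat_def Gmat_def le)
 show "Gmat l i \<otimes>\<^bsub>sl n\<^esub> Emat 0 j = (%a b. of_bool (l = i) * Emat 0 j a b + (- of_bool (j = l)) * Emat 0 i a b)"
  unfolding b(4) by (intro ext, simp only: Emat_mult Gmat_mult ksign_def, simp add: Emat_def Gmat_def le)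
 show "Gmat l i \<otimes>\<^bsub>sl n\<^esub> Emat k 0 = (%a b. of_bool (i = k) * Emat l 0 a b + (- of_bool (l = i)) * Emat k 0 a b)"
  unfolding b(5) by (intro ext, simp only: Emat_mult Gmat_mult ksign_def, simp add: Emat_def Gmat_def le)
 show "Gmat i j \<otimes>\<^bsub>sl n\<^esub> Gmat k l = (%a b. of_bool (j = k) * Gmat i l a b + (- of_bool (l = i)) * Gmat k j a b)"
  unfolding b(6) by (intro ext, simp only: Gmat_mult ksign_def, simp add: Emat_def Gmat_def le)
qed

text \<open>The entry at (0,0) is the trace of the lower block, and each \<open>Gmat i i\<close>
  carries a 1 in that place.\<close>

lemma sl_expand:
 assumes "A \<in> slc n"
 shows "A = (%a b. (\<Sum>i\<in>{1..n}. A 0 i * Emat 0 i a b) + ((\<Sum>i\<in>{1..n}. A i 0 * Emat i 0 a b)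
   + (\<Sum>i\<in>{1..n}. \<Sum>j\<in>{1..n}. A i j * Gmat i j a b)))"
proof (intro ext)
 fix a b
 have z: "A a b = 0" if "~ (a \<le> n & b \<le> n)" using assms that by (auto simp: sl_carrier mat_alg_carrier)
 have tr: "A 0 0 = (\<Sum>i = 1..n. A i i)" using assms by (simp add: sl_carrier)
 have e1: "(\<Sum>i\<in>{1..n}. A 0 i * Emat 0 i a b) = (if a = 0 & b \<in> {1..n} then A a b else 0)"
 proof -
  have "(\<Sum>i\<in>{1..n}. A 0 i * Emat 0 i a b) = (\<Sum>i\<in>{1..n}. if i = b then (if a = 0 then A a b else 0) else 0)"
   by (intro sum.cong) (auto simp: Emat_def)
  thus ?thesis by simp
 qed
 have e2: "(\<Sum>i\<in>{1..n}. A i 0 * Emat i 0 a b) = (if b = 0 & a \<in> {1..n} then A a b else 0)"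
 proof -
  have "(\<Sum>i\<in>{1..n}. A i 0 * Emat i 0 a b) = (\<Sum>i\<in>{1..n}. if i = a then (if b = 0 then A a b else 0) else 0)"
   by (intro sum.cong) (auto simp: Emat_def)
  thus ?thesis by simp
 qed
 have "(\<Sum>i\<in>{1..n}. \<Sum>j\<in>{1..n}. A i j * Gmat i j a b)
  = (\<Sum>i\<in>{1..n}. \<Sum>j\<in>{1..n}. (if j = b then (if i = a then A a b else 0) else 0)
    + (if j = i then (if a = 0 & b = 0 then A i i else 0) else 0))"
  by (intro sum.cong) (auto simp: Gmat_def Emat_def)
 also have "\<dots> = (\<Sum>i\<in>{1..n}. if i = a then (if b \<in> {1..n} then A a b else 0) else 0)
   + (\<Sum>i\<in>{1..n}. if a = 0 & b = 0 then A i i else 0)"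
  unfolding sum.distrib by (intro arg_cong2[where f="(+)"] sum.cong) auto
 finally have e3: "(\<Sum>i\<in>{1..n}. \<Sum>j\<in>{1..n}. A i j * Gmat i j a b)
   = (if a \<in> {1..n} & b \<in> {1..n} then A a b else 0) + (if a = 0 & b = 0 then A 0 0 else 0)"
  using tr by simp
 show "A a b = (\<Sum>i\<in>{1..n}. A 0 i * Emat 0 i a b) + ((\<Sum>i\<in>{1..n}. A i 0 * Emat i 0 a b)
   + (\<Sum>i\<in>{1..n}. \<Sum>j\<in>{1..n}. A i j * Gmat i j a b))"
  unfolding e1 e2 e3 using z by (cases "a = 0"; cases "b = 0") auto
qed

section \<open>Tensor products in coordinates\<close>

lemma plin_eq: "plin F ==> plin G ==> (!!b. F (bvec b) = G (bvec b)) ==> F f = G f"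
 by (rule fun_cong[of F G], rule plin_ext)

definition tp :: "'p fv => 'v fv => ('p \<times> 'v \<Rightarrow>\<^sub>0 complex)"
 where "tp f g = linext (%b. linext (%c. bvec (b, c)) g) f"

text \<open>No Koszul sign is built in. Where one is due, the parity operator of the first factor is
  composed with \<open>S\<close>.\<close>

definition tens :: "('p fv => 'p fv) => ('v fv => 'v fv) =>
  ('p \<times> 'v \<Rightarrow>\<^sub>0 complex) => ('p \<times> 'v \<Rightarrow>\<^sub>0 complex)"
 where "tens S R = linext (%(b, c). tp (S (bvec b)) (R (bvec c)))"

lemma tp_bvec [simp]: "tp (bvec b) (bvec c) = bvec (b, c)"
 by (simp add: tp_def)

lemma plin_tp_left: "plin (%f. tp f g)"
 by (simp add: tp_def)

lemma plin_tp_right: "plin (%g. tp f g)"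
proof -
 have e: "(%g. tp f g) = (%g. \<Sum>b\<in>supp f. pscale (cf f b) (linext (%c. bvec (b, c)) g))"
  by (rule ext) (simp add: tp_def linext_def[of "%b. linext (%c. bvec (b, c)) g" f for g])
 show ?thesis by (subst e) (intro plin_sum_fun plin_pscale plin_linext)
qed

lemmas tp_linear = plin_add[OF plin_tp_left] plin_add[OF plin_tp_right] plin_scale[OF plin_tp_left]
 plin_scale[OF plin_tp_right] plin_zero[OF plin_tp_left] plin_zero[OF plin_tp_right]
 plin_neg[OF plin_tp_left] plin_neg[OF plin_tp_right]

lemma supp_tp:
 assumes "supp f <= B" "supp g <= C"
 shows "supp (tp f g) <= B \<times> C"
proof -
 have "tp f g \<in> {w. supp w <= B \<times> C}"
 proof (rule supp_image[OF plin_tp_left subspace_supp assms(1)])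
  fix b assume "b \<in> B"
  thus "tp (bvec b) g \<in> {w. supp w <= B \<times> C}"
   by (intro supp_image[OF plin_tp_right subspace_supp assms(2)]) auto
 qed
 thus ?thesis by simp
qed

lemma plin_tens [simp]: "plin (tens S R)"
 by (simp add: tens_def)

lemma tens_bvec: "tens S R (bvec (b, c)) = tp (S (bvec b)) (R (bvec c))"
 by (simp add: tens_def)

lemma tens_tp:
 assumes "plin S" "plin R"
 shows "tens S R (tp f g) = tp (S f) (R g)"
proof -
 have 1: "tens S R (tp (bvec b) g) = tp (S (bvec b)) (R g)" for b
  by (rule plin_eq[where F="%g. tens S R (tp (bvec b) g)" and G="%g. tp (S (bvec b)) (R g)"],
   rule plin_comp[OF plin_tens plin_tp_right], rule plin_comp[OF plin_tp_right assms(2)], simp add: tens_bvec)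
 show ?thesis
  by (rule plin_eq[where F="%f. tens S R (tp f g)" and G="%f. tp (S f) (R g)"],
   rule plin_comp[OF plin_tens plin_tp_left], rule plin_comp[OF plin_tp_left assms(1)], rule 1)
qed

lemma tens_tens:
 assumes "plin S" "plin R"
 shows "tens S R (tens S' R' w) = tens (%f. S (S' f)) (%g. R (R' g)) w"
proof (rule plin_eq[where F="%w. tens S R (tens S' R' w)"])
 show "tens S R (tens S' R' (bvec b)) = tens (%f. S (S' f)) (%g. R (R' g)) (bvec b)" for b
  by (cases b) (simp add: tens_bvec tens_tp[OF assms])
qed (intro plin_comp[OF plin_tens plin_tens] plin_tens)+

lemma tens_cong:
 assumes "supp w <= B \<times> C" "!!b. b \<in> B ==> S (bvec b) = S' (bvec b)" "!!c. c \<in> C ==> R (bvec c) = R' (bvec c)"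
 shows "tens S R w = tens S' R' w"
 by (rule plin_eqI[OF plin_tens plin_tens assms(1)]) (use assms(2,3) in "auto simp: tens_bvec")

lemma tens_id: "tens (%f. f) (%g. g) w = w"
 by (rule plin_eq[where G="%w. w"]) (auto simp: tens_bvec plin_id)

lemma tens_left:
 "tens (%f. S f + S' f) R w = tens S R w + tens S' R w" "tens (%f. pscale c (S f)) R w = pscale c (tens S R w)"
 "tens (%f. 0) R w = 0"
proof -
 have 1: "tens (%f. S f + S' f) R = (%w. tens S R w + tens S' R w)"
  by (rule plin_ext) (auto intro: plin_plus simp: tens_bvec tp_linear)
 show "tens (%f. S f + S' f) R w = tens S R w + tens S' R w" by (simp add: 1)
 have 2: "tens (%f. pscale c (S f)) R = (%w. pscale c (tens S R w))"
  by (rule plin_ext) (auto intro: plin_pscale simp: tens_bvec tp_linear)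
 show "tens (%f. pscale c (S f)) R w = pscale c (tens S R w)" by (simp add: 2)
 have 3: "tens (%f. 0) R = (%w. 0)"
  by (rule plin_ext) (auto intro: plin_null simp: tens_bvec tp_linear)
 show "tens (%f. 0) R w = 0" by (simp add: 3)
qed

lemma tens_right:
 "tens S (%f. R f + R' f) w = tens S R w + tens S R' w" "tens S (%f. pscale c (R f)) w = pscale c (tens S R w)"
 "tens S (%f. 0) w = 0"
proof -
 have 1: "tens S (%f. R f + R' f) = (%w. tens S R w + tens S R' w)"
  by (rule plin_ext) (auto intro: plin_plus simp: tens_bvec tp_linear)
 show "tens S (%f. R f + R' f) w = tens S R w + tens S R' w" by (simp add: 1)
 have 2: "tens S (%f. pscale c (R f)) = (%w. pscale c (tens S R w))"
  by (rule plin_ext) (auto intro: plin_pscale simp: tens_bvec tp_linear)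
 show "tens S (%f. pscale c (R f)) w = pscale c (tens S R w)" by (simp add: 2)
 have 3: "tens S (%f. 0) = (%w. 0)"
  by (rule plin_ext) (auto intro: plin_null simp: tens_bvec tp_linear)
 show "tens S (%f. 0) w = 0" by (simp add: 3)
qed

lemma tens_supp:
 assumes "supp w <= B \<times> C" "!!b. b \<in> B ==> supp (S (bvec b)) <= B" "!!c. c \<in> C ==> supp (R (bvec c)) <= C"
 shows "supp (tens S R w) <= B \<times> C"
proof -
 have "tens S R w \<in> {w. supp w <= B \<times> C}"
 proof (rule supp_image[OF plin_tens subspace_supp assms(1)])
  fix bc assume "bc \<in> B \<times> C"
  thus "tens S R (bvec bc) \<in> {w. supp w <= B \<times> C}"
   using supp_tp[OF assms(2,3)] by (cases bc) (auto simp: tens_bvec)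
 qed
 thus ?thesis by simp
qed

text \<open>The coefficient in the first tensor factor at the basis vector \<open>c\<close> of the
  second; \<open>coslice\<close> exchanges the roles.\<close>

definition slice :: "('p \<times> 'v \<Rightarrow>\<^sub>0 complex) => 'v => 'p fv"
 where "slice w c = linext (%(b, c'). if c' = c then bvec b else 0) w"

definition coslice :: "('p \<times> 'v \<Rightarrow>\<^sub>0 complex) => 'p => 'v fv"
 where "coslice w b = linext (%(b', c). if b' = b then bvec c else 0) w"

lemma plin_slice: "plin (%w. slice w c)" and plin_coslice: "plin (%w. coslice w b)"
 by (simp_all add: slice_def coslice_def)

lemma slice_tp: "slice (tp f (bvec c')) c = (if c' = c then f else 0)"
 by (rule plin_eq[where F="%f. slice (tp f (bvec c')) c" and G="%f. if c' = c then f else 0"],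
  rule plin_comp[OF plin_slice plin_tp_left], rule plin_if[OF plin_id plin_null], simp add: slice_def)

lemma coslice_tp: "coslice (tp (bvec b') g) b = (if b' = b then g else 0)"
 by (rule plin_eq[where F="%g. coslice (tp (bvec b') g) b" and G="%g. if b' = b then g else 0"],
  rule plin_comp[OF plin_coslice plin_tp_right], rule plin_if[OF plin_id plin_null], simp add: coslice_def)

lemma slice_tens:
 assumes "plin S"
 shows "slice (tens S (%g. g) w) c = S (slice w c)"
proof (rule plin_eq[where F="%w. slice (tens S (%g. g) w) c" and G="%w. S (slice w c)"])
 show "slice (tens S (%g. g) (bvec b)) c = S (slice (bvec b) c)" for b
  using slice_tp[of "bvec (fst b)" "snd b" c]
  by (cases b) (auto simp: tens_bvec slice_tp plin_zero[OF assms])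
qed (rule plin_comp[OF plin_slice plin_tens], rule plin_comp[OF assms plin_slice])

lemma coslice_tens:
 assumes "plin R"
 shows "coslice (tens (%g. g) R w) b = R (coslice w b)"
proof (rule plin_eq[where F="%w. coslice (tens (%g. g) R w) b" and G="%w. R (coslice w b)"])
 show "coslice (tens (%g. g) R (bvec c)) b = R (coslice (bvec c) b)" for c
  using coslice_tp[of "fst c" "bvec (snd c)" b]
  by (cases c) (auto simp: tens_bvec coslice_tp plin_zero[OF assms])
qed (rule plin_comp[OF plin_coslice plin_tens], rule plin_comp[OF assms plin_coslice])

lemma cf_slice: "cf (slice w c) b = cf w (b, c)"
proof -
 have "slice w c = (\<Sum>x\<in>supp w. pscale (cf w x) (if snd x = c then bvec (fst x) else 0))"
  by (simp add: slice_def linext_def split_beta)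
 hence "cf (slice w c) b = (\<Sum>x\<in>supp w. cf w x * cf (if snd x = c then bvec (fst x) else 0) b)"
  by (simp only: lookup_sum cf_pscale)
 also have "\<dots> = (\<Sum>x\<in>supp w. if x = (b, c) then cf w x else 0)"
  by (rule sum.cong) (auto simp: lookup_single when_def)
 also have "\<dots> = cf w (b, c)" by (simp add: in_keys_iff)
 finally show ?thesis .
qed

lemma cf_coslice: "cf (coslice w b) c = cf w (b, c)"
proof -
 have "coslice w b = (\<Sum>x\<in>supp w. pscale (cf w x) (if fst x = b then bvec (snd x) else 0))"
  by (simp add: coslice_def linext_def split_beta)
 hence "cf (coslice w b) c = (\<Sum>x\<in>supp w. cf w x * cf (if fst x = b then bvec (snd x) else 0) c)"
  by (simp only: lookup_sum cf_pscale)
 also have "\<dots> = (\<Sum>x\<in>supp w. if x = (b, c) then cf w x else 0)"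
  by (rule sum.cong) (auto simp: lookup_single when_def)
 also have "\<dots> = cf w (b, c)" by (simp add: in_keys_iff)
 finally show ?thesis .
qed

lemma slice_zero_iff: "slice w c = 0 \<longleftrightarrow> c \<notin> snd ` supp w"
 by (force simp: poly_mapping_eq_iff fun_eq_iff cf_slice supp_iff image_iff)

lemma slice_supp: "supp w <= B \<times> C ==> supp (slice w c) <= B"
 by (auto simp: supp_iff cf_slice)

lemma coslice_supp: "supp w <= B \<times> C ==> supp (coslice w b) <= C"
 by (auto simp: supp_iff cf_coslice)

lemma slice_expand: "w = (\<Sum>c\<in>snd ` supp w. tp (slice w c) (bvec c))"
proof (rule poly_mapping_eqI)
 fix bc :: "'a \<times> 'b"
 obtain b c where bc: "bc = (b, c)" by (cases bc)
 have t: "cf (tp f (bvec c')) (b, c) = (if c' = c then cf f b else 0)" for f :: "'a \<Rightarrow>\<^sub>0 complex" and c'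
  using cf_slice[of "tp f (bvec c')" c b] by (simp add: slice_tp split: if_splits)
 have "cf (\<Sum>c\<in>snd ` supp w. tp (slice w c) (bvec c)) (b, c) = (\<Sum>c'\<in>snd ` supp w. if c' = c then cf w (b, c) else 0)"
  by (auto simp: lookup_sum t cf_slice intro!: sum.cong)
 also have "\<dots> = cf w (b, c)" by (force simp: in_keys_iff image_iff)
 finally show "cf w bc = cf (\<Sum>c\<in>snd ` supp w. tp (slice w c) (bvec c)) bc" by (simp add: bc)
qed

section \<open>Simple modules over the Weyl superalgebra\<close>

text \<open>The operator is the product of the factors 1 - 2 xi_j d/dxi_j, each of which is -1 on
  the monomials containing xi_j and 1 on the others. The induction adds one factor at a
  time.\<close>

lemma parity_weyl_op: "\<exists>\<gamma>\<in>weyl_ops n. \<forall>k I. I <= {1..n} --> \<gamma> (bvec (k, I)) = pscale ((-1) ^ card I) (bvec (k, I))"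
proof -
 have "\<exists>\<gamma>\<in>weyl_ops n. \<forall>k I. I <= {1..n} --> \<gamma> (bvec (k, I)) = pscale ((-1) ^ card (I Int {1..m})) (bvec (k, I))"
  if "m \<le> n" for m
  using that
 proof (induction m)
  case 0
  show ?case by (rule bexI[OF _ weyl_ops.one]) (simp add: mon_bvec)
 next
  case (Suc m)
  then obtain \<gamma> where g: "\<gamma> \<in> weyl_ops n"
   "!!k I. I <= {1..n} ==> \<gamma> (bvec (k, I)) = pscale ((-1) ^ card (I Int {1..m})) (bvec (k, I))" by auto
  let ?e = "%f. mon n (0, {Suc m}) (der_op n (Suc m) f)"
  have e: "?e \<in> weyl_ops n" using Suc.prems by (intro weyl_comp[OF weyl_mon weyl_ops.der]) auto
  have 1: "(%f. \<gamma> f + pscale (-2) (\<gamma> (?e f))) \<in> weyl_ops n"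
   by (rule weyl_ops.add[OF g(1) weyl_ops.scale[OF weyl_comp[OF g(1) e]]])
  have 2: "\<gamma> (bvec (k, I)) + pscale (-2) (\<gamma> (?e (bvec (k, I)))) = pscale ((-1) ^ card (I Int {1..Suc m})) (bvec (k, I))"
   if I: "I <= {1..n}" for k I
  proof -
   have fI: "finite I" using I finite_subset by auto
   have "I Int {1..Suc m} = (if Suc m \<in> I then insert (Suc m) (I Int {1..m}) else I Int {1..m})"
    by (auto simp: le_Suc_eq)
   hence "card (I Int {1..Suc m}) = (if Suc m \<in> I then Suc (card (I Int {1..m})) else card (I Int {1..m}))"
    using fI by simp
   thus ?thesis
    using I Suc.prems mon_der_diag[of "Suc m" n k I]
    by (auto simp: g(2) plin_zero[OF weyl_plin[OF g(1)]] single_arith)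
  qed
  show ?case by (rule bexI[OF _ 1], intro allI impI, rule 2)
 qed
 from this[of n] obtain \<gamma> where g: "\<gamma> \<in> weyl_ops n"
  "!!k I. I <= {1..n} ==> \<gamma> (bvec (k, I)) = pscale ((-1) ^ card (I Int {1..n})) (bvec (k, I))" by blast
 show ?thesis
 proof (intro bexI[OF _ g(1)] allI impI)
  fix k I assume I: "I <= {1..n}"
  hence "I Int {1..n} = I" by blast
  thus "\<gamma> (bvec (k, I)) = pscale ((-1) ^ card I) (bvec (k, I))" using g(2)[OF I, of k] by simp
 qed
qed

locale weyl_module = graded_coordinates "weyl n" M B kap
 for n and M :: "(laur => laur, 'p) super_module" and B kap +
 assumes assoc: "assoc_supermodule (weyl n) M" and simple: "simple_supermodule (weyl n) M"
  and countable_B: "countable B"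
begin

lemma opr_ext:
 assumes "plin F" "plin G" "!!b. b \<in> B ==> F (bvec b) = G (bvec b)" "!!b. b \<notin> B ==> F (bvec b) = 0"
  "!!b. b \<notin> B ==> G (bvec b) = 0"
 shows "F = G"
 by (rule plin_ext[OF assms(1,2)]) (use assms(3-5) in metis)

lemma opr_outside: "b \<notin> B ==> opr a (bvec b) = 0" by (simp add: opr_def)

lemma B_V: "b \<in> B ==> bvec b \<in> V" by (simp add: V_def)

lemma opr_comp:
 assumes "a \<in> weyl_ops n" "a' \<in> weyl_ops n"
 shows "opr (%f. a (a' f)) = (%f. opr a (opr a' f))"
proof (rule opr_ext)
 fix b assume b: "b \<in> B"
 have "a \<circ> a' = (%f. a (a' f))" by auto
 moreover have "act M (a \<circ> a') (inv_k (bvec b)) = act M a (act M a' (inv_k (bvec b)))"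
  using assoc assms inv_k(1)[OF B_V[OF b]] unfolding assoc_supermodule_def by simp
 ultimately show "opr (%f. a (a' f)) (bvec b) = opr a (opr a' (bvec b))"
  using assms inv_k(1)[OF B_V[OF b]] weyl_comp[OF assms]
  by (simp add: opr_inv[OF _ B_V[OF b]] opr_k act_closed)
qed (auto simp: opr_outside plin_zero intro: plin_comp)

lemma opr_sum:
 assumes "a \<in> weyl_ops n" "a' \<in> weyl_ops n"
 shows "opr (%f. a f + a' f) = (%f. opr a f + opr a' f)"
 using opr_add[of a a'] weyl_ops.add[OF assms] assms
 by (intro opr_ext) (auto simp: opr_outside B_V intro: plin_plus)

lemma opr_pscale:
 assumes "a \<in> weyl_ops n"
 shows "opr (%f. pscale c (a f)) = (%f. pscale c (opr a f))"
 using opr_scale[of a c] weyl_ops.scale[OF assms, of c] assms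
 by (intro opr_ext) (auto simp: opr_outside B_V intro: plin_pscale)

lemma opr_zero: "opr (%f. 0) = (%f. 0)"
 using opr_pscale[OF weyl_ops.one, of 0] by simp

lemma opr_one: "f \<in> V ==> opr (mon n (0, {})) f = f"
proof -
 assume f: "f \<in> V"
 have "act M \<one>\<^bsub>weyl n\<^esub> (inv_k f) = inv_k f" using assoc inv_k(1)[OF f] unfolding assoc_supermodule_def by blast
 thus ?thesis using f weyl_ops.one by (simp add: opr_inv inv_k)
qed

text \<open>The generators of the Weyl superalgebra are homogeneous, so stability extends from
  homogeneous operators along sums, multiples and products.\<close>

lemma hom_stable:
 assumes "subsp W"
  and "!!a w p. a \<in> part (weyl n) p ==> w \<in> W ==> opr a w \<in> W"
  and "a \<in> weyl_ops n" "w \<in> W"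
 shows "opr a w \<in> W"
 using assms(3,4)
proof (induction arbitrary: w rule: weyl_ops.induct)
 case (scale T c)
 thus ?case using sub_scale[OF assms(1)] by (simp add: opr_pscale)
next
 case (add S T)
 thus ?case using sub_add[OF assms(1)] by (simp add: opr_sum)
next
 case (comp S T)
 thus ?case using opr_comp[of S T] by (simp add: o_def)
next
 case (xi i)
 hence "{i} <= {1..n}" by simp
 from assms(2)[OF part_mon[OF this] xi(2)] show ?case .
next
 case (der j)
 from assms(2)[OF part_der[OF der(1)] der(2)] show ?case .
qed (rule assms(2)[OF part_mon[OF empty_subsetI]], assumption)+

text \<open>The operator of \<open>parity_weyl_op\<close> and the parity of the module have the same
  commutation signs with homogeneous operators. Their product therefore commutes with the action; it
  is an involution, and graded simplicity makes it 1 or -1. It follows that simplicity in the graded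
  sense implies simplicity without the grading.\<close>

lemma parity_in_weyl: "\<exists>\<gamma>\<in>part (weyl n) False. \<forall>f\<in>V. opr \<gamma> f = parity_op d f"
proof -
 obtain \<gamma> where g: "\<gamma> \<in> weyl_ops n"
  "!!k I. I <= {1..n} ==> \<gamma> (bvec (k, I)) = pscale ((-1) ^ card I) (bvec (k, I))"
  using parity_weyl_op by blast
 have g0: "\<gamma> \<in> part (weyl n) False"
 proof (rule weyl_partI[OF g(1)])
  fix k I assume I: "I <= {1..n}"
  have "bvec (k, I) \<in> laur_part n (odd (card I))" using I by (simp add: laur_part_def)
  thus "\<gamma> (bvec (k, I)) \<in> laur_part n (False ~= odd (card I))"
   unfolding g(2)[OF I] using sub_scale[OF subspace_laur_part] by (simp del: pscale_single)
 qed
 have ghom: "\<gamma> f = pscale (if q then -1 else 1) f" if "f \<in> laur_part n q" for f q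
  by (rule plin_eqI[OF weyl_plin[OF g(1)] plin_pscale[OF plin_id], of f "UNIV \<times> {I. I <= {1..n} & odd (card I) = q}"])
   (use that in "auto simp: laur_part_def g(2) simp del: pscale_minus_one")
 have gg: "(%f. \<gamma> (\<gamma> f)) = mon n (0, {})"
  by (rule weyl_eqI[OF _ weyl_ops.one])
   (auto simp: g(2) mon_bvec weyl_outside[OF g(1)] plin_zero[OF weyl_plin[OF g(1)]] plin_scale[OF weyl_plin[OF g(1)]]
    power_add[symmetric] mult_2[symmetric] single_pscale[of _ "(-1) ^ _"] simp del: pscale_single intro: plin_comp weyl_plin g(1))
 have comm: "(%f. \<gamma> (a f)) = (%f. pscale (if p then -1 else 1) (a (\<gamma> f)))" if a: "a \<in> part (weyl n) p" for a p
 proof (rule weyl_eqI)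
  have aw: "a \<in> weyl_ops n" using a weyl_partD by blast
  show "plin (%f. \<gamma> (a f))" by (rule plin_comp[OF weyl_plin[OF g(1)] weyl_plin[OF aw]])
  show "(%f. pscale (if p then -1 else 1) (a (\<gamma> f))) \<in> weyl_ops n" by (rule weyl_ops.scale[OF weyl_comp[OF aw g(1)]])
  fix k I
  show "~ I <= {1..n} ==> \<gamma> (a (bvec (k, I))) = 0"
   by (simp add: weyl_outside[OF aw] plin_zero[OF weyl_plin[OF g(1)]])
  assume I: "I <= {1..n}"
  have "bvec (k, I) \<in> laur_part n (odd (card I))" using I by (simp add: laur_part_def)
  from weyl_partD(2)[OF a this] have "a (bvec (k, I)) \<in> laur_part n (p ~= odd (card I))" .
  thus "\<gamma> (a (bvec (k, I))) = pscale (if p then -1 else 1) (a (\<gamma> (bvec (k, I))))"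
   using I by (simp add: ghom g(2) plin_scale[OF weyl_plin[OF aw]] plin_neg[OF weyl_plin[OF aw]] del: pscale_single)
 qed
 let ?O = "opr \<gamma>" and ?\<sigma> = "parity_op d"
 have OV: "?O f \<in> V" if "f \<in> V" for f using opr_V g(1) that by simp
 have sV: "?\<sigma> f \<in> V" if "f \<in> V" for f using supp_parity_op that by (simp add: V_def)
 have OO: "?O (?O f) = f" if "f \<in> V" for f
  using fun_cong[OF opr_comp[OF g(1) g(1)], of f] gg opr_one[OF that] by simp
 have sgn_opr: "?\<sigma> (opr a f) = pscale (if p then -1 else 1) (opr a (?\<sigma> f))"
  if a: "a \<in> part (weyl n) p" "f \<in> V" for a p f
 proof (rule plin_eqI[of "%f. ?\<sigma> (opr a f)" "%f. pscale (if p then -1 else 1) (opr a (?\<sigma> f))" f B])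
  fix b assume b: "b \<in> B"
  have aw: "a \<in> carrier (weyl n)" using a weyl_partD by simp
  have "supp (opr a (bvec b)) <= {c \<in> B. d c = (p ~= d b)}"
   by (rule opr_parity[OF a(1) aw]) (use b in auto)
  hence "supp (opr a (bvec b)) <= {c. d c = (p ~= d b)}" by auto
  from parity_op_hom[OF this] show "?\<sigma> (opr a (bvec b)) = pscale (if p then -1 else 1) (opr a (?\<sigma> (bvec b)))"
   by (auto simp: parity_op_bvec plin_neg)
 next
  show "plin (%f. ?\<sigma> (opr a f))" by (rule plin_comp[OF plin_parity_op opr_plin])
  show "plin (%f. pscale (if p then -1 else 1) (opr a (?\<sigma> f)))"
   by (rule plin_pscale[OF plin_comp[OF opr_plin plin_parity_op]])
 qed (use a in "simp add: V_def")
 have Os: "?\<sigma> (?O f) = ?O (?\<sigma> f)" if "f \<in> V" for f using sgn_opr[OF g0 that] by simp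
 have Oa: "?O (opr a f) = pscale (if p then -1 else 1) (opr a (?O f))" if "a \<in> part (weyl n) p" for a p f
 proof -
  have aw: "a \<in> weyl_ops n" using that weyl_partD by blast
  have "?O (opr a f) = opr (%f. \<gamma> (a f)) f" using opr_comp[OF g(1) aw] by simp
  also have "\<dots> = pscale (if p then -1 else 1) (opr a (?O f))"
   unfolding comm[OF that] using opr_pscale[OF weyl_comp[OF aw g(1)]] opr_comp[OF aw g(1)] by simp
  finally show ?thesis .
 qed
 \<comment> \<open>The fixed space of the involution is a graded submodule; the cases
   \<open>V\<close> and \<open>{0}\<close> correspond to the signs 1 and -1.\<close>
 let ?W = "{f \<in> V. ?\<sigma> (?O f) = f}"
 have Wsub: "subsp ?W"
  by (rule pv.subspaceI) (auto simp: plin_add plin_scale plin_zero sub_add[OF V_sub]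
    sub_scale[OF V_sub] sub_0[OF V_sub])
 have "?W = {0} | ?W = V"
 proof (rule simple_V[OF simple Wsub])
  show "?\<sigma> w \<in> ?W" if w: "w \<in> ?W" for w
  proof -
   have "?O (?\<sigma> w) = w" using Os[of w] w by simp
   hence "?\<sigma> (?O (?\<sigma> w)) = ?\<sigma> w" by (rule arg_cong)
   thus ?thesis using w sV by simp
  qed
  show "opr a w \<in> ?W" if "a \<in> carrier (weyl n)" "w \<in> ?W" for a w
  proof (rule hom_stable[OF Wsub])
   fix a w p assume a: "a \<in> part (weyl n) p" and w: "w \<in> ?W"
   have aw: "a \<in> carrier (weyl n)" using a weyl_partD by simp
   have "?\<sigma> (?O (opr a w)) = pscale (if p then -1 else 1) (?\<sigma> (opr a (?O w)))"
    unfolding Oa[OF a] by (simp add: plin_scale)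
   also have "\<dots> = opr a (?\<sigma> (?O w))" using sgn_opr[OF a OV] w by simp
   finally show "opr a w \<in> ?W" using w opr_V[OF aw] by simp
  qed (use that in auto)
 qed auto
 thus ?thesis
 proof
  assume W: "?W = V"
  have "opr \<gamma> f = parity_op d f" if "f \<in> V" for f
  proof -
   have "?\<sigma> (?O f) = f" using W that by blast
   thus ?thesis by (metis parity_op_parity_op)
  qed
  thus ?thesis using g0 by blast
 next
  assume W: "?W = {0}"
  have "opr (%f. pscale (-1) (\<gamma> f)) f = ?\<sigma> f" if f: "f \<in> V" for f
  proof -
   \<comment> \<open>Symmetrizing \<open>f\<close> gives a fixed vector, which must vanish.\<close>
   have "f + ?\<sigma> (?O f) \<in> ?W"
    using f OV sV sub_add[OF V_sub] by (simp add: plin_add Os[symmetric] OO)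
   hence "f + ?\<sigma> (?O f) = 0" using W by blast
   hence "?\<sigma> f + ?O f = 0" using plin_add[OF plin_parity_op, of d f "?\<sigma> (?O f)"] plin_zero[OF plin_parity_op, of d] by simp
   thus ?thesis unfolding opr_pscale[OF g(1)] by (simp add: minus_equation_iff[of "?O f"] eq_neg_iff_add_eq_0 add.commute) (metis add.commute add_eq_0_iff)
  qed
  thus ?thesis using weyl_part_scale[OF g0, of "-1"] by blast
 qed
qed

definition "gam = (SOME \<gamma>. \<gamma> \<in> part (weyl n) False & (\<forall>f\<in>V. opr \<gamma> f = parity_op d f))"

lemma gam: "gam \<in> weyl_ops n" "f \<in> V ==> opr gam f = parity_op d f"
proof -
 have "\<exists>\<gamma>. \<gamma> \<in> part (weyl n) False & (\<forall>f\<in>V. opr \<gamma> f = parity_op d f)" using parity_in_weyl by blast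
 from someI_ex[OF this] show "gam \<in> weyl_ops n" "f \<in> V ==> opr gam f = parity_op d f"
  unfolding gam_def[symmetric] by (auto dest: weyl_partD)
qed

lemma simple_ungraded:
 assumes "subsp W" "W <= V" "!!a w. a \<in> weyl_ops n ==> w \<in> W ==> opr a w \<in> W"
 shows "W = {0} | W = V"
proof (rule simple_V[OF simple assms(1,2)])
 show "parity_op d w \<in> W" if "w \<in> W" for w using assms(2) assms(3)[OF gam(1) that] gam(2)[of w] that by auto
qed (use assms(3) in auto)

lemma schur:
 assumes "p \<in> V" "p ~= 0" "q \<in> V" "!!a. a \<in> weyl_ops n ==> opr a p = 0 ==> opr a q = 0"
 shows "\<exists>c. q = pscale c p"
proof (rule schur_dixmier[where K="opr ` weyl_ops n" and B=B and E="opr (mon n (0, {}))", folded V_def])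
 show "(%f. S (T f)) \<in> opr ` weyl_ops n" if h: "S \<in> opr ` weyl_ops n" "T \<in> opr ` weyl_ops n" for S T
 proof -
  obtain a a' where a: "a \<in> weyl_ops n" "a' \<in> weyl_ops n" "S = opr a" "T = opr a'" using h by blast
  show ?thesis unfolding a(3,4) opr_comp[OF a(1,2), symmetric] by (rule imageI[OF weyl_comp[OF a(1,2)]])
 qed
 show "(%f. S f + T f) \<in> opr ` weyl_ops n" if h: "S \<in> opr ` weyl_ops n" "T \<in> opr ` weyl_ops n" for S T
 proof -
  obtain a a' where a: "a \<in> weyl_ops n" "a' \<in> weyl_ops n" "S = opr a" "T = opr a'" using h by blast
  show ?thesis unfolding a(3,4) opr_sum[OF a(1,2), symmetric] by (rule imageI[OF weyl_ops.add[OF a(1,2)]])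
 qed
 show "(%f. pscale c (T f)) \<in> opr ` weyl_ops n" if h: "T \<in> opr ` weyl_ops n" for T c
 proof -
  obtain a where a: "a \<in> weyl_ops n" "T = opr a" using h by blast
  show ?thesis unfolding a(2) opr_pscale[OF a(1), symmetric] by (rule imageI[OF weyl_ops.scale[OF a(1)]])
 qed
 show "W = {0} | W = V" if "subsp W" "W <= V" "!!T w. T \<in> opr ` weyl_ops n ==> w \<in> W ==> T w \<in> W" for W
  using simple_ungraded that by blast
qed (use assms opr_one weyl_ops.one opr_V countable_B in auto)

end

section \<open>Simple modules over sl(1,n)\<close>

text \<open>Common to two situations: the given simple module in coordinates, and the Kac module
  realized in a space of finitely supported functions.\<close>

locale sl_rep =
 fixes n :: nat and V :: "'v fv set" and opr :: "mat => 'v fv => 'v fv"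
 assumes rep_sub: "subsp V" and rep_plin: "plin (opr a)"
  and rep_V: "a \<in> slc n ==> f \<in> V ==> opr a f \<in> V"
  and rep_bracket: "A \<in> part (sl n) p ==> A' \<in> part (sl n) q ==> A \<otimes>\<^bsub>sl n\<^esub> A' \<in> slc n ==> f \<in> V ==>
   opr (A \<otimes>\<^bsub>sl n\<^esub> A') f = opr A (opr A' f) - pscale (ksign p q) (opr A' (opr A f))"
  and rep_lincomb: "A \<in> slc n ==> A' \<in> slc n ==> f \<in> V ==>
   opr (%a b. c * A a b + c' * A' a b) f = pscale c (opr A f) + pscale c' (opr A' f)"
begin

abbreviation "X i \<equiv> opr (Emat 0 i)"
abbreviation "Y i \<equiv> opr (Emat i 0)"
abbreviation "H i j \<equiv> opr (Gmat i j)"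

lemma gens_carrier: "i \<in> {1..n} ==> Emat 0 i \<in> slc n" "i \<in> {1..n} ==> Emat i 0 \<in> slc n"
 "i \<in> {1..n} ==> j \<in> {1..n} ==> Gmat i j \<in> slc n"
 using sl_gens[of i n] by auto

lemma opr_zero: "f \<in> V ==> opr (%a b. 0) f = 0"
 using rep_lincomb[OF sl_closed(3) sl_closed(3), of f 0 0] by simp

lemma relations:
 assumes "i \<in> {1..n}" "j \<in> {1..n}" "k \<in> {1..n}" "l \<in> {1..n}" "f \<in> V"
 shows "X i (X j f) = - X j (X i f)" "Y i (Y j f) = - Y j (Y i f)"
  "Y k (X i f) = H k i f - X i (Y k f)"
  "H l i (X j f) = X j (H l i f) + pscale (of_bool (l = i)) (X j f) - pscale (of_bool (j = l)) (X i f)"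
  "H l i (Y k f) = Y k (H l i f) + pscale (of_bool (i = k)) (Y l f) - pscale (of_bool (l = i)) (Y k f)"
  "H i j (H k l f) = H k l (H i j f) + pscale (of_bool (j = k)) (H i l f) - pscale (of_bool (l = i)) (H k j f)"
proof -
 note g = sl_gens(1)[OF assms(1,1)] sl_gens(1)[OF assms(2,2)] sl_gens(2)[OF assms(1,1)] sl_gens(2)[OF assms(2,2)]
  sl_gens(2)[OF assms(3,3)] sl_gens(3)[OF assms(4,1)] sl_gens(3)[OF assms(1,2)] sl_gens(3)[OF assms(3,4)]
 note gc = gens_carrier(1)[OF assms(1)] gens_carrier(1)[OF assms(2)] gens_carrier(2)[OF assms(4)] gens_carrier(2)[OF assms(3)]
  gens_carrier(3)[OF assms(1,4)] gens_carrier(3)[OF assms(3,2)] gens_carrier(3)[OF assms(3,1)]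
 note b = sl_brackets[OF assms(1-4)]
 have c: "Emat 0 i \<otimes>\<^bsub>sl n\<^esub> Emat 0 j \<in> slc n" "Emat i 0 \<otimes>\<^bsub>sl n\<^esub> Emat j 0 \<in> slc n"
   "Emat k 0 \<otimes>\<^bsub>sl n\<^esub> Emat 0 i \<in> slc n" "Gmat l i \<otimes>\<^bsub>sl n\<^esub> Emat 0 j \<in> slc n"
   "Gmat l i \<otimes>\<^bsub>sl n\<^esub> Emat k 0 \<in> slc n" "Gmat i j \<otimes>\<^bsub>sl n\<^esub> Gmat k l \<in> slc n"
  unfolding b by (intro sl_closed gc)+
 show "X i (X j f) = - X j (X i f)"
  using rep_bracket[OF g(1,2) c(1) assms(5)] unfolding b(1) opr_zero[OF assms(5)]
  by (simp add: ksign_def eq_neg_iff_add_eq_0)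
 show "Y i (Y j f) = - Y j (Y i f)"
  using rep_bracket[OF g(3,4) c(2) assms(5)] unfolding b(2) opr_zero[OF assms(5)]
  by (simp add: ksign_def eq_neg_iff_add_eq_0)
 show "Y k (X i f) = H k i f - X i (Y k f)"
  using rep_bracket[OF g(5,1) c(3) assms(5)] unfolding b(3) by (simp add: ksign_def)
 show "H l i (X j f) = X j (H l i f) + pscale (of_bool (l = i)) (X j f) - pscale (of_bool (j = l)) (X i f)"
  using rep_bracket[OF g(6,2) c(4) assms(5)] unfolding b(4) rep_lincomb[OF gc(2,1) assms(5)]
  by (simp add: ksign_def algebra_simps)
 show "H l i (Y k f) = Y k (H l i f) + pscale (of_bool (i = k)) (Y l f) - pscale (of_bool (l = i)) (Y k f)"
  using rep_bracket[OF g(6,5) c(5) assms(5)] unfolding b(5) rep_lincomb[OF gc(3,4) assms(5)]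
  by (simp add: ksign_def algebra_simps)
 show "H i j (H k l f) = H k l (H i j f) + pscale (of_bool (j = k)) (H i l f) - pscale (of_bool (l = i)) (H k j f)"
  using rep_bracket[OF g(7,8) c(6) assms(5)] unfolding b(6) rep_lincomb[OF gc(5,6) assms(5)]
  by (simp add: ksign_def algebra_simps)
qed

lemma gens_V: "i \<in> {1..n} ==> f \<in> V ==> X i f \<in> V" "i \<in> {1..n} ==> f \<in> V ==> Y i f \<in> V"
 "i \<in> {1..n} ==> j \<in> {1..n} ==> f \<in> V ==> H i j f \<in> V"
 by (rule rep_V[OF gens_carrier(1)] rep_V[OF gens_carrier(2)] rep_V[OF gens_carrier(3)]; assumption)+

lemma opr_sum_mat:
 assumes "finite S" "!!s. s \<in> S ==> F s \<in> slc n" "f \<in> V"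
 shows "(%a b. \<Sum>s\<in>S. c s * F s a b) \<in> slc n \<and>
  opr (%a b. \<Sum>s\<in>S. c s * F s a b) f = (\<Sum>s\<in>S. pscale (c s) (opr (F s) f))"
 using assms(1,2)
proof (induction S)
 case empty
 thus ?case using opr_zero[OF assms(3)] sl_closed(3) by simp
next
 case (insert s S)
 have 1: "F s \<in> slc n" "(%a b. \<Sum>s\<in>S. c s * F s a b) \<in> slc n" using insert by auto
 have 2: "(%a b. \<Sum>s\<in>insert s S. c s * F s a b) = (%a b. c s * F s a b + 1 * (\<Sum>s\<in>S. c s * F s a b))"
  using insert by simp
 show ?case unfolding 2 using sl_closed(1)[OF sl_closed(2)[OF 1(1)] sl_closed(2)[OF 1(2)], of "c s" 1]
  rep_lincomb[OF 1 assms(3), of "c s" 1] insert by auto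
qed

lemma opr_expand:
 assumes "A \<in> slc n" "f \<in> V"
 shows "opr A f = (\<Sum>i\<in>{1..n}. pscale (A 0 i) (X i f)) + (\<Sum>i\<in>{1..n}. pscale (A i 0) (Y i f))
   + (\<Sum>i\<in>{1..n}. \<Sum>j\<in>{1..n}. pscale (A i j) (H i j f))"
proof -
 let ?A1 = "%a b. \<Sum>i\<in>{1..n}. A 0 i * Emat 0 i a b" and ?A2 = "%a b. \<Sum>i\<in>{1..n}. A i 0 * Emat i 0 a b"
  and ?A3 = "%a b. \<Sum>s\<in>{1..n}\<times>{1..n}. A (fst s) (snd s) * Gmat (fst s) (snd s) a b"
 have e: "A = (%a b. 1 * ?A1 a b + 1 * (1 * ?A2 a b + 1 * ?A3 a b))"
  using sl_expand[OF assms(1)] by (simp add: sum.cartesian_product split_beta)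
 have 1: "?A1 \<in> slc n & opr ?A1 f = (\<Sum>i\<in>{1..n}. pscale (A 0 i) (X i f))"
  by (rule opr_sum_mat[OF _ _ assms(2)]) (auto intro: gens_carrier)
 have 2: "?A2 \<in> slc n & opr ?A2 f = (\<Sum>i\<in>{1..n}. pscale (A i 0) (Y i f))"
  by (rule opr_sum_mat[OF _ _ assms(2)]) (auto intro: gens_carrier)
 have 3: "?A3 \<in> slc n & opr ?A3 f = (\<Sum>s\<in>{1..n}\<times>{1..n}. pscale (A (fst s) (snd s)) (H (fst s) (snd s) f))"
  by (rule opr_sum_mat[OF _ _ assms(2)]) (auto intro: gens_carrier)
 have c: "(%a b. 1 * ?A2 a b + 1 * ?A3 a b) \<in> slc n"
  by (intro sl_closed) (use 2 3 in auto)
 have "opr A f = pscale 1 (opr ?A1 f) + pscale 1 (opr (%a b. 1 * ?A2 a b + 1 * ?A3 a b) f)"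
  by (subst e, rule rep_lincomb[OF _ c assms(2)]) (use 1 in blast)
 also have "opr (%a b. 1 * ?A2 a b + 1 * ?A3 a b) f = pscale 1 (opr ?A2 f) + pscale 1 (opr ?A3 f)"
  by (rule rep_lincomb[OF _ _ assms(2)]) (use 2 3 in blast)+
 finally show ?thesis using 1 2 3 by (simp add: sum.cartesian_product split_beta add.assoc)
qed

lemma gens_stable:
 assumes "subsp W" "W <= V" "A \<in> slc n" "w \<in> W"
  and "!!i w. i \<in> {1..n} ==> w \<in> W ==> X i w \<in> W" "!!i w. i \<in> {1..n} ==> w \<in> W ==> Y i w \<in> W"
  "!!i j w. i \<in> {1..n} ==> j \<in> {1..n} ==> w \<in> W ==> H i j w \<in> W"
 shows "opr A w \<in> W"
proof -
 have "w \<in> V" using assms by auto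
 thus ?thesis unfolding opr_expand[OF assms(3) \<open>w \<in> V\<close>]
  by (intro sub_add[OF assms(1)] sub_sum[OF assms(1)] sub_scale[OF assms(1)] assms)
qed

end

locale sl_module = graded_coordinates "sl n" M B kap
 for n and M :: "(mat, 'v) super_module" and B kap +
 assumes lie: "lie_supermodule (sl n) M" and simple: "simple_supermodule (sl n) M" and n2: "n \<ge> 2"
begin

lemma opr_bracket:
 assumes "A \<in> part (sl n) p" "A' \<in> part (sl n) q" "A \<otimes>\<^bsub>sl n\<^esub> A' \<in> slc n" "f \<in> V"
 shows "opr (A \<otimes>\<^bsub>sl n\<^esub> A') f = opr A (opr A' f) - pscale (ksign p q) (opr A' (opr A f))"
proof -
 have c: "A \<in> slc n" "A' \<in> slc n" using assms by auto
 note i = inv_k(1)[OF assms(4)]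
 have "act M (A \<otimes>\<^bsub>sl n\<^esub> A') (inv_k f) = act M A (act M A' (inv_k f)) \<oplus>\<^bsub>M\<^esub> (- ksign p q) \<odot>\<^bsub>M\<^esub> act M A' (act M A (inv_k f))"
  using lie assms(1,2) i unfolding lie_supermodule_def by blast
 hence "opr (A \<otimes>\<^bsub>sl n\<^esub> A') f = kap (act M A (act M A' (inv_k f)) \<oplus>\<^bsub>M\<^esub> (- ksign p q) \<odot>\<^bsub>M\<^esub> act M A' (act M A (inv_k f)))"
  using opr_inv[OF assms(3,4)] by simp
 also have "\<dots> = kap (act M A (act M A' (inv_k f))) + pscale (- ksign p q) (kap (act M A' (act M A (inv_k f))))"
  using c i by (simp add: k_add k_scale act_closed M_closed)
 also have "\<dots> = opr A (opr A' f) + pscale (- ksign p q) (opr A' (opr A f))"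
  using c i assms(4) by (simp add: opr_inv[OF _ assms(4)] opr_k act_closed)
 finally show ?thesis by simp
qed

lemma opr_lincomb:
 assumes "A \<in> slc n" "A' \<in> slc n" "f \<in> V"
 shows "opr (%a b. c * A a b + c' * A' a b) f = pscale c (opr A f) + pscale c' (opr A' f)"
 using opr_add[of "%a b. c * A a b" "%a b. c' * A' a b" f] opr_scale[of A c f] opr_scale[of A' c' f]
  sl_closed(1)[OF sl_closed(2)[OF assms(1), of c] sl_closed(2)[OF assms(2), of c']]
  sl_closed(2)[OF assms(1), of c] sl_closed(2)[OF assms(2), of c'] assms by simp

sublocale sl_rep n V opr
 by unfold_locales (use V_sub opr_V opr_bracket opr_lincomb in auto)

lemma simple_gens:
 assumes "subsp W" "W <= V" "!!w. w \<in> W ==> parity_op d w \<in> W"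
  and "!!i w. i \<in> {1..n} ==> w \<in> W ==> X i w \<in> W" "!!i w. i \<in> {1..n} ==> w \<in> W ==> Y i w \<in> W"
  "!!i j w. i \<in> {1..n} ==> j \<in> {1..n} ==> w \<in> W ==> H i j w \<in> W"
 shows "W = {0} | W = V"
 by (rule simple_V[OF simple assms(1-3)]) (use gens_stable[OF assms(1,2)] assms(4-6) in auto)

end

context graded_coordinates
begin

lemma parity_op_opr:
 assumes "a \<in> part A p" "a \<in> carrier A" "f \<in> V"
 shows "parity_op d (opr a f) = pscale (if p then -1 else 1) (opr a (parity_op d f))"
proof (rule plin_eqI[of "%f. parity_op d (opr a f)" "%f. pscale (if p then -1 else 1) (opr a (parity_op d f))" f B])
 fix b assume b: "b \<in> B"
 have "supp (opr a (bvec b)) <= {c \<in> B. d c = (p ~= d b)}"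
  by (rule opr_parity[OF assms(1,2)]) (use b in auto)
 hence "supp (opr a (bvec b)) <= {c. d c = (p ~= d b)}" by auto
 from parity_op_hom[OF this] show "parity_op d (opr a (bvec b)) = pscale (if p then -1 else 1) (opr a (parity_op d (bvec b)))"
  by (auto simp: parity_op_bvec plin_neg)
next
 show "plin (%f. parity_op d (opr a f))" by (rule plin_comp[OF plin_parity_op opr_plin])
 show "plin (%f. pscale (if p then -1 else 1) (opr a (parity_op d f)))"
  by (rule plin_pscale[OF plin_comp[OF opr_plin plin_parity_op]])
qed (use assms in "simp add: V_def")

lemma parity_op_V: "f \<in> V ==> parity_op d f \<in> V"
 using supp_parity_op by (simp add: V_def)

lemma bvec_V: "b \<in> B ==> bvec b \<in> V"
 by (simp add: V_def)

end

section \<open>Tensor products of simple modules\<close>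

locale tensor_setting = P: weyl_module n MP BP kP + V: sl_module n MV BV kV
 for n and MP :: "(laur => laur, 'p) super_module" and BP kP
  and MV :: "(mat, 'v) super_module" and BV kV
begin

definition "T = {w :: 'p \<times> 'v \<Rightarrow>\<^sub>0 complex. supp w <= BP \<times> BV}"

abbreviation "\<sigma>P \<equiv> parity_op P.d"
abbreviation "\<sigma>V \<equiv> parity_op V.d"
abbreviation left_op :: "('p fv => 'p fv) => ('p \<times> 'v \<Rightarrow>\<^sub>0 complex) => ('p \<times> 'v \<Rightarrow>\<^sub>0 complex)"
 where "left_op S \<equiv> tens S (%g. g)"
abbreviation right_op :: "('v fv => 'v fv) => ('p \<times> 'v \<Rightarrow>\<^sub>0 complex) => ('p \<times> 'v \<Rightarrow>\<^sub>0 complex)"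
 where "right_op R \<equiv> tens (%f. f) R"

lemma T_sub: "subsp T"
 unfolding T_def by (rule subspace_supp)

lemma tp_T: "f \<in> P.V ==> g \<in> V.V ==> tp f g \<in> T"
 using supp_tp[of f BP g BV] by (simp add: T_def P.V_def V.V_def)

lemma tens_T:
 assumes "w \<in> T" "!!f. f \<in> P.V ==> S f \<in> P.V" "!!g. g \<in> V.V ==> R g \<in> V.V"
 shows "tens S R w \<in> T"
 using tens_supp[of w BP BV S R] assms P.bvec_V V.bvec_V by (simp add: T_def P.V_def V.V_def)

lemma tens_eq:
 assumes "w \<in> T" "!!f. f \<in> P.V ==> S f = S' f" "!!g. g \<in> V.V ==> R g = R' g"
 shows "tens S R w = tens S' R' w"
 using tens_cong[of w BP BV S S' R R'] assms P.bvec_V V.bvec_V by (simp add: T_def)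

text \<open>A nonzero element with the fewest nonzero slices is a pure tensor: a Weyl operator that
  kills one slice shortens it and so kills all slices, whence \<open>P.schur\<close> makes them
  proportional. From a pure tensor, simplicity of the first and then of the second factor gives
  everything.\<close>

lemma tensor_simple:
 assumes N: "subsp N" "N <= T"
  and left: "!!a w. a \<in> weyl_ops n ==> w \<in> N ==> left_op (P.opr a) w \<in> N"
  and X: "!!i w. i \<in> {1..n} ==> w \<in> N ==> right_op (V.X i) w \<in> N"
  and Y: "!!i w. i \<in> {1..n} ==> w \<in> N ==> right_op (V.Y i) w \<in> N"
  and H: "!!i j w. i \<in> {1..n} ==> j \<in> {1..n} ==> w \<in> N ==> right_op (V.H i j) w \<in> N"
  and s: "!!w. w \<in> N ==> right_op \<sigma>V w \<in> N"
 shows "N = {0} | N = T"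
proof (rule disjCI)
 assume nT: "N ~= T"
 show "N = {0}"
 proof (rule ccontr)
  assume "N ~= {0}"
  hence ex: "\<exists>w. w \<in> N & w ~= 0" using sub_0[OF N(1)] by blast
  obtain w where w: "w \<in> N" "w ~= 0"
   and min: "!!u. u \<in> N ==> u ~= 0 ==> card (snd ` supp w) \<le> card (snd ` supp u)"
   using ex_has_least_nat[of "%w. w \<in> N & w ~= 0" _ "%w. card (snd ` supp w)"] ex by (metis (no_types, lifting))
  define C where "C = snd ` supp w"
  have "supp w ~= {}" using w(2) by simp
  then obtain c1 where c1: "c1 \<in> C" unfolding C_def by blast
  define p where "p = slice w c1"
  have wT: "supp w <= BP \<times> BV" using w(1) N(2) by (auto simp: T_def)
  have slP: "slice w c \<in> P.V" for c using slice_supp[OF wT] by (simp add: P.V_def)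
  have p: "p ~= 0" "p \<in> P.V" using c1 slP by (auto simp: p_def C_def slice_zero_iff)
  have "\<exists>l. slice w c = pscale l p" for c
  proof (rule P.schur[OF p(2,1) slP])
   fix a assume a: "a \<in> weyl_ops n" "P.opr a p = 0"
   let ?u = "left_op (P.opr a) w"
   have sl: "slice ?u c = P.opr a (slice w c)" for c by (rule slice_tens) simp
   have "snd ` supp ?u <= C - {c1}"
   proof
    fix c assume "c \<in> snd ` supp ?u"
    hence "slice ?u c ~= 0" by (simp add: slice_zero_iff)
    hence "P.opr a (slice w c) ~= 0" unfolding sl .
    hence "slice w c ~= 0" "c ~= c1" using a(2) by (auto simp: plin_zero p_def)
    thus "c \<in> C - {c1}" by (simp add: slice_zero_iff C_def)
   qed
   hence "snd ` supp ?u \<subset> C" using c1 by blast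
   hence "card (snd ` supp ?u) < card C"
    by (intro psubset_card_mono) (simp_all add: C_def)
   hence "?u = 0" using min[OF left[OF a(1) w(1)]] by (auto simp: C_def)
   hence "slice ?u c = 0" by (simp add: slice_def plin_zero)
   thus "P.opr a (slice w c) = 0" unfolding sl .
  qed
  then obtain l where l: "!!c. slice w c = pscale (l c) p" by metis
  define v where "v = (\<Sum>c\<in>C. pscale (l c) (bvec c))"
  have "w = (\<Sum>c\<in>C. tp (slice w c) (bvec c))" unfolding C_def by (rule slice_expand)
  also have "\<dots> = (\<Sum>c\<in>C. tp p (pscale (l c) (bvec c)))"
   unfolding l tp_linear ..
  also have "\<dots> = tp p v" unfolding v_def plin_sum[OF plin_tp_right] ..
  finally have wp: "w = tp p v" .
  have v0: "v ~= 0" using wp w(2) by (auto simp: tp_linear)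
  have "C <= BV" using wT by (auto simp: C_def)
  hence vV: "v \<in> V.V" unfolding v_def
   by (intro sub_sum[OF V.V_sub] sub_scale[OF V.V_sub] V.bvec_V) auto
  let ?W1 = "{f \<in> P.V. tp f v \<in> N}"
  have "?W1 = {0} | ?W1 = P.V"
  proof (rule P.simple_ungraded)
   show "subsp ?W1"
    by (rule pv.subspaceI) (auto simp: tp_linear sub_add[OF N(1)] sub_scale[OF N(1)]
     sub_0[OF N(1)] sub_add[OF P.V_sub] sub_scale[OF P.V_sub] sub_0[OF P.V_sub])
   show "P.opr a f \<in> ?W1" if "a \<in> weyl_ops n" "f \<in> ?W1" for a f
    using that left[OF that(1), of "tp f v"] P.opr_V[of a f] by (simp add: tens_tp plin_id)
  qed auto
  hence W1: "tp f v \<in> N" if "f \<in> P.V" for f using p w(1) wp that by blast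
  let ?W2 = "{g \<in> V.V. \<forall>f\<in>P.V. tp f g \<in> N}"
  have "?W2 = {0} | ?W2 = V.V"
  proof (rule V.simple_gens)
   show "subsp ?W2"
    by (rule pv.subspaceI) (auto simp: tp_linear sub_add[OF N(1)] sub_scale[OF N(1)]
     sub_0[OF N(1)] sub_add[OF V.V_sub] sub_scale[OF V.V_sub] sub_0[OF V.V_sub])
   have st: "R g \<in> ?W2" if g: "g \<in> ?W2" and R: "plin R" "R g \<in> V.V" "!!w. w \<in> N ==> right_op R w \<in> N" for R g
   proof -
    have "tp f (R g) \<in> N" if "f \<in> P.V" for f
     using R(3)[of "tp f g"] g that by (simp add: tens_tp R(1) plin_id)
    thus ?thesis using R(2) by simp
   qed
   show "\<sigma>V g \<in> ?W2" if "g \<in> ?W2" for g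
    by (rule st[OF that plin_parity_op]) (use that s V.parity_op_V in auto)
   show "V.X i g \<in> ?W2" if "i \<in> {1..n}" "g \<in> ?W2" for i g
    by (rule st[OF that(2) V.opr_plin]) (use X[OF that(1)] V.gens_V(1)[OF that(1)] that(2) in auto)
   show "V.Y i g \<in> ?W2" if "i \<in> {1..n}" "g \<in> ?W2" for i g
    by (rule st[OF that(2) V.opr_plin]) (use Y[OF that(1)] V.gens_V(2)[OF that(1)] that(2) in auto)
   show "V.H i j g \<in> ?W2" if "i \<in> {1..n}" "j \<in> {1..n}" "g \<in> ?W2" for i j g
    by (rule st[OF that(3) V.opr_plin]) (use H[OF that(1,2)] V.gens_V(3)[OF that(1,2)] that(3) in auto)
  qed auto
  moreover have "v \<in> ?W2" using W1 vV by auto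
  ultimately have W2: "?W2 = V.V" using v0 by blast
  have "T <= N"
  proof
   fix u assume "u \<in> T"
   hence "supp u <= BP \<times> BV" by (simp add: T_def)
   thus "u \<in> N"
   proof (rule supp_induct[OF N(1)])
    fix bc assume "bc \<in> BP \<times> BV"
    then obtain b c where bc: "bc = (b, c)" "b \<in> BP" "c \<in> BV" by auto
    hence "bvec c \<in> ?W2" unfolding W2 using V.bvec_V by blast
    hence "tp (bvec b) (bvec c) \<in> N" using P.bvec_V[OF bc(2)] by blast
    thus "bvec bc \<in> N" by (simp add: bc)
   qed
  qed
  thus False using nT N(2) by blast
 qed
qed

text \<open>The sign of E_{s,i} in pi of t^k xi_I d/dxi_i: the first factor is part of pi, the
  second comes from the derivative of xi_I by xi_s.\<close>

abbreviation "eps I s \<equiv> (-1) ^ (card I - 1) * (-1) ^ inversions {s} I :: complex"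

text \<open>The assumptions on \<open>N\<close> express stability under four kinds of fields,
  written out by means of pi: d/dt in \<open>d0\<close>, t^k xi_I d/dxi_i with
  \<open>i \<notin> I\<close> in \<open>X1\<close>, xi_i d/dt in \<open>Ef\<close>, and t d/dt +
  xi_i d/dxi_i in \<open>Gf\<close>. The assumption \<open>par\<close> says that \<open>N\<close> is
  graded. In \<open>X1\<close> the matrix unit E_{s,i} appears as \<open>Gmat s i\<close>, the two
  being equal for \<open>s \<noteq> i\<close>.\<close>

context
 fixes N
 assumes N: "subsp N" "N <= T" "N ~= {0}" "N ~= T"
  and par: "!!w. w \<in> N ==> tens \<sigma>P \<sigma>V w \<in> N"
  and d0: "!!w. w \<in> N ==> left_op (P.opr (mon_field n 0 {} 0)) w \<in> N"
  and X1: "!!w k I i. w \<in> N ==> i \<in> {1..n} ==> I <= {1..n} ==> i \<notin> I ==>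
    left_op (P.opr (mon_field n k I i)) w
    + pscale (of_int k) (tens (%f. P.opr (mon n (k - 1, I)) (\<sigma>P f)) (V.X i) w)
    + (\<Sum>s\<in>I. pscale (eps I s) (tens (P.opr (mon n (k, I - {s}))) (V.H s i) w)) \<in> N"
  and Ef: "!!w i. w \<in> N ==> i \<in> {1..n} ==> left_op (P.opr (mon_field n 0 {i} 0)) w + tens \<sigma>P (V.Y i) w \<in> N"
  and Gf: "!!w i. w \<in> N ==> i \<in> {1..n} ==> left_op (P.opr (euler_field n i)) w + right_op (V.H i i) w \<in> N"
begin

lemma mon_opr:
 assumes "I <= {1..n}" "J <= {1..n}"
 shows "P.opr (mon n (k, I)) (P.opr (mon n (l, J)) f) =
  (if I Int J = {} then pscale ((-1) ^ inversions I J) (P.opr (mon n (k + l, I Un J)) f) else 0)"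
proof -
 have "P.opr (mon n (k, I)) (P.opr (mon n (l, J)) f) = P.opr (%f. mon n (k, I) (mon n (l, J) f)) f"
  using P.opr_comp[OF weyl_mon[OF assms(1)] weyl_mon[OF assms(2)]] by simp
 also have "\<dots> = (if I Int J = {} then pscale ((-1) ^ inversions I J) (P.opr (mon n (k + l, I Un J)) f) else 0)"
  using assms P.opr_pscale[OF weyl_mon[of "I Un J" n "k + l"]] by (simp add: mon_mon P.opr_zero)
 finally show ?thesis .
qed

definition shift :: "int => ('p \<times> 'v \<Rightarrow>\<^sub>0 complex) => ('p \<times> 'v \<Rightarrow>\<^sub>0 complex)"
 where "shift k = left_op (P.opr (mon n (k, {})))"

lemma shift_plin [simp]: "plin (shift k)" by (simp add: shift_def)

lemma shift_shift: "shift k (shift l w) = shift (k + l) w"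
 by (simp add: shift_def tens_tens plin_id mon_opr[of "{}" "{}", simplified])

lemma shift_tens:
 assumes "!!f. f \<in> P.V ==> S (P.opr (mon n (k, {})) f) = P.opr (mon n (k, {})) (S f)" "plin S" "plin R" "w \<in> T"
 shows "tens S R (shift k w) = shift k (tens S R w)"
 unfolding shift_def by (simp add: tens_tens assms(2,3) plin_id) (rule tens_eq[OF assms(4)], auto simp: assms(1))

text \<open>The field t^k xi_I d/dxi_i acts as \<open>shift k (low I i w)\<close> plus
  \<open>k\<close> times \<open>shift (k - 1) (lead I i w)\<close>. Neither \<open>lead\<close> nor
  \<open>low\<close> depends on \<open>k\<close>, and both commute with shifts, so the dependence on
  \<open>k\<close> is polynomial up to powers of t.\<close>

definition lead :: "nat set => nat => ('p \<times> 'v \<Rightarrow>\<^sub>0 complex) => ('p \<times> 'v \<Rightarrow>\<^sub>0 complex)"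
 where "lead I i = tens (%f. P.opr (mon n (0, I)) (\<sigma>P f)) (V.X i)"

definition low :: "nat set => nat => ('p \<times> 'v \<Rightarrow>\<^sub>0 complex) => ('p \<times> 'v \<Rightarrow>\<^sub>0 complex)"
 where "low I i w = left_op (P.opr (mon_field n 0 I i)) w
    + (\<Sum>s\<in>I. pscale (eps I s) (tens (P.opr (mon n (0, I - {s}))) (V.H s i) w))"

lemma plin_lead [simp]: "plin (lead I i)" by (simp add: lead_def)

lemma plin_low [simp]: "plin (low I i)"
 unfolding low_def[abs_def] by (intro plin_plus plin_sum_fun plin_pscale plin_tens)

lemma X1': 
 assumes "w \<in> N" "i \<in> {1..n}" "I <= {1..n}" "i \<notin> I"
 shows "shift k (low I i w) + pscale (of_int k) (shift (k - 1) (lead I i w)) \<in> N"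
proof -
 have m: "P.opr (mon_field n k I i) = (%f. P.opr (mon n (k, {})) (P.opr (mon_field n 0 I i) f))"
 proof -
  have "mon_field n k I i = (%f. mon n (k, {}) (mon_field n 0 I i f))"
   using assms(3) by (simp add: mon_field_def mon_mon fun_eq_iff)
  thus ?thesis using P.opr_comp[OF weyl_mon[of "{}" n k] mon_field_weyl[OF assms(3), of i 0]] assms(2) by simp
 qed
 have m2: "P.opr (mon n (k, J)) = (%f. P.opr (mon n (k, {})) (P.opr (mon n (0, J)) f))" if "J <= {1..n}" for J k
  using mon_opr[of "{}" J k 0] that by (simp add: fun_eq_iff)
 have "shift k (low I i w) + pscale (of_int k) (shift (k - 1) (lead I i w)) =
    left_op (P.opr (mon_field n k I i)) w + pscale (of_int k) (tens (%f. P.opr (mon n (k - 1, I)) (\<sigma>P f)) (V.X i) w)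
    + (\<Sum>s\<in>I. pscale (eps I s) (tens (P.opr (mon n (k, I - {s}))) (V.H s i) w))"
 proof -
  have 1: "shift k (left_op (P.opr (mon_field n 0 I i)) w) = left_op (P.opr (mon_field n k I i)) w"
   unfolding m shift_def by (simp add: tens_tens plin_id)
  have 2: "shift (k - 1) (lead I i w) = tens (%f. P.opr (mon n (k - 1, I)) (\<sigma>P f)) (V.X i) w"
   unfolding m2[OF assms(3), of "k - 1"] shift_def lead_def by (simp add: tens_tens plin_id)
  have 3: "shift k (tens (P.opr (mon n (0, I - {s}))) (V.H s i) w) = tens (P.opr (mon n (k, I - {s}))) (V.H s i) w" for s
  proof -
   have "I - {s} <= {1..n}" using assms(3) by auto
   from m2[OF this, of k] show ?thesis unfolding shift_def by (simp add: tens_tens plin_id)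
  qed
  show ?thesis unfolding low_def
   by (simp add: plin_add[OF shift_plin] plin_sum[OF shift_plin] plin_scale[OF shift_plin] 1 2 3)
 qed
 thus ?thesis using X1[OF assms] by simp
qed

lemma lead_T: "w \<in> T ==> i \<in> {1..n} ==> I <= {1..n} ==> lead I i w \<in> T"
 unfolding lead_def by (rule tens_T) (auto intro!: P.opr_V P.parity_op_V V.opr_V V.gens_carrier simp: weyl_mon)

lemma low_T:
 assumes "w \<in> T" "i \<in> {1..n}" "I <= {1..n}"
 shows "low I i w \<in> T"
 unfolding low_def
proof (intro sub_add[OF T_sub] sub_sum[OF T_sub] sub_scale[OF T_sub])
 show "left_op (P.opr (mon_field n 0 I i)) w \<in> T"
  by (rule tens_T[OF assms(1)]) (use assms mon_field_weyl[OF assms(3), of i 0] in "auto intro: P.opr_V")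
 fix s assume "s \<in> I"
 hence "s \<in> {1..n}" "I - {s} <= {1..n}" using assms(3) by auto
 thus "tens (P.opr (mon n (0, I - {s}))) (V.H s i) w \<in> T"
  by (intro tens_T[OF assms(1)]) (auto intro!: P.opr_V V.gens_V(3) simp: weyl_mon assms(2)[simplified])
qed

lemma shift_lead:
 assumes "w \<in> T" "I <= {1..n}"
 shows "lead I i (shift k w) = shift k (lead I i w)"
 unfolding lead_def
proof (rule shift_tens[OF _ _ _ assms(1)])
 fix f assume f: "f \<in> P.V"
 have "\<sigma>P (P.opr (mon n (k, {})) f) = P.opr (mon n (k, {})) (\<sigma>P f)"
  using P.parity_op_opr[OF part_mon[of "{}" n k] _ f] by (simp add: weyl_mon)
 thus "P.opr (mon n (0, I)) (\<sigma>P (P.opr (mon n (k, {})) f)) = P.opr (mon n (k, {})) (P.opr (mon n (0, I)) (\<sigma>P f))"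
  using assms(2) by (simp add: mon_opr)
qed (auto intro: plin_comp[OF P.opr_plin plin_parity_op])

lemma shift_low:
 assumes "w \<in> T" "I <= {1..n}" "i \<in> {1..n}"
 shows "low I i (shift k w) = shift k (low I i w)"
proof -
 have "P.opr (mon_field n 0 I i) (P.opr (mon n (k, {})) f) = P.opr (mon n (k, {})) (P.opr (mon_field n 0 I i) f)" for f
 proof -
  have e: "(%f. mon_field n 0 I i (mon n (k, {}) f)) = (%f. mon n (k, {}) (mon_field n 0 I i f))"
   using assms(2,3) by (simp add: mon_field_def mon_mon der_mon fun_eq_iff)
  have w: "mon_field n 0 I i \<in> weyl_ops n" "mon n (k, {}) \<in> weyl_ops n"
   using mon_field_weyl[OF assms(2), of i 0] assms(3) weyl_mon by auto
  show ?thesis using fun_cong[OF P.opr_comp[OF w(1,2)], of f] fun_cong[OF P.opr_comp[OF w(2,1)], of f] e by simp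
 qed
 hence 1: "left_op (P.opr (mon_field n 0 I i)) (shift k w) = shift k (left_op (P.opr (mon_field n 0 I i)) w)"
  by (intro shift_tens[OF _ _ _ assms(1)]) (auto simp: plin_id)
 have 2: "tens (P.opr (mon n (0, I - {s}))) (V.H s i) (shift k w) = shift k (tens (P.opr (mon n (0, I - {s}))) (V.H s i) w)" for s
 proof (rule shift_tens[OF _ _ _ assms(1)])
  have "I - {s} <= {1..n}" using assms(2) by auto
  thus "P.opr (mon n (0, I - {s})) (P.opr (mon n (k, {})) f) = P.opr (mon n (k, {})) (P.opr (mon n (0, I - {s})) f)" for f
   by (simp add: mon_opr)
 qed auto
 show ?thesis unfolding low_def
  by (simp add: 1 2 plin_add[OF shift_plin] plin_sum[OF shift_plin] plin_scale[OF shift_plin])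
qed

text \<open>The second difference in \<open>k\<close> of the products below isolates the term quadratic in \<open>k\<close>.\<close>

lemma lead_lead:
 assumes w: "w \<in> N" and i: "i \<in> {1..n}" "I <= {1..n}" "i \<notin> I" and j: "j \<in> {1..n}" "J <= {1..n}" "j \<notin> J"
 shows "shift m (lead I i (lead J j w)) \<in> N"
proof -
 have wT: "w \<in> T" using w N(2) by auto
 define A where "A k w = shift k (low I i w) + pscale (of_int k) (shift (k - 1) (lead I i w))" for k w
 define B where "B k w = shift k (low J j w) + pscale (of_int k) (shift (k - 1) (lead J j w))" for k w
 have AB: "A k (B l w) \<in> N" for k l
  unfolding A_def by (rule X1'[OF _ i]) (unfold B_def, rule X1'[OF w j])
 note lins = plin_add[OF plin_low] plin_add[OF plin_lead] plin_scale[OF plin_low] plin_scale[OF plin_lead]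
  plin_add[OF shift_plin] plin_scale[OF shift_plin]
 note T1 = low_T[OF wT j(1,2)] lead_T[OF wT j(1,2)]
 have e: "A k (B l w) = shift (k + l) (low I i (low J j w)) + pscale (of_int l) (shift (k + l - 1) (low I i (lead J j w)))
   + pscale (of_int k) (shift (k + l - 1) (lead I i (low J j w))) + pscale (of_int (k * l)) (shift (k + l - 2) (lead I i (lead J j w)))" for k l
  unfolding A_def B_def lins shift_low[OF T1(1) i(2,1)] shift_low[OF T1(2) i(2,1)] shift_lead[OF T1(1) i(2)] shift_lead[OF T1(2) i(2)]
   shift_shift by (simp add: pv.scale_right_distrib algebra_simps)
 \<comment> \<open>In all three products \<open>k + l = m + 2\<close>, so corresponding terms of
   \<open>e\<close> carry the same power of t. The weights 1, -2, 1 annihilate the coefficients 1,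
   \<open>k\<close> and \<open>l\<close> and give -2 on \<open>k * l\<close>.\<close>
 have "A 1 (B (m + 1) w) - pscale 2 (A 0 (B (m + 2) w)) + A (-1) (B (m + 3) w) \<in> N"
  by (intro sub_add[OF N(1)] sub_diff[OF N(1)] sub_scale[OF N(1)] AB)
 also have "A 1 (B (m + 1) w) - pscale 2 (A 0 (B (m + 2) w)) + A (-1) (B (m + 3) w) = pscale (-2) (shift m (lead I i (lead J j w)))"
  unfolding e by (rule poly_mapping_eqI) (simp add: lookup_add lookup_minus algebra_simps)
 finally have "pscale (-1/2) (pscale (-2) (shift m (lead I i (lead J j w)))) \<in> N" by (rule sub_scale[OF N(1)])
 thus ?thesis by simp
qed

lemma mon_quadratic:
 assumes w: "w \<in> N" and ij: "i \<in> {1..n}" "j \<in> {1..n}" "i ~= j" and L: "L <= {1..n}"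
 shows "tens (P.opr (mon n (m, L))) (%g. V.X i (V.X j g)) w \<in> N"
proof -
 \<comment> \<open>The field with \<open>X i\<close> needs \<open>i \<notin> I\<close>, the one with
   \<open>X j\<close> needs \<open>j \<notin> J\<close>, and together the monomials must give xi_L.
   So a factor xi_i, if present, goes into \<open>J\<close>.\<close>
 define I J where "I = L - {i}" and "J = L Int {i}"
 have IJ: "I <= {1..n}" "i \<notin> I" "J <= {1..n}" "j \<notin> J" "I Int J = {}" "I Un J = L"
  using L ij by (auto simp: I_def J_def)
 have wT: "w \<in> T" using w N(2) by auto
 let ?s = "(if odd (card J) then -1 else 1) * (-1) ^ inversions I J :: complex"
 have "shift m (lead I i (lead J j w)) =
  tens (%f. P.opr (mon n (m, {})) (P.opr (mon n (0, I)) (\<sigma>P (P.opr (mon n (0, J)) (\<sigma>P f))))) (%g. V.X i (V.X j g)) w"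
  unfolding shift_def lead_def by (simp add: tens_tens plin_id plin_comp[OF P.opr_plin plin_parity_op])
 also have "\<dots> = tens (%f. pscale ?s (P.opr (mon n (m, L)) f)) (%g. V.X i (V.X j g)) w"
 proof (rule tens_eq[OF wT])
  fix f assume f: "f \<in> P.V"
  have "\<sigma>P (P.opr (mon n (0, J)) (\<sigma>P f)) = pscale (if odd (card J) then -1 else 1) (P.opr (mon n (0, J)) f)"
   using P.parity_op_opr[OF part_mon[OF IJ(3)] _ P.parity_op_V[OF f]] weyl_mon[OF IJ(3)] by simp
  thus "P.opr (mon n (m, {})) (P.opr (mon n (0, I)) (\<sigma>P (P.opr (mon n (0, J)) (\<sigma>P f)))) = pscale ?s (P.opr (mon n (m, L)) f)"
   using IJ mon_opr[OF IJ(1,3), of 0 0 f] mon_opr[of "{}" L m 0 f] L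
   by (simp add: plin_scale[OF P.opr_plin] plin_neg[OF P.opr_plin])
 qed simp
 finally have e: "shift m (lead I i (lead J j w)) = pscale ?s (tens (P.opr (mon n (m, L))) (%g. V.X i (V.X j g)) w)"
  by (simp add: tens_left del: pscale_minus_one)
 have "pscale ?s (shift m (lead I i (lead J j w))) \<in> N"
  by (intro sub_scale[OF N(1)] lead_lead w ij IJ)
 thus ?thesis unfolding e
  by (simp add: power_add[symmetric] mult_2[symmetric] split: if_splits)
qed

text \<open>The largest subspace of \<open>N\<close> stable under all multiplications. As
  \<open>N\<close> is stable under the derivations with constant coefficients, it is even stable
  under the whole Weyl superalgebra, which separates the tensor factors.\<close>

definition "core = {w \<in> T. \<forall>k I. I <= {1..n} --> left_op (P.opr (mon n (k, I))) w \<in> N}"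

lemma core_N: "w \<in> core ==> w \<in> N"
proof -
 assume w: "w \<in> core"
 hence "left_op (P.opr (mon n (0, {}))) w \<in> N" by (simp add: core_def)
 moreover have "left_op (P.opr (mon n (0, {}))) w = left_op (%f. f) w"
  by (rule tens_eq) (use w P.opr_one in "auto simp: core_def")
 ultimately show ?thesis by (simp add: tens_id)
qed

lemma core_sub: "subsp core"
 by (rule pv.subspaceI) (auto simp: core_def plin_add plin_scale plin_zero sub_0[OF T_sub] sub_0[OF N(1)]
  sub_add[OF T_sub] sub_add[OF N(1)] sub_scale[OF T_sub] sub_scale[OF N(1)])

text \<open>For a derivation with constant coefficients pi adds no term from sl(1,n).\<close>

lemma der_N:
 assumes "w \<in> N" "j \<le> n"
 shows "left_op (P.opr (der_op n j)) w \<in> N"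
proof -
 have e: "mon_field n 0 {} j = der_op n j"
  unfolding mon_field_def using mon_unit[OF der_laur] by auto
 show ?thesis
 proof (cases "j = 0")
  case True
  thus ?thesis using d0[OF assms(1)] e by simp
 next
  case False
  thus ?thesis using X1[OF assms(1), of j "{}" 0] assms(2) e by simp
 qed
qed

lemma left_comp:
 assumes "a \<in> weyl_ops n" "a' \<in> weyl_ops n"
 shows "left_op (P.opr a) (left_op (P.opr a') w) = left_op (P.opr (%f. a (a' f))) w"
 by (simp add: tens_tens plin_id P.opr_comp[OF assms])

lemma core_T: "w \<in> core ==> w \<in> T" by (simp add: core_def)

lemma left_T: "a \<in> weyl_ops n ==> w \<in> T ==> left_op (P.opr a) w \<in> T"
 by (rule tens_T) (auto intro: P.opr_V)

lemma core_mon: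
 assumes "w \<in> core" "J <= {1..n}"
 shows "left_op (P.opr (mon n (l, J))) w \<in> core"
proof -
 have "left_op (P.opr (mon n (k, I))) (left_op (P.opr (mon n (l, J))) w) \<in> N" if I: "I <= {1..n}" for k I
 proof -
  have "left_op (P.opr (mon n (k, I))) (left_op (P.opr (mon n (l, J))) w) =
   (if I Int J = {} then pscale ((-1) ^ inversions I J) (left_op (P.opr (mon n (k + l, I Un J))) w) else 0)"
   by (simp add: tens_tens plin_id mon_opr[OF I assms(2)] tens_left)
  also have "\<dots> \<in> N"
   using assms I by (simp add: core_def sub_scale[OF N(1)] sub_0[OF N(1)])
  finally show ?thesis .
 qed
 thus ?thesis using left_T[OF weyl_mon[OF assms(2)] core_T[OF assms(1)]] by (simp add: core_def)
qed

lemma core_der: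
 assumes w: "w \<in> core" and j: "j \<le> n"
 shows "left_op (P.opr (der_op n j)) w \<in> core"
proof -
 have "left_op (P.opr (mon n (k, I))) (left_op (P.opr (der_op n j)) w) \<in> N" if I: "I <= {1..n}" for k I
 proof -
  have mI: "mon n (k, J) \<in> weyl_ops n" if "J <= {1..n}" for k J using weyl_mon that .
  have dj: "der_op n j \<in> weyl_ops n" using j by (rule weyl_ops.der)
  have ww: "(%f. mon n (k, I) (der_op n j f)) \<in> weyl_ops n" "(%f. der_op n j (mon n (k, I) f)) \<in> weyl_ops n"
   by (rule weyl_comp[OF mI[OF I] dj], rule weyl_comp[OF dj mI[OF I]])
  \<comment> \<open>Commuting the derivation past the monomial costs only another multiplication,
    and multiplications keep \<open>w\<close> in \<open>N\<close>.\<close>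
  have key: "\<exists>c c' b. b \<in> weyl_ops n & left_op (P.opr b) w \<in> N \<and>
    (%f. mon n (k, I) (der_op n j f)) = (%f. pscale c (der_op n j (mon n (k, I) f)) + pscale c' (b f))"
  proof (cases "j = 0")
   case True
   have "(%f. mon n (k, I) (der_op n j f)) = (%f. pscale 1 (der_op n j (mon n (k, I) f)) + pscale (- of_int k) (mon n (k - 1, I) f))"
    using True I by (simp add: der0_mon)
   thus ?thesis using mI[OF I] w I unfolding core_def by blast
  next
   case False
   let ?s = "(-1) ^ card I :: complex" and ?c = "if j \<in> I then (-1) ^ inversions {j} I else 0 :: complex"
   have I': "I - {j} <= {1..n}" using I by auto
   have "(%f. mon n (k, I) (der_op n j f)) = (%f. pscale ?s (der_op n j (mon n (k, I) f)) + pscale (- ?s * ?c) (mon n (k, I - {j}) f))"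
    using False I by (auto simp: der_mon pv.scale_right_distrib power_add[symmetric] mult_2[symmetric] fun_eq_iff)
   thus ?thesis using mI[OF I'] w I' unfolding core_def by blast
  qed
  then obtain c c' b where b: "b \<in> weyl_ops n" "left_op (P.opr b) w \<in> N"
   "(%f. mon n (k, I) (der_op n j f)) = (%f. pscale c (der_op n j (mon n (k, I) f)) + pscale c' (b f))" by blast
  have "left_op (P.opr (mon n (k, I))) (left_op (P.opr (der_op n j)) w) =
   pscale c (left_op (P.opr (der_op n j)) (left_op (P.opr (mon n (k, I))) w)) + pscale c' (left_op (P.opr b) w)"
   unfolding left_comp[OF mI[OF I] dj] left_comp[OF dj mI[OF I]] b(3)
    P.opr_sum[OF weyl_ops.scale[OF ww(2)] weyl_ops.scale[OF b(1)]] P.opr_pscale[OF ww(2)] P.opr_pscale[OF b(1)]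
   by (simp add: tens_left)
  also have "\<dots> \<in> N"
   using w I b(2) by (intro sub_add[OF N(1)] sub_scale[OF N(1)] der_N[OF _ j]) (simp_all add: core_def)
  finally show ?thesis .
 qed
 thus ?thesis using left_T[OF weyl_ops.der[OF j] core_T[OF w]] by (simp add: core_def)
qed

lemma core_left:
 assumes "a \<in> weyl_ops n" "w \<in> core"
 shows "left_op (P.opr a) w \<in> core"
 using assms
proof (induction arbitrary: w rule: weyl_ops.induct)
 case (scale T c)
 thus ?case by (simp add: P.opr_pscale tens_left sub_scale[OF core_sub])
next
 case (add S T)
 thus ?case by (simp add: P.opr_sum tens_left sub_add[OF core_sub])
next
 case (comp S T)
 hence "left_op (P.opr S) (left_op (P.opr T) w) \<in> core" by blast
 thus ?case unfolding left_comp[OF comp.hyps] by (simp add: o_def)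
next
 case (xi i)
 thus ?case by (intro core_mon) auto
next
 case (der j)
 thus ?case by (intro core_der)
qed (auto intro: core_mon)

text \<open>The Koszul sign for moving a matrix of parity \<open>p\<close> past the first tensor
  factor.\<close>

definition "twist p = (if p then \<sigma>P else (%f. f))"

lemma twist: "plin (twist p)" "twist p (twist p f) = f" "f \<in> P.V ==> twist p f \<in> P.V"
 by (auto simp: twist_def plin_id P.parity_op_V)

definition "generators = {(True, Emat 0 i) | i. i \<in> {1..n}} Un {(True, Emat i 0) | i. i \<in> {1..n}}
  Un {(False, Gmat i j) | i j. i \<in> {1..n} & j \<in> {1..n}}"

lemma generators_sl: "(p, A) \<in> generators ==> A \<in> slc n"
 using V.gens_carrier by (auto simp: generators_def)

text \<open>Each generator \<open>A\<close> occurs in pi of some field with constant coefficient 1: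
  E_{0,i} for t d/dxi_i, E_{i,0} for xi_i d/dt, \<open>Gmat i j\<close> with
  \<open>i \<noteq> j\<close> for xi_i d/dxi_j, and \<open>Gmat i i\<close> for t d/dt + xi_i
  d/dxi_i.\<close>

lemma linear_field:
 assumes "(p, A) \<in> generators"
 shows "\<exists>x\<in>weyl_ops n. \<forall>w\<in>N. left_op (P.opr x) w + tens (twist p) (V.opr A) w \<in> N"
proof -
 have one: "tens (%f. P.opr (mon n (0, {})) (S f)) R w = tens S R w"
  if "w \<in> N" "!!f. f \<in> P.V ==> S f \<in> P.V" for S R w
  by (rule tens_eq) (use that N(2) P.opr_one in auto)
 consider i where "p = True" "A = Emat 0 i" "i \<in> {1..n}" | i where "p = True" "A = Emat i 0" "i \<in> {1..n}"
  | i j where "p = False" "A = Gmat i j" "i \<in> {1..n}" "j \<in> {1..n}"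
  using assms unfolding generators_def by blast
 thus ?thesis
 proof cases
  case (1 i)
  have "left_op (P.opr (mon_field n 1 {} i)) w + tens (twist p) (V.opr A) w \<in> N" if "w \<in> N" for w
   using X1[OF that 1(3), of "{}" 1] one[OF that P.parity_op_V] 1 by (simp add: twist_def)
  moreover have "mon_field n 1 {} i \<in> weyl_ops n" using 1(3) mon_field_weyl[of "{}" n i 1] by simp
  ultimately show ?thesis by blast
 next
  case (2 i)
  have "left_op (P.opr (mon_field n 0 {i} 0)) w + tens (twist p) (V.opr A) w \<in> N" if "w \<in> N" for w
   using Ef[OF that 2(3)] 2 by (simp add: twist_def)
  moreover have "mon_field n 0 {i} 0 \<in> weyl_ops n" using 2(3) mon_field_weyl[of "{i}" n 0 0] by simp
  ultimately show ?thesis by blast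
 next
  case (3 i j)
  show ?thesis
  proof (cases "i = j")
   case True
   have "left_op (P.opr (euler_field n i)) w + tens (twist p) (V.opr A) w \<in> N" if "w \<in> N" for w
    using Gf[OF that 3(3)] 3 True by (simp add: twist_def)
   moreover have "euler_field n i \<in> weyl_ops n" using euler_field(2)[OF 3(3)] weyl_partD(1) by blast
   ultimately show ?thesis by blast
  next
   case False
   have "left_op (P.opr (mon_field n 0 {i} j)) w + tens (twist p) (V.opr A) w \<in> N" if "w \<in> N" for w
    using X1[OF that 3(4), of "{i}" 0] one[OF that, of "%f. f"] 3 False by (simp add: twist_def)
   moreover have "mon_field n 0 {i} j \<in> weyl_ops n" using 3 mon_field_weyl[of "{i}" n j 0] by simp
   ultimately show ?thesis by blast
  qed
 qed
qed

lemma core_twist: "w \<in> core ==> left_op (twist p) w \<in> core"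
proof (cases p)
 case True
 assume w: "w \<in> core"
 have "left_op (twist p) w = left_op (P.opr P.gam) w"
  by (rule tens_eq[OF core_T[OF w]]) (use True P.gam(2) in "auto simp: twist_def")
 thus ?thesis using core_left[OF P.gam(1) w] by simp
qed (simp add: twist_def tens_id)

text \<open>The operator \<open>x\<close> of \<open>linear_field\<close> preserves the core, so on
  the core the summand with \<open>A\<close> alone has values in \<open>N\<close>. The twist in it
  is cancelled by that of the first factor, which preserves the core as well.\<close>

lemma core_right:
 assumes g: "(p, A) \<in> generators" and w: "w \<in> core"
 shows "right_op (V.opr A) w \<in> core"
proof -
 obtain x where x: "x \<in> weyl_ops n" "!!w. w \<in> N ==> left_op (P.opr x) w + tens (twist p) (V.opr A) w \<in> N"
  using linear_field[OF g] by blast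
 have tw: "tens (twist p) (V.opr A) w \<in> N" if "w \<in> core" for w
  using sub_diff[OF N(1) x(2)[OF core_N[OF that]] core_N[OF core_left[OF x(1) that]]] by simp
 have "left_op (P.opr (mon n (k, I))) (right_op (V.opr A) w) \<in> N" if I: "I <= {1..n}" for k I
 proof -
  have "tens (twist p) (V.opr A) (left_op (twist p) (left_op (P.opr (mon n (k, I))) w)) \<in> N"
   by (intro tw core_twist core_mon w I)
  thus ?thesis by (simp add: tens_tens plin_id twist)
 qed
 moreover have "right_op (V.opr A) w \<in> T"
  by (rule tens_T[OF core_T[OF w]]) (auto intro: V.opr_V generators_sl[OF g])
 ultimately show ?thesis by (simp add: core_def)
qed

lemma core_parity:
 assumes w: "w \<in> core"
 shows "right_op \<sigma>V w \<in> core"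
proof -
 have "left_op (P.opr (mon n (k, I))) (right_op \<sigma>V w) \<in> N" if I: "I <= {1..n}" for k I
 proof -
  have "tens \<sigma>P \<sigma>V (left_op (twist True) (left_op (P.opr (mon n (k, I))) w)) \<in> N"
   by (intro par core_N core_twist core_mon w I)
  thus ?thesis by (simp add: tens_tens plin_id twist_def)
 qed
 moreover have "right_op \<sigma>V w \<in> T"
  by (rule tens_T[OF core_T[OF w]]) (auto intro: V.parity_op_V)
 ultimately show ?thesis by (simp add: core_def)
qed

text \<open>The core is stable under the operators on both tensor factors and lies in the proper
  subspace \<open>N\<close>.\<close>

lemma core_zero: "core = {0}"
proof -
 have "core = {0} | core = T"
 proof (rule tensor_simple[OF core_sub])
  show "right_op (V.X i) w \<in> core" if "i \<in> {1..n}" "w \<in> core" for i w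
   by (rule core_right[of True]) (use that in "auto simp: generators_def")
  show "right_op (V.Y i) w \<in> core" if "i \<in> {1..n}" "w \<in> core" for i w
   by (rule core_right[of True]) (use that in "auto simp: generators_def")
  show "right_op (V.H i j) w \<in> core" if "i \<in> {1..n}" "j \<in> {1..n}" "w \<in> core" for i j w
   by (rule core_right[of False]) (use that in "auto simp: generators_def")
 qed (auto intro: core_T core_left core_parity)
 thus ?thesis using core_N N(2,4) by blast
qed

section \<open>Operators on the second factor that annihilate N\<close>

definition "kills R \<longleftrightarrow> plin R & (\<forall>w\<in>N. right_op R w = 0)"

text \<open>By \<open>mon_quadratic\<close> all multiples of the image of \<open>w\<close> lie in
  \<open>N\<close>; so the image lies in the core, which is zero.\<close>

lemma kills_quadratic:
 assumes "i \<in> {1..n}" "j \<in> {1..n}" "i ~= j"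
 shows "kills (%g. V.X i (V.X j g))"
proof -
 have "right_op (%g. V.X i (V.X j g)) w = 0" if w: "w \<in> N" for w
 proof -
  have "left_op (P.opr (mon n (k, I))) (right_op (%g. V.X i (V.X j g)) w) \<in> N" if "I <= {1..n}" for k I
   using mon_quadratic[OF w assms that, of k] by (simp add: tens_tens plin_id)
  moreover have "right_op (%g. V.X i (V.X j g)) w \<in> T"
   by (rule tens_T) (use w N(2) assms V.gens_V in auto)
  ultimately have "right_op (%g. V.X i (V.X j g)) w \<in> core" by (simp add: core_def)
  thus ?thesis using core_zero by simp
 qed
 thus ?thesis by (simp add: kills_def plin_comp[OF V.opr_plin V.opr_plin])
qed

text \<open>Operators on different factors commute. Hence, when \<open>R\<close> is applied to the
  element of \<open>N\<close> supplied by \<open>linear_field\<close>, the summand with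
  \<open>x\<close> disappears and the one with \<open>A\<close> must vanish too.\<close>

lemma kills_comp:
 assumes R: "kills R" and g: "(p, A) \<in> generators"
 shows "kills (%v. R (V.opr A v))"
proof -
 have pR: "plin R" using R by (simp add: kills_def)
 obtain x where x: "x \<in> weyl_ops n" "!!w. w \<in> N ==> left_op (P.opr x) w + tens (twist p) (V.opr A) w \<in> N"
  using linear_field[OF g] by blast
 have "right_op (%v. R (V.opr A v)) w = 0" if w: "w \<in> N" for w
 proof -
  have "right_op R (left_op (P.opr x) w) = left_op (P.opr x) (right_op R w)"
   by (simp add: tens_tens plin_id pR)
  also have "\<dots> = 0" using R w by (simp add: kills_def plin_zero)
  finally have "right_op R (tens (twist p) (V.opr A) w) = 0"
   using R x(2)[OF w] unfolding kills_def by (metis plin_add[OF plin_tens] add_0)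
  hence "left_op (twist p) (right_op R (tens (twist p) (V.opr A) w)) = 0" by (simp add: plin_zero)
  thus ?thesis by (simp add: tens_tens plin_id pR twist)
 qed
 thus ?thesis by (simp add: kills_def plin_comp[OF pR V.opr_plin])
qed

lemma kills_parity:
 assumes R: "kills R"
 shows "kills (%v. R (\<sigma>V v))"
proof -
 have pR: "plin R" using R by (simp add: kills_def)
 have "right_op (%v. R (\<sigma>V v)) w = 0" if w: "w \<in> N" for w
 proof -
  have "left_op \<sigma>P (right_op R (tens \<sigma>P \<sigma>V w)) = 0" using R par[OF w] by (simp add: kills_def plin_zero)
  thus ?thesis by (simp add: tens_tens plin_id pR)
 qed
 thus ?thesis by (simp add: kills_def plin_comp[OF pR plin_parity_op])
qed

text \<open>The vectors annihilated by every operator that kills \<open>N\<close> form a submodule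
  of the second factor, by \<open>kills_comp\<close> and \<open>kills_parity\<close>. It is nonzero
  because it contains the coslices of the elements of \<open>N\<close>, so it is everything.\<close>

lemma quadratic_zero:
 assumes "i \<in> {1..n}" "j \<in> {1..n}" "v \<in> V.V"
 shows "V.X i (V.X j v) = 0"
proof (cases "i = j")
 case True
 have "V.X i (V.X i v) = - V.X i (V.X i v)" using V.relations(1)[OF assms(1) assms(1) assms(1) assms(1) assms(3)] .
 hence "cf (V.X i (V.X i v)) b = - cf (V.X i (V.X i v)) b" for b by (metis lookup_uminus)
 hence "V.X i (V.X i v) = 0" by (intro poly_mapping_eqI) (simp add: eq_neg_iff_add_eq_0)
 thus ?thesis using True by simp
next
 case False
 let ?W = "{v \<in> V.V. \<forall>R. kills R --> R v = 0}"
 have "?W = {0} | ?W = V.V"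
 proof (rule V.simple_gens)
  show "subsp ?W"
   by (rule pv.subspaceI) (auto simp: kills_def plin_add plin_scale plin_zero sub_add[OF V.V_sub]
    sub_scale[OF V.V_sub] sub_0[OF V.V_sub])
  show "\<sigma>V v \<in> ?W" if "v \<in> ?W" for v using that kills_parity V.parity_op_V by auto
  show "V.X i v \<in> ?W" if "i \<in> {1..n}" "v \<in> ?W" for i v
  proof -
   have "(True, Emat 0 i) \<in> generators" using that by (auto simp: generators_def)
   hence "R (V.X i v) = 0" if "kills R" for R
    using kills_comp[OF that] \<open>v \<in> ?W\<close> by blast
   thus ?thesis using that V.gens_V(1) by simp
  qed
  show "V.Y i v \<in> ?W" if "i \<in> {1..n}" "v \<in> ?W" for i v
  proof -
   have "(True, Emat i 0) \<in> generators" using that by (auto simp: generators_def)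
   hence "R (V.Y i v) = 0" if "kills R" for R
    using kills_comp[OF that] \<open>v \<in> ?W\<close> by blast
   thus ?thesis using that V.gens_V(2) by simp
  qed
  show "V.H i j v \<in> ?W" if "i \<in> {1..n}" "j \<in> {1..n}" "v \<in> ?W" for i j v
  proof -
   have "(False, Gmat i j) \<in> generators" using that by (auto simp: generators_def)
   hence "R (V.H i j v) = 0" if "kills R" for R
    using kills_comp[OF that] \<open>v \<in> ?W\<close> by blast
   thus ?thesis using that V.gens_V(3) by simp
  qed
 qed auto
 moreover have "?W ~= {0}"
 proof -
  obtain w where w: "w \<in> N" "w ~= 0" using N(1,3) sub_0 by blast
  then obtain b c where bc: "cf w (b, c) ~= 0" by (metis poly_mapping_eqI lookup_zero surj_pair)
  have "supp w <= BP \<times> BV" using w N(2) by (auto simp: T_def)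
  hence "coslice w b \<in> V.V" using coslice_supp by (simp add: V.V_def)
  moreover have "R (coslice w b) = 0" if "kills R" for R
  proof -
   have "plin R" "right_op R w = 0" using that w by (auto simp: kills_def)
   hence "R (coslice w b) = coslice 0 b" using coslice_tens[of R w b] by simp
   thus ?thesis by (simp add: plin_zero[OF plin_coslice])
  qed
  moreover have "coslice w b ~= 0" using bc cf_coslice[of w b c] by auto
  ultimately show ?thesis by blast
 qed
 ultimately have "?W = V.V" by blast
 thus ?thesis using kills_quadratic[OF assms(1,2) False] assms(3) by blast
qed

end

end

section \<open>Submodules of Shen-Larsson modules\<close>

lemma module_quotient_free:
 assumes "subsp R" "R <= {f. supp f <= C}"
 shows "module_quotient (free_space C d) R"
 by (intro module_quotient.intro module_quotient_axioms.intro module_free_space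
   submodule_free_space[THEN iffD2] conjI assms)

lemma module_with_action: "Module.module complex_field (with_action M a) \<longleftrightarrow> Module.module complex_field M"
 by (simp add: Module.module_def module_axioms_def abelian_group_def abelian_monoid_def abelian_group_axioms_def
  Group.comm_monoid_def Group.monoid_def comm_monoid_axioms_def comm_group_def group_def group_axioms_def Units_def)

lemma free_space_minus: "f \<in> carrier (free_space C d) ==> g \<in> carrier (free_space C d) ==>
  f \<ominus>\<^bsub>free_space C d\<^esub> g = f - g"
proof -
 assume fg: "f \<in> carrier (free_space C d)" "g \<in> carrier (free_space C d)"
 interpret Module.module complex_field "free_space C d" by (rule module_free_space)
 have "\<ominus>\<^bsub>free_space C d\<^esub> g = - g"
  using complex_module(8)[OF module_axioms fg(2)] by simp
 thus ?thesis by (simp add: a_minus_def)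
qed

section \<open>Images of the fields under pi\<close>

lemma pi_mat_mon_field:
 assumes "i \<in> {1..n}" "I <= {1..n}" "i \<notin> I"
 shows "pi_mat n (mon_field n k I i) b = (%s j. if s \<le> n & j = i then cf (pi_coeff s (k, I)) b else 0)"
proof -
 have "mon_field n k I i (gen j) = (if j = i then bvec (k, I) else 0)" if "j \<le> n" for j
 proof (cases "j = 0")
  case True
  thus ?thesis using assms by (simp add: gen_def mon_field_bvec)
 next
  case False
  hence "{j} <= {1..n}" using that by auto
  thus ?thesis using False assms by (auto simp: gen_def mon_field_bvec)
 qed
 thus ?thesis using assms(1) by (auto simp: pi_mat_def fun_eq_iff plin_zero)
qed

text \<open>The t-derivative of t^k xi_I gives the multiple of E_{0,i}, and its derivative by xi_s
  that of E_{s,i}. The monomials that arise are pairwise distinct, so each of them carries a single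
  matrix unit.\<close>

lemma pi_mat_X1:
 assumes "i \<in> {1..n}" "I <= {1..n}" "i \<notin> I"
 shows "pi_mat n (mon_field n k I i) (k - 1, I) = (%a b. of_int k * Emat 0 i a b)"
  "s \<in> I ==> pi_mat n (mon_field n k I i) (k, I - {s}) = (%a b. (-1) ^ (card I - 1) * (-1) ^ inversions {s} I * Emat s i a b)"
  "b ~= (k - 1, I) ==> (!!s. s \<in> I ==> b ~= (k, I - {s})) ==> pi_mat n (mon_field n k I i) b = (%a b. 0)"
proof -
 have c: "cf (pi_coeff s (k, I)) b = (if s = 0 then (if b = (k - 1, I) then of_int k else 0)
   else if s \<in> I & b = (k, I - {s}) then (-1) ^ (card I - 1) * (-1) ^ inversions {s} I else 0)" for s b
  by (auto simp: pi_coeff_def der_basis_def inversions_single_left lookup_single when_def)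
 have I0: "0 \<notin> I" "!!s. s \<in> I ==> s \<le> n" using assms(2) by auto
 show "pi_mat n (mon_field n k I i) (k - 1, I) = (%a b. of_int k * Emat 0 i a b)"
  unfolding pi_mat_mon_field[OF assms] c by (auto simp: Emat_def fun_eq_iff)
 show "pi_mat n (mon_field n k I i) (k, I - {s}) = (%a b. (-1) ^ (card I - 1) * (-1) ^ inversions {s} I * Emat s i a b)" if "s \<in> I"
 proof -
  have "I - {s} = I - {t} \<longleftrightarrow> s = t" if "t \<in> I" for t using that \<open>s \<in> I\<close> by blast
  moreover have "s ~= 0" using I0 that by metis
  ultimately show ?thesis unfolding pi_mat_mon_field[OF assms] c using that I0 by (auto simp: Emat_def fun_eq_iff)
 qed
 show "pi_mat n (mon_field n k I i) b = (%a b. 0)" if "b ~= (k - 1, I)" "!!s. s \<in> I ==> b ~= (k, I - {s})"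
  unfolding pi_mat_mon_field[OF assms] c using that by (auto simp: fun_eq_iff)
qed

lemma pi_coeff_gen:
 "pi_coeff s (1, {}) = (if s = 0 then bvec (0, {}) else 0)"
 "pi_coeff s (0, {}) = 0"
 "i ~= 0 ==> pi_coeff s (0, {i}) = (if s = i then bvec (0, {}) else 0)"
proof -
 show "i ~= 0 ==> pi_coeff s (0, {i}) = (if s = i then bvec (0, {}) else 0)"
  by (auto simp: pi_coeff_def der_basis_def Collect_conv_if)
qed (auto simp: pi_coeff_def der_basis_def)

lemma pi_mat_der0: "pi_mat n (mon_field n 0 {} 0) b = (%a b. 0)"
proof -
 have "mon_field n 0 {} 0 (gen j) = (if j = 0 then bvec (0, {}) else 0)" if "j \<le> n" for j
  using that by (auto simp: gen_def mon_field_bvec)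
 thus ?thesis by (auto simp: pi_mat_def fun_eq_iff plin_zero pi_coeff_gen)
qed

lemma pi_mat_Y:
 assumes "i \<in> {1..n}"
 shows "pi_mat n (mon_field n 0 {i} 0) b = (if b = (0, {}) then Emat i 0 else (%a b. 0))"
proof -
 have "mon_field n 0 {i} 0 (gen j) = (if j = 0 then bvec (0, {i}) else 0)" if "j \<le> n" for j
  using that assms by (auto simp: gen_def mon_field_bvec)
 thus ?thesis using assms
  by (auto simp: pi_mat_def fun_eq_iff plin_zero pi_coeff_gen Emat_def lookup_single when_def)
qed

lemma pi_mat_euler:
 assumes "i \<in> {1..n}"
 shows "pi_mat n (euler_field n i) b = (if b = (0, {}) then Gmat i i else (%a b. 0))"
proof -
 have "euler_field n i (gen j) = (if j = 0 then bvec (1, {}) else if j = i then bvec (0, {i}) else 0)" if "j \<le> n" for j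
  using that assms euler_field_bvec[OF assms] by (auto simp: gen_def)
 thus ?thesis using assms
  by (auto simp: pi_mat_def fun_eq_iff plin_zero pi_coeff_gen Gmat_def Emat_def lookup_single when_def)
qed

lemma mat_part_Emat:
 "i ~= 0 ==> mat_part q (%a b. c * Emat 0 i a b) = (%a b. (if q then c else 0) * Emat 0 i a b)"
 "i ~= 0 ==> mat_part q (%a b. c * Emat i 0 a b) = (%a b. (if q then c else 0) * Emat i 0 a b)"
 "i ~= 0 ==> j ~= 0 ==> mat_part q (%a b. c * Gmat i j a b) = (%a b. (if q then 0 else c) * Gmat i j a b)"
 by (auto simp: mat_part_def Emat_def Gmat_def fun_eq_iff)

context graded_coordinates
begin

lemma component_closed: "x \<in> carrier M ==> component M p x \<in> part M p"
 using super_space_decomp[OF ss, of x p] by metis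

lemma sum_components:
 assumes "x \<in> carrier M"
 shows "(\<Sum>r\<in>UNIV. pscale (ksign q r) (kap (component M r x))) = (if q then parity_op d (kap x) else kap x)"
 by (rule poly_mapping_eqI)
  (simp add: UNIV_bool parity_op_component[OF assms] ksign_def lookup_add lookup_minus field_simps)

end

context tensor_setting
begin

text \<open>As the bases lie in the carriers, \<open>T\<close> is a subspace of \<open>PS\<close>.
  The map \<open>Th\<close> turns out to be a projection of \<open>PS\<close> onto \<open>T\<close>
  with kernel \<open>R\<close>; so \<open>T\<close> is the tensor product in coordinates.\<close>

definition "PS = {f :: 'p \<times> 'v \<Rightarrow>\<^sub>0 complex. supp f <= carrier MP \<times> carrier MV}"
definition "R = tensor_null MP MV"
definition "Th = linext (%(y, v). tp (kP y) (kV v))"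

abbreviation "pairs \<equiv> pair_space MP MV"
abbreviation cls ("\<langle>_\<rangle>") where "\<langle>f\<rangle> \<equiv> R +>\<^bsub>pairs\<^esub> f"

lemma pairs_simps [simp]: "carrier pairs = PS" "x \<oplus>\<^bsub>pairs\<^esub> y = x + y" "c \<odot>\<^bsub>pairs\<^esub> x = pscale c x"
 "\<zero>\<^bsub>pairs\<^esub> = 0" "part pairs p = {f. supp f <= (\<Union>q. part MP (p ~= q) \<times> part MV q)}"
 by (simp_all add: pair_space_def PS_def)

lemma PS_sub: "subsp PS" unfolding PS_def by (rule subspace_supp)

lemma bvec_PS: "y \<in> carrier MP ==> v \<in> carrier MV ==> bvec (y, v) \<in> PS"
 by (simp add: PS_def)

lemma single_PS: "y \<in> carrier MP ==> v \<in> carrier MV ==> sgl (y, v) c \<in> PS"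
 using sub_scale[OF PS_sub bvec_PS, of y v c] by simp

lemma rels_PS: "bilinear_rels MP MV <= PS"
proof
 fix r assume "r \<in> bilinear_rels MP MV"
 thus "r \<in> PS" unfolding bilinear_rels_def
  by (elim UnE CollectE exE conjE; hypsubst)
   (intro sub_diff[OF PS_sub] sub_scale[OF PS_sub] bvec_PS P.M_closed V.M_closed; assumption)+
qed

lemma R_eq: "R = pv.span (bilinear_rels MP MV)"
 unfolding R_def tensor_null_def pair_space_def using rels_PS
 by (intro lin_span_free_space) (simp add: PS_def)

lemma R_sub: "subsp R" by (simp add: R_eq)

lemma R_PS: "R <= PS"
 unfolding R_eq by (rule pv.span_minimal[OF rels_PS PS_sub])

sublocale quot: module_quotient pairs R
 unfolding pair_space_def
 by (rule module_quotient_free[OF R_sub]) (use R_PS in "simp add: PS_def")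

lemma pairs_minus: "f \<in> PS ==> g \<in> PS ==> f \<ominus>\<^bsub>pairs\<^esub> g = f - g"
 unfolding pair_space_def by (rule free_space_minus) (simp_all add: PS_def)

lemma cls_eq: "f \<in> PS ==> g \<in> PS ==> \<langle>f\<rangle> = \<langle>g\<rangle> \<longleftrightarrow> f - g \<in> R"
 using quot.coset_eq_iff[of f g] by (simp add: pairs_minus)

lemma plin_Th [simp]: "plin Th" by (simp add: Th_def)

lemma Th_single: "Th (sgl (y, v) c) = pscale c (tp (kP y) (kV v))"
 by (simp add: Th_def)

lemma Th_R: "f \<in> R ==> Th f = 0"
proof -
 assume "f \<in> R"
 hence "Th f \<in> {0}" unfolding R_eq
 proof (rule plin_span[OF plin_Th pv.subspace_single_0, rotated])
  fix r assume "r \<in> bilinear_rels MP MV"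
  thus "Th r \<in> {0}" unfolding bilinear_rels_def
   by (elim UnE CollectE exE conjE; hypsubst)
    (simp_all add: plin_diff[OF plin_Th] plin_scale[OF plin_Th] Th_single tp_linear P.k_add V.k_add P.k_scale V.k_scale)
 qed
 thus ?thesis by simp
qed

lemma T_PS: "T <= PS" unfolding T_def PS_def using P.B_M V.B_M by auto

lemma Th_T: "f \<in> PS ==> Th f \<in> T"
proof -
 assume "f \<in> PS"
 hence "supp f <= carrier MP \<times> carrier MV" by (simp add: PS_def)
 thus ?thesis
 proof (rule supp_image[OF plin_Th T_sub])
  fix b assume "b \<in> carrier MP \<times> carrier MV"
  thus "Th (bvec b) \<in> T" using P.k_V V.k_V by (cases b) (auto simp: Th_single intro: tp_T)
 qed
qed

lemma Th_id: "w \<in> T ==> Th w = w"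
 by (rule plin_eqI[OF plin_Th plin_id, of w "BP \<times> BV"])
  (auto simp: T_def Th_single P.k_basis V.k_basis)

text \<open>Modulo the bilinear relations each argument can be expanded in its basis: the second
  while the first is a basis vector, and then the first.\<close>

lemma Th_mod:
 assumes "f \<in> PS"
 shows "f - Th f \<in> R"
proof -
 have rel: "r \<in> R" if "r \<in> bilinear_rels MP MV" for r using that by (simp add: R_eq pv.span_base)
 have L: "bvec (x \<oplus>\<^bsub>MP\<^esub> y, v) - bvec (x, v) - bvec (y, v) \<in> R" "bvec (c \<odot>\<^bsub>MP\<^esub> x, v) - pscale c (bvec (x, v)) \<in> R"
  if "x \<in> carrier MP" "y \<in> carrier MP" "v \<in> carrier MV" for x y v c
  using that by (intro rel, unfold bilinear_rels_def, blast)+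
 have L': "bvec (x, v \<oplus>\<^bsub>MV\<^esub> w) - bvec (x, v) - bvec (x, w) \<in> R" "bvec (x, c \<odot>\<^bsub>MV\<^esub> v) - pscale c (bvec (x, v)) \<in> R"
  if "x \<in> carrier MP" "v \<in> carrier MV" "w \<in> carrier MV" for x v w c
  using that by (intro rel, unfold bilinear_rels_def, blast)+
 have Z: "bvec (\<zero>\<^bsub>MP\<^esub>, v) \<in> R" if "v \<in> carrier MV" for v
  using L(2)[OF P.M_closed(3) P.M_closed(3) that, of 0] complex_module(6)[OF P.module P.M_closed(3)] by simp
 have Z': "bvec (x, \<zero>\<^bsub>MV\<^esub>) \<in> R" if "x \<in> carrier MP" for x
  using L'(2)[OF that V.M_closed(3) V.M_closed(3), of 0] complex_module(6)[OF V.module V.M_closed(3)] by simp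
 have basis: "bvec (b, v) - tp (kP b) (kV v) \<in> R" if b: "b \<in> BP" and v: "v \<in> carrier MV" for b v
  using v
 proof (rule V.V_induct)
  have bM: "b \<in> carrier MP" using b P.B_M by auto
  show "bvec (b, c) - tp (kP b) (kV c) \<in> R" if "c \<in> BV" for c
   using that b by (simp add: P.k_basis V.k_basis sub_0[OF R_sub])
  show "bvec (b, \<zero>\<^bsub>MV\<^esub>) - tp (kP b) (kV \<zero>\<^bsub>MV\<^esub>) \<in> R"
   using Z'[OF bM] by (simp add: V.k_zero tp_linear)
  show "bvec (b, x \<oplus>\<^bsub>MV\<^esub> y) - tp (kP b) (kV (x \<oplus>\<^bsub>MV\<^esub> y)) \<in> R"
   if h: "x \<in> carrier MV" "y \<in> carrier MV" "bvec (b, x) - tp (kP b) (kV x) \<in> R" "bvec (b, y) - tp (kP b) (kV y) \<in> R" for x y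
   using sub_add[OF R_sub L'(1)[OF bM h(1,2)] sub_add[OF R_sub h(3,4)]]
   by (simp add: V.k_add h tp_linear algebra_simps)
  show "bvec (b, c \<odot>\<^bsub>MV\<^esub> x) - tp (kP b) (kV (c \<odot>\<^bsub>MV\<^esub> x)) \<in> R"
   if h: "x \<in> carrier MV" "bvec (b, x) - tp (kP b) (kV x) \<in> R" for c x
   using sub_add[OF R_sub L'(2)[OF bM h(1) h(1), of c] sub_scale[OF R_sub h(2), of c]]
   by (simp add: V.k_scale h tp_linear pv.scale_right_diff_distrib)
 qed
 have all: "bvec (y, v) - tp (kP y) (kV v) \<in> R" if y: "y \<in> carrier MP" and v: "v \<in> carrier MV" for y v
  using y
 proof (rule P.V_induct)
  show "bvec (b, v) - tp (kP b) (kV v) \<in> R" if "b \<in> BP" for b using basis that v by blast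
  show "bvec (\<zero>\<^bsub>MP\<^esub>, v) - tp (kP \<zero>\<^bsub>MP\<^esub>) (kV v) \<in> R"
   using Z[OF v] by (simp add: P.k_zero tp_linear)
  show "bvec (x \<oplus>\<^bsub>MP\<^esub> y, v) - tp (kP (x \<oplus>\<^bsub>MP\<^esub> y)) (kV v) \<in> R"
   if h: "x \<in> carrier MP" "y \<in> carrier MP" "bvec (x, v) - tp (kP x) (kV v) \<in> R" "bvec (y, v) - tp (kP y) (kV v) \<in> R" for x y
   using sub_add[OF R_sub L(1)[OF h(1,2) v] sub_add[OF R_sub h(3,4)]]
   by (simp add: P.k_add h tp_linear algebra_simps)
  show "bvec (c \<odot>\<^bsub>MP\<^esub> x, v) - tp (kP (c \<odot>\<^bsub>MP\<^esub> x)) (kV v) \<in> R"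
   if h: "x \<in> carrier MP" "bvec (x, v) - tp (kP x) (kV v) \<in> R" for c x
   using sub_add[OF R_sub L(2)[OF h(1) h(1) v, of c] sub_scale[OF R_sub h(2), of c]]
   by (simp add: P.k_scale h tp_linear pv.scale_right_diff_distrib)
 qed
 have "supp f <= carrier MP \<times> carrier MV" using assms by (simp add: PS_def)
 thus ?thesis
  by (rule supp_image[OF plin_minus[OF plin_id plin_Th] R_sub]) (use all in "auto simp: Th_single")
qed

lemma cls_Th: "f \<in> PS ==> \<langle>Th f\<rangle> = \<langle>f\<rangle>"
 using Th_mod[of f] Th_T[of f] T_PS sub_neg[OF R_sub, of "f - Th f"] by (subst cls_eq) auto

abbreviation "F \<equiv> F_module n MP MV"

lemma F_simps [simp]: "carrier F = (%f. \<langle>f\<rangle>) ` PS" "\<zero>\<^bsub>F\<^esub> = R" "add F = set_add pairs"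
 "module.smult F = (%c. descend pairs R (%x. c \<odot>\<^bsub>pairs\<^esub> x))"
 "part F p = (%f. \<langle>f\<rangle>) ` part pairs p"
 "act F x = descend pairs R (linext (shen_larsson_pair n MP MV x))"
 using quot.carrier_quot unfolding F_module_def tensor_def R_def[symmetric] by simp_all

lemma F_zero: "\<langle>0\<rangle> = R"
 using quot.a_coset_add_zero R_PS by simp

lemma module_F: "Module.module complex_field F"
 unfolding F_module_def tensor_def R_def[symmetric] module_with_action by (rule quot.module_quot)

lemma pair_op_PS:
 assumes x: "x \<in> weyl_ops n" and S: "{b. pi_mat n x b ~= (%s j. 0)} <= UNIV \<times> Pow {1..n}"
  and sl: "!!b. pi_mat n x b \<in> slc n" and f: "f \<in> PS"
 shows "linext (shen_larsson_pair n MP MV x) f \<in> PS"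
proof -
 have "supp f <= carrier MP \<times> carrier MV" using f by (simp add: PS_def)
 thus ?thesis
 proof (rule supp_image[OF plin_linext PS_sub])
  fix yv assume "yv \<in> carrier MP \<times> carrier MV"
  then obtain y v where yv: "yv = (y, v)" "y \<in> carrier MP" "v \<in> carrier MV" by auto
  have "sgl (act MP (mon n b) (component MP r y), act MV (component (sl n) q (pi_mat n x b)) v) (ksign q r) \<in> PS"
   if b: "b \<in> {b. pi_mat n x b ~= (%s j. 0)}" for b q r
  proof (rule single_PS)
   have "mon n b \<in> weyl_ops n" using S b weyl_mon by (cases b) auto
   thus "act MP (mon n b) (component MP r y) \<in> carrier MP"
    using P.component_closed[OF yv(2)] super_space_part_sub[OF P.ss] by (intro P.act_closed) auto
   show "act MV (component (sl n) q (pi_mat n x b)) v \<in> carrier MV"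
    by (intro V.act_closed yv) (simp add: component_sl[OF sl] mat_part_sl[OF sl])
  qed
  hence "shen_larsson_pair n MP MV x (y, v) \<in> PS"
   unfolding shen_larsson_pair_def prod.case
   by (intro sub_add[OF PS_sub] sub_sum[OF PS_sub] bvec_PS P.act_closed yv) (use x in auto)
  thus "linext (shen_larsson_pair n MP MV x) (bvec yv) \<in> PS" using yv by simp
 qed
qed

text \<open>The sum over the components of \<open>y\<close> with their Koszul signs is
  \<open>y\<close> for an even matrix and its parity image for an odd one, by
  \<open>sum_components\<close>. In this way the signs turn into \<open>\<sigma>P\<close>. The set
  \<open>S\<close> may exceed the support of \<open>pi_mat\<close>, as zero matrices contribute
  nothing.\<close>

lemma Th_pair_op:
 assumes x: "x \<in> weyl_ops n" and S: "finite S" "S <= UNIV \<times> Pow {1..n}" "!!b. b \<notin> S ==> pi_mat n x b = (%s j. 0)"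
  and sl: "!!b. pi_mat n x b \<in> slc n" and w: "w \<in> T"
 shows "Th (linext (shen_larsson_pair n MP MV x) w) = left_op (P.opr x) w +
  (\<Sum>b\<in>S. tens (P.opr (mon n b)) (V.opr (mat_part False (pi_mat n x b))) w
   + tens (%f. P.opr (mon n b) (\<sigma>P f)) (V.opr (mat_part True (pi_mat n x b))) w)"
proof -
 let ?G = "%w. left_op (P.opr x) w +
  (\<Sum>b\<in>S. tens (P.opr (mon n b)) (V.opr (mat_part False (pi_mat n x b))) w
   + tens (%f. P.opr (mon n b) (\<sigma>P f)) (V.opr (mat_part True (pi_mat n x b))) w)"
 have sw: "supp w <= BP \<times> BV" using w by (simp add: T_def)
 show ?thesis
 proof (rule plin_eqI[of "%w. Th (linext (shen_larsson_pair n MP MV x) w)" ?G, OF _ _ sw])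
  show "plin (%w. Th (linext (shen_larsson_pair n MP MV x) w))" by (rule plin_comp[OF plin_Th plin_linext])
  show "plin ?G" by (intro plin_plus plin_sum_fun plin_tens)
  fix bc assume "bc \<in> BP \<times> BV"
  then obtain y v where bc: "bc = (y, v)" "y \<in> BP" "v \<in> BV" by auto
  have y: "y \<in> carrier MP" and v: "v \<in> carrier MV" using bc P.B_M V.B_M by auto
  have ky: "kP y = bvec y" "kV v = bvec v" using bc by (auto simp: P.k_basis V.k_basis)
  have mw: "mon n b \<in> carrier (weyl n)" if "b \<in> S" for b using that S(2) weyl_mon by (cases b) auto
  have slp: "mat_part q (pi_mat n x b) \<in> slc n" for q b by (rule mat_part_sl[OF sl])
  have cc: "component MP r y \<in> carrier MP" for r using P.component_closed[OF y] super_space_part_sub[OF P.ss] by blast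
  define t where "t q b = tp (P.opr (mon n b) (if q then \<sigma>P (bvec y) else bvec y)) (V.opr (mat_part q (pi_mat n x b)) (bvec v))" for q b
  have tq: "(\<Sum>r\<in>UNIV. Th (sgl (act MP (mon n b) (component MP r y), act MV (component (sl n) q (pi_mat n x b)) v) (ksign q r))) = t q b"
   if b: "b \<in> S" for q b
  proof -
   have "(\<Sum>r\<in>UNIV. Th (sgl (act MP (mon n b) (component MP r y), act MV (component (sl n) q (pi_mat n x b)) v) (ksign q r)))
    = (\<Sum>r\<in>UNIV. tp (pscale (ksign q r) (P.opr (mon n b) (kP (component MP r y)))) (V.opr (mat_part q (pi_mat n x b)) (bvec v)))"
    unfolding Th_single component_sl[OF sl] P.opr_k[OF mw[OF b] cc, symmetric] V.opr_k[OF slp v, symmetric] ky tp_linear ..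
   also have "\<dots> = tp (P.opr (mon n b) (\<Sum>r\<in>UNIV. pscale (ksign q r) (kP (component MP r y)))) (V.opr (mat_part q (pi_mat n x b)) (bvec v))"
    by (simp only: plin_sum[OF P.opr_plin] plin_scale[OF P.opr_plin] plin_sum[OF plin_tp_left])
   finally show ?thesis unfolding P.sum_components[OF y] ky t_def .
  qed
  have t0: "t q b = 0" if "pi_mat n x b = (%s j. 0)" for q b
  proof -
   have "mat_part q (pi_mat n x b) = (%s j. 0)" by (simp add: that mat_part_def)
   thus ?thesis using V.opr_zero[OF V.bvec_V[OF bc(3)]] by (simp add: t_def tp_linear)
  qed
  have sub: "{b. pi_mat n x b ~= (%s j. 0)} <= S" using S(3) by blast
  have "Th (linext (shen_larsson_pair n MP MV x) (bvec bc)) = tp (kP (act MP x y)) (kV v) +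
   (\<Sum>b | pi_mat n x b ~= (%s j. 0). \<Sum>q\<in>UNIV. \<Sum>r\<in>UNIV.
    Th (sgl (act MP (mon n b) (component MP r y), act MV (component (sl n) q (pi_mat n x b)) v) (ksign q r)))"
   by (simp add: bc(1) shen_larsson_pair_def plin_add[OF plin_Th] plin_sum[OF plin_Th] Th_single del: pscale_single)
  also have "(\<Sum>b | pi_mat n x b ~= (%s j. 0). \<Sum>q\<in>UNIV. \<Sum>r\<in>UNIV.
    Th (sgl (act MP (mon n b) (component MP r y), act MV (component (sl n) q (pi_mat n x b)) v) (ksign q r)))
   = (\<Sum>b | pi_mat n x b ~= (%s j. 0). \<Sum>q\<in>UNIV. t q b)"
   using sub by (intro sum.cong refl tq) auto
  also have "\<dots> = (\<Sum>b\<in>S. \<Sum>q\<in>UNIV. t q b)"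
   by (rule sum.mono_neutral_left[OF S(1) sub]) (simp add: t0)
  also have "tp (kP (act MP x y)) (kV v) = left_op (P.opr x) (bvec bc)"
   using P.opr_k[of x y] x y by (simp add: bc(1) tens_bvec ky)
  finally show "Th (linext (shen_larsson_pair n MP MV x) (bvec bc)) = ?G (bvec bc)"
   by (simp add: bc(1) tens_bvec UNIV_bool t_def)
 qed
qed

section \<open>From a submodule of F(P,V) to a subspace of T\<close>

context
 fixes N
 assumes N: "sub_supermodule (S_prime n) F N"
begin

definition "Nt = {w \<in> T. \<langle>w\<rangle> \<in> N}"

lemma N_mod: "N <= carrier F" "R \<in> N" "x \<in> N ==> y \<in> N ==> set_add pairs x y \<in> N"
  "x \<in> N ==> descend pairs R (%x. c \<odot>\<^bsub>pairs\<^esub> x) x \<in> N"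
 using N unfolding sub_supermodule_def submodule_iff[OF module_F] by auto

lemma Nt_sub: "subsp Nt"
proof (rule pv.subspaceI)
 show "0 \<in> Nt" using N_mod(2) F_zero sub_0[OF T_sub] by (simp add: Nt_def)
 fix x y c assume x: "x \<in> Nt"
 hence xP: "x \<in> PS" "x \<in> T" "\<langle>x\<rangle> \<in> N" using T_PS by (auto simp: Nt_def)
 { assume "y \<in> Nt"
  hence yP: "y \<in> PS" "y \<in> T" "\<langle>y\<rangle> \<in> N" using T_PS by (auto simp: Nt_def)
  show "x + y \<in> Nt" using N_mod(3)[OF xP(3) yP(3)] quot.add_coset[of x y] xP yP sub_add[OF T_sub] by (simp add: Nt_def) }
 show "pscale c x \<in> Nt" using N_mod(4)[OF xP(3), of c] quot.smult_coset[of x c] xP sub_scale[OF T_sub] by (simp add: Nt_def)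
qed

lemma Nt_stable:
 assumes x: "x \<in> weyl_ops n" "x \<in> carrier (S_prime n)"
  and S: "finite S" "S <= UNIV \<times> Pow {1..n}" "!!b. b \<notin> S ==> pi_mat n x b = (%s j. 0)"
  and sl: "!!b. b \<in> S ==> pi_mat n x b \<in> slc n" and w: "w \<in> Nt"
 shows "left_op (P.opr x) w +
  (\<Sum>b\<in>S. tens (P.opr (mon n b)) (V.opr (mat_part False (pi_mat n x b))) w
   + tens (%f. P.opr (mon n b) (\<sigma>P f)) (V.opr (mat_part True (pi_mat n x b))) w) \<in> Nt"
proof -
 have sl': "pi_mat n x b \<in> slc n" for b using sl[of b] S(3)[of b] sl_closed(3) by (cases "b \<in> S") auto
 let ?L = "linext (shen_larsson_pair n MP MV x)"
 have wT: "w \<in> T" "\<langle>w\<rangle> \<in> N" "w \<in> PS" using w T_PS by (auto simp: Nt_def)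
 have "{b. pi_mat n x b ~= (%s j. 0)} <= UNIV \<times> Pow {1..n}" using S(2,3) by blast
 from pair_op_PS[OF x(1) this sl' wT(3)] have LP: "?L w \<in> PS" .
 have "act F x \<langle>w\<rangle> \<in> N" using N x(2) wT(2) unfolding sub_supermodule_def by blast
 hence d: "descend pairs R ?L \<langle>w\<rangle> \<in> N" by simp
 \<comment> \<open>The value of \<open>descend\<close> belongs to \<open>N\<close>, so it is a
   single coset. As a union over representatives it contains the coset of \<open>?L w\<close>, and
   therefore equals it.\<close>
 then obtain g where g: "g \<in> PS" "descend pairs R ?L \<langle>w\<rangle> = \<langle>g\<rangle>" using N_mod(1) by auto
 have "w \<in> \<langle>w\<rangle>" using quot.coset_self[of w] wT by simp
 hence "\<langle>?L w\<rangle> <= descend pairs R ?L \<langle>w\<rangle>" unfolding descend_def by blast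
 hence "?L w \<in> \<langle>g\<rangle>" using quot.coset_self[of "?L w"] LP g(2) by auto
 hence "\<langle>?L w\<rangle> = \<langle>g\<rangle>" using quot.coset_mem(2)[of g "?L w"] g(1) LP by (simp add: cls_eq pairs_minus)
 hence "\<langle>Th (?L w)\<rangle> \<in> N" using d g(2) cls_Th[OF LP] by simp
 hence "Th (?L w) \<in> Nt" using Th_T[OF LP] by (simp add: Nt_def)
 moreover have "Th (?L w) = left_op (P.opr x) w +
  (\<Sum>b\<in>S. tens (P.opr (mon n b)) (V.opr (mat_part False (pi_mat n x b))) w
   + tens (%f. P.opr (mon n b) (\<sigma>P f)) (V.opr (mat_part True (pi_mat n x b))) w)"
  by (rule Th_pair_op[OF x(1) S sl' wT(1)])
 ultimately show ?thesis by metis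
qed

text \<open>The even component of a coset is read off through \<open>Th\<close>, which respects
  parities and is injective modulo \<open>R\<close>. The parity image of \<open>w\<close> is twice
  the even part minus \<open>w\<close>.\<close>

lemma Nt_parity:
 assumes w: "w \<in> Nt"
 shows "tens \<sigma>P \<sigma>V w \<in> Nt"
proof -
 define D where "D = (%(b, c). P.d b ~= V.d c)"
 have ts: "tens \<sigma>P \<sigma>V u = parity_op D u" for u
 proof (rule plin_eq[OF plin_tens plin_parity_op])
  fix bc :: "'p \<times> 'v"
  obtain b c where "bc = (b, c)" by (cases bc)
  thus "tens \<sigma>P \<sigma>V (bvec bc) = parity_op D (bvec bc)"
   by (cases "P.d b"; cases "V.d c") (simp_all add: tens_bvec parity_op_bvec D_def tp_linear)
 qed
 have wT: "w \<in> T" "\<langle>w\<rangle> \<in> N" "w \<in> PS" using w T_PS by (auto simp: Nt_def)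
 hence "supp w <= BP \<times> BV" by (simp add: T_def)
 then obtain w0 w1 where w01: "w = w0 + w1" "supp w0 <= {b \<in> BP \<times> BV. ~ D b}" "supp w1 <= {b \<in> BP \<times> BV. D b}"
  "w0 = pscale (1/2) (w + parity_op D w)"
  by (rule parity_decomp[of w "BP \<times> BV" D])
 have w0T: "w0 \<in> T" "w1 \<in> T" using w01(2,3) by (auto simp: T_def)
 hence w0P: "w0 \<in> PS" "w1 \<in> PS" using T_PS by auto
 have part: "u \<in> part pairs p" if "supp u <= {b \<in> BP \<times> BV. D b = p}" for u p
 proof -
  have "supp u <= (\<Union>q. part MP (p ~= q) \<times> part MV q)"
  proof
   fix bc assume "bc \<in> supp u"
   hence m: "bc \<in> {b \<in> BP \<times> BV. D b = p}" using that by blast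
   obtain b c where e: "bc = (b, c)" by (cases bc)
   have bc: "bc = (b, c)" "b \<in> BP" "c \<in> BV" "(P.d b ~= V.d c) = p" using m e by (auto simp: D_def)
   hence "b \<in> part MP (p ~= V.d c)" "c \<in> part MV (V.d c)" using P.part_B V.part_B by auto
   thus "bc \<in> (\<Union>q. part MP (p ~= q) \<times> part MV q)" using bc(1) by blast
  qed
  thus ?thesis by simp
 qed
 have ThD: "supp (Th f) <= {b \<in> BP \<times> BV. D b = p} & f \<in> PS" if f: "f \<in> part pairs p" for f p
 proof -
  have sf: "supp f <= (\<Union>q. part MP (p ~= q) \<times> part MV q)" using f by simp
  hence "Th f \<in> {g. supp g <= {b \<in> BP \<times> BV. D b = p}}"
  proof (rule supp_image[OF plin_Th subspace_supp])
   fix yv assume "yv \<in> (\<Union>q. part MP (p ~= q) \<times> part MV q)"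
   then obtain y v q where yv: "yv = (y, v)" "y \<in> part MP (p ~= q)" "v \<in> part MV q" by auto
   have "supp (kP y) <= {b \<in> BP. P.d b = (p ~= q)}" "supp (kV v) <= {b \<in> BV. V.d b = q}"
    using P.part_V[of "p ~= q"] V.part_V[of q] yv by auto
   from supp_tp[OF this] have "supp (tp (kP y) (kV v)) <= {b \<in> BP \<times> BV. D b = p}" by (auto simp: D_def)
   thus "Th (bvec yv) \<in> {g. supp g <= {b \<in> BP \<times> BV. D b = p}}" by (simp add: yv(1) Th_single)
  qed
  moreover have "f \<in> PS" using sf super_space_part_sub[OF P.ss] super_space_part_sub[OF V.ss] unfolding PS_def by blast
  ultimately show ?thesis by simp
 qed
 have "component F False \<langle>w\<rangle> = \<langle>w0\<rangle>"
  unfolding component_def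
 proof (rule the_equality)
  have p0: "w0 \<in> part pairs False" by (rule part) (use w01(2) in simp)
  have p1: "w1 \<in> part pairs (~ False)" by (rule part) (use w01(3) in simp)
  have e: "\<langle>w\<rangle> = \<langle>w0\<rangle> \<oplus>\<^bsub>F\<^esub> \<langle>w1\<rangle>"
   using quot.add_coset[of w0 w1] w0P w01(1) by simp
  have "\<langle>w0\<rangle> \<in> part F False" unfolding F_simps(5) by (rule imageI[OF p0])
  moreover have "\<langle>w1\<rangle> \<in> part F (~ False)" unfolding F_simps(5) by (rule imageI[OF p1])
  ultimately show "\<langle>w0\<rangle> \<in> part F False & (\<exists>b\<in>part F (~ False). \<langle>w\<rangle> = \<langle>w0\<rangle> \<oplus>\<^bsub>F\<^esub> b)" using e by blast
  fix a assume "a \<in> part F False & (\<exists>b\<in>part F (~ False). \<langle>w\<rangle> = a \<oplus>\<^bsub>F\<^esub> b)"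
  then obtain f0 f1 where f: "f0 \<in> part pairs False" "a = \<langle>f0\<rangle>" "f1 \<in> part pairs True" "\<langle>w\<rangle> = \<langle>f0\<rangle> \<oplus>\<^bsub>F\<^esub> \<langle>f1\<rangle>"
   unfolding F_simps(5) by auto
  note t0 = ThD[OF f(1)] and t1 = ThD[OF f(3)]
  have "\<langle>w\<rangle> = \<langle>f0 + f1\<rangle>" using f(4) quot.add_coset[of f0 f1] t0 t1 by simp
  hence "w - (f0 + f1) \<in> R" using cls_eq[OF wT(3) sub_add[OF PS_sub]] t0 t1 by blast
  hence "Th w = Th f0 + Th f1" using Th_R[of "w - (f0 + f1)"] by (simp add: plin_diff plin_add)
  hence "w0 + w1 = Th f0 + Th f1" unfolding Th_id[OF wT(1)] by (simp only: w01(1))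
  hence "w0 - Th f0 = Th f1 - w1" by (simp add: algebra_simps)
  moreover have "supp (w0 - Th f0) <= {b \<in> BP \<times> BV. ~ D b}" using t0 w01(2) by (intro supp_subspaceD) auto
  moreover have "supp (Th f1 - w1) <= {b \<in> BP \<times> BV. D b}" using t1 w01(3) by (intro supp_subspaceD) auto
  ultimately have "supp (w0 - Th f0) <= {}" by fastforce
  hence "Th f0 = w0" by simp
  thus "a = \<langle>w0\<rangle>" using f(2) cls_Th[of f0] t0 by simp
 qed
 hence "\<langle>w0\<rangle> \<in> N" using N wT(2) unfolding sub_supermodule_def by metis
 hence "w0 \<in> Nt" using w0T by (simp add: Nt_def)
 hence "pscale 2 w0 - w \<in> Nt" using w by (intro sub_diff[OF Nt_sub] sub_scale[OF Nt_sub])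
 also have "pscale 2 w0 - w = parity_op D w"
  unfolding w01(4) by (rule poly_mapping_eqI) (simp add: lookup_add lookup_minus)
 finally show ?thesis unfolding ts .
qed

lemma opr_scaled:
 assumes "A \<in> slc n" "w \<in> T"
 shows "tens S (V.opr (%a b. c * A a b)) w = pscale c (tens S (V.opr A) w)"
proof -
 have "tens S (V.opr (%a b. c * A a b)) w = tens S (%f. pscale c (V.opr A f)) w"
  by (rule tens_eq[OF assms(2)]) (use V.opr_scale[of A c] sl_closed(2)[OF assms(1)] assms(1) in auto)
 thus ?thesis by (simp add: tens_right)
qed

lemma tens_opr_zero: "w \<in> T ==> tens S (V.opr (%a b. 0)) w = 0"
 using opr_scaled[OF sl_closed(3), of w S 0] by simp

lemma Nt_X1:
 assumes w: "w \<in> Nt" and i: "i \<in> {1..n}" "I <= {1..n}" "i \<notin> I"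
 shows "left_op (P.opr (mon_field n k I i)) w
    + pscale (of_int k) (tens (%f. P.opr (mon n (k - 1, I)) (\<sigma>P f)) (V.X i) w)
    + (\<Sum>s\<in>I. pscale (eps I s) (tens (P.opr (mon n (k, I - {s}))) (V.H s i) w)) \<in> Nt"
proof -
 have wT: "w \<in> T" using w by (simp add: Nt_def)
 have fI: "finite I" using i(2) finite_subset by auto
 let ?x = "mon_field n k I i" and ?S = "insert (k - 1, I) ((%s. (k, I - {s})) ` I)"
 have sI: "Emat s i = Gmat s i" if "s \<in> I" for s using that i by (auto simp: Gmat_def fun_eq_iff)
 note p1 = pi_mat_X1(1)[OF i, of k]
 have p2: "pi_mat n ?x (k, I - {s}) = (%a b. eps I s * Gmat s i a b)" if "s \<in> I" for s
  using pi_mat_X1(2)[OF i that, of k] sI[OF that] by simp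
 have xw: "?x \<in> weyl_ops n" using mon_field_weyl[OF i(2), of i k] i(1) by simp
 let ?t = "%b. tens (P.opr (mon n b)) (V.opr (mat_part False (pi_mat n ?x b))) w
   + tens (%f. P.opr (mon n b) (\<sigma>P f)) (V.opr (mat_part True (pi_mat n ?x b))) w"
 have "left_op (P.opr ?x) w + (\<Sum>b\<in>?S. ?t b) \<in> Nt"
 proof (rule Nt_stable[OF xw S_prime_mon_field[OF i(2,1,3) V.n2] _ _ _ _ w])
  show "pi_mat n ?x b = (%s j. 0)" if "b \<notin> ?S" for b
   by (rule pi_mat_X1(3)[OF i]) (use that in auto)
  show "pi_mat n ?x b \<in> slc n" if h: "b \<in> ?S" for b
  proof -
   consider "b = (k - 1, I)" | s where "s \<in> I" "b = (k, I - {s})" using h by blast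
   thus ?thesis
   proof cases
    case 1
    thus ?thesis unfolding 1 p1 by (intro sl_closed(2) V.gens_carrier i)
   next
    case (2 s)
    hence "s \<in> {1..n}" using i by auto
    thus ?thesis unfolding 2(2) p2[OF 2(1)] by (intro sl_closed(2) V.gens_carrier i)
   qed
  qed
 qed (use fI i in auto)
 also have "(\<Sum>b\<in>?S. ?t b) = ?t (k - 1, I) + (\<Sum>b\<in>(%s. (k, I - {s})) ` I. ?t b)"
  using fI by (intro sum.insert) auto
 also have "(\<Sum>b\<in>(%s. (k, I - {s})) ` I. ?t b) = (\<Sum>s\<in>I. ?t (k, I - {s}))"
  by (subst sum.reindex) (auto simp: inj_on_def)
 also have "?t (k - 1, I) = pscale (of_int k) (tens (%f. P.opr (mon n (k - 1, I)) (\<sigma>P f)) (V.X i) w)"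
 proof -
  have "i ~= 0" using i by auto
  thus ?thesis
   unfolding p1 mat_part_Emat(1)[OF \<open>i ~= 0\<close>] opr_scaled[OF V.gens_carrier(1)[OF i(1)] wT] by simp
 qed
 also have "(\<Sum>s\<in>I. ?t (k, I - {s})) = (\<Sum>s\<in>I. pscale (eps I s) (tens (P.opr (mon n (k, I - {s}))) (V.H s i) w))"
 proof (rule sum.cong[OF refl])
  fix s assume s: "s \<in> I"
  hence "s ~= 0" "i ~= 0" "s \<in> {1..n}" using i by auto
  thus "?t (k, I - {s}) = pscale (eps I s) (tens (P.opr (mon n (k, I - {s}))) (V.H s i) w)"
   unfolding p2[OF s] mat_part_Emat(3)[OF \<open>s ~= 0\<close> \<open>i ~= 0\<close>] opr_scaled[OF V.gens_carrier(3)[OF \<open>s \<in> {1..n}\<close> i(1)] wT] by simp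
 qed
 finally show ?thesis by (simp add: add.assoc)
qed

lemma Nt_der0:
 assumes w: "w \<in> Nt"
 shows "left_op (P.opr (mon_field n 0 {} 0)) w \<in> Nt"
 using Nt_stable[OF mon_field_weyl[of "{}" n 0 0] S_prime_der0[OF V.n2], of "{}" w] w pi_mat_der0 by simp

lemma Nt_Y:
 assumes w: "w \<in> Nt" and i: "i \<in> {1..n}"
 shows "left_op (P.opr (mon_field n 0 {i} 0)) w + tens \<sigma>P (V.Y i) w \<in> Nt"
proof -
 have wT: "w \<in> T" using w by (simp add: Nt_def)
 let ?x = "mon_field n 0 {i} 0"
 have i0: "i ~= 0" using i by auto
 have xw: "?x \<in> weyl_ops n" using mon_field_weyl[of "{i}" n 0 0] i by simp
 have m: "mat_part q (Emat i 0) = (%a b. (if q then 1 else 0) * Emat i 0 a b)" for q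
  using mat_part_Emat(2)[OF i0, of q 1] by simp
 have "left_op (P.opr ?x) w + (\<Sum>b\<in>{(0, {})}. tens (P.opr (mon n b)) (V.opr (mat_part False (pi_mat n ?x b))) w
   + tens (%f. P.opr (mon n b) (\<sigma>P f)) (V.opr (mat_part True (pi_mat n ?x b))) w) \<in> Nt"
  by (rule Nt_stable[OF xw S_prime_xi_der0[OF V.n2 i] _ _ _ _ w])
   (use V.gens_carrier(2)[OF i] in "auto simp: pi_mat_Y[OF i]")
 moreover have "tens (%f. P.opr (mon n (0, {})) (\<sigma>P f)) (V.Y i) w = tens \<sigma>P (V.Y i) w"
  by (rule tens_eq[OF wT]) (auto simp: P.opr_one P.parity_op_V)
 ultimately show ?thesis
  by (simp add: pi_mat_Y[OF i] m tens_opr_zero[OF wT])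
qed

lemma Nt_euler:
 assumes w: "w \<in> Nt" and i: "i \<in> {1..n}"
 shows "left_op (P.opr (euler_field n i)) w + right_op (V.H i i) w \<in> Nt"
proof -
 have wT: "w \<in> T" using w by (simp add: Nt_def)
 let ?x = "euler_field n i"
 have i0: "i ~= 0" using i by auto
 have xw: "?x \<in> weyl_ops n" using euler_field(2)[OF i] weyl_partD(1) by blast
 have m: "mat_part q (Gmat i i) = (%a b. (if q then 0 else 1) * Gmat i i a b)" for q
  using mat_part_Emat(3)[OF i0 i0, of q 1] by simp
 have "left_op (P.opr ?x) w + (\<Sum>b\<in>{(0, {})}. tens (P.opr (mon n b)) (V.opr (mat_part False (pi_mat n ?x b))) w
   + tens (%f. P.opr (mon n b) (\<sigma>P f)) (V.opr (mat_part True (pi_mat n ?x b))) w) \<in> Nt"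
  by (rule Nt_stable[OF xw S_prime_euler_field[OF V.n2 i] _ _ _ _ w])
   (use V.gens_carrier(3)[OF i i] in "auto simp: pi_mat_euler[OF i]")
 moreover have "tens (P.opr (mon n (0, {}))) (V.H i i) w = right_op (V.H i i) w"
  by (rule tens_eq[OF wT]) (auto simp: P.opr_one)
 ultimately show ?thesis
  by (simp add: pi_mat_euler[OF i] m tens_opr_zero[OF wT])
qed

lemma Nt_proper:
 assumes "N ~= {R}" "N ~= carrier F"
 shows "Nt ~= {0}" "Nt ~= T"
proof -
 have mem: "\<langle>f\<rangle> \<in> N \<longleftrightarrow> Th f \<in> Nt" if "f \<in> PS" for f
  using cls_Th[OF that] Th_T[OF that] by (simp add: Nt_def)
 show "Nt ~= {0}"
 proof
  assume z: "Nt = {0}"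
  have "N <= {R}"
  proof
   fix X assume X: "X \<in> N"
   then obtain f where f: "f \<in> PS" "X = \<langle>f\<rangle>" using N_mod(1) by auto
   hence "Th f = 0" using mem X z by auto
   hence "X = \<langle>0\<rangle>" using cls_Th[OF f(1)] f(2) by simp
   thus "X \<in> {R}" using F_zero by simp
  qed
  thus False using assms(1) N_mod(2) by auto
 qed
 show "Nt ~= T"
 proof
  assume z: "Nt = T"
  have "carrier F <= N" using mem z Th_T by auto
  thus False using assms(2) N_mod(1) by blast
 qed
qed

end

theorem not_simple_imp_quadratic:
 assumes "~ simple_supermodule (S_prime n) F" "i \<in> {1..n}" "j \<in> {1..n}" "v \<in> V.V"
 shows "V.X i (V.X j v) = 0"
proof -
 \<comment> \<open>Nonzeroness is part of simplicity; once it is known, failure of simplicity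
   provides a proper nonzero submodule.\<close>
 have "carrier F ~= {\<zero>\<^bsub>F\<^esub>}"
 proof
  assume c: "carrier F = {\<zero>\<^bsub>F\<^esub>}"
  have "BP ~= {}" using P.V_nonzero[OF P.simple] by (auto simp: P.V_def)
  moreover have "BV ~= {}" using V.V_nonzero[OF V.simple] by (auto simp: V.V_def)
  ultimately obtain b c where bc: "b \<in> BP" "c \<in> BV" by blast
  hence m: "bvec (b, c) \<in> T" by (simp add: T_def)
  hence "\<langle>bvec (b, c)\<rangle> = R" using c T_PS by auto
  hence "bvec (b, c) - 0 \<in> R" using cls_eq[of "bvec (b, c)" 0] m T_PS F_zero sub_0[OF PS_sub] by auto
  hence "bvec (b, c) = 0" using Th_R[of "bvec (b, c)"] Th_id[OF m] by simp
  thus False by (metis keys_single keys_zero one_neq_zero insert_not_empty)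
 qed
 then obtain N where N: "sub_supermodule (S_prime n) F N" "N ~= {R}" "N ~= carrier F"
  using assms(1) by (auto simp: simple_supermodule_def)
 note p = Nt_proper[OF N]
 show ?thesis
  by (rule quadratic_zero[of "Nt N"])
   (use Nt_sub[OF N(1)] p Nt_parity[OF N(1)] Nt_der0[OF N(1)] Nt_X1[OF N(1)] Nt_Y[OF N(1)] Nt_euler[OF N(1)] assms in
    \<open>auto simp: Nt_def[OF N(1)]\<close>)
qed

end

section \<open>Modules over gl(n) of Weyl algebra type\<close>

text \<open>In the Weyl algebra, the normally ordered product of \<open>t\<^sub>k\<partial>\<^sub>j\<close> and \<open>t\<^sub>l\<partial>\<^sub>i\<close> is symmetric in \<open>i, j\<close>;
  this is the axiom \<open>swap\<close>. It makes the weight spaces of cyclic weight modules one-dimensional.\<close>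

locale gl_system = vector_space scale
 for scale :: "complex => 'x::ab_group_add => 'x" +
 fixes n :: nat and H :: "nat => nat => 'x => 'x" and M :: "'x set"
 assumes M_sub: "subspace M"
  and H_M: "i \<in> {1..n} ==> j \<in> {1..n} ==> x \<in> M ==> H i j x \<in> M"
  and H_add: "H i j (x + y) = H i j x + H i j y"
  and H_scale: "H i j (scale c x) = scale c (H i j x)"
  and comm: "i \<in> {1..n} ==> j \<in> {1..n} ==> k \<in> {1..n} ==> l \<in> {1..n} ==> x \<in> M ==>
   H i j (H k l x) = H k l (H i j x) + scale (of_bool (j = k)) (H i l x) - scale (of_bool (l = i)) (H k j x)"
  and swap: "i \<in> {1..n} ==> j \<in> {1..n} ==> k \<in> {1..n} ==> l \<in> {1..n} ==> x \<in> M ==>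
   H k j (H l i x) - scale (of_bool (j = l)) (H k i x) = H k i (H l j x) - scale (of_bool (i = l)) (H k j x)"
begin

definition word :: "(nat \<times> nat) list => 'x => 'x"
 where "word w x = foldr (%(a, b). H a b) w x"

definition "letters w \<longleftrightarrow> set w <= {1..n} \<times> {1..n}"

text \<open>The words of weight zero: every index is raised as often as it is lowered.\<close>

definition "balanced w \<longleftrightarrow> mset (map fst w) = mset (map snd w)"

definition "weight nu x \<longleftrightarrow> (\<forall>i\<in>{1..n}. H i i x = scale (nu i) x)"

lemma word_simps [simp]: "word [] x = x" "word ((a, b) # w) x = H a b (word w x)"
 "word (u @ v) x = word u (word v x)"
 by (simp_all add: word_def)

lemma word_M: "letters w ==> x \<in> M ==> word w x \<in> M"
 by (induction w) (auto simp: letters_def H_M)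

lemma H_zero: "H i j 0 = 0" using H_scale[of i j 0 0] by simp

lemma H_diff: "H i j (x - y) = H i j x - H i j y"
 using H_add[of i j x "scale (-1) y"] H_scale[of i j "-1" y] by simp

lemma word_add: "word w (x + y) = word w x + word w y"
 by (induction w) (auto simp: H_add)

lemma word_scale: "word w (scale c x) = scale c (word w x)"
 by (induction w) (auto simp: H_scale)

lemma word_diff: "word w (x - y) = word w x - word w y"
 using word_add[of w x "scale (-1) y"] word_scale[of w "-1" y] by simp

text \<open>Induction on the length. If the first letter is \<open>(a, b)\<close> with
  \<open>a \<noteq> b\<close>, some later letter has the form \<open>(d, a)\<close>. Commutators
  move it next to the first one at the cost of shorter balanced words. There \<open>swap\<close>
  turns the pair into \<open>(a, a)\<close> and \<open>(d, b)\<close>, again up to shorter words,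
  and the diagonal letter acts by a scalar on the multiple of \<open>x\<close> that the rest
  produces.\<close>

lemma balanced_scalar:
 assumes x: "x \<in> M" "weight nu x"
 shows "letters w ==> balanced w ==> \<exists>c. word w x = scale c x"
proof (induction "length w" arbitrary: w rule: less_induct)
 case less
 note IH = less.hyps
 show ?case
 proof (cases w)
  case Nil
  thus ?thesis by (intro exI[of _ 1]) simp
 next
  case (Cons ab w1)
  obtain a b where ab: "ab = (a, b)" by (cases ab)
  have w: "w = (a, b) # w1" using Cons ab by simp
  have l: "a \<in> {1..n}" "b \<in> {1..n}" "letters w1" using less.prems(1) by (auto simp: w letters_def)
  have diag: "\<exists>c. word ((a, a) # u) x = scale c x" if u: "length u < length w" "letters u" "balanced u" for u
  proof -
   obtain c where "word u x = scale c x" using IH[OF u] by blast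
   moreover have "H a a x = scale (nu a) x" using x(2) l(1) by (simp add: weight_def)
   ultimately show ?thesis by (intro exI[of _ "c * nu a"]) (simp add: H_scale)
  qed
  show ?thesis
  proof (cases "a = b")
   case True
   hence "balanced w1" using less.prems(2) by (simp add: balanced_def w)
   thus ?thesis using diag[of w1] l w True by simp
  next
   case False
   have "a \<in># mset (map fst w)" by (simp add: w)
   hence "a \<in># mset (map snd w)" using less.prems(2) by (simp only: balanced_def)
   hence "a \<in> snd ` set w1" using False by (auto simp: w)
   then obtain d u v where uv: "w1 = u @ (d, a) # v" by (metis imageE prod.collapse split_list)
   \<comment> \<open>Induction on the word between the two letters; each step moves
     \<open>(d, a)\<close> to the left past the last letter of \<open>u\<close>.\<close>
   have "\<exists>c. word ((a, b) # u @ (d, a) # v) x = scale c x"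
    if "length ((a, b) # u @ (d, a) # v) = length w" "letters ((a, b) # u @ (d, a) # v)" "balanced ((a, b) # u @ (d, a) # v)" for u v
    using that
   proof (induction u arbitrary: v rule: rev_induct)
    case Nil
    have d: "d \<in> {1..n}" and lv: "letters v" using Nil.prems(2) by (auto simp: letters_def)
    have vM: "word v x \<in> M" by (rule word_M[OF lv x(1)])
    have e: "word ((a, b) # [] @ (d, a) # v) x = H a a (H d b (word v x)) - scale (of_bool (a = d)) (H a b (word v x))
      + scale (of_bool (b = d)) (H a a (word v x))"
     using swap[of a b a d "word v x"] l d vM by (simp add: algebra_simps)
    obtain c1 where c1: "H a a (H d b (word v x)) = scale c1 x"
    proof -
     have "length ((d, b) # v) < length w" "letters ((d, b) # v)" "balanced ((d, b) # v)"
      using Nil.prems l d lv by (auto simp: letters_def balanced_def)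
     from diag[OF this] that show ?thesis by auto
    qed
    obtain c2 where c2: "scale (of_bool (a = d)) (H a b (word v x)) = scale c2 x"
    proof (cases "a = d")
     case True
     have "length ((a, b) # v) < length w" "letters ((a, b) # v)" "balanced ((a, b) # v)"
      using Nil.prems l True lv by (auto simp: letters_def balanced_def)
     from IH[OF this] that True show ?thesis by auto
    qed (use that[of 0] in simp)
    obtain c3 where c3: "scale (of_bool (b = d)) (H a a (word v x)) = scale c3 x"
    proof (cases "b = d")
     case True
     have "length v < length w" "balanced v"
      using Nil.prems True by (auto simp: balanced_def)
     from diag[OF this(1) lv this(2)] that True show ?thesis by auto
    qed (use that[of 0] in simp)
    show ?case unfolding e c1 c2 c3
     by (intro exI[of _ "c1 - c2 + c3"]) (simp add: scale_left_distrib scale_left_diff_distrib)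
   next
    case (snoc ef u)
    obtain e f where ef: "ef = (e, f)" by (cases ef)
    have e: "e \<in> {1..n}" "f \<in> {1..n}" "d \<in> {1..n}" and lv: "letters v" "letters u"
     using snoc.prems(2) by (auto simp: letters_def ef)
    have vM: "word v x \<in> M" by (rule word_M[OF lv(1) x(1)])
    let ?p = "(a, b) # u"
    have eq: "word ((a, b) # (u @ [ef]) @ (d, a) # v) x = word (?p @ (d, a) # (e, f) # v) x
      + scale (of_bool (f = d)) (word (?p @ (e, a) # v) x) - scale (of_bool (a = e)) (word (?p @ (d, f) # v) x)"
     using comm[of e f d a "word v x"] l e vM
     by (simp add: ef word_add word_diff word_scale H_add H_diff H_scale)
    obtain c1 where c1: "word (?p @ (d, a) # (e, f) # v) x = scale c1 x"
    proof -
     have "length ((a, b) # u @ (d, a) # (e, f) # v) = length w" "letters ((a, b) # u @ (d, a) # (e, f) # v)"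
       "balanced ((a, b) # u @ (d, a) # (e, f) # v)"
      using snoc.prems by (auto simp: letters_def balanced_def ef)
     from snoc.IH[OF this] that show ?thesis by auto
    qed
    obtain c2 where c2: "scale (of_bool (f = d)) (word (?p @ (e, a) # v) x) = scale c2 x"
    proof (cases "f = d")
     case True
     have "length (?p @ (e, a) # v) < length w" "letters (?p @ (e, a) # v)" "balanced (?p @ (e, a) # v)"
      using snoc.prems True by (auto simp: letters_def balanced_def ef add_mset_commute)
     from IH[OF this] obtain c where "word (?p @ (e, a) # v) x = scale c x" ..
     thus ?thesis using that[of c] True by simp
    qed (use that[of 0] in simp)
    obtain c3 where c3: "scale (of_bool (a = e)) (word (?p @ (d, f) # v) x) = scale c3 x"
    proof (cases "a = e")
     case True
     have "length (?p @ (d, f) # v) < length w" "letters (?p @ (d, f) # v)" "balanced (?p @ (d, f) # v)"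
      using snoc.prems True by (auto simp: letters_def balanced_def ef add_mset_commute)
     from IH[OF this] obtain c where "word (?p @ (d, f) # v) x = scale c x" ..
     thus ?thesis using that[of c] True by simp
    qed (use that[of 0] in simp)
    show ?case unfolding eq c1 c2 c3
     by (intro exI[of _ "c1 + c2 - c3"]) (simp add: scale_left_distrib scale_left_diff_distrib)
   qed
   thus ?thesis using less.prems by (simp add: w uv)
  qed
 qed
qed

lemma weight_word:
 assumes "x \<in> M" "weight nu x" "letters w"
 shows "weight (%i. nu i + of_nat (count (mset (map fst w)) i) - of_nat (count (mset (map snd w)) i)) (word w x)"
 using assms(3)
proof (induction w)
 case Nil
 thus ?case using assms by (simp add: weight_def)
next
 case (Cons ab w)
 obtain a b where ab: "ab = (a, b)" by (cases ab)
 have l: "a \<in> {1..n}" "b \<in> {1..n}" "letters w" using Cons.prems by (auto simp: ab letters_def)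
 have wM: "word w x \<in> M" by (rule word_M[OF l(3) assms(1)])
 show ?case unfolding weight_def
 proof
  fix i assume i: "i \<in> {1..n}"
  let ?c = "nu i + of_nat (count (mset (map fst w)) i) - of_nat (count (mset (map snd w)) i)"
  have "H i i (word w x) = scale ?c (word w x)" using Cons.IH[OF l(3)] i by (simp add: weight_def)
  hence "H i i (H a b (word w x)) = scale ?c (H a b (word w x)) + scale (of_bool (i = a)) (H i b (word w x))
    - scale (of_bool (b = i)) (H a i (word w x))"
   using comm[OF i i l(1,2) wM] by (simp add: H_scale)
  also have "\<dots> = scale (?c + of_bool (i = a) - of_bool (b = i)) (H a b (word w x))"
   by (auto simp: scale_left_distrib scale_left_diff_distrib)
  also have "?c + of_bool (i = a) - of_bool (b = i) = nu i + of_nat (count (mset (map fst (ab # w))) i) - of_nat (count (mset (map snd (ab # w))) i)"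
   by (auto simp: ab)
  finally show "H i i (word (ab # w) x) = scale (nu i + of_nat (count (mset (map fst (ab # w))) i) - of_nat (count (mset (map snd (ab # w))) i)) (word (ab # w) x)"
   by (simp add: ab)
 qed
qed

text \<open>A product of factors \<open>H i i - e\<close>. It commutes with the diagonal operators
  and multiplies a weight vector by a number, so suitable factors remove unwanted weights.\<close>

definition diag_op :: "(nat \<times> complex) list => 'x => 'x"
 where "diag_op D x = foldr (%(i, e) y. H i i y - scale e y) D x"

lemma diag_op_simps [simp]: "diag_op [] x = x" "diag_op ((i, e) # D) x = H i i (diag_op D x) - scale e (diag_op D x)"
 by (simp_all add: diag_op_def)

lemma diag_op_add: "diag_op D (x + y) = diag_op D x + diag_op D y"
 by (induction D) (auto simp: H_add scale_right_distrib)

lemma diag_op_scale: "diag_op D (scale c x) = scale c (diag_op D x)"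
 by (induction D) (auto simp: H_scale scale_right_diff_distrib mult.commute)

lemma diag_op_diff: "diag_op D (x - y) = diag_op D x - diag_op D y"
 using diag_op_add[of D x "scale (-1) y"] diag_op_scale[of D "-1" y] by simp

lemma diag_op_M: "fst ` set D <= {1..n} ==> x \<in> M ==> diag_op D x \<in> M"
 by (induction D) (auto intro!: subspace_diff[OF M_sub] subspace_scale[OF M_sub] H_M)

lemma diag_op_H:
 assumes "fst ` set D <= {1..n}" "x \<in> M" "i \<in> {1..n}"
 shows "diag_op D (H i i x) = H i i (diag_op D x)"
 using assms(1)
proof (induction D)
 case (Cons je D)
 obtain j e where je: "je = (j, e)" by (cases je)
 have "diag_op D x \<in> M" by (rule diag_op_M) (use Cons.prems assms in auto)
 hence "H i i (H j j (diag_op D x)) = H j j (H i i (diag_op D x))"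
  using comm[of i i j j "diag_op D x"] assms(3) Cons.prems by (auto simp: je)
 thus ?case using Cons by (simp add: je H_diff H_scale)
qed simp

lemma diag_op_weight:
 assumes "fst ` set D <= {1..n}" "weight nu x"
 shows "diag_op D x = scale (\<Prod>(i, e)\<leftarrow>D. nu i - e) x"
 using assms(1)
proof (induction D)
 case (Cons je D)
 obtain j e where je: "je = (j, e)" by (cases je)
 have "H j j x = scale (nu j) x" using assms(2) Cons.prems by (auto simp: je weight_def)
 thus ?case using Cons by (simp add: je H_scale left_diff_distrib scale_left_diff_distrib mult.commute)
qed simp

text \<open>Balanced words map \<open>g\<close> to multiples of \<open>g\<close>. The image under an
  unbalanced word has, at some index \<open>i\<close>, an eigenvalue \<open>e\<close> different from
  \<open>nu i\<close>, so a factor \<open>H i i - e\<close> kills it. The product of these factors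
  annihilates \<open>y - scale c g\<close>, but on vectors of weight \<open>nu\<close> it is a
  nonzero scalar.\<close>

lemma weight_space_cyclic:
 assumes g: "g \<in> M" "weight nu g" and y: "y \<in> span {word w g | w. letters w}" "weight nu y"
 shows "\<exists>c. y = scale c g"
proof -
 have SM: "span {word w g | w. letters w} <= M"
  by (rule span_minimal[OF _ M_sub]) (use word_M g in auto)
 let ?Q = "%x. \<exists>c D. fst ` set D <= {1..n} & (\<forall>(i, e)\<in>set D. e ~= nu i) & diag_op D (x - scale c g) = 0"
 have "?Q y" using y(1)
 proof (induction rule: span_induct_alt)
  case base
  show ?case by (intro exI[of _ 0] exI[of _ "[]"]) simp
 next
  case (step a x y)
  obtain w where w: "x = word w g" "letters w" using step(1) by auto
  obtain c D where D: "fst ` set D <= {1..n}" "\<forall>(i, e)\<in>set D. e ~= nu i" "diag_op D (y - scale c g) = 0" using step(2) by auto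
  show ?case
  proof (cases "balanced w")
   case True
   then obtain c' where "x = scale c' g" using balanced_scalar[OF g w(2)] w by auto
   hence "scale a x + y - scale (a * c' + c) g = y - scale c g" by (simp add: scale_left_distrib)
   thus ?thesis using D by metis
  next
   case False
   then obtain i where i: "count (mset (map fst w)) i ~= count (mset (map snd w)) i"
    by (auto simp: balanced_def multiset_eq_iff)
   have il: "i \<in> {1..n}"
   proof (rule ccontr)
    assume "i \<notin> {1..n}"
    hence "i \<notin> set (map fst w)" "i \<notin> set (map snd w)" using w(2) by (auto simp: letters_def)
    hence "i \<notin># mset (map fst w)" "i \<notin># mset (map snd w)" by simp_all
    thus False using i by (simp only: count_eq_zero_iff[symmetric])
   qed
   define e where "e = nu i + of_nat (count (mset (map fst w)) i) - of_nat (count (mset (map snd w)) i)"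
   have e: "e ~= nu i" "H i i x = scale e x"
    using i weight_word[OF g w(2)] il w(1) by (auto simp: e_def weight_def)
   have xM: "x \<in> M" using word_M w g by simp
   have "diag_op D (scale a x + y - scale c g) = scale a (diag_op D x) + diag_op D (y - scale c g)"
    by (simp add: diag_op_add diag_op_diff diag_op_scale)
   hence "diag_op ((i, e) # D) (scale a x + y - scale c g) = scale a (H i i (diag_op D x) - scale e (diag_op D x))"
    using D(3) by (simp add: H_scale scale_right_diff_distrib mult.commute)
   also have "H i i (diag_op D x) = scale e (diag_op D x)"
    using diag_op_H[OF D(1) xM il] e(2) by (simp add: diag_op_scale)
   finally have "diag_op ((i, e) # D) (scale a x + y - scale c g) = 0" by simp
   thus ?thesis using D(1,2) e(1) il by (intro exI[of _ c] exI[of _ "(i, e) # D"]) auto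
  qed
 qed
 then obtain c D where D: "fst ` set D <= {1..n}" "\<forall>(i, e)\<in>set D. e ~= nu i" "diag_op D (y - scale c g) = 0" by auto
 have "weight nu (y - scale c g)" using g(2) y(2) by (simp add: weight_def H_diff H_scale scale_right_diff_distrib mult.commute)
 from diag_op_weight[OF D(1) this] D(3) have "(\<Prod>(i, e)\<leftarrow>D. nu i - e) = 0 | y - scale c g = 0" by (metis scale_eq_0_iff)
 moreover have "(\<Prod>(i, e)\<leftarrow>D. nu i - e) ~= 0" using D(2) by (induction D) auto
 ultimately show ?thesis by auto
qed

end

section \<open>The modules N(lambda)\<close>

lemma single_sum_fun: "(\<Sum>s\<in>A. sgl k (f s)) = sgl k (\<Sum>s\<in>A. f s)"
 by (induction A rule: infinite_finite_induct) (simp_all add: single_add)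

text \<open>The set consists of the nonnegative integers, of the negative integers, or of a coset of
  the integers other than the integers themselves. The only barrier is between -1 and 0, and no such
  set has points on both sides of it.\<close>

lemma exponents_facts:
 "x \<in> exponents z ==> x ~= -1 ==> x + 1 \<in> exponents z"
 "x \<in> exponents z ==> x ~= 0 ==> x - 1 \<in> exponents z"
 "-1 \<in> exponents z ==> of_nat m \<notin> exponents z"
 "0 \<in> exponents z ==> - of_nat (Suc m) \<notin> exponents z"
 "x \<in> exponents z ==> y \<in> exponents z ==> \<exists>k. y = x + of_int k"
 "z \<in> exponents z"
proof -
 have neg: "- of_nat (Suc m) \<notin> (\<nat> :: complex set)" for m
 proof
  assume "- of_nat (Suc m) \<in> (\<nat> :: complex set)"
  then obtain k where "- of_nat (Suc m) = (of_nat k :: complex)" by (auto simp: Nats_def)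
  hence "of_nat (Suc m + k) = (0 :: complex)"
   by (metis add.commute add.right_inverse add.assoc of_nat_add)
  hence "Suc m + k = 0" by (simp only: of_nat_eq_0_iff)
  thus False by simp
 qed
 have neg1: "-1 \<notin> (\<nat> :: complex set)" using neg[of 0] by simp
 have notnat: "\<exists>m. x = - of_nat (Suc m)" if xi: "x \<in> \<int>" "x \<notin> \<nat>" for x :: complex
 proof -
  obtain k where k: "x = of_int k" using xi(1) by (rule Ints_cases)
  have "k < 0"
  proof (rule ccontr)
   assume "~ k < 0"
   hence "x = of_nat (nat k)" using k by simp
   thus False using xi(2) by simp
  qed
  hence "x = - of_nat (Suc (nat (- k - 1)))" by (simp add: k)
  thus ?thesis by blast
 qed
 consider "z \<in> \<nat>" "exponents z = \<nat>" | "z \<notin> \<nat>" "z \<in> \<int>" "exponents z = \<int> - \<nat>"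
  | "z \<notin> \<int>" "exponents z = {z + of_int k | k. True}"
  using Nats_subset_Ints unfolding exponents_def by (cases "z \<in> \<nat>"; cases "z \<in> \<int>") simp_all
 note cs = this
 have shift: "z + of_int k \<notin> \<int>" if "z \<notin> \<int>" for k using that by (metis Ints_diff Ints_of_int add_diff_cancel_right')
 show "x \<in> exponents z ==> x ~= -1 ==> x + 1 \<in> exponents z"
 proof (cases rule: cs)
  case 2
  assume x: "x \<in> exponents z" "x ~= -1"
  then obtain m where m: "x = - of_nat (Suc m)" using 2 notnat by auto
  then obtain m' where "m = Suc m'" using x(2) by (cases m) auto
  hence e: "x + 1 = - of_nat (Suc m')" using m by simp
  have "x + 1 \<in> \<int>" "x + 1 \<notin> \<nat>" unfolding e by (rule Ints_minus[OF Ints_of_nat], rule neg)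
  thus ?thesis using 2 by simp
 next
  case 3
  assume "x \<in> exponents z"
  then obtain k where "x = z + of_int k" using 3 by auto
  hence "x + 1 = z + of_int (k + 1)" by simp
  thus ?thesis using 3 by blast
 qed auto
 show "x \<in> exponents z ==> x ~= 0 ==> x - 1 \<in> exponents z"
 proof (cases rule: cs)
  case 1
  assume x: "x \<in> exponents z" "x ~= 0"
  then obtain m where m: "x = of_nat m" using 1 by (auto simp: Nats_def)
  then obtain m' where "m = Suc m'" using x(2) by (cases m) auto
  thus ?thesis using 1 m by simp
 next
  case 2
  assume x: "x \<in> exponents z"
  then obtain m where m: "x = - of_nat (Suc m)" using 2 notnat by auto
  hence e: "x - 1 = - of_nat (Suc (Suc m))" by simp
  have "x - 1 \<in> \<int>" "x - 1 \<notin> \<nat>" unfolding e by (rule Ints_minus[OF Ints_of_nat], rule neg)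
  thus ?thesis using 2 by simp
 next
  case 3
  assume "x \<in> exponents z"
  then obtain k where "x = z + of_int k" using 3 by auto
  hence "x - 1 = z + of_int (k - 1)" by simp
  thus ?thesis using 3 by blast
 qed
 show "-1 \<in> exponents z ==> of_nat m \<notin> exponents z"
 proof (cases rule: cs)
  case 3
  assume "-1 \<in> exponents z"
  then obtain k where "-1 = z + of_int k" using 3 by auto
  thus ?thesis using shift[OF 3(1), of k] by (metis Ints_1 Ints_minus)
 qed (use neg1 in auto)
 show "0 \<in> exponents z ==> - of_nat (Suc m) \<notin> exponents z"
 proof (cases rule: cs)
  case 1
  thus ?thesis using neg by auto
 next
  case 3
  assume "0 \<in> exponents z"
  then obtain k where "0 = z + of_int k" using 3 by auto
  thus ?thesis using shift[OF 3(1), of k] by (metis Ints_0)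
 qed auto
 show "x \<in> exponents z ==> y \<in> exponents z ==> \<exists>k. y = x + of_int k"
 proof -
  assume xy: "x \<in> exponents z" "y \<in> exponents z"
  have "y - x \<in> \<int>"
  proof (cases rule: cs)
   case 1
   thus ?thesis using xy Nats_subset_Ints by (intro Ints_diff) auto
  next
   case 2
   thus ?thesis using xy by (intro Ints_diff) auto
  next
   case 3
   then obtain k l where "x = z + of_int k" "y = z + of_int l" using xy by auto
   hence "y - x = of_int (l - k)" by simp
   thus ?thesis by simp
  qed
  then obtain k where "y - x = of_int k" by (auto simp: Ints_def)
  hence "y = x + of_int k" by (simp add: algebra_simps)
  thus ?thesis ..
 qed
 show "z \<in> exponents z"
 proof (cases rule: cs)
  case 3
  have "z = z + of_int 0" by simp
  thus ?thesis using 3 by blast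
 qed auto
qed

context
 fixes n :: nat and lam :: "nat => complex"
begin

definition NH :: "nat => nat => ((nat => complex) \<Rightarrow>\<^sub>0 complex) => ((nat => complex) \<Rightarrow>\<^sub>0 complex)"
 where "NH i j v = t_mult n lam i (t_der j v)"

definition sh :: "nat => nat => (nat => complex) => (nat => complex)"
 where "sh i j nu = (%a. nu a - of_bool (a = j) + of_bool (a = i))"

definition "mon0 = {nu \<in> monomials n lam. (\<Sum>i\<in>{1..n}. nu i) = (\<Sum>i\<in>{1..n}. lam i)}"

lemma plin_NH [simp]: "plin (NH i j)"
 unfolding NH_def[abs_def] t_mult_def t_der_def by (rule plin_comp) simp_all

lemma NH_bvec: "NH i j (bvec nu) = (if sh i j nu \<in> monomials n lam then sgl (sh i j nu) (nu j) else 0)"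
proof -
 have "(nu(j := nu j - 1))(i := (nu(j := nu j - 1)) i + 1) = sh i j nu" by (auto simp: sh_def fun_eq_iff)
 thus ?thesis by (simp add: NH_def t_mult_def t_der_def)
qed

lemma sh_self [simp]: "sh i i nu = nu" by (simp add: sh_def)

text \<open>On monomials the Euler operator is diagonal, with the total degree as
  eigenvalue.\<close>

lemma N_carrier_eq: "N_carrier n lam = {v. supp v <= mon0}"
proof -
 have e: "(\<Sum>s\<in>{1..n}. t_mult n lam s (t_der s v)) = linext (%nu. sgl nu (\<Sum>s\<in>{1..n}. nu s)) v"
  if "supp v <= monomials n lam" for v
 proof (rule plin_eqI[OF _ plin_linext that])
  show "plin (%v. \<Sum>s\<in>{1..n}. t_mult n lam s (t_der s v))"
   using plin_sum_fun[of "{1..n}" "%s. NH s s"] by (simp add: NH_def)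
  fix nu assume "nu \<in> monomials n lam"
  hence "NH s s (bvec nu) = sgl nu (nu s)" for s by (simp add: NH_bvec)
  thus "(\<Sum>s\<in>{1..n}. t_mult n lam s (t_der s (bvec nu))) = linext (%nu. sgl nu (\<Sum>s\<in>{1..n}. nu s)) (bvec nu)"
   using single_sum_fun[of nu "%s. nu s" "{1..n}"] by (simp add: NH_def[symmetric])
 qed
 have c: "cf (linext (%nu. sgl nu (c nu)) v) \<mu> = c \<mu> * cf v \<mu>" for c v and \<mu> :: "nat => complex"
  by (simp add: linext_def lookup_sum lookup_single when_def if_distrib[of "%x. _ * x"] sum.delta in_keys_iff cong: if_cong)
 show ?thesis
 proof (intro equalityI subsetI)
  fix v assume v: "v \<in> N_carrier n lam"
  hence sv: "supp v <= monomials n lam" by (simp add: N_carrier_def)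
  have "linext (%nu. sgl nu (\<Sum>s\<in>{1..n}. nu s)) v = pscale (\<Sum>i\<in>{1..n}. lam i) v"
   using v e[OF sv] by (simp add: N_carrier_def)
  hence "(\<Sum>s\<in>{1..n}. nu s) * cf v nu = (\<Sum>i\<in>{1..n}. lam i) * cf v nu" for nu
   using c[of "%nu. \<Sum>s\<in>{1..n}. nu s" v nu] by auto
  thus "v \<in> {v. supp v <= mon0}" using sv by (fastforce simp: mon0_def supp_iff)
 next
  fix v assume v: "v \<in> {v. supp v <= mon0}"
  hence sv: "supp v <= monomials n lam" by (auto simp: mon0_def)
  have "linext (%nu. sgl nu (\<Sum>s\<in>{1..n}. nu s)) v = pscale (\<Sum>i\<in>{1..n}. lam i) v"
  proof (rule poly_mapping_eqI)
   fix nu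
   show "cf (linext (%nu. sgl nu (\<Sum>s\<in>{1..n}. nu s)) v) nu = cf (pscale (\<Sum>i\<in>{1..n}. lam i) v) nu"
    using v by (cases "cf v nu = 0") (auto simp: c mon0_def supp_iff subset_iff)
  qed
  thus "v \<in> N_carrier n lam" using sv e[OF sv] by (simp add: N_carrier_def)
 qed
qed

lemma sum_sh:
 assumes "i \<in> {1..n}" "j \<in> {1..n}"
 shows "(\<Sum>a\<in>{1..n}. sh i j nu a) = (\<Sum>a\<in>{1..n}. nu a)"
 using assms by (simp add: sh_def sum.distrib sum_subtractf of_bool_def)

lemma N_sub: "subsp (N_carrier n lam)"
 unfolding N_carrier_eq by (rule subspace_supp)

lemma NH_N:
 assumes "i \<in> {1..n}" "j \<in> {1..n}" "v \<in> N_carrier n lam"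
 shows "NH i j v \<in> N_carrier n lam"
proof (rule supp_image[OF plin_NH N_sub])
 show "supp v <= mon0" using assms by (simp add: N_carrier_eq)
 fix nu assume "nu \<in> mon0"
 thus "NH i j (bvec nu) \<in> N_carrier n lam"
  using assms sum_sh[OF assms(1,2), of nu] by (auto simp: NH_bvec N_carrier_eq mon0_def)
qed

text \<open>Normal ordering: the product is t_k t_l d_i d_j plus a first-order term if
  \<open>j = l\<close>. Truncating after the first operator does no harm, since by
  \<open>key\<close> the intermediate monomial is in the basis whenever the final one is and the
  coefficient is nonzero.\<close>

lemma NH_NH:
 assumes "nu \<in> monomials n lam" "i \<in> {1..n}" "j \<in> {1..n}" "k \<in> {1..n}" "l \<in> {1..n}"
 shows "NH k j (NH l i (bvec nu)) = pscale (of_bool (j = l)) (NH k i (bvec nu)) +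
  (if (%a. nu a - of_bool (a = i) - of_bool (a = j) + of_bool (a = k) + of_bool (a = l)) \<in> monomials n lam
   then sgl (%a. nu a - of_bool (a = i) - of_bool (a = j) + of_bool (a = k) + of_bool (a = l))
    (nu i * (nu j - of_bool (i = j))) else 0)"
proof -
 let ?\<phi> = "%a. nu a - of_bool (a = i) - of_bool (a = j) + of_bool (a = k) + of_bool (a = l)"
 let ?nu1 = "sh l i nu"
 have phi: "sh k j ?nu1 = ?\<phi>" by (auto simp: sh_def fun_eq_iff)
 have phi': "j = l ==> sh k i nu = ?\<phi>" by (auto simp: sh_def fun_eq_iff)
 have nu1j: "?nu1 j = nu j - of_bool (i = j) + of_bool (j = l)" by (auto simp: sh_def)
 have key: "?nu1 \<in> monomials n lam" if "?\<phi> \<in> monomials n lam" "nu i * ?nu1 j ~= 0"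
 proof -
  have "?nu1 a \<in> exponents (lam a)" if a: "a \<in> {1..n}" for a
  proof -
   have nu: "nu a \<in> exponents (lam a)" using assms(1) a by (auto simp: monomials_def)
   have ph: "?\<phi> a \<in> exponents (lam a)" using \<open>?\<phi> \<in> monomials n lam\<close> a unfolding monomials_def by blast
   show ?thesis
   proof (cases "l = i")
    case True
    thus ?thesis using nu by (simp add: sh_def)
   next
    case li: False
    show ?thesis
    proof (cases "a = i")
     case True
     thus ?thesis using nu exponents_facts(2)[OF nu] \<open>nu i * ?nu1 j ~= 0\<close> li by (auto simp: sh_def)
    next
     case ai: False
     show ?thesis
     proof (cases "a = l")
      case True
      \<comment> \<open>Multiplying t_l^-1 by t_l leaves the basis. Only a later derivative by t_l
        could lead back into it, but the exponent of t_l is then 0, and so is the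
        coefficient.\<close>
      have "nu l ~= -1"
      proof
       assume m: "nu l = -1"
       hence E: "-1 \<in> exponents (lam l)" using nu True by simp
       have pe: "?\<phi> l = of_bool (l = k) - of_bool (l = j)" using m li by auto
       hence "of_bool (l = k) - of_bool (l = j) \<in> exponents (lam l)" using ph by (simp only: True pe)
       hence "j = l" "k ~= l" using exponents_facts(3)[OF E, of 0] exponents_facts(3)[OF E, of 1]
        by (auto simp: of_bool_def split: if_splits)
       hence "?nu1 j = 0" using m li by (simp add: sh_def)
       thus False using \<open>nu i * ?nu1 j ~= 0\<close> by simp
      qed
      thus ?thesis using exponents_facts(1)[OF nu] True ai by (simp add: sh_def)
     next
      case False
      thus ?thesis using nu ai by (simp add: sh_def)
     qed
    qed
   qed
  qed
  moreover have "?nu1 a = 0" if "a \<notin> {1..n}" for a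
   using assms that by (auto simp: sh_def monomials_def)
  ultimately show ?thesis by (simp add: monomials_def)
 qed
 have "NH k j (NH l i (bvec nu)) = (if ?nu1 \<in> monomials n lam & ?\<phi> \<in> monomials n lam then sgl ?\<phi> (nu i * ?nu1 j) else 0)"
  using plin_scale[OF plin_NH, of k j "nu i" "bvec ?nu1"] by (auto simp: NH_bvec phi plin_zero)
 also have "\<dots> = (if ?\<phi> \<in> monomials n lam then sgl ?\<phi> (nu i * ?nu1 j) else 0)"
  using key by (cases "nu i * ?nu1 j = 0") auto
 also have "\<dots> = pscale (of_bool (j = l)) (NH k i (bvec nu)) +
  (if ?\<phi> \<in> monomials n lam then sgl ?\<phi> (nu i * (nu j - of_bool (i = j))) else 0)"
  unfolding nu1j by (cases "j = l") (simp_all add: NH_bvec phi' single_arith algebra_simps)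
 finally show ?thesis .
qed

text \<open>The normally ordered term of \<open>NH_NH\<close> is unchanged by the index exchanges
  involved, so only the first-order terms are left.\<close>

lemma NH_relations:
 assumes "i \<in> {1..n}" "j \<in> {1..n}" "k \<in> {1..n}" "l \<in> {1..n}" "v \<in> N_carrier n lam"
 shows "NH i j (NH k l v) = NH k l (NH i j v) + pscale (of_bool (j = k)) (NH i l v) - pscale (of_bool (l = i)) (NH k j v)"
  "NH k j (NH l i v) - pscale (of_bool (j = l)) (NH k i v) = NH k i (NH l j v) - pscale (of_bool (i = l)) (NH k j v)"
proof -
 have sv: "supp v <= mon0" using assms by (simp add: N_carrier_eq)
 let ?\<phi> = "%nu i j k l a. nu a - of_bool (a = i) - of_bool (a = j) + of_bool (a = k) + of_bool (a = l) :: complex"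
 have s1: "?\<phi> nu i j k l = ?\<phi> nu j i k l" "?\<phi> nu i j k l = ?\<phi> nu i j l k" for nu :: "nat => complex" and i j k l by auto
 note pl = plin_comp[OF plin_NH plin_NH]
 show "NH i j (NH k l v) = NH k l (NH i j v) + pscale (of_bool (j = k)) (NH i l v) - pscale (of_bool (l = i)) (NH k j v)"
 proof (rule plin_eqI[OF _ _ sv])
  show "plin (%v. NH i j (NH k l v))" by (rule pl)
  show "plin (%v. NH k l (NH i j v) + pscale (of_bool (j = k)) (NH i l v) - pscale (of_bool (l = i)) (NH k j v))"
   by (intro plin_plus plin_minus plin_pscale pl plin_NH)
  fix nu assume "nu \<in> mon0"
  hence m: "nu \<in> monomials n lam" by (simp add: mon0_def)
  have "?\<phi> nu l j i k = ?\<phi> nu j l k i" by auto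
  moreover have "nu l * (nu j - of_bool (l = j)) = nu j * (nu l - of_bool (j = l))" by auto
  ultimately show "NH i j (NH k l (bvec nu)) = NH k l (NH i j (bvec nu)) + pscale (of_bool (j = k)) (NH i l (bvec nu)) - pscale (of_bool (l = i)) (NH k j (bvec nu))"
   unfolding NH_NH[OF m assms(4) assms(2) assms(1) assms(3)] NH_NH[OF m assms(2) assms(4) assms(3) assms(1)] by simp
 qed
 show "NH k j (NH l i v) - pscale (of_bool (j = l)) (NH k i v) = NH k i (NH l j v) - pscale (of_bool (i = l)) (NH k j v)"
 proof (rule plin_eqI[OF _ _ sv])
  show "plin (%v. NH k j (NH l i v) - pscale (of_bool (j = l)) (NH k i v))"
   "plin (%v. NH k i (NH l j v) - pscale (of_bool (i = l)) (NH k j v))"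
   by (intro plin_minus plin_pscale pl plin_NH)+
  fix nu assume "nu \<in> mon0"
  hence m: "nu \<in> monomials n lam" by (simp add: mon0_def)
  have "?\<phi> nu i j k l = ?\<phi> nu j i k l" by auto
  moreover have "nu i * (nu j - of_bool (i = j)) = nu j * (nu i - of_bool (j = i))" by auto
  ultimately show "NH k j (NH l i (bvec nu)) - pscale (of_bool (j = l)) (NH k i (bvec nu)) = NH k i (NH l j (bvec nu)) - pscale (of_bool (i = l)) (NH k j (bvec nu))"
   unfolding NH_NH[OF m assms(1) assms(2) assms(3) assms(4)] NH_NH[OF m assms(2) assms(1) assms(3) assms(4)] by simp
 qed
qed

text \<open>The degrees agree, so unless the monomials coincide, one exponent has to grow and
  another to fall. Moving one unit between these two places reduces the distance;
  \<open>exponents_facts\<close> keeps the new monomial in the basis and the coefficient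
  nonzero.\<close>

lemma mon0_connected:
 assumes W: "subsp W" "!!i j w. i \<in> {1..n} ==> j \<in> {1..n} ==> w \<in> W ==> NH i j w \<in> W"
  and nu': "nu' \<in> mon0"
 shows "nu \<in> mon0 ==> bvec nu \<in> W ==> (!!a. a \<in> {1..n} ==> nu' a = nu a + of_int (k a)) ==> bvec nu' \<in> W"
proof (induction "\<Sum>a\<in>{1..n}. nat \<bar>k a\<bar>" arbitrary: nu k rule: less_induct)
 case less
 have out: "nu a = 0" "nu' a = 0" if "a \<notin> {1..n}" for a using that less.prems(1) nu' by (auto simp: mon0_def monomials_def)
 show ?case
 proof (cases "\<forall>a\<in>{1..n}. k a = 0")
  case True
  hence "nu' = nu" using less.prems(3) out by (intro ext) (metis add.right_neutral of_int_0)
  thus ?thesis using less.prems(2) by simp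
 next
  case False
  have "(\<Sum>a\<in>{1..n}. nu' a) = (\<Sum>a\<in>{1..n}. nu a) + of_int (\<Sum>a\<in>{1..n}. k a)"
   using less.prems(3) by (simp add: sum.distrib)
  moreover have "(\<Sum>a\<in>{1..n}. nu' a) = (\<Sum>a\<in>{1..n}. nu a)" using less.prems(1) nu' by (simp add: mon0_def)
  ultimately have "of_int (\<Sum>a\<in>{1..n}. k a) = (0 :: complex)" by simp
  hence s0: "(\<Sum>a\<in>{1..n}. k a) = 0" by (simp only: of_int_eq_0_iff)
  have pos: "\<exists>i\<in>{1..n}. k i > 0"
  proof (rule ccontr)
   assume "~ ?thesis"
   hence "\<forall>a\<in>{1..n}. - k a \<ge> 0" by auto
   moreover have "(\<Sum>a\<in>{1..n}. - k a) = 0" using s0 by (simp add: sum_negf)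
   ultimately have "\<forall>a\<in>{1..n}. - k a = 0" using sum_nonneg_eq_0_iff[of "{1..n}" "%a. - k a"] by auto
   thus False using False by auto
  qed
  have neg: "\<exists>j\<in>{1..n}. k j < 0"
  proof (rule ccontr)
   assume "~ ?thesis"
   hence "\<forall>a\<in>{1..n}. k a \<ge> 0" by auto
   hence "\<forall>a\<in>{1..n}. k a = 0" using sum_nonneg_eq_0_iff[of "{1..n}" k] s0 by auto
   thus False using False by auto
  qed
  obtain i j where ij: "i \<in> {1..n}" "k i > 0" "j \<in> {1..n}" "k j < 0" using pos neg by blast
  hence nij: "i ~= j" by auto
  have E: "nu a \<in> exponents (lam a)" "nu' a \<in> exponents (lam a)" if "a \<in> {1..n}" for a
   using that less.prems(1) nu' by (auto simp: mon0_def monomials_def)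
  have ni: "nu i ~= -1"
  proof
   assume m: "nu i = -1"
   have "nu' i = of_nat (nat (k i - 1))" using less.prems(3)[OF ij(1)] m ij(2) by simp
   thus False using exponents_facts(3)[of "lam i" "nat (k i - 1)"] E[OF ij(1)] m by simp
  qed
  have nj: "nu j ~= 0"
  proof
   assume m: "nu j = 0"
   have "nu' j = - of_nat (Suc (nat (- k j - 1)))" using less.prems(3)[OF ij(3)] m ij(4) by simp
   thus False using exponents_facts(4)[of "lam j" "nat (- k j - 1)"] E[OF ij(3)] m by simp
  qed
  let ?nu1 = "sh i j nu"
  have "?nu1 a \<in> exponents (lam a)" if "a \<in> {1..n}" for a
   using E(1)[OF that] exponents_facts(1)[OF E(1)[OF ij(1)] ni] exponents_facts(2)[OF E(1)[OF ij(3)] nj] nij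
   by (auto simp: sh_def)
  moreover have "?nu1 a = 0" if "a \<notin> {1..n}" for a using that out ij by (auto simp: sh_def)
  ultimately have mm: "?nu1 \<in> monomials n lam" by (simp add: monomials_def)
  hence m1: "?nu1 \<in> mon0" using less.prems(1) sum_sh[OF ij(1,3)] by (simp add: mon0_def)
  have "NH i j (bvec nu) \<in> W" using W(2)[OF ij(1,3) less.prems(2)] .
  hence "pscale (inverse (nu j)) (NH i j (bvec nu)) \<in> W" by (rule sub_scale[OF W(1)])
  hence w1: "bvec ?nu1 \<in> W" using mm nj by (simp add: NH_bvec)
  let ?k = "k(i := k i - 1, j := k j + 1)"
  have "(\<Sum>a\<in>{1..n}. nat \<bar>?k a\<bar>) < (\<Sum>a\<in>{1..n}. nat \<bar>k a\<bar>)"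
   by (rule sum_strict_mono_ex1) (use ij nij in "auto intro!: bexI[of _ i]")
  moreover have "nu' a = ?nu1 a + of_int (?k a)" if "a \<in> {1..n}" for a
   using less.prems(3)[OF that] nij by (auto simp: sh_def)
  ultimately show ?thesis using less.hyps[of ?k ?nu1] m1 w1 by blast
 qed
qed

text \<open>The diagonal operators separate monomials, so a nonzero submodule contains one of them,
  and \<open>mon0_connected\<close> reaches the others.\<close>

lemma N_simple:
 assumes W: "subsp W" "W <= N_carrier n lam" "W ~= {0}"
  "!!i j w. i \<in> {1..n} ==> j \<in> {1..n} ==> w \<in> W ==> NH i j w \<in> W"
 shows "W = N_carrier n lam"
proof -
 obtain x where x: "x \<in> W" "x ~= 0" using W(1,3) sub_0 by blast
 then obtain nu where nu: "nu \<in> supp x" by (metis ex_in_conv keys_eq_empty)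
 have sx: "supp x <= mon0" using x W(2) by (auto simp: N_carrier_eq)
 have diag: "NH i i (bvec \<mu>) = pscale (\<mu> i) (bvec \<mu>)" if "\<mu> \<in> mon0" for i \<mu>
  using that by (simp add: NH_bvec mon0_def)
 have "pscale (cf x nu) (bvec nu) \<in> W"
 proof (rule pv.joint_eigenvectors_in_subspace[where H="(%i. NH i i) ` {1..n}" and A="supp x"
   and x="%nu. pscale (cf x nu) (bvec nu)" and \<chi>="%h \<mu>. cf (h (bvec \<mu>)) \<mu>", OF W(1)])
  show "h y \<in> W" if "h \<in> (%i. NH i i) ` {1..n}" "y \<in> W" for h y using that W(4) by auto
  show "h (y + z) = h y + h z" if "h \<in> (%i. NH i i) ` {1..n}" for h y z
   using that plin_add[OF plin_NH] by auto
  show "h (pscale c y) = pscale c (h y)" if "h \<in> (%i. NH i i) ` {1..n}" for h y c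
   using that plin_scale[OF plin_NH] by auto
  show "h (pscale (cf x \<mu>) (bvec \<mu>)) - pscale (cf (h (bvec \<mu>)) \<mu>) (pscale (cf x \<mu>) (bvec \<mu>)) \<in> W"
   if m: "\<mu> \<in> supp x" and hh: "h \<in> (%i. NH i i) ` {1..n}" for \<mu> h
  proof -
   obtain i where h: "h = NH i i" using hh by blast
   have "\<mu> \<in> mon0" using m sx by blast
   thus ?thesis using sub_0[OF W(1)] unfolding h plin_scale[OF plin_NH] diag[OF \<open>\<mu> \<in> mon0\<close>]
    by (simp add: mult.commute)
  qed
  show "\<exists>h\<in>(%i. NH i i) ` {1..n}. cf (h (bvec \<mu>)) \<mu> ~= cf (h (bvec \<mu>')) \<mu>'"
   if "\<mu> \<in> supp x" "\<mu>' \<in> supp x" and ne: "\<mu> ~= \<mu>'" for \<mu> \<mu>'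
  proof -
   have m: "\<mu> \<in> mon0" "\<mu>' \<in> mon0" using that sx by blast+
   obtain i where i: "\<mu> i ~= \<mu>' i" using ne by auto
   hence "i \<in> {1..n}" using m by (cases "i \<in> {1..n}") (simp_all add: mon0_def monomials_def)
   thus ?thesis using i by (intro bexI[of _ "NH i i"]) (simp_all add: diag m)
  qed
  show "(\<Sum>\<mu>\<in>supp x. pscale (cf x \<mu>) (bvec \<mu>)) \<in> W"
  proof -
   have "(\<Sum>\<mu>\<in>supp x. pscale (cf x \<mu>) (bvec \<mu>)) = x"
    using plin_eq[OF plin_linext plin_id, of bvec x] by (simp add: linext_def)
   thus ?thesis using x by simp
  qed
 qed (use nu in simp_all)
 hence "pscale (inverse (cf x nu)) (pscale (cf x nu) (bvec nu)) \<in> W" by (rule sub_scale[OF W(1)])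
 hence b: "bvec nu \<in> W" using nu by (simp add: in_keys_iff)
 have num: "nu \<in> mon0" using nu sx by blast
 have all: "bvec nu' \<in> W" if nu': "nu' \<in> mon0" for nu'
 proof -
  have "\<forall>a. \<exists>k. a \<in> {1..n} --> nu' a = nu a + of_int k"
  proof
   fix a
   have "nu' a \<in> exponents (lam a)" "nu a \<in> exponents (lam a)" if "a \<in> {1..n}"
    using that nu' num by (simp_all add: mon0_def monomials_def)
   thus "\<exists>k. a \<in> {1..n} --> nu' a = nu a + of_int k" using exponents_facts(5) by blast
  qed
  then obtain k where "!!a. a \<in> {1..n} ==> nu' a = nu a + of_int (k a)" by metis
  from mon0_connected[OF W(1,4) nu' num b this] show ?thesis .
 qed
 have "N_carrier n lam <= W"
 proof
  fix y assume "y \<in> N_carrier n lam"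
  hence sy: "supp y <= mon0" by (simp add: N_carrier_eq)
  show "y \<in> W" using supp_image[OF plin_id W(1) sy] all by simp
 qed
 thus ?thesis using W(2) by blast
qed

end

section \<open>The lowest layer of a simple weight module with vanishing products of raising operators\<close>

locale quadratic_sl_module = sl_module +
 assumes quadratic: "i \<in> {1..n} ==> j \<in> {1..n} ==> v \<in> V ==> X i (X j v) = 0"
begin

definition "Vp p = {f. supp f <= {b \<in> B. d b = p}}"

definition "lowest = {v \<in> V. \<forall>i\<in>{1..n}. Y i v = 0}"

lemma Vp_sub: "subsp (Vp p)" unfolding Vp_def by (rule subspace_supp)

lemma Vp_V: "f \<in> Vp p ==> f \<in> V" by (auto simp: Vp_def V_def)

lemma Vp_disjoint: "f \<in> Vp p ==> f \<in> Vp (~ p) ==> f = 0"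
 by (rule poly_mapping_eqI) (auto simp: Vp_def supp_iff subset_iff)

lemma gens_Vp:
 assumes "i \<in> {1..n}" "j \<in> {1..n}" "f \<in> Vp p"
 shows "X i f \<in> Vp (~ p)" "Y i f \<in> Vp (~ p)" "H i j f \<in> Vp p"
 using opr_parity[of "Emat 0 i" True f p] opr_parity[of "Emat i 0" True f p] opr_parity[of "Gmat i j" False f p]
  sl_gens[OF assms(1,2)] gens_carrier assms by (auto simp: Vp_def)

lemma lowest_sub: "subsp lowest"
 unfolding lowest_def
 by (rule pv.subspaceI) (auto simp: sub_0[OF V_sub] sub_add[OF V_sub] sub_scale[OF V_sub]
   plin_zero plin_add plin_scale)

lemma H_lowest: "i \<in> {1..n} ==> j \<in> {1..n} ==> v \<in> lowest ==> H i j v \<in> lowest"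
proof -
 assume a: "i \<in> {1..n}" "j \<in> {1..n}" "v \<in> lowest"
 have v: "v \<in> V" "!!k. k \<in> {1..n} ==> Y k v = 0" using a by (auto simp: lowest_def)
 have "Y k (H i j v) = 0" if k: "k \<in> {1..n}" for k
 proof -
  have "H i j (Y k v) = Y k (H i j v) + pscale (of_bool (j = k)) (Y i v) - pscale (of_bool (i = j)) (Y k v)"
   using relations(5)[OF a(2,2) k a(1) v(1)] by simp
  thus ?thesis using v(2) a k by (simp add: plin_zero)
 qed
 thus ?thesis using gens_V(3)[OF a(1,2) v(1)] by (simp add: lowest_def)
qed

lemma lowest_swap:
 assumes "i \<in> {1..n}" "j \<in> {1..n}" "k \<in> {1..n}" "l \<in> {1..n}" "m \<in> lowest"
 shows "H k j (H l i m) - pscale (of_bool (j = l)) (H k i m) = H k i (H l j m) - pscale (of_bool (i = l)) (H k j m)"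
proof -
 have yx: "Y a (X b w) = H a b w" if "a \<in> {1..n}" "b \<in> {1..n}" "w \<in> lowest" for a b w
  using relations(3)[OF that(2) that(2) that(1) that(1)] that by (simp add: lowest_def plin_zero)
 have mV: "m \<in> V" using assms(5) by (simp add: lowest_def)
 \<comment> \<open>First \<open>Y l\<close> is applied to \<open>X i (X j m) = 0\<close>, later
   \<open>Y k\<close> to the identity obtained; by \<open>yx\<close> each remaining pair of a
   \<open>Y\<close> and an \<open>X\<close> becomes an \<open>H\<close>.\<close>
 have "H l i (X j m) - X i (Y l (X j m)) = 0"
  using relations(3)[OF assms(1,1) assms(4,4) gens_V(1)[OF assms(2) mV]] quadratic[OF assms(1,2) mV]
  by (simp add: plin_zero)
 hence "H l i (X j m) = X i (H l j m)" using yx[OF assms(4,2,5)] by simp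
 hence "X j (H l i m) + pscale (of_bool (l = i)) (X j m) - pscale (of_bool (j = l)) (X i m) = X i (H l j m)"
  using relations(4)[OF assms(1,2,4,4) mV] by simp
 hence "Y k (X j (H l i m) + pscale (of_bool (l = i)) (X j m) - pscale (of_bool (j = l)) (X i m)) = Y k (X i (H l j m))"
  by (rule arg_cong)
 hence "H k j (H l i m) + pscale (of_bool (l = i)) (H k j m) - pscale (of_bool (j = l)) (H k i m) = H k i (H l j m)"
  using assms by (simp add: plin_add plin_diff plin_scale yx H_lowest)
 thus ?thesis by (auto simp: algebra_simps of_bool_def)
qed

text \<open>The sums on the right form a submodule: products of two \<open>X\<close> vanish, the
  \<open>Y\<close> kill \<open>W\<close>, and \<open>Y k (X i w) = H k i w\<close> is in
  \<open>W\<close> again. Thus any nonzero gl(n)-stable part of the lowest layer of one parity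
  generates \<open>V\<close>; the choice of \<open>W\<close> varies with the application.\<close>

lemma layers:
 assumes W: "subsp W" "W <= lowest" "W <= Vp p" "W ~= {0}"
  and HW: "!!i j w. i \<in> {1..n} ==> j \<in> {1..n} ==> w \<in> W ==> H i j w \<in> W"
  and v: "v \<in> V"
 obtains a f where "a \<in> W" "!!i. i \<in> {1..n} ==> f i \<in> W" "v = a + (\<Sum>i\<in>{1..n}. X i (f i))"
proof -
 define S where "S = {v. \<exists>a f. a \<in> W & (\<forall>i\<in>{1..n}. f i \<in> W) & v = a + (\<Sum>i\<in>{1..n}. X i (f i))}"
 have WV: "w \<in> V" if "w \<in> W" for w using that W(2) by (auto simp: lowest_def)
 have SI: "a + (\<Sum>i\<in>{1..n}. X i (f i)) \<in> S" if "a \<in> W" "!!i. i \<in> {1..n} ==> f i \<in> W" for a f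
  using that unfolding S_def by blast
 have W0: "0 \<in> W" by (rule sub_0[OF W(1)])
 have S_sub: "subsp S"
 proof (rule pv.subspaceI)
  show "0 \<in> S" using SI[OF W0, of "%_. 0"] W0 by (simp add: plin_zero)
  fix x y c assume "x \<in> S"
  then obtain a f where x: "a \<in> W" "!!i. i \<in> {1..n} ==> f i \<in> W" "x = a + (\<Sum>i\<in>{1..n}. X i (f i))"
   unfolding S_def by blast
  { assume "y \<in> S"
   then obtain b g where y: "b \<in> W" "!!i. i \<in> {1..n} ==> g i \<in> W" "y = b + (\<Sum>i\<in>{1..n}. X i (g i))"
    unfolding S_def by blast
   have "x + y = (a + b) + (\<Sum>i\<in>{1..n}. X i (f i + g i))"
    unfolding x y by (simp add: plin_add sum.distrib)
   thus "x + y \<in> S" by (simp only:) (rule SI; use x y sub_add[OF W(1)] in blast) }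
  have "pscale c x = pscale c a + (\<Sum>i\<in>{1..n}. X i (pscale c (f i)))"
   unfolding x by (simp add: plin_scale pv.scale_right_distrib pv.scale_sum_right)
  thus "pscale c x \<in> S" using SI[of "pscale c a" "%i. pscale c (f i)"] x sub_scale[OF W(1)] by simp
 qed
 have WS: "w \<in> S" if "w \<in> W" for w using SI[OF that, of "%_. 0"] W0 by (simp add: plin_zero)
 have XS: "X i w \<in> S" if "i \<in> {1..n}" "w \<in> W" for i w
 proof -
  have e: "X j (if j = i then w else 0) = (if j = i then X i w else 0)" for j by (simp add: plin_zero)
  show ?thesis
   using SI[OF W0, of "%j. if j = i then w else 0"] W0 that by (simp add: e)
 qed
 have ind: "F s \<in> S" if s: "s \<in> S" and "plin F" and "!!w. w \<in> W ==> F w \<in> S"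
  and "!!i w. i \<in> {1..n} ==> w \<in> W ==> F (X i w) \<in> S" for F s
 proof -
  obtain a f where "a \<in> W" "!!i. i \<in> {1..n} ==> f i \<in> W" "s = a + (\<Sum>i\<in>{1..n}. X i (f i))"
   using s unfolding S_def by blast
  thus ?thesis using that(3,4) sub_sum[OF S_sub, of "{1..n}" "%i. F (X i (f i))"]
   by (simp add: plin_add[OF that(2)] plin_sum[OF that(2)] sub_add[OF S_sub])
 qed
 have yx: "Y k (X i w) = H k i w" if "k \<in> {1..n}" "i \<in> {1..n}" "w \<in> W" for k i w
  using relations(3)[OF that(2,2) that(1,1) WV[OF that(3)]] that W(2) by (auto simp: lowest_def plin_zero)
 have "S = {0} | S = V"
 proof (rule simple_gens[OF S_sub])
  show "S <= V"
  proof
   fix s assume "s \<in> S"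
   then obtain a f where s: "a \<in> W" "!!i. i \<in> {1..n} ==> f i \<in> W" "s = a + (\<Sum>i\<in>{1..n}. X i (f i))"
    unfolding S_def by blast
   show "s \<in> V" unfolding s(3)
    by (intro sub_add[OF V_sub] sub_sum[OF V_sub] gens_V(1) WV s(1) s(2))
  qed
  show "parity_op d s \<in> S" if "s \<in> S" for s
  proof (rule ind[OF that])
   have h: "parity_op d w = (if p then - w else w)" if "w \<in> Vp p" for w p
    by (rule parity_op_hom) (use that in "auto simp: Vp_def")
   show "parity_op d w \<in> S" if "w \<in> W" for w
    using h[of w p] that W(3) WS sub_neg[OF S_sub] by auto
   show "parity_op d (X i w) \<in> S" if "i \<in> {1..n}" "w \<in> W" for i w
    using h[of "X i w" "~ p"] gens_Vp(1)[OF that(1,1), of w p] that W(3) XS sub_neg[OF S_sub] by auto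
  qed simp
  show "X i s \<in> S" if "i \<in> {1..n}" "s \<in> S" for i s
   by (rule ind[OF that(2)]) (use XS quadratic that(1) WV sub_0[OF S_sub] in auto)
  show "Y i s \<in> S" if i: "i \<in> {1..n}" "s \<in> S" for i s
  proof (rule ind[OF i(2)])
   show "Y i w \<in> S" if "w \<in> W" for w
    using that W(2) i(1) sub_0[OF S_sub] by (auto simp: lowest_def)
   show "Y i (X j w) \<in> S" if "j \<in> {1..n}" "w \<in> W" for j w
    using yx[OF i(1) that] HW i(1) that WS by simp
  qed simp
  show "H i j s \<in> S" if ij: "i \<in> {1..n}" "j \<in> {1..n}" "s \<in> S" for i j s
  proof (rule ind[OF ij(3)])
   show "H i j w \<in> S" if "w \<in> W" for w using that HW ij WS by blast
   show "H i j (X k w) \<in> S" if "k \<in> {1..n}" "w \<in> W" for k w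
    unfolding relations(4)[OF ij(2) that(1) ij(1,1) WV[OF that(2)]]
    by (intro sub_diff[OF S_sub] sub_add[OF S_sub] sub_scale[OF S_sub] XS HW that ij)
  qed simp
 qed
 moreover have "S ~= {0}" using WS W(4) W0 by blast
 ultimately have "v \<in> S" using v by simp
 thus ?thesis using that unfolding S_def by blast
qed

lemma weight_vector:
 assumes "weight_module n M"
 obtains v \<mu> where "v \<in> V" "v ~= 0" "!!i. i \<in> {1..n} ==> H i i v = pscale (\<mu> i) v"
proof -
 let ?S = "{v \<in> carrier M. \<forall>h \<in> slc n. (\<forall>i j. i ~= j --> h i j = 0) --> (\<exists>c. act M h v = c \<odot>\<^bsub>M\<^esub> v)}"
 have c: "carrier M = lin_span M ?S" using assms by (simp add: weight_module_def)
 have "~ ?S <= {\<zero>\<^bsub>M\<^esub>}"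
 proof
  assume S: "?S <= {\<zero>\<^bsub>M\<^esub>}"
  interpret Module.module complex_field M by (rule module)
  have "submodule {\<zero>\<^bsub>M\<^esub>} complex_field M"
   unfolding submodule_iff[OF module] using complex_module[OF module] by auto
  hence "lin_span M ?S <= {\<zero>\<^bsub>M\<^esub>}" using S unfolding lin_span_def by blast
  hence "carrier M = {\<zero>\<^bsub>M\<^esub>}" using c zero_closed by blast
  thus False using simple by (simp add: simple_supermodule_def)
 qed
 then obtain u where u: "u \<in> ?S" "u ~= \<zero>\<^bsub>M\<^esub>" by blast
 have uM: "u \<in> carrier M" using u by blast
 have "\<exists>c. H i i (kap u) = pscale c (kap u)" if i: "i \<in> {1..n}" for i
 proof -
  have "\<forall>a b. a ~= b --> Gmat i i a b = 0" by (auto simp: Gmat_def Emat_def)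
  then obtain c where "act M (Gmat i i) u = c \<odot>\<^bsub>M\<^esub> u" using u gens_carrier(3)[OF i i] by blast
  thus ?thesis using opr_k[OF gens_carrier(3)[OF i i] uM] k_scale[OF uM] by auto
 qed
 then obtain \<mu> where "!!i. i \<in> {1..n} ==> H i i (kap u) = pscale (\<mu> i) (kap u)" by metis
 moreover have "kap u ~= 0" using k_inj[OF uM M_closed(3)] k_zero u by auto
 ultimately show ?thesis using that k_V[OF uM] by blast
qed

text \<open>Starting from a homogeneous weight vector, the operators \<open>Y 1\<close>,
  \<open>Y 2\<close> and so on are treated in turn: a vector not killed by the current one is
  replaced by its image. The \<open>Y\<close> anticommute and square to zero, so those treated
  before still kill the new vector.\<close>

lemma lowest_weight_vector:
 assumes "weight_module n M"
 obtains m \<mu> p where "m \<in> lowest" "m \<in> Vp p" "m ~= 0" "!!i. i \<in> {1..n} ==> H i i m = pscale (\<mu> i) m"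
proof -
 let ?Q = "%m. m ~= 0 & (\<exists>p. m \<in> Vp p) & (\<exists>\<mu>. \<forall>i\<in>{1..n}. H i i m = pscale (\<mu> i) m)"
 obtain v \<mu> where v: "v \<in> V" "v ~= 0" "!!i. i \<in> {1..n} ==> H i i v = pscale (\<mu> i) v"
  using weight_vector[OF assms] by metis
 obtain f0 f1 where f: "v = f0 + f1" "supp f0 <= {b \<in> B. ~ d b}" "supp f1 <= {b \<in> B. d b}"
  "f0 = pscale (1/2) (v + parity_op d v)" "f1 = pscale (1/2) (v - parity_op d v)"
  using v(1) parity_decomp[of v B d] unfolding V_def by blast
 have "H i i f0 = pscale (\<mu> i) f0" "H i i f1 = pscale (\<mu> i) f1" if i: "i \<in> {1..n}" for i
 proof -
  have "H i i (parity_op d v) = parity_op d (H i i v)"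
   using parity_op_opr[of "Gmat i i" False v] sl_gens(3)[OF i i] gens_carrier(3)[OF i i] v(1) by simp
  thus "H i i f0 = pscale (\<mu> i) f0" "H i i f1 = pscale (\<mu> i) f1" unfolding f(4,5)
   by (simp_all add: plin_add plin_diff plin_scale v(3)[OF i] pv.scale_right_distrib pv.scale_right_diff_distrib mult.commute)
 qed
 moreover have "f0 \<in> Vp False" "f1 \<in> Vp True" using f(2,3) by (auto simp: Vp_def)
 moreover have "f0 ~= 0 | f1 ~= 0" using f(1) v(2) by auto
 ultimately have base: "\<exists>m. ?Q m" by blast
 have "\<exists>m. ?Q m & (\<forall>i\<in>{1..k}. Y i m = 0)" if "k \<le> n" for k
  using that
 proof (induction k)
  case 0
  thus ?case using base by auto
 next
  case (Suc k)
  then obtain m p \<mu> where m: "m ~= 0" "m \<in> Vp p" "!!i. i \<in> {1..n} ==> H i i m = pscale (\<mu> i) m" "!!i. i \<in> {1..k} ==> Y i m = 0"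
   by (metis Suc_leD)
  have k: "Suc k \<in> {1..n}" using Suc.prems by simp
  show ?case
  proof (cases "Y (Suc k) m = 0")
   case True
   hence "\<forall>i\<in>{1..Suc k}. Y i m = 0" using m(4) by (auto simp: le_Suc_eq)
   thus ?thesis using m by blast
  next
   case False
   note mV = Vp_V[OF m(2)]
   have "H i i (Y (Suc k) m) = pscale (\<mu> i + of_bool (i = Suc k) - 1) (Y (Suc k) m)" if i: "i \<in> {1..n}" for i
    using relations(5)[OF i i k i mV] m(3)[OF i]
    by (auto simp: plin_scale pv.scale_left_distrib pv.scale_left_diff_distrib)
   moreover have "Y i (Y (Suc k) m) = 0" if i: "i \<in> {1..Suc k}" for i
   proof -
    have "i \<in> {1..n}" using i k by auto
    hence r: "Y i (Y (Suc k) m) = - Y (Suc k) (Y i m)" using relations(2)[OF _ k k k mV] by blast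
    show ?thesis
    proof (cases "i = Suc k")
     case True
     hence "Y i (Y i m) + Y i (Y i m) = 0" using r by (metis add.right_inverse)
     hence "pscale 2 (Y i (Y i m)) = 0" by (metis one_add_one pv.scale_left_distrib pv.scale_one)
     thus ?thesis using True by (metis pv.scale_eq_0_iff zero_neq_numeral)
    next
     case False
     thus ?thesis using r m(4)[of i] i by (simp add: plin_zero)
    qed
   qed
   ultimately show ?thesis
    using False gens_Vp(2)[OF k k m(2)]
    by (intro exI[of _ "Y (Suc k) m"] conjI exI[of _ "~ p"] exI[of _ "%i. \<mu> i + of_bool (i = Suc k) - 1"] ballI)
  qed
 qed
 from this[of n] obtain m p \<mu> where m: "m ~= 0" "m \<in> Vp p" "!!i. i \<in> {1..n} ==> H i i m = pscale (\<mu> i) m" "!!i. i \<in> {1..n} ==> Y i m = 0"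
  by blast
 hence "m \<in> lowest" using Vp_V[OF m(2)] by (simp add: lowest_def)
 thus ?thesis using that[OF _ m(2,1,3)] by blast
qed

text \<open>Taking for lambda the weight of a vector in the lowest layer provides a monomial of the
  same weight in N(lambda). The relations shared by both sides then apply to the product, and the
  submodule generated by the pair of these vectors is compared with each factor.\<close>

lemma lowest_model:
 assumes "weight_module n M"
 obtains lam \<psi> p where
  "!!x y. x \<in> N_carrier n lam ==> y \<in> N_carrier n lam ==> \<psi> (x + y) = \<psi> x + \<psi> y"
  "!!c x. x \<in> N_carrier n lam ==> \<psi> (pscale c x) = pscale c (\<psi> x)"
  "!!x. x \<in> N_carrier n lam ==> \<psi> x \<in> lowest" "!!x. x \<in> N_carrier n lam ==> \<psi> x \<in> Vp p"
  "!!x. x \<in> N_carrier n lam ==> \<psi> x = 0 ==> x = 0" "!!i j x. i \<in> {1..n} ==> j \<in> {1..n} ==> x \<in> N_carrier n lam ==> \<psi> (NH n lam i j x) = H i j (\<psi> x)"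
  "\<psi> ` N_carrier n lam ~= {0}"
proof -
 obtain m \<mu>' p where m: "m \<in> lowest" "m \<in> Vp p" "m ~= 0" "!!i. i \<in> {1..n} ==> H i i m = pscale (\<mu>' i) m"
  using lowest_weight_vector[OF assms] by metis
 \<comment> \<open>Exponent vectors of monomials are zero outside \<open>{1..n}\<close>.\<close>
 define \<mu> where "\<mu> i = (if i \<in> {1..n} then \<mu>' i else 0)" for i
 let ?N = "N_carrier n \<mu>" and ?NH = "NH n \<mu>"
 have mu: "\<mu> \<in> mon0 n \<mu>" by (auto simp: mon0_def monomials_def exponents_facts(6) \<mu>_def)
 hence muN: "bvec \<mu> \<in> ?N" by (simp add: N_carrier_eq)
 let ?sc = "%c. map_prod (pscale c) (pscale c) :: 'b fv \<times> ((nat => complex) \<Rightarrow>\<^sub>0 complex) => _"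
 let ?HH = "%i j. map_prod (H i j) (?NH i j)"
 interpret prv: vector_space ?sc
  by unfold_locales (auto simp: pv.scale_right_distrib pv.scale_left_distrib)
 interpret pr: gl_system ?sc n ?HH "lowest \<times> ?N"
 proof
  show "prv.subspace (lowest \<times> ?N)"
   by (rule prv.subspaceI)
    (auto simp: zero_prod_def sub_0 sub_add sub_scale lowest_sub N_sub)
  fix i j k l x
  show "?HH i j (x + y) = ?HH i j x + ?HH i j y" for y by (cases x; cases y) (simp add: plin_add)
  show "?HH i j (?sc c x) = ?sc c (?HH i j x)" for c by (cases x) (simp add: plin_scale)
  assume i: "i \<in> {1..n}" "j \<in> {1..n}" and x: "x \<in> lowest \<times> ?N"
  thus "?HH i j x \<in> lowest \<times> ?N" by (auto simp: H_lowest NH_N)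
  assume k: "k \<in> {1..n}" "l \<in> {1..n}"
  obtain x1 x2 where x': "x = (x1, x2)" "x1 \<in> lowest" "x2 \<in> ?N" using x by auto
  have x1: "x1 \<in> V" using x' by (simp add: lowest_def)
  show "?HH i j (?HH k l x) = ?HH k l (?HH i j x) + ?sc (of_bool (j = k)) (?HH i l x) - ?sc (of_bool (l = i)) (?HH k j x)"
   using relations(6)[OF i k x1] NH_relations(1)[OF i k x'(3)] by (simp add: x'(1))
  show "?HH k j (?HH l i x) - ?sc (of_bool (j = l)) (?HH k i x) = ?HH k i (?HH l j x) - ?sc (of_bool (i = l)) (?HH k j x)"
   using lowest_swap[OF i k x'(2)] NH_relations(2)[OF i k x'(3)] by (simp add: x'(1))
 qed
 let ?g = "(m, bvec \<mu>)"
 define G where "G = prv.span {pr.word w ?g | w. pr.letters w}"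
 have G_sub: "prv.subspace G" unfolding G_def by (rule prv.subspace_span)
 have gG: "?g \<in> G" unfolding G_def by (rule prv.span_base) (auto intro!: exI[of _ "[]"] simp: pr.letters_def)
 have G_M: "G <= (lowest Int Vp p) \<times> ?N"
  unfolding G_def
 proof (rule prv.span_minimal)
  show "prv.subspace ((lowest Int Vp p) \<times> ?N)"
   by (rule prv.subspaceI)
    (auto simp: zero_prod_def sub_0 sub_add sub_scale lowest_sub N_sub Vp_sub)
  have "pr.letters w ==> pr.word w ?g \<in> (lowest Int Vp p) \<times> ?N" for w
   by (induction w) (use m muN in "auto simp: pr.letters_def H_lowest NH_N gens_Vp(3) split: prod.splits")
  thus "{pr.word w ?g | w. pr.letters w} <= (lowest Int Vp p) \<times> ?N" by blast
 qed
 have G_H: "?HH i j x \<in> G" if ij: "i \<in> {1..n}" "j \<in> {1..n}" and x: "x \<in> G" for i j x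
  using x unfolding G_def
 proof (induction rule: prv.span_induct)
  show "prv.subspace {x. ?HH i j x \<in> prv.span {pr.word w ?g | w. pr.letters w}}"
   using prv.subspace_span[of "{pr.word w ?g | w. pr.letters w}"]
   by (intro prv.subspaceI)
    (simp_all add: pr.H_zero pr.H_add pr.H_scale prv.span_zero prv.span_add prv.span_scale del: map_prod_simp)
  fix x assume "x \<in> {pr.word w ?g | w. pr.letters w}"
  then obtain w where "x = pr.word w ?g" "pr.letters w" by blast
  thus "?HH i j x \<in> prv.span {pr.word w ?g | w. pr.letters w}"
   using ij by (intro prv.span_base) (auto intro!: exI[of _ "(i, j) # w"] simp: pr.letters_def simp del: map_prod_simp)
 qed
 have wb: "?NH i i (bvec \<mu>) = pscale (\<mu> i) (bvec \<mu>)" for i using mu by (simp add: NH_bvec mon0_def)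
 have wm: "H i i m = pscale (\<mu> i) m" if "i \<in> {1..n}" for i using m(4)[OF that] that by (simp add: \<mu>_def)
 have cyc: "\<exists>c. x = ?sc c ?g" if "x \<in> G" "!!i. i \<in> {1..n} ==> ?HH i i x = ?sc (\<mu> i) x" for x
  using pr.weight_space_cyclic[of ?g \<mu> x] that m(1) muN wb wm unfolding G_def pr.weight_def by auto
 have bn: "bvec \<mu> ~= 0" by (metis lookup_single_eq lookup_zero one_neq_zero)
 \<comment> \<open>By \<open>cyc\<close> the vectors of weight \<open>\<mu>\<close> in
   \<open>G\<close> are multiples of the pair \<open>?g\<close>. Both of its entries are nonzero, so
   neither occurs alone.\<close>
 have c1: "(m, 0) \<notin> G" using cyc[of "(m, 0)"] wm bn m(3) by (auto simp: plin_zero simp del: pscale_single)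
 have c2: "(0, bvec \<mu>) \<notin> G" using cyc[of "(0, bvec \<mu>)"] wb bn m(3) by (auto simp: plin_zero simp del: pscale_single)
 have G0: "(0, 0) \<in> G" using prv.subspace_0[OF G_sub] by (simp add: zero_prod_def)
 have Gadd: "(v + v', x + x') \<in> G" if "(v, x) \<in> G" "(v', x') \<in> G" for v v' x x'
  using prv.subspace_add[OF G_sub that] by simp
 have Gsc: "(pscale c v, pscale c x) \<in> G" if "(v, x) \<in> G" for c v x
  using prv.subspace_scale[OF G_sub that, of c] by simp
 have GH: "(H i j v, ?NH i j x) \<in> G" if "i \<in> {1..n}" "j \<in> {1..n}" "(v, x) \<in> G" for i j v x
  using G_H[OF that] by simp
 \<comment> \<open>The first entries paired with 0 form a space stable under all
   \<open>H i j\<close>. If it is nonzero, \<open>layers\<close> expresses \<open>m\<close> through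
   it, and comparing parities puts \<open>m\<close> itself there, contrary to
   \<open>c1\<close>.\<close>
 have A0: "v = 0" if v0: "(v, 0) \<in> G" for v
 proof (rule ccontr)
  assume vn: "v ~= 0"
  let ?A = "{v. (v, 0) \<in> G}"
  have A: "subsp ?A"
  proof (rule pv.subspaceI)
   show "0 \<in> ?A" using G0 by simp
   fix x y c assume "x \<in> ?A"
   thus "y \<in> ?A ==> x + y \<in> ?A" "pscale c x \<in> ?A" using Gadd[of x 0 y 0] Gsc[of x 0 c] by simp_all
  qed
  have 1: "?A <= lowest" "?A <= Vp p" "?A ~= {0}" using G_M vn v0 by auto
  have 2: "H i j w \<in> ?A" if "i \<in> {1..n}" "j \<in> {1..n}" "w \<in> ?A" for i j w
   using GH[OF that(1,2), of w 0] that(3) by (simp add: plin_zero)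
  have mV: "m \<in> V" using m(1) by (simp add: lowest_def)
  obtain a f where af: "a \<in> ?A" "!!i. i \<in> {1..n} ==> f i \<in> ?A" "m = a + (\<Sum>i\<in>{1..n}. X i (f i))"
   by (rule layers[OF A 1 2 mV]) blast+
  have "(\<Sum>i\<in>{1..n}. X i (f i)) \<in> Vp (~ p)"
   by (rule sub_sum[OF Vp_sub]) (use gens_Vp(1) af(2) 1(2) in blast)
  moreover have "m - a \<in> Vp p" using sub_diff[OF Vp_sub] m(2) af(1) 1(2) by blast
  moreover have "m - a = (\<Sum>i\<in>{1..n}. X i (f i))" using af(3) by (simp add: algebra_simps)
  ultimately have "m - a = 0" using Vp_disjoint by metis
  thus False using af(1) c1 by simp
 qed
 have B0: "x = 0" if x0: "(0, x) \<in> G" for x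
 proof (rule ccontr)
  assume xn: "x ~= 0"
  have "{x. (0, x) \<in> G} = ?N"
  proof (rule N_simple)
   show "subsp {x. (0, x) \<in> G}"
   proof (rule pv.subspaceI)
    show "0 \<in> {x. (0, x) \<in> G}" using G0 by simp
    fix x y c assume "x \<in> {x. (0, x) \<in> G}"
    thus "y \<in> {x. (0, x) \<in> G} ==> x + y \<in> {x. (0, x) \<in> G}" "pscale c x \<in> {x. (0, x) \<in> G}"
     using Gadd[of 0 x 0 y] Gsc[of 0 x c] by simp_all
   qed
   show "{x. (0, x) \<in> G} <= ?N" "{x. (0, x) \<in> G} ~= {0}" using G_M xn x0 by auto
   show "?NH i j w \<in> {x. (0, x) \<in> G}" if "i \<in> {1..n}" "j \<in> {1..n}" "w \<in> {x. (0, x) \<in> G}" for i j w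
    using GH[OF that(1,2), of 0 w] that(3) by (simp add: plin_zero)
  qed
  thus False using muN c2 by blast
 qed
 have onto: "snd ` G = ?N"
 proof (rule N_simple)
  show "subsp (snd ` G)"
  proof (rule pv.subspaceI)
   show "0 \<in> snd ` G" using G0 by force
   fix x y c assume "x \<in> snd ` G"
   then obtain v where v: "(v, x) \<in> G" by auto
   show "pscale c x \<in> snd ` G" using Gsc[OF v, of c] by force
   assume "y \<in> snd ` G"
   then obtain v' where v': "(v', y) \<in> G" by auto
   thus "x + y \<in> snd ` G" using Gadd[OF v v'] by force
  qed
  show "snd ` G <= ?N" using G_M by auto
  show "snd ` G ~= {0}" using gG bn by force
  show "?NH i j w \<in> snd ` G" if ij: "i \<in> {1..n}" "j \<in> {1..n}" "w \<in> snd ` G" for i j w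
  proof -
   obtain v where "(v, w) \<in> G" using ij(3) by auto
   thus ?thesis using GH[OF ij(1,2)] by force
  qed
 qed
 define \<psi> where "\<psi> x = (SOME v. (v, x) \<in> G)" for x
 have psi: "(\<psi> x, x) \<in> G" if "x \<in> ?N" for x
 proof -
  have "\<exists>v. (v, x) \<in> G" using onto that by force
  thus ?thesis unfolding \<psi>_def by (rule someI_ex)
 qed
 have uniq: "\<psi> x = v" if "(v, x) \<in> G" for v x
 proof -
  have "x \<in> ?N" using onto that by force
  hence "(\<psi> x - v, x - x) \<in> G" using prv.subspace_diff[OF G_sub psi[of x] that] by simp
  thus ?thesis using A0[of "\<psi> x - v"] by simp
 qed
 show ?thesis
 proof (rule that)
  fix x y c i j
  show "x \<in> ?N ==> y \<in> ?N ==> \<psi> (x + y) = \<psi> x + \<psi> y" by (rule uniq[OF Gadd[OF psi psi]])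
  assume x: "x \<in> ?N"
  show "\<psi> (pscale c x) = pscale c (\<psi> x)" by (rule uniq[OF Gsc[OF psi[OF x]]])
  show "\<psi> x \<in> lowest" "\<psi> x \<in> Vp p" using psi[OF x] G_M by auto
  show "\<psi> x = 0 ==> x = 0" using psi[OF x] B0 by metis
  show "i \<in> {1..n} ==> j \<in> {1..n} ==> \<psi> (?NH i j x) = H i j (\<psi> x)" by (rule uniq[OF GH[OF _ _ psi[OF x]]])
 next
  show "\<psi> ` ?N ~= {0}" using uniq[OF gG] muN m(3) by force
 qed
qed

end

section \<open>Modules generated by a lowest layer\<close>

text \<open>An abstraction of the Kac module: it is generated by a space \<open>D0\<close> that all
  \<open>Y\<close> kill and on which diag(n, 1, ..., 1) acts by the number \<open>c\<close>.\<close>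

locale generated_sl_rep = sl_rep n V opr
 for n and V :: "'v fv set" and opr +
 fixes D0 :: "'v fv set" and c :: complex
 assumes n2: "n \<ge> 2" and D0_sub: "subsp D0" and D0_V: "D0 <= V"
  and Y_D0: "i \<in> {1..n} ==> x \<in> D0 ==> Y i x = 0"
  and H_D0: "i \<in> {1..n} ==> j \<in> {1..n} ==> x \<in> D0 ==> H i j x \<in> D0"
  and trace_D0: "x \<in> D0 ==> (\<Sum>i\<in>{1..n}. H i i x) = pscale c x"
  and generated: "subsp U ==> U <= V ==> D0 <= U ==> (!!a u. a \<in> slc n ==> u \<in> U ==> opr a u \<in> U) ==> U = V"
begin

primrec D :: "nat => 'v fv set"
 where "D 0 = D0"
 | "D (Suc r) = pv.span {X i x | i x. i \<in> {1..n} & x \<in> D r}"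

text \<open>The sum of all \<open>Gmat i i\<close> is diag(n, 1, ..., 1), which is central in the
  even part of sl(1,n).\<close>

definition "trace_op x = (\<Sum>i\<in>{1..n}. H i i x)"

definition "layer_sums R = pv.span (\<Union>r\<in>R. D r)"

lemma plin_trace_op [simp]: "plin trace_op"
 unfolding trace_op_def[abs_def] by (rule plin_sum_fun) (rule rep_plin)

lemma D_sub: "subsp (D r)" by (cases r) (simp_all add: D0_sub)

lemma X_D: "i \<in> {1..n} ==> x \<in> D r ==> X i x \<in> D (Suc r)"
 by (auto intro!: pv.span_base)

lemma D_Suc_induct:
 assumes "x \<in> D (Suc r)" "subsp W" "plin F" "!!i y. i \<in> {1..n} ==> y \<in> D r ==> F (X i y) \<in> W"
 shows "F x \<in> W"
 using plin_span[OF assms(3,2), of "{X i x | i x. i \<in> {1..n} & x \<in> D r}" x] assms(1,4) by auto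

lemma D_V: "x \<in> D r ==> x \<in> V"
proof (induction r arbitrary: x)
 case (Suc r)
 show ?case by (rule D_Suc_induct[OF Suc.prems rep_sub plin_id]) (use Suc.IH gens_V in auto)
qed (use D0_V in auto)

lemma H_D: "i \<in> {1..n} ==> j \<in> {1..n} ==> x \<in> D r ==> H i j x \<in> D r"
proof (induction r arbitrary: x)
 case (Suc r)
 show ?case
 proof (rule D_Suc_induct[OF Suc.prems(3) D_sub rep_plin])
  fix k y assume k: "k \<in> {1..n}" and y: "y \<in> D r"
  show "H i j (X k y) \<in> D (Suc r)"
   unfolding relations(4)[OF Suc.prems(2) k Suc.prems(1,1) D_V[OF y]]
   by (intro sub_diff[OF D_sub] sub_add[OF D_sub] sub_scale[OF D_sub] X_D Suc.IH Suc.prems k y)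
 qed
qed (simp add: H_D0)

lemma Y_D: "k \<in> {1..n} ==> x \<in> D (Suc r) ==> Y k x \<in> D r"
proof (induction r arbitrary: x)
 case 0
 show ?case
 proof (rule D_Suc_induct[OF 0(2) D_sub rep_plin])
  fix i y assume "i \<in> {1..n}" "y \<in> D 0"
  thus "Y k (X i y) \<in> D 0"
   using relations(3)[of i i k k y] 0(1) D_V[of y 0] Y_D0 H_D0 by (simp add: plin_zero[OF rep_plin])
 qed
next
 case (Suc r)
 show ?case
 proof (rule D_Suc_induct[OF Suc.prems(2) D_sub rep_plin])
  fix i y assume i: "i \<in> {1..n}" and y: "y \<in> D (Suc r)"
  show "Y k (X i y) \<in> D (Suc r)"
   unfolding relations(3)[OF i i Suc.prems(1,1) D_V[OF y]]
   by (intro sub_diff[OF D_sub] H_D X_D Suc.IH Suc.prems i y)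
 qed
qed

text \<open>Commuting diag(n, 1, ..., 1) past \<open>X i\<close> adds n - 1 to the eigenvalue. As n
  is at least 2, different layers have different eigenvalues.\<close>

lemma trace_D: "x \<in> D r ==> trace_op x = pscale (c + of_nat r * (of_nat n - 1)) x"
proof (induction r arbitrary: x)
 case 0
 thus ?case unfolding trace_op_def using trace_D0[of x] by simp
next
 case (Suc r)
 let ?e = "c + of_nat (Suc r) * (of_nat n - 1)"
 have "trace_op x - pscale ?e x \<in> {0}"
 proof (rule D_Suc_induct[OF Suc.prems, of "{0}" "%x. trace_op x - pscale ?e x"])
  show "subsp {0}" by (rule pv.subspace_single_0)
  show "plin (%x. trace_op x - pscale ?e x)" by (intro plin_minus plin_trace_op plin_pscale plin_id)
  fix i y assume i: "i \<in> {1..n}" and y: "y \<in> D r"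
  have "H l l (X i y) = X i (H l l y) + X i y - pscale (of_bool (i = l)) (X l y)" if "l \<in> {1..n}" for l
   using relations(4)[OF that i that that D_V[OF y]] relations(4)[OF i i that that D_V[OF y]] by (cases "i = l") simp_all
  hence "trace_op (X i y) = (\<Sum>l\<in>{1..n}. X i (H l l y) + X i y - (if l = i then X l y else 0))"
   unfolding trace_op_def by (intro sum.cong) auto
  also have "\<dots> = X i (trace_op y) + pscale (of_nat n) (X i y) - X i y"
   unfolding trace_op_def plin_sum[OF rep_plin] using i
   by (simp add: sum.distrib sum_subtractf pv.sum_constant_scale)
  also have "\<dots> = pscale ?e (X i y)"
   unfolding Suc.IH[OF y] plin_scale[OF rep_plin] by (rule poly_mapping_eqI) (simp add: lookup_add lookup_minus algebra_simps)
  finally show "trace_op (X i y) - pscale ?e (X i y) \<in> {0}" by simp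
 qed
 thus ?case by simp
qed

lemma layer_sums_sub: "subsp (layer_sums R)" unfolding layer_sums_def by (rule pv.subspace_span)

lemma D_layer_sums: "x \<in> D r ==> r \<in> R ==> x \<in> layer_sums R"
 unfolding layer_sums_def by (rule pv.span_base) blast

lemma layer_sums_induct:
 assumes "x \<in> layer_sums R" "subsp W" "plin F" "!!r y. r \<in> R ==> y \<in> D r ==> F y \<in> W"
 shows "F x \<in> W"
 using plin_span[OF assms(3,2), of "\<Union>r\<in>R. D r" x] assms(1,4) unfolding layer_sums_def by auto

lemma layer_sums_V: "layer_sums R <= V"
 unfolding layer_sums_def by (rule pv.span_minimal[OF _ rep_sub]) (use D_V in blast)

lemma V_layers: "V = layer_sums UNIV"
proof -
 have X: "X i w \<in> layer_sums UNIV" if "i \<in> {1..n}" "w \<in> layer_sums UNIV" for i w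
  by (rule layer_sums_induct[OF that(2) layer_sums_sub rep_plin]) (use X_D that(1) D_layer_sums in blast)
 have Y: "Y i w \<in> layer_sums UNIV" if "i \<in> {1..n}" "w \<in> layer_sums UNIV" for i w
 proof (rule layer_sums_induct[OF that(2) layer_sums_sub rep_plin])
  fix r y assume y: "y \<in> D r"
  show "Y i y \<in> layer_sums UNIV"
  proof (cases r)
   case 0
   thus ?thesis using y that(1) sub_0[OF layer_sums_sub] by (simp add: Y_D0)
  next
   case (Suc r')
   thus ?thesis using Y_D[OF that(1), of y r'] y D_layer_sums by blast
  qed
 qed
 have H: "H i j w \<in> layer_sums UNIV" if "i \<in> {1..n}" "j \<in> {1..n}" "w \<in> layer_sums UNIV" for i j w
  by (rule layer_sums_induct[OF that(3) layer_sums_sub rep_plin]) (use H_D that(1,2) D_layer_sums in blast)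
 show ?thesis
  by (rule generated[OF layer_sums_sub layer_sums_V, symmetric])
   (use D_layer_sums[of _ 0] gens_stable[OF layer_sums_sub layer_sums_V _ _ X Y H] in auto)
qed

lemma layer_sums_decomp:
 assumes "k \<in> layer_sums R"
 obtains S f where "finite S" "S <= R" "!!r. f r \<in> D r" "k = (\<Sum>r\<in>S. f r)"
proof -
 let ?P = "%k. \<exists>S f. finite S & S <= R & (\<forall>r. f r \<in> D r) & k = (\<Sum>r\<in>S. f r)"
 have "?P k" using assms unfolding layer_sums_def
 proof (induction rule: pv.span_induct_alt)
  case base
  show ?case by (intro exI[of _ "{}"] exI[of _ "%_. 0"]) (simp add: sub_0[OF D_sub])
 next
  case (step a x y)
  obtain s where s: "s \<in> R" "x \<in> D s" using step(1) by blast
  obtain S f where S: "finite S" "S <= R" "!!r. f r \<in> D r" "y = (\<Sum>r\<in>S. f r)" using step(2) by blast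
  let ?g = "%r. (if r = s then pscale a x else 0) + (if r \<in> S then f r else 0)"
  have "(\<Sum>r\<in>insert s S. ?g r) = pscale a x + y"
   unfolding sum.distrib S(4) using S(1) by (simp add: sum.If_cases insert_absorb Int_insert_left)
  moreover have "?g r \<in> D r" for r
   using s S(3) sub_0[OF D_sub] sub_scale[OF D_sub] by (intro sub_add[OF D_sub]) auto
  ultimately show ?case using S(1,2) s(1) by (intro exI[of _ "insert s S"] exI[of _ ?g]) auto
 qed
 thus ?thesis using that by blast
qed

lemma layer_components:
 assumes U: "subsp U" "!!u. u \<in> U ==> trace_op u \<in> U"
  and f: "finite S" "!!r. r \<in> S ==> f r \<in> D r" "(\<Sum>r\<in>S. f r) \<in> U" "r \<in> S"
 shows "f r \<in> U"
proof (rule pv.joint_eigenvectors_in_subspace[where H="{trace_op}" and A=S and x=f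
   and \<chi>="%h r. c + of_nat r * (of_nat n - 1)", OF U(1)])
 show "\<exists>h\<in>{trace_op}. c + of_nat r * (of_nat n - 1) ~= c + of_nat s * (of_nat n - 1)" if "r ~= s" for r s
 proof -
  have "of_nat n ~= (1 :: complex)" using n2 by (metis numeral_le_one_iff of_nat_1 of_nat_eq_iff semiring_norm(69))
  thus ?thesis using that by simp
 qed
 show "h (f r) - pscale (c + of_nat r * (of_nat n - 1)) (f r) \<in> U" if "r \<in> S" "h \<in> {trace_op}" for r h
  using that trace_D[OF f(2)] sub_0[OF U(1)] by auto
qed (use U f in "auto simp: plin_add plin_scale")

lemma layer_sums_disjoint:
 assumes "R Int R' = {}" "x \<in> layer_sums R" "x \<in> layer_sums R'"
 shows "x = 0"
proof -
 obtain S f where S: "finite S" "S <= R" "!!r. f r \<in> D r" "x = (\<Sum>r\<in>S. f r)" using layer_sums_decomp[OF assms(2)] by blast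
 obtain S' f' where S': "finite S'" "S' <= R'" "!!r. f' r \<in> D r" "x = (\<Sum>r\<in>S'. f' r)" using layer_sums_decomp[OF assms(3)] by blast
 define g where "g r = (if r \<in> S then f r else - f' r)" for r
 have d: "S Int S' = {}" using S S' assms(1) by blast
 have "(\<Sum>r\<in>S Un S'. g r) = (\<Sum>r\<in>S. g r) + (\<Sum>r\<in>S'. g r)" by (rule sum.union_disjoint[OF S(1) S'(1) d])
 also have "(\<Sum>r\<in>S. g r) = x" unfolding S(4) by (rule sum.cong) (auto simp: g_def)
 also have "(\<Sum>r\<in>S'. g r) = (\<Sum>r\<in>S'. - f' r)" by (rule sum.cong) (use d in "auto simp: g_def")
 also have "\<dots> = - x" unfolding S'(4) by (rule sum_negf)
 finally have "(\<Sum>r\<in>S Un S'. g r) \<in> {0}" by simp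
 moreover have "g r \<in> D r" for r unfolding g_def using S(3) S'(3) sub_neg[OF D_sub] by auto
 ultimately have "g r \<in> {0}" if "r \<in> S Un S'" for r
  using layer_components[of "{0}" "S Un S'" g r] S(1) S'(1) that by (auto simp: plin_zero)
 hence "f r = 0" if "r \<in> S" for r using that by (force simp: g_def)
 thus ?thesis unfolding S(4) by simp
qed

text \<open>Each \<open>X\<close> is odd, so with \<open>D0\<close> regarded as even the index of a
  layer modulo 2 is its parity.\<close>

definition "graded_layers p = layer_sums {r. odd r = p}"

lemma graded_layers_sub: "subsp (graded_layers p)" unfolding graded_layers_def by (rule layer_sums_sub)

lemma graded_layers_V: "graded_layers p <= V" unfolding graded_layers_def by (rule layer_sums_V)

lemma graded_layers_disjoint: "x \<in> graded_layers p ==> x \<in> graded_layers (~ p) ==> x = 0"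
proof -
 have "{r :: nat. odd r = p} Int {r. odd r = (~ p)} = {}" by auto
 thus "x \<in> graded_layers p ==> x \<in> graded_layers (~ p) ==> x = 0"
  unfolding graded_layers_def by (rule layer_sums_disjoint)
qed

lemma graded_layers_decomp:
 assumes "x \<in> V"
 obtains a b where "a \<in> graded_layers p" "b \<in> graded_layers (~ p)" "x = a + b"
proof -
 have "x \<in> layer_sums UNIV" using assms V_layers by simp
 then obtain S f where S: "finite S" "!!r. f r \<in> D r" "x = (\<Sum>r\<in>S. f r)" using layer_sums_decomp by metis
 have "x = (\<Sum>r\<in>{r\<in>S. odd r = p}. f r) + (\<Sum>r\<in>{r\<in>S. odd r = (~ p)}. f r)"
  unfolding S(3) by (subst sum.union_disjoint[symmetric]) (use S(1) in "auto intro!: sum.cong")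
 moreover have "(\<Sum>r\<in>{r\<in>S. odd r = q}. f r) \<in> graded_layers q" for q
  unfolding graded_layers_def by (intro sub_sum[OF layer_sums_sub] D_layer_sums[OF S(2)]) auto
 ultimately show ?thesis by (intro that)
qed

lemma opr_graded_layers:
 assumes a: "a \<in> part (sl n) q" "a \<in> slc n" and x: "x \<in> graded_layers p"
 shows "opr a x \<in> graded_layers (q ~= p)"
proof -
 have "opr a y \<in> graded_layers (q ~= p)" if r: "odd r = p" and y: "y \<in> D r" for r y
 proof -
  note gl = graded_layers_sub[of "q ~= p"]
  have part: "a i j = 0" if "((i = 0) ~= (j = 0)) ~= q" for i j
   using a(1) that by (auto simp: mat_alg_part)
  have in1: "z \<in> graded_layers (~ p)" if "z \<in> D (Suc r)" for z
   unfolding graded_layers_def by (rule D_layer_sums[OF that]) (use r in auto)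
  have X: "pscale (a 0 i) (X i y) \<in> graded_layers (q ~= p)" if "i \<in> {1..n}" for i
  proof (cases q)
   case True
   thus ?thesis using in1[OF X_D[OF that y]] sub_scale[OF gl] by simp
  qed (use part[of 0 i] that sub_0[OF gl] in simp)
  have Y: "pscale (a i 0) (Y i y) \<in> graded_layers (q ~= p)" if "i \<in> {1..n}" for i
  proof (cases q)
   case True
   have "Y i y \<in> graded_layers (~ p)"
   proof (cases r)
    case 0
    thus ?thesis using y that sub_0[OF graded_layers_sub] by (simp add: Y_D0)
   next
    case (Suc r')
    thus ?thesis unfolding graded_layers_def using D_layer_sums[OF Y_D[OF that, of y r']] y r by auto
   qed
   thus ?thesis using True sub_scale[OF gl] by simp
  qed (use part[of i 0] that sub_0[OF gl] in simp)
  have H: "pscale (a i j) (H i j y) \<in> graded_layers (q ~= p)" if "i \<in> {1..n}" "j \<in> {1..n}" for i j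
  proof (cases q)
   case False
   have "H i j y \<in> graded_layers p" unfolding graded_layers_def by (rule D_layer_sums[OF H_D[OF that y]]) (use r in simp)
   thus ?thesis using False sub_scale[OF gl] by simp
  qed (use part[of i j] that sub_0[OF gl] in simp)
  show ?thesis unfolding opr_expand[OF a(2) D_V[OF y]]
   by (intro sub_add[OF gl] sub_sum[OF gl] X Y H)
 qed
 thus ?thesis
  by (intro layer_sums_induct[OF x[unfolded graded_layers_def] graded_layers_sub rep_plin]) simp
qed

end

text \<open>A homomorphism onto the given simple module that is injective on the generating layer.
  The parity \<open>p0\<close> is that of the image of \<open>D0\<close>; it decides whether the
  final isomorphism needs a parity change.\<close>

locale covering_map = K: generated_sl_rep n VK A D0 c + T: quadratic_sl_module n M B kap
 for n VK and A :: "mat => 'k fv => 'k \<Rightarrow>\<^sub>0 complex" and D0 c and M :: "(mat, 'v) super_module" and B kap +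
 fixes \<Phi> :: "'k fv => 'v \<Rightarrow>\<^sub>0 complex" and p0 :: bool
 assumes plin_Phi: "plin \<Phi>"
  and Phi_opr: "a \<in> slc n ==> k \<in> VK ==> \<Phi> (A a k) = T.opr a (\<Phi> k)"
  and Phi_V: "k \<in> VK ==> \<Phi> k \<in> T.V"
  and Phi_D0: "x \<in> D0 ==> \<Phi> x \<in> T.lowest" "x \<in> D0 ==> \<Phi> x \<in> T.Vp p0"
  and Phi_inj: "x \<in> D0 ==> \<Phi> x = 0 ==> x = 0"
  and Phi_nonzero: "\<Phi> ` D0 ~= {0}"
  and D0_simple: "subsp W ==> W <= D0 ==> W ~= {0} ==>
   (!!i j w. i \<in> {1..n} ==> j \<in> {1..n} ==> w \<in> W ==> K.H i j w \<in> W) ==> W = D0"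
begin

lemma Phi_X: "i \<in> {1..n} ==> x \<in> K.D r ==> \<Phi> (K.X i x) = T.X i (\<Phi> x)"
 using Phi_opr K.gens_carrier(1) K.D_V by blast

lemma Phi_D1: "x \<in> K.D (Suc 0) ==> \<Phi> x \<in> T.Vp (~ p0)"
 by (rule K.D_Suc_induct[OF _ T.Vp_sub plin_Phi]) (use Phi_X[of _ _ 0] T.gens_Vp(1) Phi_D0(2) in "auto simp del: K.D.simps(2)")

lemma Phi_D2: "x \<in> K.D (Suc (Suc r)) ==> \<Phi> x = 0"
proof -
 assume x: "x \<in> K.D (Suc (Suc r))"
 have "\<Phi> x \<in> {0}"
 proof (rule K.D_Suc_induct[OF x pv.subspace_single_0 plin_Phi])
  fix i y assume i: "i \<in> {1..n}" and y: "y \<in> K.D (Suc r)"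
  have "\<Phi> (K.X i y) \<in> {0}"
  proof (rule K.D_Suc_induct[OF y pv.subspace_single_0])
   show "plin (%y. \<Phi> (K.X i y))" by (rule plin_comp[OF plin_Phi K.rep_plin])
   fix j z assume j: "j \<in> {1..n}" and z: "z \<in> K.D r"
   show "\<Phi> (K.X i (K.X j z)) \<in> {0}"
    using Phi_X[OF i K.X_D[OF j z]] Phi_X[OF j z] T.quadratic[OF i j Phi_V[OF K.D_V[OF z]]] by simp
  qed
  thus "\<Phi> (K.X i y) \<in> {0}" .
 qed
 thus ?thesis by simp
qed

lemma Phi_graded: "k \<in> K.graded_layers p ==> \<Phi> k \<in> T.Vp (p ~= p0)"
 unfolding K.graded_layers_def
proof (erule K.layer_sums_induct[OF _ T.Vp_sub plin_Phi])
 fix r y assume r: "r \<in> {r. odd r = p}" and y: "y \<in> K.D r"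
 consider "r = 0" | "r = Suc 0" | r' where "r = Suc (Suc r')" by (metis not0_implies_Suc)
 thus "\<Phi> y \<in> T.Vp (p ~= p0)"
  by cases (use r y Phi_D0(2) Phi_D1 Phi_D2 sub_0[OF T.Vp_sub] in "auto simp del: K.D.simps(2)")
qed

text \<open>By \<open>layers\<close> for the image of \<open>D0\<close>, a vector is the sum of one
  such image and of \<open>X i\<close> applied to others. These two summands have opposite parities,
  so for a homogeneous vector one of them is zero.\<close>

lemma Phi_onto:
 assumes v: "v \<in> T.Vp (p ~= p0)"
 obtains k where "k \<in> K.graded_layers p" "\<Phi> k = v"
proof -
 let ?W = "\<Phi> ` D0"
 have W: "subsp ?W" by (rule subspace_image[OF plin_Phi K.D0_sub])
 have sub: "?W <= T.lowest" "?W <= T.Vp p0" using Phi_D0 by auto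
 have HW: "T.H i j w \<in> ?W" if i: "i \<in> {1..n}" "j \<in> {1..n}" and w: "w \<in> ?W" for i j w
 proof -
  obtain x where x: "x \<in> D0" "w = \<Phi> x" using w by blast
  hence "T.H i j w = \<Phi> (K.H i j x)" using Phi_opr[OF K.gens_carrier(3)[OF i]] K.D0_V by auto
  thus ?thesis using K.H_D0[OF i x(1)] by blast
 qed
 obtain a f where af: "a \<in> ?W" "!!i. i \<in> {1..n} ==> f i \<in> ?W" "v = a + (\<Sum>i\<in>{1..n}. T.X i (f i))"
  by (rule T.layers[OF W sub Phi_nonzero HW T.Vp_V[OF v]]) blast+
 have s: "(\<Sum>i\<in>{1..n}. T.X i (f i)) \<in> T.Vp (~ p0)"
  by (rule sub_sum[OF T.Vp_sub]) (use T.gens_Vp(1) af(2) sub(2) in blast)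
 have a0: "a \<in> T.Vp p0" using af sub by blast
 obtain x where x: "x \<in> D0" "a = \<Phi> x" using af(1) by blast
 have "\<forall>i\<in>{1..n}. \<exists>y. y \<in> D0 & f i = \<Phi> y" using af(2) by blast
 then obtain y where y: "!!i. i \<in> {1..n} ==> y i \<in> D0" "!!i. i \<in> {1..n} ==> f i = \<Phi> (y i)" by metis
 show ?thesis
 proof (cases p)
  case False
  hence "v - a \<in> T.Vp p0" using v a0 sub_diff[OF T.Vp_sub] by simp
  hence "v - a = 0" using T.Vp_disjoint[of "v - a" p0] s af(3) by simp
  moreover have "x \<in> K.graded_layers p" unfolding K.graded_layers_def
   by (rule K.D_layer_sums[of _ 0]) (use x False in auto)
  ultimately show ?thesis using that x by simp
 next
  case True
  hence "v - (\<Sum>i\<in>{1..n}. T.X i (f i)) \<in> T.Vp (~ p0)" using v s sub_diff[OF T.Vp_sub] by simp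
  hence a: "a = 0" using T.Vp_disjoint[OF a0] af(3) by simp
  let ?k = "\<Sum>i\<in>{1..n}. K.X i (y i)"
  have "\<Phi> ?k = (\<Sum>i\<in>{1..n}. T.X i (f i))"
   unfolding plin_sum[OF plin_Phi] by (rule sum.cong) (use Phi_X[of _ _ 0] y in auto)
  moreover have "?k \<in> K.graded_layers p" unfolding K.graded_layers_def
   by (intro sub_sum[OF K.layer_sums_sub] K.D_layer_sums[of _ "Suc 0"] K.X_D) (use y True in auto)
  ultimately show ?thesis using that a af(3) by simp
 qed
qed

text \<open>Vectors of this parity come from the odd layers, of which only layer 1 has a nonzero
  image; there a further \<open>X\<close> gives zero.\<close>

lemma X_upper:
 assumes i: "i \<in> {1..n}" and v: "v \<in> T.Vp (~ p0)"
 shows "T.X i v = 0"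
proof -
 obtain k where k: "k \<in> K.graded_layers True" "\<Phi> k = v" using Phi_onto[of v True] v by auto
 have "T.X i (\<Phi> k) \<in> {0}"
 proof (rule K.layer_sums_induct[OF k(1)[unfolded K.graded_layers_def] pv.subspace_single_0])
  show pl: "plin (%k. T.X i (\<Phi> k))" by (rule plin_comp[OF T.rep_plin plin_Phi])
  fix r y assume r: "r \<in> {r. odd r = True}" and y: "y \<in> K.D r"
  show "T.X i (\<Phi> y) \<in> {0}"
  proof (cases "r = Suc 0")
   case True
   show ?thesis
   proof (rule K.D_Suc_induct[OF y[unfolded True] pv.subspace_single_0 pl])
    fix j z assume j: "j \<in> {1..n}" and z: "z \<in> K.D 0"
    show "T.X i (\<Phi> (K.X j z)) \<in> {0}"
     using Phi_X[OF j z] T.quadratic[OF i j Phi_V[OF K.D_V[OF z]]] by simp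
   qed
  next
   case False
   then obtain r' where "r = Suc (Suc r')" using r by (cases r; cases "r - 1") auto
   thus ?thesis using Phi_D2 y by (simp add: plin_zero[OF T.rep_plin] del: K.D.simps(2))
  qed
 qed
 thus ?thesis using k(2) by simp
qed

text \<open>The layer components of \<open>u\<close> lie in \<open>U\<close>, and one in layer 0 or
  1 has nonzero image. From layer 1 some \<open>Y i\<close> leads to a nonzero element of
  \<open>D0\<close>, so \<open>U\<close> meets \<open>D0\<close>; then \<open>D0_simple\<close> puts
  all of \<open>D0\<close> into \<open>U\<close>, and \<open>D0\<close> generates.\<close>

lemma stable_above_kernel:
 assumes U: "subsp U" "U <= VK" "!!a u. a \<in> slc n ==> u \<in> U ==> A a u \<in> U"
  and u: "u \<in> U" "\<Phi> u ~= 0"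
 shows "U = VK"
proof -
 have "u \<in> K.layer_sums UNIV" using u U(2) K.V_layers by blast
 then obtain S f where S: "finite S" "!!r. f r \<in> K.D r" "u = (\<Sum>r\<in>S. f r)" using K.layer_sums_decomp by metis
 have tr: "K.trace_op w \<in> U" if "w \<in> U" for w
  unfolding K.trace_op_def by (intro sub_sum[OF U(1)] U(3) K.gens_carrier that)
 have fU: "f r \<in> U" if "r \<in> S" for r
  using K.layer_components[OF U(1) tr S(1), of f r] S that u(1) by simp
 obtain r where r: "r \<in> S" "\<Phi> (f r) ~= 0" using u(2) S(3) plin_sum[OF plin_Phi] by (metis (mono_tags, lifting) sum.neutral)
 have "\<exists>x\<in>D0. x \<in> U & x ~= 0"
 proof (cases "r = 0")
  case True
  thus ?thesis using fU[OF r(1)] S(2)[of r] r(2) plin_zero[OF plin_Phi] by auto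
 next
  case False
  then obtain r' where r': "r = Suc r'" by (cases r) auto
  have r1: "f r \<in> K.D (Suc 0)" using Phi_D2[of "f r"] S(2)[of r] r(2) r' by (cases r') auto
  let ?v = "\<Phi> (f r)"
  have vp: "?v \<in> T.Vp (~ p0)" by (rule Phi_D1[OF r1])
  \<comment> \<open>Otherwise \<open>?v\<close> is a lowest vector of parity \<open>~ p0\<close>.
    Vectors of this kind would generate everything by \<open>layers\<close>, but
    \<open>X_upper\<close> kills them, so no nonzero vector of parity \<open>p0\<close> could
    exist.\<close>
  have "\<exists>i\<in>{1..n}. T.Y i ?v ~= 0"
  proof (rule ccontr)
   assume "~ ?thesis"
   hence vl: "?v \<in> T.lowest" using T.Vp_V[OF vp] by (simp add: T.lowest_def)
   let ?W = "T.lowest Int T.Vp (~ p0)"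
   have W: "subsp ?W" by (rule pv.subspace_inter[OF T.lowest_sub T.Vp_sub])
   have "\<exists>x\<in>D0. \<Phi> x ~= 0"
   proof (rule ccontr)
    assume "~ ?thesis"
    hence "\<Phi> ` D0 = {0}" using sub_0[OF K.D0_sub] by force
    thus False using Phi_nonzero by contradiction
   qed
   then obtain x where x: "x \<in> D0" "\<Phi> x ~= 0" by blast
   have ne: "?W ~= {0}" using vl vp r(2) by blast
   have HW: "T.H i j w \<in> ?W" if "i \<in> {1..n}" "j \<in> {1..n}" "w \<in> ?W" for i j w
    using that(3) T.H_lowest[OF that(1,2)] T.gens_Vp(3)[OF that(1,2)] by blast
   have xV: "\<Phi> x \<in> T.V" using Phi_V x(1) K.D0_V by blast
   obtain a g where ag: "a \<in> ?W" "!!i. i \<in> {1..n} ==> g i \<in> ?W" "\<Phi> x = a + (\<Sum>i\<in>{1..n}. T.X i (g i))"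
    by (rule T.layers[OF W inf_le1 inf_le2 ne HW xV]) blast+
   have "(\<Sum>i\<in>{1..n}. T.X i (g i)) = 0" using ag(2) X_upper by (intro sum.neutral) blast
   hence "\<Phi> x \<in> T.Vp (~ p0)" using ag by simp
   thus False using T.Vp_disjoint[OF Phi_D0(2)[OF x(1)]] x(2) by simp
  qed
  then obtain i where i: "i \<in> {1..n}" "T.Y i ?v ~= 0" by blast
  have "K.Y i (f r) \<in> D0" using K.Y_D[OF i(1) r1] by simp
  moreover have "K.Y i (f r) \<in> U" by (rule U(3)[OF K.gens_carrier(2)[OF i(1)] fU[OF r(1)]])
  moreover have "\<Phi> (K.Y i (f r)) = T.Y i ?v" using Phi_opr[OF K.gens_carrier(2)[OF i(1)] K.D_V[OF r1]] .
  ultimately show ?thesis using i(2) plin_zero[OF plin_Phi] by metis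
 qed
 hence ne: "D0 Int U ~= {0}" by blast
 have "D0 Int U = D0"
  by (rule D0_simple[OF pv.subspace_inter[OF K.D0_sub U(1)] _ ne]) (use K.H_D0 U(3) K.gens_carrier(3) in auto)
 thus ?thesis using K.generated[OF U(1,2) _ U(3)] by blast
qed

end

section \<open>Enveloping algebras\<close>

text \<open>A projection along \<open>I\<close> comes from coordinates of the quotient, with a
  representative chosen for each basis coset. Its range realizes the quotient inside the original
  type.\<close>

lemma subspace_projection:
 fixes I :: "'x fv set"
 assumes I: "subsp I"
 obtains \<pi> where "plin \<pi>" "!!k. k - \<pi> k \<in> I" "!!k. k \<in> I ==> \<pi> k = 0"
proof -
 let ?F = "free_space UNIV (%p. {}) :: 'x fv super_space"
 interpret Q: module_quotient ?F I by (rule module_quotient_free[OF I]) simp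
 let ?q = "%k. I +>\<^bsub>?F\<^esub> k"
 obtain B kap where kap: "B <= carrier (quot_space ?F I)" "bij_betw kap (carrier (quot_space ?F I)) {f. supp f <= B}"
  "!!x y. x \<in> carrier (quot_space ?F I) ==> y \<in> carrier (quot_space ?F I) ==> kap (x \<oplus>\<^bsub>quot_space ?F I\<^esub> y) = kap x + kap y"
  "!!c x. x \<in> carrier (quot_space ?F I) ==> kap (c \<odot>\<^bsub>quot_space ?F I\<^esub> x) = pscale c (kap x)"
  "!!b. b \<in> B ==> kap b = bvec b"
  using module_coordinates[OF Q.module_quot subset_refl] by blast
 have car: "carrier (quot_space ?F I) = range ?q" using Q.carrier_quot by simp
 have q_mem: "?q k \<in> carrier (quot_space ?F I)" for k unfolding car by simp
 have q_eq: "?q k = ?q k' \<longleftrightarrow> k - k' \<in> I" for k k'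
  using Q.coset_eq_iff[of k k'] by (simp add: free_space_minus)
 define r where "r = linext (%b. SOME k. b = ?q k)"
 define \<pi> where "\<pi> k = r (kap (?q k))" for k
 have kq: "plin (%k. kap (?q k))"
 proof (rule plinI)
  fix x y c
  show "kap (?q (x + y)) = kap (?q x) + kap (?q y)"
   using kap(3)[OF q_mem q_mem, of x y] Q.add_coset[of x y] by simp
  show "kap (?q (pscale c x)) = pscale c (kap (?q x))"
   using kap(4)[OF q_mem, of c x] Q.smult_coset[of x c] by simp
 qed
 have \<pi>: "plin \<pi>" unfolding \<pi>_def[abs_def] r_def by (rule plin_comp[OF plin_linext kq])
 have kr: "kap (?q (r f)) = f" if "supp f <= B" for f
 proof (rule plin_eqI[OF _ plin_id that])
  show "plin (%f. kap (?q (r f)))" unfolding r_def by (rule plin_comp[OF kq plin_linext])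
  fix b assume b: "b \<in> B"
  have "\<exists>k. b = ?q k" using b kap(1) car by auto
  hence "b = ?q (SOME k. b = ?q k)" by (rule someI_ex)
  thus "kap (?q (r (bvec b))) = bvec b" using kap(5)[OF b] by (simp add: r_def)
 qed
 have inj: "inj_on kap (carrier (quot_space ?F I))" using kap(2) by (simp add: bij_betw_def)
 show ?thesis
 proof (rule that[OF \<pi>])
  fix k
  have "supp (kap (?q k)) <= B" using kap(2) q_mem[of k] unfolding bij_betw_def by blast
  hence "kap (?q (\<pi> k)) = kap (?q k)" unfolding \<pi>_def by (rule kr)
  hence "?q (\<pi> k) = ?q k" by (rule inj_onD[OF inj _ q_mem q_mem])
  thus "k - \<pi> k \<in> I" using q_eq[of k "\<pi> k"] by simp
 next
  fix k assume "k \<in> I"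
  hence "?q k = ?q 0" unfolding q_eq by simp
  thus "\<pi> k = 0" unfolding \<pi>_def using plin_zero[OF kq] plin_zero[OF plin_linext] by (simp add: r_def)
 qed
qed

lemma plin_word_mult_left: "plin (%f. word_mult f g)" and plin_word_mult_right: "plin (%g. word_mult f g)"
proof -
 show "plin (%f. word_mult f g)" unfolding word_mult_def by simp
 show "plin (%g. word_mult f g)" unfolding word_mult_def linext_def[of _ f]
  by (intro plin_sum_fun plin_pscale plin_linext)
qed

lemmas word_mult_linear = plin_add[OF plin_word_mult_left] plin_diff[OF plin_word_mult_left] plin_scale[OF plin_word_mult_left]
 plin_add[OF plin_word_mult_right] plin_diff[OF plin_word_mult_right] plin_scale[OF plin_word_mult_right]

lemma word_mult_bvec [simp]: "word_mult (bvec a) (bvec b) = bvec (a @ b)"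
 by (simp add: word_mult_def)

lemma word_mult_assoc: "word_mult (word_mult f g) h = word_mult f (word_mult g h)"
proof -
 have 1: "word_mult (word_mult (bvec a) (bvec b)) h = word_mult (bvec a) (word_mult (bvec b) h)" for a b
  by (rule plin_eq[OF plin_word_mult_right plin_comp[OF plin_word_mult_right plin_word_mult_right]]) simp
 have 2: "word_mult (word_mult (bvec a) g) h = word_mult (bvec a) (word_mult g h)" for a
  by (rule plin_eq[OF plin_comp[OF plin_word_mult_left plin_word_mult_right] plin_comp[OF plin_word_mult_right plin_word_mult_left]])
   (rule 1)
 show ?thesis
  by (rule plin_eq[OF plin_comp[OF plin_word_mult_left plin_word_mult_left] plin_word_mult_left]) (rule 2)
qed

lemma word_mult_Nil [simp]: "word_mult (bvec []) f = f" "word_mult f (bvec []) = f"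
 by (rule plin_eq[OF plin_word_mult_right plin_id], simp) (rule plin_eq[OF plin_word_mult_left plin_id], simp)

locale bracket_space =
 fixes G :: "'g super_space"
 assumes add_closed: "x \<in> carrier G ==> y \<in> carrier G ==> x \<oplus>\<^bsub>G\<^esub> y \<in> carrier G"
  and smult_closed: "x \<in> carrier G ==> c \<odot>\<^bsub>G\<^esub> x \<in> carrier G"
  and part_closed: "x \<in> part G p ==> x \<in> carrier G"
  and bracket_closed: "x \<in> part G p ==> y \<in> part G q ==> x \<otimes>\<^bsub>G\<^esub> y \<in> carrier G"
begin

definition "WS = {f. supp f <= lists (carrier G)}"

definition "env_rels =
   ({bvec (a @ (x \<oplus>\<^bsub>G\<^esub> y) # b) - bvec (a @ x # b) - bvec (a @ y # b) | a b x y.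
    a \<in> lists (carrier G) & b \<in> lists (carrier G) & x \<in> carrier G & y \<in> carrier G} \<union>
   {bvec (a @ (c \<odot>\<^bsub>G\<^esub> x) # b) - pscale c (bvec (a @ x # b)) | a b c x.
    a \<in> lists (carrier G) & b \<in> lists (carrier G) & x \<in> carrier G} \<union>
   {bvec (a @ x # y # b) - pscale (ksign p q) (bvec (a @ y # x # b)) - bvec (a @ (x \<otimes>\<^bsub>G\<^esub> y) # b)
    | a b x y p q.
    a \<in> lists (carrier G) & b \<in> lists (carrier G) & x \<in> part G p & y \<in> part G q})"

abbreviation "EN \<equiv> env_null G"

lemma env_rels_cases:
 assumes "s \<in> env_rels"
 obtains a b x y where "a \<in> lists (carrier G)" "b \<in> lists (carrier G)" "x \<in> carrier G" "y \<in> carrier G"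
   "s = bvec (a @ (x \<oplus>\<^bsub>G\<^esub> y) # b) - bvec (a @ x # b) - bvec (a @ y # b)"
 | a b c x where "a \<in> lists (carrier G)" "b \<in> lists (carrier G)" "x \<in> carrier G"
   "s = bvec (a @ (c \<odot>\<^bsub>G\<^esub> x) # b) - pscale c (bvec (a @ x # b))"
 | a b x y p q where "a \<in> lists (carrier G)" "b \<in> lists (carrier G)" "x \<in> part G p" "y \<in> part G q"
   "s = bvec (a @ x # y # b) - pscale (ksign p q) (bvec (a @ y # x # b)) - bvec (a @ (x \<otimes>\<^bsub>G\<^esub> y) # b)"
 using assms unfolding env_rels_def by blast

lemma env_relsI:
 assumes "a \<in> lists (carrier G)" "b \<in> lists (carrier G)"
 shows "x \<in> carrier G ==> y \<in> carrier G ==> bvec (a @ (x \<oplus>\<^bsub>G\<^esub> y) # b) - bvec (a @ x # b) - bvec (a @ y # b) \<in> env_rels"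
  "x \<in> carrier G ==> bvec (a @ (c \<odot>\<^bsub>G\<^esub> x) # b) - pscale c (bvec (a @ x # b)) \<in> env_rels"
  "x \<in> part G p ==> y \<in> part G q ==>
   bvec (a @ x # y # b) - pscale (ksign p q) (bvec (a @ y # x # b)) - bvec (a @ (x \<otimes>\<^bsub>G\<^esub> y) # b) \<in> env_rels"
 unfolding env_rels_def using assms by blast+

lemma WS_sub: "subsp WS" unfolding WS_def by (rule subspace_supp)

lemma bvec_WS: "w \<in> lists (carrier G) ==> bvec w \<in> WS" by (simp add: WS_def)

lemma env_rels_WS: "env_rels <= WS"
proof
 fix s assume "s \<in> env_rels"
 thus "s \<in> WS"
 proof (cases rule: env_rels_cases)
  case (1 a b x y)
  thus ?thesis unfolding 1(5)
   by (intro sub_diff[OF WS_sub] bvec_WS) (simp_all add: add_closed)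
 next
  case (2 a b c x)
  thus ?thesis unfolding 2(4)
   by (intro sub_diff[OF WS_sub] sub_scale[OF WS_sub] bvec_WS) (simp_all add: smult_closed)
 next
  case (3 a b x y p q)
  thus ?thesis unfolding 3(5)
   by (intro sub_diff[OF WS_sub] sub_scale[OF WS_sub] bvec_WS)
    (simp_all add: bracket_closed[OF 3(3,4)] part_closed[OF 3(3)] part_closed[OF 3(4)])
 qed
qed

lemma env_null_span: "EN = pv.span env_rels"
 unfolding env_null_def word_space_def env_rels_def[symmetric]
 by (rule lin_span_free_space) (use env_rels_WS in "simp add: WS_def")

lemma EN_sub: "subsp EN" unfolding env_null_span by (rule pv.subspace_span)

lemma EN_WS: "EN <= WS" unfolding env_null_span by (rule pv.span_minimal[OF env_rels_WS WS_sub])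

lemma env_rels_EN: "s \<in> env_rels ==> s \<in> EN" unfolding env_null_span by (rule pv.span_base)

lemma word_mult_WS: "f \<in> WS ==> g \<in> WS ==> word_mult f g \<in> WS"
proof -
 assume f: "f \<in> WS" and g: "g \<in> WS"
 show ?thesis
 proof (rule supp_image[OF plin_word_mult_left WS_sub])
  show "supp f <= lists (carrier G)" using f by (simp add: WS_def)
  fix a assume a: "a \<in> lists (carrier G)"
  show "word_mult (bvec a) g \<in> WS"
   by (rule supp_image[OF plin_word_mult_right WS_sub, of g "lists (carrier G)"])
    (use g a in "auto simp: WS_def")
 qed
qed

text \<open>The relations carry arbitrary words \<open>a\<close> and \<open>b\<close> on both sides,
  so multiplying one of them by a word gives another.\<close>

lemma EN_ideal:
 assumes f: "f \<in> EN" and g: "g \<in> WS"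
 shows "word_mult f g \<in> EN" "word_mult g f \<in> EN"
proof -
 have sg: "supp g <= lists (carrier G)" using g by (simp add: WS_def)
 have "word_mult s (bvec w) \<in> EN & word_mult (bvec w) s \<in> EN" if s: "s \<in> env_rels" and w: "w \<in> lists (carrier G)" for s w
  using s
 proof (cases rule: env_rels_cases)
  case (1 a b x y)
  have "b @ w \<in> lists (carrier G)" "w @ a \<in> lists (carrier G)" using 1 w by auto
  from env_rels_EN[OF env_relsI(1)[OF 1(1) this(1) 1(3,4)]] env_rels_EN[OF env_relsI(1)[OF this(2) 1(2-4)]]
  show ?thesis unfolding 1(5) by (simp add: word_mult_linear del: pscale_single)
 next
  case (2 a b c x)
  have "b @ w \<in> lists (carrier G)" "w @ a \<in> lists (carrier G)" using 2 w by auto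
  from env_rels_EN[OF env_relsI(2)[OF 2(1) this(1) 2(3)]] env_rels_EN[OF env_relsI(2)[OF this(2) 2(2,3)]]
  show ?thesis unfolding 2(4) by (simp add: word_mult_linear del: pscale_single)
 next
  case (3 a b x y p q)
  have "b @ w \<in> lists (carrier G)" "w @ a \<in> lists (carrier G)" using 3 w by auto
  from env_rels_EN[OF env_relsI(3)[OF 3(1) this(1) 3(3,4)]] env_rels_EN[OF env_relsI(3)[OF this(2) 3(2-4)]]
  show ?thesis unfolding 3(5) by (simp add: word_mult_linear del: pscale_single)
 qed
 hence b: "word_mult f (bvec w) \<in> EN" "word_mult (bvec w) f \<in> EN" if "w \<in> lists (carrier G)" for w
  using plin_span[OF plin_word_mult_left EN_sub _ f[unfolded env_null_span], of "bvec w"]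
   plin_span[OF plin_word_mult_right EN_sub _ f[unfolded env_null_span], of "bvec w"] that by blast+
 show "word_mult f g \<in> EN" by (rule supp_image[OF plin_word_mult_right EN_sub sg b(1)])
 show "word_mult g f \<in> EN" by (rule supp_image[OF plin_word_mult_left EN_sub sg b(2)])
qed

sublocale env: module_quotient "word_space G" EN
 unfolding word_space_def by (rule module_quotient_free[OF EN_sub]) (use EN_WS in "simp add: WS_def")

abbreviation cl where "cl f \<equiv> EN +>\<^bsub>word_space G\<^esub> f"

lemma word_space_WS: "carrier (word_space G) = WS" by (simp add: word_space_def WS_def)

lemma cl_eq: "f \<in> WS ==> g \<in> WS ==> cl f = cl g \<longleftrightarrow> f - g \<in> EN"
 using env.coset_eq_iff[of f g] free_space_minus[of f "lists (carrier G)" _ g]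
 by (simp add: word_space_WS) (simp add: word_space_def WS_def)

lemma env_carrier: "carrier (env G) = cl ` WS"
 using env.carrier_quot by (simp add: env_def word_space_WS)

lemma env_part: "part (env G) p = cl ` {f. supp f <= {w. hom_word G p w}}"
 by (simp add: env_def) (simp add: word_space_def)

lemma env_add: "f \<in> WS ==> g \<in> WS ==> cl f \<oplus>\<^bsub>env G\<^esub> cl g = cl (f + g)"
 using env.add_coset[of f g] by (simp add: env_def word_space_WS) (simp add: word_space_def)

lemma env_smult: "f \<in> WS ==> c \<odot>\<^bsub>env G\<^esub> cl f = cl (pscale c f)"
 using env.smult_coset[of f c] by (simp add: env_def word_space_WS) (simp add: word_space_def)

lemma env_incl_cl: "env_incl G x = cl (bvec [x])" by (simp add: env_incl_def)

lemma env_mult: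
 assumes f: "f \<in> WS" and g: "g \<in> WS"
 shows "cl f \<otimes>\<^bsub>env G\<^esub> cl g = cl (word_mult f g)"
proof -
 have m: "h \<in> WS" "h - f \<in> EN" if "h \<in> cl f" "f \<in> WS" for h f
 proof -
  show "h \<in> WS" using env.coset_mem(1)[of f h] that by (simp add: word_space_WS)
  hence "cl h = cl f" using env.coset_mem(2)[of f h] env.coset_eq_iff[of h f] that by (simp add: word_space_WS)
  thus "h - f \<in> EN" using cl_eq \<open>h \<in> WS\<close> that by simp
 qed
 have "cl (word_mult f' g') = cl (word_mult f g)" if "f' \<in> cl f" "g' \<in> cl g" for f' g'
 proof -
  note f' = m[OF that(1) f] and g' = m[OF that(2) g]
  have "word_mult f' g' - word_mult f g = word_mult (f' - f) g' + word_mult f (g' - g)"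
   by (simp add: word_mult_linear)
  also have "\<dots> \<in> EN" by (rule sub_add[OF EN_sub EN_ideal(1)[OF f'(2) g'(1)] EN_ideal(2)[OF g'(2) f]])
  finally show ?thesis using cl_eq[OF word_mult_WS[OF f'(1) g'(1)] word_mult_WS[OF f g]] by simp
 qed
 moreover have "f \<in> cl f" "g \<in> cl g" using f g env.coset_self by (simp_all add: word_space_WS)
 ultimately have "(\<Union>f'\<in>cl f. \<Union>g'\<in>cl g. cl (word_mult f' g')) = cl (word_mult f g)" by blast
 thus ?thesis by (simp add: env_def)
qed

lemma hom_word_lists: "hom_word G p w ==> w \<in> lists (carrier G)"
 by (induction rule: hom_word.induct) (auto intro: part_closed)

end

text \<open>The supertrace of a supercommutator vanishes. Index 0 is split off from each sum, and
  the four combinations of parities are compared.\<close>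

lemma bracket_sl_closed:
 assumes A: "A \<in> part (sl n) p" and B: "B \<in> part (sl n) q"
 shows "A \<otimes>\<^bsub>sl n\<^esub> B \<in> slc n"
proof -
 have ins: "(\<Sum>k\<le>n. f k) = f 0 + (\<Sum>k\<in>{1..n}. f k)" for f :: "nat => complex"
 proof -
  have "{..n} = insert 0 {1..n}" by auto
  thus ?thesis by simp
 qed
 let ?Z = "%i j. (\<Sum>k\<le>n. A i k * B k j) - ksign p q * (\<Sum>k\<le>n. B i k * A k j)"
 have z: "A i j = 0" if "((i = 0) ~= (j = 0)) ~= p" for i j using A that by (auto simp: mat_alg_part)
 have z': "B i j = 0" if "((i = 0) ~= (j = 0)) ~= q" for i j using B that by (auto simp: mat_alg_part)
 have out: "A i j = 0" "B i j = 0" if "~ (i \<le> n & j \<le> n)" for i j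
  using A B that by (auto simp: mat_alg_part)
 have "i \<le> n & j \<le> n" if nz: "?Z i j ~= 0" for i j
 proof (rule ccontr)
  assume "~ (i \<le> n & j \<le> n)"
  hence "A i k * B k j = 0" "B i k * A k j = 0" for k using out[of i k] out[of k j] by auto
  hence "(\<Sum>k\<le>n. A i k * B k j) = 0" "(\<Sum>k\<le>n. B i k * A k j) = 0" by (simp_all only: sum.neutral_const)
  thus False using nz by simp
 qed
 moreover have "?Z 0 0 = (\<Sum>i\<in>{1..n}. ?Z i i)"
 proof -
  have A0: "A 0 k = 0 & A k 0 = 0" if "~ p" "k \<in> {1..n}" for k using z[of 0 k] z[of k 0] that by auto
  have A1: "A 0 0 = 0" "i \<in> {1..n} ==> k \<in> {1..n} ==> A i k = 0" if "p" for i k using z[of 0 0] z[of i k] that by auto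
  have B0: "B 0 k = 0 & B k 0 = 0" if "~ q" "k \<in> {1..n}" for k using z'[of 0 k] z'[of k 0] that by auto
  have B1: "B 0 0 = 0" "i \<in> {1..n} ==> k \<in> {1..n} ==> B i k = 0" if "q" for i k using z'[of 0 0] z'[of i k] that by auto
  have sw: "(\<Sum>i\<in>{1..n}. \<Sum>k\<in>{1..n}. A i k * B k i) = (\<Sum>i\<in>{1..n}. \<Sum>k\<in>{1..n}. B i k * A k i)"
   by (subst sum.swap) (simp add: mult.commute)
  have cm: "(\<Sum>k\<in>{1..n}. A 0 k * B k 0) = (\<Sum>k\<in>{1..n}. B k 0 * A 0 k)" "(\<Sum>k\<in>{1..n}. B 0 k * A k 0) = (\<Sum>k\<in>{1..n}. A k 0 * B 0 k)"
   by (simp_all add: mult.commute)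
  show ?thesis
  proof (cases p; cases q)
   assume pq: "p" "q"
   have "(\<Sum>i\<in>{1..n}. ?Z i i) = (\<Sum>i\<in>{1..n}. A i 0 * B 0 i + B i 0 * A 0 i)"
    unfolding ins by (intro sum.cong refl) (simp add: A1[OF pq(1)] B1[OF pq(2)] ksign_def pq)
   also have "\<dots> = ?Z 0 0" unfolding ins using cm by (simp add: A1[OF pq(1)] B1[OF pq(2)] ksign_def pq sum.distrib)
   finally show ?thesis by simp
  next
   assume pq: "p" "~ q"
   have "(\<Sum>i\<in>{1..n}. ?Z i i) = 0" "?Z 0 0 = 0"
    unfolding ins using B0[OF pq(2)] by (auto simp: A1[OF pq(1)] intro!: sum.neutral)
   thus ?thesis by (simp only:)
  next
   assume pq: "~ p" "q"
   have "(\<Sum>i\<in>{1..n}. ?Z i i) = 0" "?Z 0 0 = 0"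
    unfolding ins using A0[OF pq(1)] by (auto simp: B1[OF pq(2)] intro!: sum.neutral)
   thus ?thesis by (simp only:)
  next
   assume pq: "~ p" "~ q"
   have "(\<Sum>i\<in>{1..n}. ?Z i i) = (\<Sum>i\<in>{1..n}. (\<Sum>k\<in>{1..n}. A i k * B k i) - (\<Sum>k\<in>{1..n}. B i k * A k i))"
    unfolding ins using A0[OF pq(1)] B0[OF pq(2)] by (intro sum.cong refl) (simp add: ksign_def pq)
   also have "\<dots> = 0" using sw by (simp add: sum_subtractf)
   also have "0 = ?Z 0 0" unfolding ins using A0[OF pq(1)] B0[OF pq(2)] by (simp add: ksign_def pq mult.commute)
   finally show ?thesis by simp
  qed
 qed
 ultimately show ?thesis unfolding bracket_sl[OF A B] sl_carrier mat_alg_carrier by blast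
qed

lemma bracket_space_sl: "bracket_space (sl n)"
proof
 fix x y p q
 show "x \<in> slc n ==> y \<in> slc n ==> x \<oplus>\<^bsub>sl n\<^esub> y \<in> slc n"
  using sl_closed(1) by simp
 show "x \<in> slc n ==> c \<odot>\<^bsub>sl n\<^esub> x \<in> slc n" for c using sl_closed(2) by simp
qed (simp, rule bracket_sl_closed)

section \<open>The Kac module\<close>

lemma plin_foldr: "(!!a. plin (f a)) ==> plin (%v. foldr f w v)"
 by (induction w) (simp_all add: plin_id id_def comp_def plin_comp)

locale kac_setup =
 fixes n :: nat and lam :: "nat => complex"
 assumes n_ge2: "n \<ge> 2"
begin

sublocale bracket_space "sl n" by (rule bracket_space_sl)

abbreviation "N \<equiv> N_carrier n lam"
abbreviation "NM \<equiv> extend_by_zero n (N_module n lam)"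
abbreviation "E \<equiv> env (sl n)"

definition "nact A v = (\<Sum>i\<in>{1..n}. \<Sum>j\<in>{1..n}. pscale (A i j) (NH n lam i j v))"
definition "PS = {f. supp f <= carrier E \<times> N}"
definition "PSp p = {f. supp f <= (\<Union>q. part E (p ~= q) \<times> part NM q)}"
definition "I = induced_null (sl n) (sl_nonpos n) NM"
definition "irels = bilinear_rels E NM \<union>
   {bvec (u \<otimes>\<^bsub>E\<^esub> env_incl (sl n) y, v) - bvec (u, act NM y v) | u y v.
    u \<in> carrier E & y \<in> sl_nonpos n & v \<in> carrier NM}"
definition "op a = linext (%(u, v). bvec (env_incl (sl n) a \<otimes>\<^bsub>E\<^esub> u, v))"

lemma NM_simps [simp]: "carrier NM = N" "x \<oplus>\<^bsub>NM\<^esub> y = x + y" "c \<odot>\<^bsub>NM\<^esub> x = pscale c x"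
 "part NM p = (if p then {0} else N)"
 by (simp_all add: extend_by_zero_def N_module_def)

lemma sl_nonpos_carrier: "y \<in> sl_nonpos n ==> y \<in> slc n"
 unfolding sl_nonpos_def sl_minus_def using sl_closed(1) by auto

lemma act_NM: "A \<in> slc n ==> act NM A v = nact A v"
 by (auto simp: extend_by_zero_def N_module_def nact_def NH_def component_sl mat_part_def intro!: sum.cong)

lemma nact_N: "v \<in> N ==> nact A v \<in> N"
 unfolding nact_def by (intro sub_sum[OF N_sub] sub_scale[OF N_sub] NH_N)

lemma N0: "0 \<in> N" by (rule sub_0[OF N_sub])

lemma EC: "f \<in> WS ==> cl f \<in> carrier E" by (simp add: env_carrier)

lemma PS_sub: "subsp PS" unfolding PS_def by (rule subspace_supp)

lemma PSp_sub: "subsp (PSp p)" unfolding PSp_def by (rule subspace_supp)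

lemma bvec_PS: "f \<in> WS ==> v \<in> N ==> bvec (cl f, v) \<in> PS" by (simp add: PS_def EC)

text \<open>Elements of the enveloping algebra are replaced by representatives in the free algebra,
  where all further computations take place.\<close>

lemma irels_cases:
 assumes "s \<in> irels"
 obtains f g v where "f \<in> WS" "g \<in> WS" "v \<in> N" "s = bvec (cl (f + g), v) - bvec (cl f, v) - bvec (cl g, v)"
 | f v w where "f \<in> WS" "v \<in> N" "w \<in> N" "s = bvec (cl f, v + w) - bvec (cl f, v) - bvec (cl f, w)"
 | f c v where "f \<in> WS" "v \<in> N" "s = bvec (cl (pscale c f), v) - pscale c (bvec (cl f, v))"
 | f c v where "f \<in> WS" "v \<in> N" "s = bvec (cl f, pscale c v) - pscale c (bvec (cl f, v))"
 | f y v where "f \<in> WS" "y \<in> sl_nonpos n" "v \<in> N" "s = bvec (cl (word_mult f (bvec [y])), v) - bvec (cl f, nact y v)"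
proof -
 from assms show thesis unfolding irels_def bilinear_rels_def NM_simps
 proof (elim UnE CollectE exE conjE, goal_cases)
  case (1 x y v)
  obtain f g where f: "f \<in> WS" "g \<in> WS" "x = cl f" "y = cl g" using 1(2,3) unfolding env_carrier by blast
  show ?case by (rule that(1)[OF f(1,2) 1(4)]) (simp add: 1(1) f env_add)
 next
  case (2 x v w)
  obtain f where f: "f \<in> WS" "x = cl f" using 2(2) unfolding env_carrier by blast
  show ?case by (rule that(2)[OF f(1) 2(3,4)]) (simp add: 2(1) f)
 next
  case (3 c x v)
  obtain f where f: "f \<in> WS" "x = cl f" using 3(2) unfolding env_carrier by blast
  show ?case by (rule that(3)[OF f(1) 3(3), of c]) (simp add: 3(1) f env_smult)
 next
  case (4 c x v)
  obtain f where f: "f \<in> WS" "x = cl f" using 4(2) unfolding env_carrier by blast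
  show ?case by (rule that(4)[OF f(1) 4(3), of c]) (simp add: 4(1) f)
 next
  case (5 x y v)
  obtain f where f: "f \<in> WS" "x = cl f" using 5(2) unfolding env_carrier by blast
  have "bvec [y] \<in> WS" using sl_nonpos_carrier[OF 5(3)] by (intro bvec_WS) simp
  thus ?case
   by (intro that(5)[OF f(1) 5(3,4)]) (simp add: 5(1) f env_incl_cl env_mult act_NM sl_nonpos_carrier 5(3))
 qed
qed

lemma irelsI:
 assumes "f \<in> WS" "v \<in> N"
 shows "g \<in> WS ==> bvec (cl (f + g), v) - bvec (cl f, v) - bvec (cl g, v) \<in> irels"
  "w \<in> N ==> bvec (cl f, v + w) - bvec (cl f, v) - bvec (cl f, w) \<in> irels"
  "bvec (cl (pscale c f), v) - pscale c (bvec (cl f, v)) \<in> irels"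
  "bvec (cl f, pscale c v) - pscale c (bvec (cl f, v)) \<in> irels"
  "y \<in> sl_nonpos n ==> bvec (cl (word_mult f (bvec [y])), v) - bvec (cl f, nact y v) \<in> irels"
proof -
 note E = EC[OF assms(1)]
 show "bvec (cl (f + g), v) - bvec (cl f, v) - bvec (cl g, v) \<in> irels" if "g \<in> WS"
  unfolding env_add[OF assms(1) that, symmetric] irels_def bilinear_rels_def NM_simps
  using E EC[OF that] assms(2) by blast
 show "bvec (cl f, v + w) - bvec (cl f, v) - bvec (cl f, w) \<in> irels" if "w \<in> N"
  unfolding irels_def bilinear_rels_def NM_simps using E that assms(2) by blast
 show "bvec (cl (pscale c f), v) - pscale c (bvec (cl f, v)) \<in> irels"
  unfolding env_smult[OF assms(1), symmetric] irels_def bilinear_rels_def NM_simps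
  using E assms(2) by blast
 show "bvec (cl f, pscale c v) - pscale c (bvec (cl f, v)) \<in> irels"
  unfolding irels_def bilinear_rels_def NM_simps using E assms(2) by blast
 assume y: "y \<in> sl_nonpos n"
 have bW: "bvec [y] \<in> WS" using sl_nonpos_carrier[OF y] by (intro bvec_WS) simp
 have "bvec (cl f \<otimes>\<^bsub>E\<^esub> env_incl (sl n) y, v) - bvec (cl f, act NM y v) \<in> irels"
  unfolding irels_def NM_simps using E assms(2) y by blast
 thus "bvec (cl (word_mult f (bvec [y])), v) - bvec (cl f, nact y v) \<in> irels"
  unfolding env_incl_cl env_mult[OF assms(1) bW] act_NM[OF sl_nonpos_carrier[OF y]] .
qed

lemma irels_PS: "irels <= PS"
proof
 fix s assume "s \<in> irels"
 thus "s \<in> PS"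
 proof (cases rule: irels_cases)
  case (1 f g v)
  thus ?thesis unfolding 1(4)
   by (intro sub_diff[OF PS_sub] bvec_PS sub_add[OF WS_sub])
 next
  case (2 f v w)
  thus ?thesis unfolding 2(4)
   by (intro sub_diff[OF PS_sub] bvec_PS sub_add[OF N_sub])
 next
  case (3 f c v)
  thus ?thesis unfolding 3(3)
   by (intro sub_diff[OF PS_sub] sub_scale[OF PS_sub] bvec_PS sub_scale[OF WS_sub])
 next
  case (4 f c v)
  thus ?thesis unfolding 4(3)
   by (intro sub_diff[OF PS_sub] sub_scale[OF PS_sub] bvec_PS sub_scale[OF N_sub])
 next
  case (5 f y v)
  have "bvec [y] \<in> WS" using sl_nonpos_carrier[OF 5(2)] by (intro bvec_WS) simp
  thus ?thesis using 5 unfolding 5(4)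
   by (intro sub_diff[OF PS_sub] bvec_PS word_mult_WS nact_N)
 qed
qed

lemma I_span: "I = pv.span irels"
 unfolding I_def induced_null_def irels_def[symmetric] pair_space_def
 by (rule lin_span_free_space) (use irels_PS in "simp add: PS_def")

lemma I_sub: "subsp I" unfolding I_span by (rule pv.subspace_span)

lemma I_PS: "I <= PS" unfolding I_span by (rule pv.span_minimal[OF irels_PS PS_sub])

lemma irels_I: "s \<in> irels ==> s \<in> I" unfolding I_span by (rule pv.span_base)

lemma PS_induct:
 assumes "k \<in> PS" "plin F" "subsp W" "!!f v. f \<in> WS ==> v \<in> N ==> F (bvec (cl f, v)) \<in> W"
 shows "F k \<in> W"
proof (rule supp_image[OF assms(2,3)])
 show "supp k <= carrier E \<times> N" using assms(1) by (simp add: PS_def)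
 fix b assume "b \<in> carrier E \<times> N"
 then obtain f v where "b = (cl f, v)" "f \<in> WS" "v \<in> N" unfolding env_carrier by blast
 thus "F (bvec b) \<in> W" using assms(4) by simp
qed

lemma plin_op [simp]: "plin (op a)" by (simp add: op_def)

lemma gen_WS: "a \<in> slc n ==> bvec [a] \<in> WS" by (intro bvec_WS) simp

lemma op_cl: "a \<in> slc n ==> f \<in> WS ==> op a (bvec (cl f, v)) = bvec (cl (word_mult (bvec [a]) f), v)"
 by (simp add: op_def env_incl_cl env_mult gen_WS)

lemma op_PS: "a \<in> slc n ==> k \<in> PS ==> op a k \<in> PS"
 by (erule PS_induct[OF _ plin_op PS_sub]) (simp add: op_cl bvec_PS word_mult_WS gen_WS)

text \<open>Balancing acts on the right end of the first argument, so left multiplication turns each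
  relation into another one.\<close>

lemma op_I:
 assumes a: "a \<in> slc n" and k: "k \<in> I"
 shows "op a k \<in> I"
proof (rule plin_span[OF plin_op I_sub _ k[unfolded I_span]])
 fix s assume "s \<in> irels"
 thus "op a s \<in> I"
 proof (cases rule: irels_cases)
  case (1 f g v)
  thus ?thesis
   using irels_I[OF irelsI(1)[OF word_mult_WS[OF gen_WS[OF a] 1(1)] 1(3) word_mult_WS[OF gen_WS[OF a] 1(2)]]]
   by (simp add: plin_diff op_cl a sub_add[OF WS_sub] word_mult_linear)
 next
  case (2 f v w)
  thus ?thesis
   using irels_I[OF irelsI(2)[OF word_mult_WS[OF gen_WS[OF a] 2(1)] 2(2,3)]]
   by (simp add: plin_diff op_cl a)
 next
  case (3 f c v)
  thus ?thesis
   using irels_I[OF irelsI(3)[OF word_mult_WS[OF gen_WS[OF a] 3(1)] 3(2)]]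
   by (simp add: plin_diff plin_scale op_cl a sub_scale[OF WS_sub] word_mult_linear del: pscale_single)
 next
  case (4 f c v)
  thus ?thesis
   using irels_I[OF irelsI(4)[OF word_mult_WS[OF gen_WS[OF a] 4(1)] 4(2)]]
   by (simp add: plin_diff plin_scale op_cl a del: pscale_single)
 next
  case (5 f y v)
  thus ?thesis
   using irels_I[OF irelsI(5)[OF word_mult_WS[OF gen_WS[OF a] 5(1)] 5(3,2)]]
   by (simp add: plin_diff op_cl a word_mult_assoc word_mult_WS gen_WS sl_nonpos_carrier)
 qed
qed

text \<open>The Kac module is realized on the range \<open>VK\<close> of a projection with kernel \<open>I\<close>.\<close>

definition "proj = (SOME \<pi>. plin \<pi> & (\<forall>k. k - \<pi> k \<in> I) & (\<forall>k\<in>I. \<pi> k = 0))"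

lemma proj: "plin proj" "k - proj k \<in> I" "k \<in> I ==> proj k = 0"
proof -
 have "\<exists>\<pi>. plin \<pi> & (\<forall>k. k - \<pi> k \<in> I) & (\<forall>k\<in>I. \<pi> k = 0)"
  using subspace_projection[OF I_sub] by metis
 hence "plin proj & (\<forall>k. k - proj k \<in> I) & (\<forall>k\<in>I. proj k = 0)"
  unfolding proj_def by (rule someI_ex)
 thus "plin proj" "k - proj k \<in> I" "k \<in> I ==> proj k = 0" by blast+
qed

definition "VK = proj ` PS"
definition "A a k = proj (op a k)"
text \<open>The class of f tensor v. Defining it on words makes it linear in \<open>f\<close> at
  once; \<open>proj_cl\<close> identifies it with the class obtained from the coset of
  \<open>f\<close>.\<close>

definition "J v f = proj (linext (%w. bvec (cl (bvec w), v)) f)"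

lemma plin_J [simp]: "plin (J v)" unfolding J_def[abs_def] by (rule plin_comp[OF proj(1) plin_linext])

lemma plin_A [simp]: "plin (A a)" unfolding A_def[abs_def] by (rule plin_comp[OF proj(1) plin_op])

lemma proj_proj [simp]: "proj (proj k) = proj k"
 using plin_diff[OF proj(1), of k "proj k"] proj(3)[OF proj(2)] by simp

lemma proj_PS: "k \<in> PS ==> proj k \<in> PS"
 using sub_diff[OF PS_sub, of k "k - proj k"] proj(2)[of k] I_PS by auto

lemma VK_sub: "subsp VK" unfolding VK_def by (rule subspace_image[OF proj(1) PS_sub])

lemma VK_PS: "VK <= PS" unfolding VK_def using proj_PS by blast

lemma proj_VK: "k \<in> VK ==> proj k = k" unfolding VK_def by auto

lemma proj_rel: "s \<in> irels ==> proj s = 0" using proj(3) irels_I by blast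

lemma proj_cl:
 assumes f: "f \<in> WS" and v: "v \<in> N"
 shows "proj (bvec (cl f, v)) = J v f"
proof -
 let ?W = "{f \<in> WS. proj (bvec (cl f, v)) = J v f}"
 have add: "proj (bvec (cl (g + h), v)) = proj (bvec (cl g, v)) + proj (bvec (cl h, v))" if "g \<in> WS" "h \<in> WS" for g h
  using proj_rel[OF irelsI(1)[OF that(1) v that(2)]] by (simp add: plin_diff[OF proj(1)] plin_add[OF proj(1)] algebra_simps)
 have sc: "proj (bvec (cl (pscale c g), v)) = pscale c (proj (bvec (cl g, v)))" if "g \<in> WS" for c g
  using proj_rel[OF irelsI(3)[OF that v, of c]] by (simp add: plin_diff[OF proj(1)] plin_scale[OF proj(1)] del: pscale_single)
 have W0: "0 \<in> WS" by (rule sub_0[OF WS_sub])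
 have "f \<in> ?W"
 proof (rule supp_induct)
  show "supp f <= lists (slc n)" using f by (simp add: WS_def)
  show "subsp ?W"
  proof (rule pv.subspaceI)
   show "0 \<in> ?W" using sc[OF W0, of 0] W0 by (simp add: plin_zero)
   fix x y c assume "x \<in> ?W"
   thus "y \<in> ?W ==> x + y \<in> ?W" "pscale c x \<in> ?W"
    using add sc sub_add[OF WS_sub] sub_scale[OF WS_sub] by (auto simp: plin_add plin_scale)
  qed
  show "bvec w \<in> ?W" if "w \<in> lists (slc n)" for w
   using bvec_WS[OF that] by (simp add: J_def)
 qed
 thus ?thesis by simp
qed

lemma J_add: "f \<in> WS ==> v \<in> N ==> w \<in> N ==> J (v + w) f = J v f + J w f"
 using proj_rel[OF irelsI(2)[where f=f and v=v and w=w]] sub_add[OF N_sub[of n lam], of v w]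
 by (simp add: plin_diff[OF proj(1)] proj_cl diff_eq_eq add.commute)

lemma J_scale: "f \<in> WS ==> v \<in> N ==> J (pscale c v) f = pscale c (J v f)"
 using proj_rel[OF irelsI(4)[where f=f and v=v and c=c]] sub_scale[OF N_sub[of n lam], of v c]
 by (simp add: plin_diff[OF proj(1)] plin_scale[OF proj(1)] proj_cl del: pscale_single)

lemma J_zero: "f \<in> WS ==> J 0 f = 0" using J_scale[of f 0 0] N0 by simp

lemma J_balanced: "f \<in> WS ==> v \<in> N ==> y \<in> sl_nonpos n ==> J v (word_mult f (bvec [y])) = J (nact y v) f"
 using proj_rel[OF irelsI(5)[where f=f and v=v and y=y]]
 by (simp add: plin_diff[OF proj(1)] proj_cl nact_N word_mult_WS gen_WS sl_nonpos_carrier)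

lemma J_EN: "f \<in> EN ==> v \<in> N ==> J v f = 0"
proof -
 assume f: "f \<in> EN" and v: "v \<in> N"
 have fW: "f \<in> WS" using f EN_WS by blast
 have "cl f = cl 0" using cl_eq[OF fW sub_0[OF WS_sub]] f by simp
 thus "J v f = 0" using proj_cl[OF fW v] proj_cl[OF sub_0[OF WS_sub] v] by (simp add: plin_zero)
qed

lemma J_VK: "f \<in> WS ==> v \<in> N ==> J v f \<in> VK"
 using proj_cl bvec_PS unfolding VK_def by force

lemma A_proj: "a \<in> slc n ==> A a (proj k) = proj (op a k)"
proof -
 assume a: "a \<in> slc n"
 have "proj (op a (k - proj k)) = 0" by (rule proj(3)[OF op_I[OF a proj(2)]])
 thus ?thesis by (simp add: A_def plin_diff plin_diff[OF proj(1)])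
qed

lemma A_J: "a \<in> slc n ==> f \<in> WS ==> v \<in> N ==> A a (J v f) = J v (word_mult (bvec [a]) f)"
 using A_proj[of a "bvec (cl f, v)"] by (simp add: proj_cl op_cl word_mult_WS gen_WS)

lemma VK_induct:
 assumes "k \<in> VK" "plin F" "subsp W" "!!f v. f \<in> WS ==> v \<in> N ==> F (J v f) \<in> W"
 shows "F k \<in> W"
proof -
 obtain k0 where k0: "k0 \<in> PS" "k = proj k0" using assms(1) unfolding VK_def by blast
 show ?thesis unfolding k0(2)
  by (rule PS_induct[OF k0(1) plin_comp[OF assms(2) proj(1)] assms(3)]) (simp add: proj_cl assms(4))
qed

text \<open>The bracket rule comes from the third kind of relations of the enveloping algebra,
  linearity in the matrix from the other two. Since \<open>EN\<close> is an ideal, they may be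
  multiplied by any \<open>f\<close>.\<close>

lemma sl_rep_VK: "sl_rep n VK A"
proof
 show "subsp VK" by (rule VK_sub)
 show "plin (A a)" for a by simp
 show "A a f \<in> VK" if "a \<in> slc n" "f \<in> VK" for a f
  by (rule VK_induct[OF that(2) plin_A VK_sub]) (simp add: A_J that(1) J_VK word_mult_WS gen_WS)
next
 fix x p y q k
 assume x: "x \<in> part (sl n) p" and y: "y \<in> part (sl n) q" and xy: "x \<otimes>\<^bsub>sl n\<^esub> y \<in> slc n" and k: "k \<in> VK"
 have c: "x \<in> slc n" "y \<in> slc n" using part_closed x y by blast+
 let ?F = "%k. A (x \<otimes>\<^bsub>sl n\<^esub> y) k - (A x (A y k) - pscale (ksign p q) (A y (A x k)))"
 have "?F k \<in> {0}"
 proof (rule VK_induct[OF k _ pv.subspace_single_0])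
  show "plin ?F" by (intro plin_minus plin_pscale plin_comp[OF plin_A plin_A] plin_A)
  fix f v assume f: "f \<in> WS" and v: "v \<in> N"
  have "bvec [x, y] - pscale (ksign p q) (bvec [y, x]) - bvec [x \<otimes>\<^bsub>sl n\<^esub> y] \<in> EN"
   using env_rels_EN[OF env_relsI(3)[OF _ _ x y, of "[]" "[]"]] by simp
  from J_EN[OF EN_ideal(1)[OF this f] v]
  have "J v (word_mult (word_mult (bvec [x]) (bvec [y])) f) - pscale (ksign p q) (J v (word_mult (word_mult (bvec [y]) (bvec [x])) f))
    - J v (word_mult (bvec [x \<otimes>\<^bsub>sl n\<^esub> y]) f) = 0"
   by (simp add: word_mult_linear plin_diff plin_scale del: pscale_single)
  thus "?F (J v f) \<in> {0}"
   using f v c xy by (simp add: A_J word_mult_WS gen_WS word_mult_assoc del: word_mult_bvec)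
 qed
 thus "A (x \<otimes>\<^bsub>sl n\<^esub> y) k = A x (A y k) - pscale (ksign p q) (A y (A x k))" by simp
next
 fix x y k c c' assume x: "x \<in> slc n" and y: "y \<in> slc n" and k: "k \<in> VK"
 let ?z = "%a b. c * x a b + c' * y a b"
 let ?F = "%k. A ?z k - (pscale c (A x k) + pscale c' (A y k))"
 have cx: "(%a b. c * x a b) \<in> slc n" "(%a b. c' * y a b) \<in> slc n" "?z \<in> slc n"
  by (rule sl_closed(2)[OF x], rule sl_closed(2)[OF y], rule sl_closed(1)[OF sl_closed(2)[OF x] sl_closed(2)[OF y]])
 have "?F k \<in> {0}"
 proof (rule VK_induct[OF k _ pv.subspace_single_0])
  show "plin ?F" by (intro plin_minus plin_plus plin_pscale plin_A)
  fix f v assume f: "f \<in> WS" and v: "v \<in> N"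
  have r: "bvec [?z] - bvec [%a b. c * x a b] - bvec [%a b. c' * y a b] \<in> EN"
   "bvec [%a b. c * x a b] - pscale c (bvec [x]) \<in> EN" "bvec [%a b. c' * y a b] - pscale c' (bvec [y]) \<in> EN"
   using env_rels_EN[OF env_relsI(1)[OF _ _ cx(1,2), of "[]" "[]"]] env_rels_EN[OF env_relsI(2)[OF _ _ x, of "[]" "[]" c]]
    env_rels_EN[OF env_relsI(2)[OF _ _ y, of "[]" "[]" c']] by simp_all
  from J_EN[OF EN_ideal(1)[OF r(1) f] v] J_EN[OF EN_ideal(1)[OF r(2) f] v] J_EN[OF EN_ideal(1)[OF r(3) f] v]
  show "?F (J v f) \<in> {0}"
   using f v x y cx by (simp add: A_J word_mult_linear plin_diff plin_add plin_scale algebra_simps del: pscale_single)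
 qed
 thus "A ?z k = pscale c (A x k) + pscale c' (A y k)" by simp
qed

section \<open>The generating layer and the grading of the Kac module\<close>

definition "D0 = (%x. J x (bvec [])) ` N"

lemma Nil_WS: "bvec [] \<in> WS" by (rule bvec_WS) simp

lemma A_D0: "y \<in> sl_nonpos n ==> x \<in> N ==> A y (J x (bvec [])) = J (nact y x) (bvec [])"
 using J_balanced[OF Nil_WS, of x y] A_J[OF sl_nonpos_carrier Nil_WS, of y x] by simp

lemma Emat_nonpos: "i \<in> {1..n} ==> Emat i 0 \<in> sl_nonpos n" "i \<in> {1..n} ==> nact (Emat i 0) x = 0"
proof -
 assume i: "i \<in> {1..n}"
 have "Emat i 0 \<in> sl_minus n" using sl_gens(2)[OF i i] i by (auto simp: sl_minus_def Emat_def)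
 moreover have "(%i j. 0) \<in> part (sl n) False" using sl_closed(3) by (auto simp: mat_alg_part)
 ultimately show "Emat i 0 \<in> sl_nonpos n" unfolding sl_nonpos_def by force
 show "nact (Emat i 0) x = 0" unfolding nact_def by (intro sum.neutral ballI) (simp add: Emat_def)
qed

lemma Gmat_nonpos: 
 assumes "i \<in> {1..n}" "j \<in> {1..n}"
 shows "Gmat i j \<in> sl_nonpos n" "nact (Gmat i j) x = NH n lam i j x"
proof -
 have "(%i j. 0) \<in> sl_minus n" using sl_closed(3) by (auto simp: sl_minus_def)
 thus "Gmat i j \<in> sl_nonpos n" using sl_gens(3)[OF assms] unfolding sl_nonpos_def by force
 have "nact (Gmat i j) x = (\<Sum>a\<in>{1..n}. \<Sum>b\<in>{1..n}. if b = j then if a = i then NH n lam a b x else 0 else 0)"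
  unfolding nact_def by (intro sum.cong refl) (auto simp: Gmat_def Emat_def)
 thus "nact (Gmat i j) x = NH n lam i j x" using assms by simp
qed

lemma D0_sub: "subsp D0"
proof (rule pv.subspaceI)
 show "0 \<in> D0" unfolding D0_def using J_zero[OF Nil_WS] N0 by force
 fix x y c assume "x \<in> D0"
 then obtain u where u: "u \<in> N" "x = J u (bvec [])" unfolding D0_def by blast
 show "pscale c x \<in> D0" unfolding D0_def u(2) J_scale[OF Nil_WS u(1), symmetric] using sub_scale[OF N_sub u(1)] by blast
 assume "y \<in> D0"
 then obtain v where v: "v \<in> N" "y = J v (bvec [])" unfolding D0_def by blast
 show "x + y \<in> D0" unfolding D0_def u(2) v(2) J_add[OF Nil_WS u(1) v(1), symmetric] using sub_add[OF N_sub u(1) v(1)] by blast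
qed

sublocale K: generated_sl_rep n VK A D0 "\<Sum>i\<in>{1..n}. lam i"
proof (intro generated_sl_rep.intro sl_rep_VK generated_sl_rep_axioms.intro n_ge2 D0_sub)
 show "D0 <= VK" unfolding D0_def using J_VK Nil_WS by blast
 fix i x assume i: "i \<in> {1..n}" and "x \<in> D0"
 then obtain u where u: "u \<in> N" "x = J u (bvec [])" unfolding D0_def by blast
 show "A (Emat i 0) x = 0" unfolding u(2) A_D0[OF Emat_nonpos(1)[OF i] u(1)] Emat_nonpos(2)[OF i] by (rule J_zero[OF Nil_WS])
 fix j assume j: "j \<in> {1..n}"
 show "A (Gmat i j) x \<in> D0"
  unfolding u(2) A_D0[OF Gmat_nonpos(1)[OF i j] u(1)] D0_def using nact_N[OF u(1)] by blast
next
 fix x assume "x \<in> D0"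
 then obtain u where u: "u \<in> N" "x = J u (bvec [])" unfolding D0_def by blast
 have "(\<Sum>i\<in>S. A (Gmat i i) x) = J (\<Sum>i\<in>S. NH n lam i i u) (bvec [])" if "finite S" "S <= {1..n}" for S
  using that
 proof (induction S)
  case empty
  thus ?case using J_zero[OF Nil_WS] by simp
 next
  case (insert i S)
  have i: "i \<in> {1..n}" using insert by simp
  have "(\<Sum>i\<in>S. NH n lam i i u) \<in> N" using insert.prems by (intro sub_sum[OF N_sub] NH_N u) auto
  thus ?case using insert J_add[OF Nil_WS NH_N[OF i i u(1)]]
   by (simp add: u(2) A_D0[OF Gmat_nonpos(1)[OF i i] u(1)] Gmat_nonpos(2)[OF i i])
 qed
 hence "(\<Sum>i\<in>{1..n}. A (Gmat i i) x) = J (\<Sum>i\<in>{1..n}. NH n lam i i u) (bvec [])" by blast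
 \<comment> \<open>This is the defining equation of N(lambda), the eigenvalue equation of the Euler
   operator.\<close>
 also have "(\<Sum>i\<in>{1..n}. NH n lam i i u) = pscale (\<Sum>i\<in>{1..n}. lam i) u"
  using u(1) by (simp add: N_carrier_def NH_def)
 finally show "(\<Sum>i\<in>{1..n}. A (Gmat i i) x) = pscale (\<Sum>i\<in>{1..n}. lam i) x"
  unfolding u(2) J_scale[OF Nil_WS u(1)] .
next
 fix U assume U: "subsp U" "U <= VK" "D0 <= U" "!!a u. a \<in> slc n ==> u \<in> U ==> A a u \<in> U"
 have w: "J v (bvec w) \<in> U" if "w \<in> lists (slc n)" "v \<in> N" for w v
  using that
 proof (induction w)
  case Nil
  thus ?case using U(3) unfolding D0_def by blast
 next
  case (Cons a w)
  have a: "a \<in> slc n" "w \<in> lists (slc n)" using Cons.hyps by auto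
  hence "A a (J v (bvec w)) \<in> U" using U(4) Cons by blast
  thus ?case using A_J[OF a(1) bvec_WS[OF a(2)] Cons.prems(1)] by simp
 qed
 have "k \<in> U" if "k \<in> VK" for k
 proof (rule VK_induct[OF that plin_id U(1)])
  fix f v assume f: "f \<in> WS" and v: "v \<in> N"
  show "J v f \<in> U" by (rule supp_image[OF plin_J U(1) f[unfolded WS_def mem_Collect_eq]]) (rule w[OF _ v])
 qed
 thus "U = VK" using U(2) by blast
qed

lemma op_PSp:
 assumes a: "a \<in> part (sl n) q" and k: "k \<in> PSp p"
 shows "op a k \<in> PSp (q ~= p)"
proof (rule supp_image[OF plin_op PSp_sub k[unfolded PSp_def mem_Collect_eq]])
 fix b assume "b \<in> (\<Union>r. part E (p ~= r) \<times> part NM r)"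
 then obtain r f v where b: "b = (cl f, v)" "supp f <= {w. hom_word (sl n) (p ~= r) w}" "v \<in> part NM r"
  unfolding env_part by blast
 have fW: "f \<in> WS" using b(2) hom_word_lists unfolding WS_def by blast
 have "word_mult (bvec [a]) f \<in> {f. supp f <= {w. hom_word (sl n) (q ~= (p ~= r)) w}}"
 proof (rule supp_image[OF plin_word_mult_right subspace_supp b(2)])
  fix w assume "w \<in> {w. hom_word (sl n) (p ~= r) w}"
  hence "hom_word (sl n) (q ~= (p ~= r)) (a # w)" using hom_word.Cons[OF a] by blast
  thus "word_mult (bvec [a]) (bvec w) \<in> {f. supp f <= {w. hom_word (sl n) (q ~= (p ~= r)) w}}" by simp
 qed
 hence "cl (word_mult (bvec [a]) f) \<in> part E (q ~= (p ~= r))"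
  unfolding env_part by (rule imageI)
 moreover have "(q ~= (p ~= r)) = ((q ~= p) ~= r)" by auto
 ultimately have "cl (word_mult (bvec [a]) f) \<in> part E ((q ~= p) ~= r)" by (simp only:)
 thus "op a (bvec b) \<in> PSp (q ~= p)"
  using b(3) unfolding b(1) op_cl[OF part_closed[OF a] fW] PSp_def by (auto simp del: NM_simps)
qed

text \<open>The grading of the quotient is declared through homogeneous words. Words of parity
  \<open>p\<close> map the generating layer into layers of that parity, and every layer is reached
  by words with as many \<open>X\<close> as its index; so this grading is the one by layers, for
  which a direct decomposition is known.\<close>

lemma proj_PSp: "proj ` PSp p = K.graded_layers p"
proof
 have hom: "J v (bvec w) \<in> K.graded_layers p" if "hom_word (sl n) p w" "v \<in> N" for p w v
  using that
 proof (induction rule: hom_word.induct)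
  case Nil
  hence "J v (bvec []) \<in> D0" unfolding D0_def by blast
  hence "J v (bvec []) \<in> K.D 0" by (simp only: K.D.simps)
  thus ?case unfolding K.graded_layers_def by (rule K.D_layer_sums) simp
 next
  case (Cons a p q w)
  have "J v (bvec (a # w)) = A a (J v (bvec w))"
   using A_J[OF part_closed[OF Cons(1)] bvec_WS[OF hom_word_lists[OF Cons(2)]] Cons.prems] by simp
  thus ?case using K.opr_graded_layers[OF Cons(1) part_closed[OF Cons(1)]] Cons by simp
 qed
 show "proj ` PSp p <= K.graded_layers p"
 proof
  fix y assume "y \<in> proj ` PSp p"
  then obtain k where k: "k \<in> PSp p" "y = proj k" by blast
  show "y \<in> K.graded_layers p" unfolding k(2)
  proof (rule supp_image[OF proj(1) K.graded_layers_sub k(1)[unfolded PSp_def mem_Collect_eq]])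
   fix b assume "b \<in> (\<Union>r. part E (p ~= r) \<times> part NM r)"
   then obtain r f v where b: "b = (cl f, v)" "supp f <= {w. hom_word (sl n) (p ~= r) w}" "v \<in> part NM r"
    unfolding env_part by blast
   have fW: "f \<in> WS" using b(2) hom_word_lists unfolding WS_def by blast
   show "proj (bvec b) \<in> K.graded_layers p"
   proof (cases r)
    case True
    hence "proj (bvec b) = 0" using b proj_cl[OF fW N0] J_zero[OF fW] by simp
    thus ?thesis using sub_0[OF K.graded_layers_sub] by simp
   next
    case False
    hence v: "v \<in> N" using b(3) by simp
    show ?thesis unfolding b(1) proj_cl[OF fW v]
     by (rule supp_image[OF plin_J K.graded_layers_sub b(2)]) (use hom False v in auto)
   qed
  qed
 qed
 have D: "K.D r <= proj ` PSp (odd r)" for r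
 proof (induction r)
  case 0
  have "J x (bvec []) \<in> proj ` PSp False" if "x \<in> N" for x
  proof -
   have "cl (bvec []) \<in> part E False" unfolding env_part by (rule imageI) (simp add: hom_word.Nil)
   hence "bvec (cl (bvec []), x) \<in> PSp False" using that unfolding PSp_def by auto
   thus ?thesis using proj_cl[OF Nil_WS that] by force
  qed
  hence "D0 <= proj ` PSp False" unfolding D0_def by blast
  thus ?case by simp
 next
  case (Suc r)
  have "x \<in> proj ` PSp (odd (Suc r))" if x: "x \<in> K.D (Suc r)" for x
  proof (rule K.D_Suc_induct[OF x subspace_image[OF proj(1) PSp_sub] plin_id])
   fix i y assume i: "i \<in> {1..n}" and "y \<in> K.D r"
   then obtain k where k: "k \<in> PSp (odd r)" "y = proj k" using Suc.IH by blast
   have "A (Emat 0 i) y = proj (op (Emat 0 i) k)" unfolding k(2) by (rule A_proj[OF K.gens_carrier(1)[OF i]])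
   moreover have "op (Emat 0 i) k \<in> PSp (odd (Suc r))" using op_PSp[OF sl_gens(1)[OF i i] k(1)] by simp
   ultimately show "A (Emat 0 i) y \<in> proj ` PSp (odd (Suc r))" by blast
  qed
  thus ?case by blast
 qed
 show "K.graded_layers p <= proj ` PSp p"
  unfolding K.graded_layers_def K.layer_sums_def
  by (rule pv.span_minimal[OF _ subspace_image[OF proj(1) PSp_sub]]) (use D in auto)
qed

end

section \<open>The simple top of the Kac module\<close>

text \<open>The embedding \<open>\<psi>\<close> of N(lambda) into the lowest layer is to be extended
  to the Kac module.\<close>

locale kac_cover = kac_setup n lam + T: quadratic_sl_module n M B kap
 for n lam and M :: "(mat, 'v) super_module" and B kap +
 fixes \<psi> :: "((nat => complex) \<Rightarrow>\<^sub>0 complex) => 'v \<Rightarrow>\<^sub>0 complex" and p0 :: bool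
 assumes psi_add: "x \<in> N ==> y \<in> N ==> \<psi> (x + y) = \<psi> x + \<psi> y"
  and psi_scale: "x \<in> N ==> \<psi> (pscale c x) = pscale c (\<psi> x)"
  and psi_lowest: "x \<in> N ==> \<psi> x \<in> T.lowest" and psi_Vp: "x \<in> N ==> \<psi> x \<in> T.Vp p0"
  and psi_inj: "x \<in> N ==> \<psi> x = 0 ==> x = 0"
  and psi_H: "i \<in> {1..n} ==> j \<in> {1..n} ==> x \<in> N ==> \<psi> (NH n lam i j x) = T.H i j (\<psi> x)"
  and psi_nonzero: "\<psi> ` N ~= {0}"
begin

text \<open>The free algebra acts on the simple module word by word. The map \<open>Phi\<close>
  sends u tensor x to u acting on \<open>\<psi> x\<close>, by way of a chosen representative of the
  coset u.\<close>

definition "EV f v = linext (%w. foldr T.opr w v) f"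
definition "Phi = linext (%(u, x). EV (SOME f. f \<in> WS & u = cl f) (\<psi> x))"

lemma plin_EV: "plin (%f. EV f v)" and plin_EV_right: "plin (EV f)"
proof -
 show "plin (%f. EV f v)" unfolding EV_def by (rule plin_linext)
 show "plin (EV f)" unfolding EV_def[abs_def] linext_def
  by (intro plin_sum_fun plin_pscale plin_foldr T.rep_plin)
qed

lemma plin_Phi: "plin Phi" by (simp add: Phi_def)

lemma foldr_V: "w \<in> lists (slc n) ==> v \<in> T.V ==> foldr T.opr w v \<in> T.V"
 by (induction w) (auto intro: T.rep_V)

lemma psi_V: "x \<in> N ==> \<psi> x \<in> T.V" using psi_Vp T.Vp_V by blast

lemma EV_V: "f \<in> WS ==> v \<in> T.V ==> EV f v \<in> T.V"
 by (rule supp_image[OF plin_EV T.V_sub, of f "lists (slc n)"]) (simp_all add: WS_def EV_def foldr_V)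

lemma EV_EN:
 assumes f: "f \<in> EN" and v: "v \<in> T.V"
 shows "EV f v = 0"
proof -
 have "EV f v \<in> {0}"
 proof (rule plin_span[OF plin_EV pv.subspace_single_0 _ f[unfolded env_null_span]])
  fix s assume "s \<in> env_rels"
  thus "EV s v \<in> {0}"
  proof (cases rule: env_rels_cases)
   case (1 a b x y)
   show ?thesis unfolding 1(5) plin_diff[OF plin_EV]
    using T.opr_add[OF 1(3,4) add_closed[OF 1(3,4)] foldr_V[OF 1(2) v]]
    by (simp add: EV_def plin_add[OF plin_foldr[OF T.rep_plin]])
  next
   case (2 a b c x)
   show ?thesis unfolding 2(4) plin_diff[OF plin_EV] plin_scale[OF plin_EV]
    using T.opr_scale[OF 2(3) smult_closed[OF 2(3)] foldr_V[OF 2(2) v]]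
    by (simp add: EV_def plin_scale[OF plin_foldr[OF T.rep_plin]])
  next
   case (3 a b x y p q)
   have e: "EV (bvec w) v = foldr T.opr w v" for w by (simp add: EV_def)
   note br = T.opr_bracket[OF 3(3,4) bracket_closed[OF 3(3,4)] foldr_V[OF 3(2) v]]
   show ?thesis unfolding 3(5) plin_diff[OF plin_EV] plin_scale[OF plin_EV] e foldr_append foldr.simps comp_def br
    by (simp add: plin_diff[OF plin_foldr[OF T.rep_plin]] plin_scale[OF plin_foldr[OF T.rep_plin]])
  qed
 qed
 thus ?thesis by simp
qed

lemma EV_mult: "EV (word_mult f (bvec [y])) v = EV f (T.opr y v)" "EV (word_mult (bvec [a]) f) v = T.opr a (EV f v)"
proof -
 show "EV (word_mult f (bvec [y])) v = EV f (T.opr y v)"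
  by (rule plin_eq[OF plin_comp[OF plin_EV plin_word_mult_left] plin_EV]) (simp add: EV_def)
 show "EV (word_mult (bvec [a]) f) v = T.opr a (EV f v)"
  by (rule plin_eq[OF plin_comp[OF plin_EV plin_word_mult_right] plin_comp[OF T.rep_plin plin_EV]]) (simp add: EV_def)
qed

lemma Phi_cl: "f \<in> WS ==> v \<in> N ==> Phi (bvec (cl f, v)) = EV f (\<psi> v)"
proof -
 assume f: "f \<in> WS" and v: "v \<in> N"
 define g where "g = (SOME g. g \<in> WS & cl f = cl g)"
 have "g \<in> WS & cl f = cl g" unfolding g_def by (rule someI[of _ f]) (simp add: f)
 hence "f - g \<in> EN" using cl_eq[OF f] by blast
 hence "EV f (\<psi> v) = EV g (\<psi> v)" using EV_EN[of "f - g" "\<psi> v"] psi_V[OF v] plin_diff[OF plin_EV, of f g] by simp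
 thus ?thesis by (simp add: Phi_def g_def)
qed

lemma psi_zero: "\<psi> 0 = 0" using psi_scale[OF N0, of 0] by simp

lemma psi_sum: "finite S ==> (!!s. s \<in> S ==> g s \<in> N) ==> \<psi> (\<Sum>s\<in>S. g s) = (\<Sum>s\<in>S. \<psi> (g s))"
proof (induction S rule: finite_induct)
 case (insert s S)
 thus ?case using psi_add[of "g s" "\<Sum>s\<in>S. g s"] sub_sum[OF N_sub, of S g] by simp
qed (simp add: psi_zero)

text \<open>The part of \<open>y\<close> in \<open>sl_minus n\<close> contributes nothing on either
  side: it kills the lowest layer, and \<open>nact\<close> uses only entries with positive indices.
  For the even part the claim is \<open>psi_H\<close>.\<close>

lemma psi_nact:
 assumes y: "y \<in> sl_nonpos n" and v: "v \<in> N"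
 shows "T.opr y (\<psi> v) = \<psi> (nact y v)"
proof -
 obtain C D where CD: "C \<in> part (sl n) False" "D \<in> sl_minus n" "y = C \<oplus>\<^bsub>sl n\<^esub> D" using y unfolding sl_nonpos_def by blast
 have "C 0 i = 0" "D 0 i = 0" if "i \<in> {1..n}" for i
  using CD(1,2) that by (auto simp: mat_alg_part sl_minus_def)
 hence y0: "y 0 i = 0" if "i \<in> {1..n}" for i using that CD(3) by simp
 have Y: "T.Y i (\<psi> v) = 0" if "i \<in> {1..n}" for i using psi_lowest[OF v] that by (simp add: T.lowest_def)
 have NN: "pscale (y i j) (NH n lam i j v) \<in> N" if "i \<in> {1..n}" "j \<in> {1..n}" for i j
  by (rule sub_scale[OF N_sub NH_N[OF that v]])
 have "\<psi> (nact y v) = (\<Sum>i\<in>{1..n}. \<psi> (\<Sum>j\<in>{1..n}. pscale (y i j) (NH n lam i j v)))"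
  unfolding nact_def by (rule psi_sum[OF finite_atLeastAtMost]) (intro sub_sum[OF N_sub] NN)
 also have "\<dots> = (\<Sum>i\<in>{1..n}. \<Sum>j\<in>{1..n}. pscale (y i j) (T.H i j (\<psi> v)))"
 proof (rule sum.cong[OF refl])
  fix i assume i: "i \<in> {1..n}"
  have "\<psi> (\<Sum>j\<in>{1..n}. pscale (y i j) (NH n lam i j v)) = (\<Sum>j\<in>{1..n}. \<psi> (pscale (y i j) (NH n lam i j v)))"
   by (rule psi_sum) (use NN[OF i] in auto)
  also have "\<dots> = (\<Sum>j\<in>{1..n}. pscale (y i j) (T.H i j (\<psi> v)))"
   by (rule sum.cong[OF refl]) (use psi_scale[OF NH_N[OF i _ v]] psi_H[OF i _ v] in simp)
  finally show "\<psi> (\<Sum>j\<in>{1..n}. pscale (y i j) (NH n lam i j v)) = (\<Sum>j\<in>{1..n}. pscale (y i j) (T.H i j (\<psi> v)))" .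
 qed
 also have "\<dots> = T.opr y (\<psi> v)"
 proof -
  have "(\<Sum>i\<in>{1..n}. pscale (y 0 i) (T.X i (\<psi> v))) = 0" "(\<Sum>i\<in>{1..n}. pscale (y i 0) (T.Y i (\<psi> v))) = 0"
   by (intro sum.neutral ballI; simp add: y0 Y)+
  thus ?thesis unfolding T.opr_expand[OF sl_nonpos_carrier[OF y] psi_V[OF v]] by simp
 qed
 finally show ?thesis by simp
qed

text \<open>The universal property of the induced module: balancing is respected because
  \<open>\<psi>\<close> commutes with the nonpositive part, by \<open>psi_nact\<close>.\<close>

lemma Phi_I: "k \<in> I ==> Phi k = 0"
proof -
 assume k: "k \<in> I"
 have "Phi k \<in> {0}"
 proof (rule plin_span[OF plin_Phi pv.subspace_single_0 _ k[unfolded I_span]])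
  fix s assume "s \<in> irels"
  thus "Phi s \<in> {0}"
  proof (cases rule: irels_cases)
   case (1 f g v)
   thus ?thesis by (simp add: plin_diff[OF plin_Phi] Phi_cl sub_add[OF WS_sub] plin_add[OF plin_EV])
  next
   case (2 f v w)
   thus ?thesis by (simp add: plin_diff[OF plin_Phi] Phi_cl sub_add[OF N_sub] psi_add plin_add[OF plin_EV_right])
  next
   case (3 f c v)
   thus ?thesis
    by (simp add: plin_diff[OF plin_Phi] plin_scale[OF plin_Phi] Phi_cl sub_scale[OF WS_sub] plin_scale[OF plin_EV] del: pscale_single)
  next
   case (4 f c v)
   thus ?thesis
    by (simp add: plin_diff[OF plin_Phi] plin_scale[OF plin_Phi] Phi_cl sub_scale[OF N_sub] psi_scale plin_scale[OF plin_EV_right] del: pscale_single)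
  next
   case (5 f y v)
   thus ?thesis
    by (simp add: plin_diff[OF plin_Phi] Phi_cl nact_N word_mult_WS gen_WS sl_nonpos_carrier EV_mult psi_nact)
  qed
 qed
 thus ?thesis by simp
qed

lemma Phi_proj: "Phi (proj k) = Phi k"
 using Phi_I[OF proj(2)[of k]] by (simp add: plin_diff[OF plin_Phi])

lemma Phi_J: "f \<in> WS ==> v \<in> N ==> Phi (J v f) = EV f (\<psi> v)"
 using Phi_proj[of "bvec (cl f, v)"] by (simp add: proj_cl Phi_cl)

lemma Phi_D0_psi: "x \<in> N ==> Phi (J x (bvec [])) = \<psi> x"
 using Phi_J[OF Nil_WS] by (simp add: EV_def)

lemma A_H_D0: "i \<in> {1..n} ==> j \<in> {1..n} ==> x \<in> N ==> A (Gmat i j) (J x (bvec [])) = J (NH n lam i j x) (bvec [])"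
 using A_D0[OF Gmat_nonpos(1)] Gmat_nonpos(2) by simp

sublocale C: covering_map n VK A D0 "\<Sum>i\<in>{1..n}. lam i" M B kap Phi p0
proof
 show "plin Phi" by (rule plin_Phi)
 fix k assume k: "k \<in> VK"
 show "Phi k \<in> T.V"
  by (rule VK_induct[OF k plin_Phi T.V_sub]) (simp add: Phi_J EV_V psi_V)
 fix a assume a: "a \<in> slc n"
 have "Phi (A a k) - T.opr a (Phi k) \<in> {0}"
 proof (rule VK_induct[OF k _ pv.subspace_single_0])
  show "plin (%k. Phi (A a k) - T.opr a (Phi k))"
   by (rule plin_minus[OF plin_comp[OF plin_Phi plin_A] plin_comp[OF T.rep_plin plin_Phi]])
  show "Phi (A a (J v f)) - T.opr a (Phi (J v f)) \<in> {0}" if "f \<in> WS" "v \<in> N" for f v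
   using that a by (simp add: A_J Phi_J word_mult_WS gen_WS EV_mult)
 qed
 thus "Phi (A a k) = T.opr a (Phi k)" by simp
next
 fix x assume "x \<in> D0"
 then obtain u where u: "u \<in> N" "x = J u (bvec [])" unfolding D0_def by blast
 show "Phi x \<in> T.lowest" "Phi x \<in> T.Vp p0" unfolding u(2) Phi_D0_psi[OF u(1)] by (rule psi_lowest[OF u(1)], rule psi_Vp[OF u(1)])
 show "x = 0" if "Phi x = 0"
  using that psi_inj[OF u(1)] J_zero[OF Nil_WS] unfolding u(2) Phi_D0_psi[OF u(1)] by simp
next
 have "Phi ` D0 = \<psi> ` N" unfolding D0_def image_image by (rule image_cong[OF refl]) (rule Phi_D0_psi)
 thus "Phi ` D0 ~= {0}" using psi_nonzero by simp
next
 fix W assume W: "subsp W" "W <= D0" "W ~= {0}" "!!i j w. i \<in> {1..n} ==> j \<in> {1..n} ==> w \<in> W ==> A (Gmat i j) w \<in> W"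
 let ?U = "{x \<in> N. J x (bvec []) \<in> W}"
 have "?U = N"
 proof (rule N_simple)
  show "subsp ?U"
  proof (rule pv.subspaceI)
   show "0 \<in> ?U" using J_zero[OF Nil_WS] N0 sub_0[OF W(1)] by simp
   fix x y c assume "x \<in> ?U"
   thus "y \<in> ?U ==> x + y \<in> ?U" "pscale c x \<in> ?U"
    using J_add[OF Nil_WS] J_scale[OF Nil_WS] sub_add[OF W(1)] sub_scale[OF W(1)]
     sub_add[OF N_sub] sub_scale[OF N_sub] by auto
  qed
  show "?U <= N" by blast
  show "?U ~= {0}"
  proof
   assume U: "?U = {0}"
   obtain w where w: "w \<in> W" "w ~= 0" using W(1,3) sub_0 by blast
   then obtain x where x: "x \<in> N" "w = J x (bvec [])" using W(2) unfolding D0_def by blast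
   hence "x \<in> ?U" using w by simp
   hence "x = 0" using U by blast
   thus False using x w J_zero[OF Nil_WS] by simp
  qed
  show "NH n lam i j w \<in> ?U" if "i \<in> {1..n}" "j \<in> {1..n}" "w \<in> ?U" for i j w
  proof -
   have w: "w \<in> N" "J w (bvec []) \<in> W" using that(3) by blast+
   show ?thesis using W(4)[OF that(1,2) w(2)] NH_N[OF that(1,2) w(1)] unfolding A_H_D0[OF that(1,2) w(1)] by blast
  qed
 qed
 thus "W = D0" using W(2) unfolding D0_def by blast
qed

section \<open>The maximal submodule of the Kac module\<close>

abbreviation "pairs \<equiv> pair_space E NM"
abbreviation "Kac \<equiv> kac n (N_module n lam)"
abbreviation "qc k \<equiv> I +>\<^bsub>pairs\<^esub> k"

lemma Kac_eq: "Kac = with_action (quot_space pairs I) (%y. descend pairs I (op y))"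
 unfolding kac_def induced_def I_def op_def[abs_def] ..

sublocale Q: module_quotient pairs I
 unfolding pair_space_def by (rule module_quotient_free[OF I_sub]) (use I_PS in "simp add: PS_def")

lemma pairs_simps: "carrier pairs = PS" "part pairs p = PSp p" "x \<oplus>\<^bsub>pairs\<^esub> y = x + y" "c \<odot>\<^bsub>pairs\<^esub> x = pscale c x" "\<zero>\<^bsub>pairs\<^esub> = 0"
 by (simp_all add: pair_space_def PS_def PSp_def)

lemma pairs_minus: "x \<in> PS ==> y \<in> PS ==> x \<ominus>\<^bsub>pairs\<^esub> y = x - y"
 unfolding pair_space_def by (rule free_space_minus) (simp_all add: PS_def)

lemma qc_eq: "k \<in> PS ==> k' \<in> PS ==> qc k = qc k' \<longleftrightarrow> k - k' \<in> I"
 using Q.coset_eq_iff[of k k'] by (simp add: pairs_simps pairs_minus)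

lemma PSp_PS: "PSp p <= PS"
proof -
 have "(\<Union>q. part E (p ~= q) \<times> part NM q) <= carrier E \<times> N"
 proof -
  have "part E r <= carrier E" for r
   unfolding env_part env_carrier WS_def using hom_word_lists by blast
  moreover have "part NM q <= N" for q using N0 by simp
  ultimately show ?thesis by blast
 qed
 thus ?thesis unfolding PSp_def PS_def by blast
qed

lemma qc_proj: "k \<in> PS ==> qc (proj k) = qc k"
 using qc_eq[of k "proj k"] proj(2) proj_PS by simp

lemma Kac_simps:
 "carrier Kac = qc ` VK" "part Kac p = qc ` K.graded_layers p" "\<zero>\<^bsub>Kac\<^esub> = qc 0"
 "k \<in> VK ==> k' \<in> VK ==> qc k \<oplus>\<^bsub>Kac\<^esub> qc k' = qc (k + k')"
 "k \<in> VK ==> c \<odot>\<^bsub>Kac\<^esub> qc k = qc (pscale c k)"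
 "a \<in> slc n ==> k \<in> VK ==> act Kac a (qc k) = qc (A a k)"
proof -
 have im: "qc ` (proj ` S) = qc ` S" if "S <= PS" for S
  unfolding image_image by (rule image_cong[OF refl]) (use qc_proj that in blast)
 show "carrier Kac = qc ` VK"
  unfolding Kac_eq VK_def im[OF subset_refl] with_action_simps Q.carrier_quot by (simp add: pairs_simps)
 show "part Kac p = qc ` K.graded_layers p"
  unfolding Kac_eq proj_PSp[symmetric] im[OF PSp_PS] by (simp add: pairs_simps)
 show "\<zero>\<^bsub>Kac\<^esub> = qc 0"
  using Q.a_coset_add_zero[OF Q.a_subset] unfolding Kac_eq with_action_simps quot_space_simps pairs_simps by (rule sym)
 show "qc k \<oplus>\<^bsub>Kac\<^esub> qc k' = qc (k + k')" if "k \<in> VK" "k' \<in> VK"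
 proof -
  have "k \<in> carrier pairs" "k' \<in> carrier pairs" using that VK_PS unfolding pairs_simps by blast+
  from Q.add_coset[OF this] show ?thesis unfolding Kac_eq with_action_simps quot_space_simps pairs_simps .
 qed
 show "c \<odot>\<^bsub>Kac\<^esub> qc k = qc (pscale c k)" if "k \<in> VK"
 proof -
  have "k \<in> carrier pairs" using that VK_PS unfolding pairs_simps by blast
  from Q.smult_coset[OF this, of c] show ?thesis unfolding Kac_eq with_action_simps quot_space_simps pairs_simps .
 qed
 assume a: "a \<in> slc n" and k: "k \<in> VK"
 have kP: "k \<in> PS" using k VK_PS by blast
 have "descend pairs I (op a) (qc k) = qc (op a k)"
 proof (rule Q.descend_coset, unfold pairs_simps)
  fix x y assume x: "x \<in> PS"
  show "op a x \<in> PS" by (rule op_PS[OF a x])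
  assume y: "y \<in> PS" and xy: "x \<ominus>\<^bsub>pairs\<^esub> y \<in> I"
  have "op a (x - y) \<in> I" using op_I[OF a] xy unfolding pairs_minus[OF x y] .
  thus "op a x \<ominus>\<^bsub>pairs\<^esub> op a y \<in> I"
   unfolding pairs_minus[OF op_PS[OF a x] op_PS[OF a y]] by (simp add: plin_diff)
 qed (rule kP)
 also have "\<dots> = qc (A a k)" using qc_proj[OF op_PS[OF a kP]] by (simp add: A_def)
 finally show "act Kac a (qc k) = qc (A a k)" unfolding Kac_eq by simp
qed

lemma qc_inj: "k \<in> VK ==> k' \<in> VK ==> qc k = qc k' \<longleftrightarrow> k = k'"
proof -
 assume k: "k \<in> VK" "k' \<in> VK"
 have "k - k' \<in> I ==> k = k'" using proj(3)[of "k - k'"] proj_VK k by (simp add: plin_diff[OF proj(1)])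
 thus ?thesis using qc_eq[of k k'] k VK_PS by blast
qed

lemma Kac_module: "Module.module complex_field Kac"
 unfolding Kac_eq module_with_action by (rule Q.module_quot)

lemma component_Kac:
 assumes "a \<in> K.graded_layers p" "b \<in> K.graded_layers (~ p)"
 shows "component Kac p (qc (a + b)) = qc a"
 unfolding component_def
proof (rule the_equality)
 have V: "x \<in> VK" if "x \<in> K.graded_layers q" for x q using that K.graded_layers_V by blast
 show "qc a \<in> part Kac p & (\<exists>c\<in>part Kac (~ p). qc (a + b) = qc a \<oplus>\<^bsub>Kac\<^esub> c)"
  using assms V by (auto simp: Kac_simps)
 fix X assume "X \<in> part Kac p & (\<exists>c\<in>part Kac (~ p). qc (a + b) = X \<oplus>\<^bsub>Kac\<^esub> c)"
 then obtain a' b' where ab: "a' \<in> K.graded_layers p" "b' \<in> K.graded_layers (~ p)" "X = qc a'" "qc (a + b) = qc a' \<oplus>\<^bsub>Kac\<^esub> qc b'"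
  unfolding Kac_simps(2) by blast
 hence "qc (a + b) = qc (a' + b')" using V by (simp add: Kac_simps)
 hence "a + b = a' + b'"
  using qc_inj[OF sub_add[OF VK_sub V[OF assms(1)] V[OF assms(2)]] sub_add[OF VK_sub V[OF ab(1)] V[OF ab(2)]]]
  by simp
 hence "a - a' = b' - b" by (simp add: algebra_simps)
 moreover have "a - a' \<in> K.graded_layers p" "b' - b \<in> K.graded_layers (~ p)"
  using assms ab(1,2) sub_diff[OF K.graded_layers_sub] by blast+
 ultimately have "a - a' = 0" using K.graded_layers_disjoint by metis
 thus "X = qc a" using ab(3) by simp
qed

definition "Zk = qc ` {k \<in> VK. Phi k = 0}"

lemma Zk_iff: "k \<in> VK ==> qc k \<in> Zk \<longleftrightarrow> Phi k = 0"
 unfolding Zk_def using qc_inj by blast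

text \<open>The kernel is graded because \<open>Phi\<close> maps even and odd layers to different
  parities, so both components of an element of the kernel are mapped to zero.\<close>

lemma Zk_sub: "sub_supermodule (sl n) Kac Zk"
 unfolding sub_supermodule_def submodule_iff[OF Kac_module]
proof (intro conjI ballI allI)
 have VK0: "0 \<in> VK" by (rule sub_0[OF VK_sub])
 show "Zk <= carrier Kac" unfolding Zk_def Kac_simps by blast
 show "\<zero>\<^bsub>Kac\<^esub> \<in> Zk" unfolding Kac_simps Zk_iff[OF VK0] by (rule plin_zero[OF plin_Phi])
 fix x assume "x \<in> Zk"
 then obtain k where k: "k \<in> VK" "Phi k = 0" "x = qc k" unfolding Zk_def by blast
 show "c \<odot>\<^bsub>Kac\<^esub> x \<in> Zk" for c
  unfolding k(3) Kac_simps(5)[OF k(1)] using Zk_iff[OF sub_scale[OF VK_sub k(1)]] k(2) by (simp add: plin_scale[OF plin_Phi])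
 show "x \<oplus>\<^bsub>Kac\<^esub> y \<in> Zk" if y: "y \<in> Zk" for y
 proof -
  obtain k' where k': "k' \<in> VK" "Phi k' = 0" "y = qc k'" using y unfolding Zk_def by blast
  show ?thesis unfolding k(3) k'(3) Kac_simps(4)[OF k(1) k'(1)]
   using Zk_iff[OF sub_add[OF VK_sub k(1) k'(1)]] k(2) k'(2) by (simp add: plin_add[OF plin_Phi])
 qed
 show "act Kac a x \<in> Zk" if a: "a \<in> slc n" for a
  unfolding k(3) Kac_simps(6)[OF a k(1)] Zk_iff[OF K.rep_V[OF a k(1)]] C.Phi_opr[OF a k(1)] k(2)
  by (rule plin_zero[OF T.rep_plin])
 fix p
 obtain a b where ab: "a \<in> K.graded_layers p" "b \<in> K.graded_layers (~ p)" "k = a + b"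
  using K.graded_layers_decomp[OF k(1)] by blast
 have aV: "a \<in> VK" using ab(1) K.graded_layers_V by blast
 have "Phi a = - Phi b" using k(2) unfolding ab(3) plin_add[OF plin_Phi] by (simp add: eq_neg_iff_add_eq_0)
 moreover have "Phi a \<in> T.Vp (p ~= p0)" "Phi b \<in> T.Vp (~ (p ~= p0))"
  using C.Phi_graded[OF ab(1)] C.Phi_graded[OF ab(2)] by (auto simp: not_iff)
 ultimately have "Phi a = 0" using T.Vp_disjoint[of "Phi a" "p ~= p0"] sub_neg[OF T.Vp_sub] by metis
 thus "component Kac p x \<in> Zk"
  unfolding k(3) ab(3) component_Kac[OF ab(1,2)] Zk_iff[OF aV] .
qed

text \<open>A submodule not contained in \<open>Zk\<close> has an element with nonzero image and is
  everything by \<open>stable_above_kernel\<close>. So \<open>Zk\<close> is the only maximal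
  submodule.\<close>

lemma sub_supermodule_top:
 assumes N': "sub_supermodule (sl n) Kac N'"
 shows "N' <= Zk | N' = carrier Kac"
proof (rule disjCI)
 assume "N' ~= carrier Kac"
 note s = N'[unfolded sub_supermodule_def submodule_iff[OF Kac_module]]
 let ?U = "{k \<in> VK. qc k \<in> N'}"
 have U: "subsp ?U"
 proof (rule pv.subspaceI)
  show "0 \<in> ?U" using s sub_0[OF VK_sub] by (simp add: Kac_simps)
  fix x y c assume x: "x \<in> ?U"
  have "c \<odot>\<^bsub>Kac\<^esub> qc x \<in> N'" using s x by blast
  thus "pscale c x \<in> ?U" using x Kac_simps(5) sub_scale[OF VK_sub] by auto
  assume y: "y \<in> ?U"
  have "qc x \<oplus>\<^bsub>Kac\<^esub> qc y \<in> N'" using s x y by blast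
  thus "x + y \<in> ?U" using x y Kac_simps(4) sub_add[OF VK_sub] by auto
 qed
 have st: "A a u \<in> ?U" if a: "a \<in> slc n" and u: "u \<in> ?U" for a u
 proof -
  have "act Kac a (qc u) \<in> N'" using s a u by blast
  thus ?thesis using u Kac_simps(6)[OF a] K.rep_V[OF a] by auto
 qed
 have sub: "N' <= qc ` VK" using s Kac_simps(1) by blast
 have "?U ~= VK"
 proof
  assume "?U = VK"
  hence "carrier Kac <= N'" unfolding Kac_simps by blast
  thus False using \<open>N' ~= carrier Kac\<close> s by blast
 qed
 hence "Phi k = 0" if "k \<in> ?U" for k
  using C.stable_above_kernel[OF U _ st that] by blast
 thus "N' <= Zk" using sub unfolding Zk_def by blast
qed

lemma Zk_proper: "Zk ~= carrier Kac"
proof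
 assume Z: "Zk = carrier Kac"
 have "Phi k = 0" if "k \<in> VK" for k using that Z Zk_iff[OF that] unfolding Kac_simps by blast
 hence "Phi ` D0 <= {0}" using K.D0_V by blast
 moreover have "0 \<in> Phi ` D0" using sub_0[OF K.D0_sub] plin_zero[OF plin_Phi] by force
 ultimately show False using C.Phi_nonzero by blast
qed

lemma maximal_submodule_Zk: "(THE N. maximal_submodule (sl n) Kac N) = Zk"
proof (rule the_equality)
 show "maximal_submodule (sl n) Kac Zk"
  unfolding maximal_submodule_def using Zk_sub Zk_proper sub_supermodule_top by blast
 show "N' = Zk" if "maximal_submodule (sl n) Kac N'" for N'
  using that Zk_sub Zk_proper sub_supermodule_top[of N'] unfolding maximal_submodule_def by blast
qed

section \<open>The isomorphism with the simple top\<close>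

lemma L_module_eq: "L_module n (N_module n lam) = quot_module Kac Zk"
 unfolding L_module_def simple_top_def maximal_submodule_Zk ..

sublocale R: module_quotient Kac Zk
 by (intro module_quotient.intro module_quotient_axioms.intro Kac_module)
  (use Zk_sub in "simp add: sub_supermodule_def")

abbreviation "top_cls k \<equiv> Zk +>\<^bsub>Kac\<^esub> qc k"

lemma Kac_minus: "k \<in> VK ==> k' \<in> VK ==> qc k \<ominus>\<^bsub>Kac\<^esub> qc k' = qc (k - k')"
proof -
 assume k: "k \<in> VK" "k' \<in> VK"
 have "qc k' \<in> carrier Kac" using k unfolding Kac_simps by blast
 hence "\<ominus>\<^bsub>Kac\<^esub> qc k' = qc (pscale (-1) k')"
  using complex_module(8)[OF Kac_module, of "qc k'"] Kac_simps(5)[OF k(2)] by simp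
 thus ?thesis unfolding a_minus_def
  using Kac_simps(4)[OF k(1) sub_scale[OF VK_sub k(2)], of "-1"] by simp
qed

lemma top_cls_eq: "k \<in> VK ==> k' \<in> VK ==> top_cls k = top_cls k' \<longleftrightarrow> Phi k = Phi k'"
 using R.coset_eq_iff[of "qc k" "qc k'"] Zk_iff[OF sub_diff[OF VK_sub, of k k']]
 by (simp add: Kac_simps(1) Kac_minus plin_diff[OF plin_Phi])

abbreviation "L \<equiv> L_module n (N_module n lam)"

lemma L_simps:
 "carrier L = top_cls ` VK" "part L p = top_cls ` K.graded_layers p"
 "k \<in> VK ==> k' \<in> VK ==> top_cls k \<oplus>\<^bsub>L\<^esub> top_cls k' = top_cls (k + k')"
 "k \<in> VK ==> c \<odot>\<^bsub>L\<^esub> top_cls k = top_cls (pscale c k)"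
 "a \<in> slc n ==> k \<in> VK ==> act L a (top_cls k) = top_cls (A a k)"
proof -
 show "carrier L = top_cls ` VK"
  unfolding L_module_eq quot_module_def with_action_simps R.carrier_quot Kac_simps by (simp add: image_image)
 show "part L p = top_cls ` K.graded_layers p"
  unfolding L_module_eq quot_module_def with_action_simps quot_space_simps Kac_simps by (simp add: image_image)
 have mem: "qc k \<in> carrier Kac" if "k \<in> VK" for k using that unfolding Kac_simps by blast
 show "top_cls k \<oplus>\<^bsub>L\<^esub> top_cls k' = top_cls (k + k')" if "k \<in> VK" "k' \<in> VK"
  unfolding L_module_eq quot_module_def with_action_simps quot_space_simps
  using R.add_coset[OF mem mem] that by (simp add: Kac_simps)
 show "c \<odot>\<^bsub>L\<^esub> top_cls k = top_cls (pscale c k)" if "k \<in> VK"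
  unfolding L_module_eq quot_module_def with_action_simps quot_space_simps
  using R.smult_coset[OF mem[OF that], of c] Kac_simps(5)[OF that] by simp
 assume a: "a \<in> slc n" and k: "k \<in> VK"
 have "descend Kac Zk (act Kac a) (top_cls k) = Zk +>\<^bsub>Kac\<^esub> (act Kac a (qc k))"
 proof (rule R.descend_coset)
  fix x assume "x \<in> carrier Kac"
  then obtain u where u: "u \<in> VK" "x = qc u" unfolding Kac_simps by blast
  show "act Kac a x \<in> carrier Kac" unfolding u(2) Kac_simps(6)[OF a u(1)] by (rule mem[OF K.rep_V[OF a u(1)]])
  fix y assume "y \<in> carrier Kac" and xy: "x \<ominus>\<^bsub>Kac\<^esub> y \<in> Zk"
  then obtain w where w: "w \<in> VK" "y = qc w" unfolding Kac_simps by blast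
  have uw: "u - w \<in> VK" by (rule sub_diff[OF VK_sub u(1) w(1)])
  have "Phi (u - w) = 0" using xy unfolding u(2) w(2) Kac_minus[OF u(1) w(1)] Zk_iff[OF uw] .
  hence "Phi (A a (u - w)) = 0" using C.Phi_opr[OF a uw] plin_zero[OF T.rep_plin] by simp
  thus "act Kac a x \<ominus>\<^bsub>Kac\<^esub> act Kac a y \<in> Zk"
   unfolding u(2) w(2) Kac_simps(6)[OF a u(1)] Kac_simps(6)[OF a w(1)] Kac_minus[OF K.rep_V[OF a u(1)] K.rep_V[OF a w(1)]]
   using Zk_iff[OF K.rep_V[OF a uw]] by (simp add: plin_diff)
 qed (rule mem[OF k])
 thus "act L a (top_cls k) = top_cls (A a k)"
  unfolding L_module_eq quot_module_def with_action_simps Kac_simps(6)[OF a k] .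
qed

lemma Phi_surj: "v \<in> T.V ==> \<exists>k\<in>VK. Phi k = v"
proof -
 assume v: "v \<in> T.V"
 obtain f0 f1 where f: "v = f0 + f1" "supp f0 <= {b \<in> B. ~ T.d b}" "supp f1 <= {b \<in> B. T.d b}"
  using v parity_decomp[of v B T.d] unfolding T.V_def by blast
 have "f0 \<in> T.Vp (p0 ~= p0)" "f1 \<in> T.Vp ((~ p0) ~= p0)" using f(2,3) by (simp_all add: T.Vp_def)
 hence f01: "f0 \<in> T.Vp (p0 ~= p0)" "f1 \<in> T.Vp ((~ p0) ~= p0)" by blast+
 obtain k0 where k0: "k0 \<in> K.graded_layers p0" "Phi k0 = f0" by (rule C.Phi_onto[OF f01(1)])
 obtain k1 where k1: "k1 \<in> K.graded_layers (~ p0)" "Phi k1 = f1" by (rule C.Phi_onto[OF f01(2)])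
 have "k0 \<in> VK" "k1 \<in> VK" using k0(1) k1(1) K.graded_layers_V by blast+
 hence "k0 + k1 \<in> VK" by (rule sub_add[OF VK_sub])
 moreover have "Phi (k0 + k1) = v" unfolding plin_add[OF plin_Phi] k0(2) k1(2) f(1) ..
 ultimately show ?thesis by blast
qed

text \<open>The inverse of the bijection that \<open>Phi\<close> induces on the quotient by its
  kernel; by \<open>top_cls_eq\<close> the chosen preimage does not matter.\<close>

definition "\<theta> v = top_cls (SOME k. k \<in> VK & Phi k = kap v)"

lemma theta_eq: "k \<in> VK ==> Phi k = kap v ==> \<theta> v = top_cls k"
proof -
 assume k: "k \<in> VK" "Phi k = kap v"
 define k' where "k' = (SOME k. k \<in> VK & Phi k = kap v)"
 have "k' \<in> VK & Phi k' = kap v" unfolding k'_def by (rule someI[of _ k]) (simp add: k)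
 hence "top_cls k' = top_cls k" using top_cls_eq[of k' k] k by simp
 thus ?thesis unfolding \<theta>_def k'_def .
qed

lemma theta_obtain:
 assumes "v \<in> carrier M"
 obtains k where "k \<in> VK" "Phi k = kap v" "\<theta> v = top_cls k"
 using Phi_surj[OF T.k_V[OF assms]] theta_eq by blast

lemma part_M: "v \<in> part M p \<longleftrightarrow> v \<in> carrier M & kap v \<in> T.Vp p"
proof
 assume v: "v \<in> part M p"
 hence "kap v \<in> kap ` part M p" by blast
 thus "v \<in> carrier M & kap v \<in> T.Vp p"
  using v super_space_part_sub[OF T.ss] unfolding T.part_V T.Vp_def by blast
next
 assume v: "v \<in> carrier M & kap v \<in> T.Vp p"
 hence "kap v \<in> kap ` part M p" unfolding T.part_V T.Vp_def by blast
 then obtain u where "u \<in> part M p" "kap v = kap u" by blast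
 thus "v \<in> part M p" using T.k_inj[of v u] v super_space_part_sub[OF T.ss] by blast
qed

text \<open>N(lambda) is the even generating layer of the Kac module, while its image in
  \<open>M\<close> has parity \<open>p0\<close>; hence the shift.\<close>

lemma theta_part: "\<theta> ` part M (p ~= p0) = part L p"
proof (intro equalityI subsetI)
 fix X assume "X \<in> \<theta> ` part M (p ~= p0)"
 then obtain v where v: "v \<in> part M (p ~= p0)" "X = \<theta> v" by blast
 hence "kap v \<in> T.Vp (p ~= p0)" using part_M by blast
 then obtain k where "k \<in> K.graded_layers p" "Phi k = kap v" using C.Phi_onto by blast
 thus "X \<in> part L p" unfolding v(2) L_simps using theta_eq K.graded_layers_V by blast
next
 fix X assume "X \<in> part L p"
 then obtain k where k: "k \<in> K.graded_layers p" "X = top_cls k" unfolding L_simps by blast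
 have kV: "k \<in> VK" using k(1) K.graded_layers_V by blast
 have ph: "Phi k \<in> T.Vp (p ~= p0)" by (rule C.Phi_graded[OF k(1)])
 let ?v = "T.inv_k (Phi k)"
 have v: "?v \<in> carrier M" "kap ?v = Phi k" using T.inv_k(1,2)[OF T.Vp_V[OF ph]] by blast+
 hence "?v \<in> part M (p ~= p0)" using part_M ph by simp
 moreover have "\<theta> ?v = X" unfolding k(2) using theta_eq[OF kV] v(2) by simp
 ultimately show "X \<in> \<theta> ` part M (p ~= p0)" by blast
qed

lemma theta_iso:
 "bij_betw \<theta> (carrier M) (carrier L)"
 "x \<in> carrier M ==> y \<in> carrier M ==> \<theta> (x \<oplus>\<^bsub>M\<^esub> y) = \<theta> x \<oplus>\<^bsub>L\<^esub> \<theta> y"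
 "x \<in> carrier M ==> \<theta> (c \<odot>\<^bsub>M\<^esub> x) = c \<odot>\<^bsub>L\<^esub> \<theta> x"
 "a \<in> slc n ==> x \<in> carrier M ==> \<theta> (act M a x) = act L a (\<theta> x)"
proof -
 show "bij_betw \<theta> (carrier M) (carrier L)"
 proof (rule bij_betwI')
  fix x y assume x: "x \<in> carrier M" and y: "y \<in> carrier M"
  obtain k k' where "k \<in> VK" "Phi k = kap x" "\<theta> x = top_cls k" "k' \<in> VK" "Phi k' = kap y" "\<theta> y = top_cls k'"
   using theta_obtain[OF x] theta_obtain[OF y] by metis
  thus "\<theta> x = \<theta> y \<longleftrightarrow> x = y" using top_cls_eq T.k_inj[OF x y] by auto
 next
  fix x assume "x \<in> carrier M"
  thus "\<theta> x \<in> carrier L" unfolding L_simps using theta_obtain by blast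
 next
  fix X assume "X \<in> carrier L"
  then obtain k where k: "k \<in> VK" "X = top_cls k" unfolding L_simps by blast
  have v: "T.inv_k (Phi k) \<in> carrier M" "kap (T.inv_k (Phi k)) = Phi k" using T.inv_k(1,2)[OF C.Phi_V[OF k(1)]] by blast+
  thus "\<exists>x\<in>carrier M. X = \<theta> x" using theta_eq[OF k(1)] k(2) by (intro bexI[of _ "T.inv_k (Phi k)"]) simp_all
 qed
 assume x: "x \<in> carrier M"
 obtain k where k: "k \<in> VK" "Phi k = kap x" "\<theta> x = top_cls k" by (rule theta_obtain[OF x])
 show "\<theta> (c \<odot>\<^bsub>M\<^esub> x) = c \<odot>\<^bsub>L\<^esub> \<theta> x"
  unfolding k(3) L_simps(4)[OF k(1)]
  by (rule theta_eq[OF sub_scale[OF VK_sub k(1)]]) (simp add: plin_scale[OF plin_Phi] k(2) T.k_scale[OF x])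
 show "\<theta> (x \<oplus>\<^bsub>M\<^esub> y) = \<theta> x \<oplus>\<^bsub>L\<^esub> \<theta> y" if y: "y \<in> carrier M"
 proof -
  obtain k' where k': "k' \<in> VK" "Phi k' = kap y" "\<theta> y = top_cls k'" by (rule theta_obtain[OF y])
  show ?thesis unfolding k(3) k'(3) L_simps(3)[OF k(1) k'(1)]
   by (rule theta_eq[OF sub_add[OF VK_sub k(1) k'(1)]]) (simp add: plin_add[OF plin_Phi] k(2) k'(2) T.k_add[OF x y])
 qed
 show "\<theta> (act M a x) = act L a (\<theta> x)" if a: "a \<in> slc n"
  unfolding k(3) L_simps(5)[OF a k(1)]
  by (rule theta_eq[OF K.rep_V[OF a k(1)]]) (simp add: C.Phi_opr[OF a k(1)] k(2) T.opr_k[OF a x])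
qed

theorem iso_L_module: "supermodule_iso (sl n) M L | supermodule_iso (sl n) (parity_change M) L"
proof (cases p0)
 case True
 hence "supermodule_iso (sl n) (parity_change M) L"
  unfolding supermodule_iso_def parity_change_def
  by (intro exI[of _ \<theta>]) (use theta_iso theta_part in simp)
 thus ?thesis ..
next
 case False
 hence "supermodule_iso (sl n) M L"
  unfolding supermodule_iso_def by (intro exI[of _ \<theta>]) (use theta_iso theta_part in simp)
 thus ?thesis ..
qed

end

section \<open>The theorem\<close>

lemma lin_span_props:
 assumes "Module.module complex_field M" "S <= carrier M"
 shows "submodule (lin_span M S) complex_field M" "S <= lin_span M S"
  "submodule N complex_field M ==> S <= N ==> lin_span M S <= N"
proof -
 interpret Module.module complex_field M by fact
 have c: "submodule (carrier M) complex_field M" unfolding submodule_iff[OF assms(1)] using complex_module(1)[OF assms(1)] by auto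
 show "S <= lin_span M S" unfolding lin_span_def by blast
 show "submodule N complex_field M ==> S <= N ==> lin_span M S <= N" unfolding lin_span_def by blast
 have s: "N <= carrier M" "\<zero>\<^bsub>M\<^esub> \<in> N" "!!x y. x \<in> N ==> y \<in> N ==> x \<oplus>\<^bsub>M\<^esub> y \<in> N" "!!c x. x \<in> N ==> c \<odot>\<^bsub>M\<^esub> x \<in> N"
  if "submodule N complex_field M" for N
  using that unfolding submodule_iff[OF assms(1)] by blast+
 show "submodule (lin_span M S) complex_field M"
  unfolding submodule_iff[OF assms(1)]
 proof (intro conjI ballI allI)
  show "lin_span M S <= carrier M" using c assms(2) unfolding lin_span_def by blast
  show "\<zero>\<^bsub>M\<^esub> \<in> lin_span M S" using s(2) unfolding lin_span_def by blast
  show "x \<oplus>\<^bsub>M\<^esub> y \<in> lin_span M S" if "x \<in> lin_span M S" "y \<in> lin_span M S" for x y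
   using s(3) that unfolding lin_span_def by blast
  show "c \<odot>\<^bsub>M\<^esub> x \<in> lin_span M S" if "x \<in> lin_span M S" for c x
   using s(4) that unfolding lin_span_def by blast
 qed
qed

lemma homogeneous_generate:
 assumes "super_space M" "submodule N complex_field M" "part M False Un part M True <= N"
 shows "carrier M <= N"
proof
 fix x assume x: "x \<in> carrier M"
 obtain a b where ab: "a \<in> part M False" "b \<in> part M (~ False)" "x = a \<oplus>\<^bsub>M\<^esub> b"
  using super_space_decomp[OF assms(1) x, of False] by metis
 have "a \<in> N" "b \<in> N" using ab(1,2) assms(3) by auto
 thus "x \<in> N" using assms(2) unfolding ab(3) submodule_iff[OF super_spaceD(1)[OF assms(1)]] by blast
qed

lemma sl_module_coordinates:
 assumes "n \<ge> 2" "lie_supermodule (sl n) V" "simple_supermodule (sl n) V"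
 obtains B kap where "sl_module n V B kap"
proof -
 have ga: "graded_action (sl n) V" using assms(2) by (simp add: lie_supermodule_def)
 hence ss: "super_space V" by (simp add: graded_action_def)
 show thesis
 proof (rule super_space_coordinates[OF ss subset_refl homogeneous_generate[OF ss]])
  fix B kap assume B: "B <= part V False Un part V True" "bij_betw kap (carrier V) {f. supp f <= B}"
  "!!x y. x \<in> carrier V ==> y \<in> carrier V ==> kap (x \<oplus>\<^bsub>V\<^esub> y) = kap x + kap y"
  "!!c x. x \<in> carrier V ==> kap (c \<odot>\<^bsub>V\<^esub> x) = pscale c (kap x)"
  "!!b. b \<in> B ==> kap b = bvec b"
  "!!p. kap ` part V p = {f. supp f <= B Int part V p}"
  "B Int part V False Int part V True = {}"
  have "graded_coordinates (sl n) V B kap" by (rule graded_coordinates.intro[OF ga B(2-6) B(1) B(7)])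
  hence "sl_module n V B kap" by (intro sl_module.intro sl_module_axioms.intro assms)
  thus thesis by (rule that)
 qed
qed

definition weyl_gens :: "nat => (laur => laur) set"
 where "weyl_gens n = {mul_op n (bvec (1, {})), mul_op n (bvec (-1, {}))} \<union>
   (%i. mul_op n (bvec (0, {i}))) ` {1..n} Un der_op n ` {..n}"

lemma weyl_gens_part: "g \<in> weyl_gens n ==> \<exists>p. g \<in> part (weyl n) p"
 unfolding weyl_gens_def using part_mon[of "{}" n] part_mon[of "{i}" n 0 for i] part_der[of _ n]
 by (elim UnE imageE insertE emptyE) (auto intro!: exI)

text \<open>A simple module over the Weyl superalgebra has countable dimension: it is spanned by the images
  of a homogeneous vector under the words in the generators.\<close>

lemma weyl_module_coordinates:
 assumes P: "assoc_supermodule (weyl n) P" "simple_supermodule (weyl n) P"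
 obtains B kap where "weyl_module n P B kap"
proof -
 have ga: "graded_action (weyl n) P" using P(1) by (simp add: assoc_supermodule_def)
 hence ss: "super_space P" by (simp add: graded_action_def)
 note mod = super_spaceD(1)[OF ss]
 interpret Module.module complex_field P by (rule mod)
 note pp = super_spaceD(2)[OF ss, unfolded submodule_iff[OF mod]]
 have "~ part P False Un part P True <= {\<zero>\<^bsub>P\<^esub>}"
 proof
  assume a: "part P False Un part P True <= {\<zero>\<^bsub>P\<^esub>}"
  have "submodule {\<zero>\<^bsub>P\<^esub>} complex_field P"
   unfolding submodule_iff[OF mod] using complex_module[OF mod] by auto
  from homogeneous_generate[OF ss this a] have "carrier P = {\<zero>\<^bsub>P\<^esub>}" using zero_closed by blast
  thus False using P(2) by (simp add: simple_supermodule_def)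
 qed
 \<comment> \<open>Starting from a homogeneous vector, words in homogeneous generators yield
   homogeneous vectors, as \<open>super_space_coordinates\<close> requires of a generating
   set.\<close>
 then obtain x0 p where x0: "x0 \<in> part P p" "x0 ~= \<zero>\<^bsub>P\<^esub>" by blast
 define S where "S = (%w. foldr (act P) w x0) ` lists (weyl_gens n)"
 have "countable (weyl_gens n)" unfolding weyl_gens_def by (intro countable_finite) simp
 hence cS: "countable S" unfolding S_def by (intro countable_image countable_lists)
 have wc: "g \<in> weyl_ops n" if "g \<in> part (weyl n) q" for g q using that by (simp add: weyl_def)
 have act_part: "act P g x \<in> part P (q ~= r)" if "g \<in> part (weyl n) q" "x \<in> part P r" for g q x r
  using ga that unfolding graded_action_def by blast
 have "\<exists>q. foldr (act P) w x0 \<in> part P q" if "w \<in> lists (weyl_gens n)" for w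
  using that
 proof (induction w)
  case Nil
  thus ?case using x0(1) by auto
 next
  case (Cons g w)
  then obtain q r where "g \<in> part (weyl n) q" "foldr (act P) w x0 \<in> part P r" using weyl_gens_part by blast
  hence "act P g (foldr (act P) w x0) \<in> part P (q ~= r)" by (rule act_part)
  thus ?case unfolding foldr.simps comp_def by (rule exI)
 qed
 hence Sq: "\<exists>q. s \<in> part P q" if "s \<in> S" for s using that unfolding S_def by auto
 have S_part: "S <= part P False Un part P True"
 proof
  fix s assume "s \<in> S"
  then obtain q where "s \<in> part P q" using Sq by blast
  thus "s \<in> part P False Un part P True" by (cases q) simp_all
 qed
 hence S_car: "S <= carrier P" using super_space_part_sub[OF ss] by blast
 have x0S: "x0 \<in> S" unfolding S_def by (rule image_eqI[of _ _ "[]"]) simp_all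
 have gS: "act P g s \<in> S" if g: "g \<in> weyl_gens n" and s: "s \<in> S" for g s
 proof -
  obtain w where "w \<in> lists (weyl_gens n)" "s = foldr (act P) w x0" using s unfolding S_def by blast
  thus ?thesis using g unfolding S_def by (intro image_eqI[of _ _ "g # w"]) simp_all
 qed
 define L where "L = lin_span P S"
 note L1 = lin_span_props[OF mod S_car, folded L_def]
 note Ls = L1(1)[unfolded submodule_iff[OF mod]]
 have car: "carrier (weyl n) = weyl_ops n" by (simp add: weyl_def)
 have act_cl: "act P g x \<in> carrier P" if "g \<in> weyl_ops n" "x \<in> carrier P" for g x
  using ga that unfolding graded_action_def car by blast
 have act_lin: "act P g (x \<oplus>\<^bsub>P\<^esub> y) = act P g x \<oplus>\<^bsub>P\<^esub> act P g y" "act P g (c \<odot>\<^bsub>P\<^esub> x) = c \<odot>\<^bsub>P\<^esub> act P g x"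
  if "g \<in> weyl_ops n" "x \<in> carrier P" "y \<in> carrier P" for g x y c
  using ga that unfolding graded_action_def car by blast+
 have act_add: "act P (T \<oplus>\<^bsub>weyl n\<^esub> T') x = act P T x \<oplus>\<^bsub>P\<^esub> act P T' x"
  if "T \<in> weyl_ops n" "T' \<in> weyl_ops n" "x \<in> carrier P" for T T' x
  using ga that unfolding graded_action_def car by simp
 have act_scale: "act P (c \<odot>\<^bsub>weyl n\<^esub> T) x = c \<odot>\<^bsub>P\<^esub> act P T x"
  if "T \<in> weyl_ops n" "x \<in> carrier P" for T x c
  using ga that unfolding graded_action_def car by simp
 have gL: "act P g x \<in> L" if g: "g \<in> weyl_gens n" and x: "x \<in> L" for g x
 proof -
  have go: "g \<in> weyl_ops n" using weyl_gens_part[OF g] wc by blast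
  have "act P g (0 \<odot>\<^bsub>P\<^esub> \<zero>\<^bsub>P\<^esub>) = 0 \<odot>\<^bsub>P\<^esub> act P g \<zero>\<^bsub>P\<^esub>" by (rule act_lin(2)[OF go zero_closed zero_closed])
  hence g0: "act P g \<zero>\<^bsub>P\<^esub> = \<zero>\<^bsub>P\<^esub>" using complex_module(6,7)[OF mod] act_cl[OF go zero_closed] by simp
  have "submodule {x \<in> carrier P. act P g x \<in> L} complex_field P"
   unfolding submodule_iff[OF mod]
   using Ls g0 act_lin[OF go] complex_module(1)[OF mod] by auto
  hence "L <= {x \<in> carrier P. act P g x \<in> L}"
   by (rule L1(3)) (use gS[OF g] L1(2) S_car in blast)
  thus ?thesis using x by blast
 qed
 have opL: "act P T x \<in> L" if "T \<in> weyl_ops n" "x \<in> L" for T x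
  using that
 proof (induction arbitrary: x rule: weyl_ops.induct)
  case one
  have "act P (\<one>\<^bsub>weyl n\<^esub>) x = x" using P(1) one Ls unfolding assoc_supermodule_def by blast
  thus ?case using one by (simp add: weyl_def)
 next
  case (scale T c)
  have "act P (c \<odot>\<^bsub>weyl n\<^esub> T) x = c \<odot>\<^bsub>P\<^esub> act P T x"
   by (rule act_scale[OF scale(1)]) (use scale(3) Ls in blast)
  thus ?case using scale(2)[OF scale(3)] Ls by (simp add: weyl_def)
 next
  case (add T T')
  have "act P (T \<oplus>\<^bsub>weyl n\<^esub> T') x = act P T x \<oplus>\<^bsub>P\<^esub> act P T' x"
   by (rule act_add[OF add(1,2)]) (use add(5) Ls in blast)
  thus ?case using add(3,4)[OF add(5)] Ls by (simp add: weyl_def)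
 next
  case (comp T T')
  have "act P (T \<otimes>\<^bsub>weyl n\<^esub> T') x = act P T (act P T' x)"
   using P(1) comp(1,2) Ls comp(5) unfolding assoc_supermodule_def car by (meson subsetD)
  thus ?case using comp(3)[OF comp(4)[OF comp(5)]] by (simp add: weyl_def comp_def)
 qed (auto intro!: gL simp: weyl_gens_def)
 \<comment> \<open>The elements with both components in \<open>L\<close> form a submodule. It
   contains the homogeneous vectors of \<open>S\<close>, hence all of \<open>L\<close>.\<close>
 have compL: "component P q x \<in> L" if x: "x \<in> L" for q x
 proof -
  let ?Q = "{x \<in> carrier P. \<exists>a\<in>part P q Int L. \<exists>b\<in>part P (~ q) Int L. x = a \<oplus>\<^bsub>P\<^esub> b}"
  have QI: "a \<oplus>\<^bsub>P\<^esub> b \<in> ?Q" if "a \<in> part P q Int L" "b \<in> part P (~ q) Int L" for a b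
   using that Ls by blast
  have zz: "\<zero>\<^bsub>P\<^esub> \<in> part P r Int L" for r using pp Ls by blast
  have "submodule ?Q complex_field P"
   unfolding submodule_iff[OF mod]
  proof (intro conjI ballI allI)
   show "?Q <= carrier P" by blast
   show "\<zero>\<^bsub>P\<^esub> \<in> ?Q" using QI[OF zz zz] by simp
   fix x assume "x \<in> ?Q"
   then obtain a b where ab: "a \<in> part P q Int L" "b \<in> part P (~ q) Int L" "x = a \<oplus>\<^bsub>P\<^esub> b" by blast
   have abc: "a \<in> carrier P" "b \<in> carrier P" using ab(1,2) Ls by blast+
   show "c \<odot>\<^bsub>P\<^esub> x \<in> ?Q" for c
   proof -
    have "c \<odot>\<^bsub>P\<^esub> x = c \<odot>\<^bsub>P\<^esub> a \<oplus>\<^bsub>P\<^esub> c \<odot>\<^bsub>P\<^esub> b" unfolding ab(3) by (rule complex_module(3)[OF mod abc])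
    moreover have "c \<odot>\<^bsub>P\<^esub> a \<in> part P q Int L" "c \<odot>\<^bsub>P\<^esub> b \<in> part P (~ q) Int L" using ab(1,2) pp Ls by blast+
    ultimately show ?thesis using QI by simp
   qed
   fix y assume "y \<in> ?Q"
   then obtain a' b' where ab': "a' \<in> part P q Int L" "b' \<in> part P (~ q) Int L" "y = a' \<oplus>\<^bsub>P\<^esub> b'" by blast
   have abc': "a' \<in> carrier P" "b' \<in> carrier P" using ab'(1,2) Ls by blast+
   have "x \<oplus>\<^bsub>P\<^esub> y = (a \<oplus>\<^bsub>P\<^esub> a') \<oplus>\<^bsub>P\<^esub> (b \<oplus>\<^bsub>P\<^esub> b')"
    unfolding ab(3) ab'(3) using abc abc' by (simp add: a_ac)
   moreover have "a \<oplus>\<^bsub>P\<^esub> a' \<in> part P q Int L" "b \<oplus>\<^bsub>P\<^esub> b' \<in> part P (~ q) Int L" using ab(1,2) ab'(1,2) pp Ls by blast+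
   ultimately show "x \<oplus>\<^bsub>P\<^esub> y \<in> ?Q" using QI by simp
  qed
  moreover have "S <= ?Q"
  proof
   fix s assume s: "s \<in> S"
   then obtain r where r: "s \<in> part P r" using Sq by blast
   have sL: "s \<in> L" "s \<in> carrier P" using s L1(2) S_car by blast+
   show "s \<in> ?Q"
   proof (cases "r = q")
    case True
    thus ?thesis using QI[of s "\<zero>\<^bsub>P\<^esub>"] r sL zz by simp
   next
    case False
    hence "r = (~ q)" by simp
    thus ?thesis using QI[of "\<zero>\<^bsub>P\<^esub>" s] r sL zz by simp
   qed
  qed
  ultimately have "L <= ?Q" by (rule L1(3))
  then obtain a b where "a \<in> part P q Int L" "b \<in> part P (~ q) Int L" "x = a \<oplus>\<^bsub>P\<^esub> b" using x by blast
  thus ?thesis using component_eq[OF ss, of a q b x] by simp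
 qed
 have "sub_supermodule (weyl n) P L" unfolding sub_supermodule_def car using L1(1) compL opL by blast
 moreover have "L ~= {\<zero>\<^bsub>P\<^esub>}" using x0S L1(2) x0(2) by blast
 ultimately have LP: "L = carrier P" using P(2) unfolding simple_supermodule_def by blast
 have gen: "carrier P <= U" if "submodule U complex_field P" "S <= U" for U using L1(3)[OF that] LP by simp
 show thesis
 proof (rule super_space_coordinates[OF ss S_part gen])
  fix B kap assume B: "B <= S" "bij_betw kap (carrier P) {f. supp f <= B}"
  "!!x y. x \<in> carrier P ==> y \<in> carrier P ==> kap (x \<oplus>\<^bsub>P\<^esub> y) = kap x + kap y"
  "!!c x. x \<in> carrier P ==> kap (c \<odot>\<^bsub>P\<^esub> x) = pscale c (kap x)"
  "!!b. b \<in> B ==> kap b = bvec b"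
  "!!p. kap ` part P p = {f. supp f <= B Int part P p}"
  "B Int part P False Int part P True = {}"
  have "graded_coordinates (weyl n) P B kap"
   by (rule graded_coordinates.intro[OF ga B(2-6) subset_trans[OF B(1) S_part] B(7)])
  hence "weyl_module n P B kap"
   by (intro weyl_module.intro weyl_module_axioms.intro P countable_subset[OF B(1) cS])
  thus thesis by (rule that)
 qed
qed

theorem theorem3p1:
  fixes n :: nat
    and P :: "(laur \<Rightarrow> laur, 'p) super_module"
    and V :: "(mat, 'v) super_module"
  assumes "n \<ge> 2"
    and "assoc_supermodule (weyl n) P" and "simple_supermodule (weyl n) P"
    and "lie_supermodule (sl n) V" and "simple_supermodule (sl n) V" and "weight_module n V"
    and "\<not> simple_supermodule (S_prime n) (F_module n P V)"
  shows "\<exists>lam. supermodule_iso (sl n) V (L_module n (N_module n lam)) \<or>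
             supermodule_iso (sl n) (parity_change V) (L_module n (N_module n lam))"
proof -
  obtain BP kP where P: "weyl_module n P BP kP" using weyl_module_coordinates[OF assms(2,3)] .
  obtain BV kV where V: "sl_module n V BV kV" using sl_module_coordinates[OF assms(1,4,5)] .
  interpret PV: tensor_setting n P BP kP V BV kV by (rule tensor_setting.intro[OF P V])
  interpret Q: quadratic_sl_module n V BV kV
    by (intro quadratic_sl_module.intro V quadratic_sl_module_axioms.intro PV.not_simple_imp_quadratic[OF assms(7)])
  obtain lam \<psi> p where *:
    "\<And>x y. x \<in> N_carrier n lam \<Longrightarrow> y \<in> N_carrier n lam \<Longrightarrow> \<psi> (x + y) = \<psi> x + \<psi> y"
    "\<And>c x. x \<in> N_carrier n lam \<Longrightarrow> \<psi> (pscale c x) = pscale c (\<psi> x)"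
    "\<And>x. x \<in> N_carrier n lam \<Longrightarrow> \<psi> x \<in> Q.lowest" "\<And>x. x \<in> N_carrier n lam \<Longrightarrow> \<psi> x \<in> Q.Vp p"
    "\<And>x. x \<in> N_carrier n lam \<Longrightarrow> \<psi> x = 0 \<Longrightarrow> x = 0"
    "\<And>i j x. i \<in> {1..n} \<Longrightarrow> j \<in> {1..n} \<Longrightarrow> x \<in> N_carrier n lam \<Longrightarrow> \<psi> (NH n lam i j x) = PV.V.H i j (\<psi> x)"
    "\<psi> ` N_carrier n lam \<noteq> {0}"
    by (rule Q.lowest_model[OF assms(6)]) blast
  interpret kac_cover n lam V BV kV \<psi> p
    by (intro kac_cover.intro kac_setup.intro kac_cover_axioms.intro assms(1) Q.quadratic_sl_module_axioms *)
  show ?thesis using iso_L_module by blast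
qed

end
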